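(* Let $X$ be a Banach space and let $A$ be a $0$-sectorial operator on $X$ having a (bounded) $\mathcal{M}^\alpha$ calculus for some $\alpha>0$. Let $(\dot\varphi_n)_{n\in\mathbb{Z}}$ be a homogeneous dyadic partition of unity on $\mathbb{R}_+$ and $(\varphi_n)_{n\in\mathbb{N}_0}$ an inhomogeneous dyadic partition of unity on $\mathbb{R}_+$. Then the norm on $X$ has the equivalent descriptions $$\|x\|\cong \mathbb{E}\Bigl\|\sum_{n\in\mathbb{Z}}\epsilon_n\dot\varphi_n(A)x\Bigr\|_X\cong \sup\Bigl\{\Bigl\|\sum_{n\in\mathbb{Z}}a_n\dot\varphi_n(A)x\Bigr\|:\ a_n\in\mathbb{C},\ |a_n|\le 1\Bigr\}$$ and $$\|x\|\cong \mathbb{E}\Bigl\|\sum_{n\in\mathbb{N}_0}\epsilon_n\varphi_n(A)x\Bigr\|_X\cong \sup\Bigl\{\Bigl\|\sum_{n\in\mathbb{N}_0}a_n\varphi_n(A)x\Bigr\|:\ a_n\in\mathbb{C},\ |a_n|\le 1\Bigr\}$$ for all $x\in X$. In particular the series $\sum_{n\in\mathbb{Z}}\dot\varphi_n(A)x$ converges unconditionally in $X$ for all $x\in X$.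
   Context: $\mathbb{R}_+=(0,\infty)$. $a\cong b$ means $c^{-1}a\le b\le c\,a$ with a constant $c$ independent of $x$. $(\epsilon_n)$ is a sequence of independent Rademacher variables ($P(\epsilon_n=\pm1)=\frac12$), $\mathbb{E}$ is expectation. Sectorial operators. $\Sigma_\omega=\{z\in\mathbb{C}\setminus\{0\}:|\arg z|<\omega\}$ and $H^\infty(\Sigma_\omega)$ is the Banach algebra of bounded holomorphic functions on $\Sigma_\omega$ with the sup norm. A closed densely defined operator $A$ on $X$ is $\omega$-sectorial if $\sigma(A)\subset\overline{\Sigma_\omega}$, its range $R(A)$ is dense in $X$, and for every $\theta>\omega$ there is $C_\theta$ with $\|\lambda(\lambda-A)^{-1}\|\le C_\theta$ for all $\lambda\in\mathbb{C}\setminus\overline{\Sigma_\theta}$ (then $A$ is injective). $A$ is $0$-sectorial if it is $\omega$-sectorial for all $\omega>0$. Let $H^\infty_0(\Sigma_\theta)=\{f\in H^\infty(\Sigma_\theta):\exists C,\epsilon>0:\ |f(\lambda)|\le C(1+|\log\lambda|)^{-1-\epsilon}\}$. For $f\in H_0^\infty(\Sigma_\theta)$, $f(A)=\frac1{2\pi i}\int_\Gamma f(\lambda)(\lambda-A)^{-1}d\lambda\in B(X)$, $\Gamma=\partial\Sigma_\sigma$ oriented counterclockwise, $0<\sigma<\theta$. With $\rho(\lambda)=\lambda(1+\lambda)^{-2}$, if $f$ is holomorphic on $\Sigma_\theta$ and $\rho^n f\in H^\infty_0(\Sigma_\theta)$ for some $n$, then $f(A)=\rho(A)^{-n}(\rho^nf)(A)$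 with its natural domain, which is a closed densely defined operator. Besov spaces and Mihlin classes. Let $\phi_0,\phi_1\in C_c^\infty(\mathbb{R})$, $\operatorname{supp}\phi_1\subset[\frac12,2]$, $\operatorname{supp}\phi_0\subset[-1,1]$, $\phi_n=\phi_1(2^{1-n}\cdot)$ for $n\ge2$, $\phi_n=\phi_{-n}(-\cdot)$ for $n\le-1$, $\sum_{n\in\mathbb{Z}}\phi_n=1$ on $\mathbb{R}$. $\mathcal{B}^\alpha_{\infty,q}$ is the space of bounded uniformly continuous $f:\mathbb{R}\to\mathbb{C}$ with $\|f\|^q_{\mathcal{B}^\alpha_{\infty,q}}=\sum_{n\in\mathbb{Z}}2^{|n|\alpha q}\|f*\check\phi_n\|_\infty^q<\infty$ (sup if $q=\infty$), $\check{\ }$ being the inverse Fourier transform. For $f:\mathbb{R}_+\to\mathbb{C}$ put $f_e(x)=f(e^x)$. $\mathcal{M}^\alpha=\{f:\mathbb{R}_+\to\mathbb{C}:\ f_e\in\mathcal{B}^\alpha_{\infty,1}\}$ with $\|f\|_{\mathcal{M}^\alpha}=\|f_e\|_{\mathcal{B}^\alpha_{\infty,1}}$. The set $\bigcap_{0<\omega<\pi}H^\infty(\Sigma_\omega)\cap\mathcal{M}^\alpha$ is dense in $\mathcal{M}^\alpha$. $A$ has a (bounded) $\mathcal{M}^\alpha$ calculus if there is $C$ with $\|f(A)\|\le C\|f\|_{\mathcal{M}^\alpha}$ for all $f\in\bigcap_{0<\omega<\pi}H^\infty(\Sigma_\omega)\cap\mathcal{M}^\alpha$; then $f\mapsto f(A)$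 extends uniquely to a bounded algebra homomorphism $\mathcal{M}^\alpha\to B(X)$, again denoted $f\mapsto f(A)$. Partitions of unity. A homogeneous dyadic partition of unity on $\mathbb{R}_+$ is $\dot\varphi_n=\dot\varphi(2^{-n}\cdot)$, $n\in\mathbb{Z}$, with $\dot\varphi\in C_c^\infty(0,\infty)$, $\operatorname{supp}\dot\varphi\subset[\frac12,2]$, $\sum_{n\in\mathbb{Z}}\dot\varphi(2^{-n}t)=1$ for $t>0$. An inhomogeneous one is $(\varphi_n)_{n\in\mathbb{N}_0}$ with $\varphi_n=\dot\varphi_n$ for $n\ge1$ and $\varphi_0=\sum_{k\le0}\dot\varphi_k$ for some homogeneous one $(\dot\varphi_n)$. *)

theory Defs
  imports "HOL-Complex_Analysis.Complex_Analysis" "HOL-Probability.Probability"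
begin

section \<open>Complex Banach spaces\<close>

class complex_banach = banach +
  fixes scaleC :: "complex \<Rightarrow> 'a \<Rightarrow> 'a" (infixr "*\<^sub>C" 75)
  assumes scaleC_add_right: "c *\<^sub>C (x + y) = c *\<^sub>C x + c *\<^sub>C y"
    and scaleC_add_left: "(c + d) *\<^sub>C x = c *\<^sub>C x + d *\<^sub>C x"
    and scaleC_scaleC: "c *\<^sub>C d *\<^sub>C x = (c * d) *\<^sub>C x"
    and scaleR_scaleC: "r *\<^sub>R x = complex_of_real r *\<^sub>C x"
    and norm_scaleC: "norm (c *\<^sub>C x) = cmod c * norm x"

instantiation complex :: complex_banach
begin

definition scaleC_complex :: "complex \<Rightarrow> complex \<Rightarrow> complex"
  where "scaleC_complex c z = c * z"

instance
  by standard (simp_all add: scaleC_complex_def algebra_simps norm_mult scaleR_conv_of_real)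

end


section \<open>Unbounded operators as graphs\<close>

text \<open>A (partially defined) operator is its graph, so that \<^const>\<open>Domain\<close> and \<^const>\<open>Range\<close> are its
  domain and range, \<^const>\<open>closed\<close> means that it is a closed operator, and \<^const>\<open>converse\<close> is the
  inverse of an injective operator.\<close>

definition linear_operator :: "('a::complex_banach \<times> 'a) set \<Rightarrow> bool" where
  "linear_operator A \<longleftrightarrow> single_valued A \<and> (0, 0) \<in> A \<and>
     (\<forall>x y x' y'. (x, y) \<in> A \<longrightarrow> (x', y') \<in> A \<longrightarrow> (x + x', y + y') \<in> A) \<and>
     (\<forall>c x y. (x, y) \<in> A \<longrightarrow> (c *\<^sub>C x, c *\<^sub>C y) \<in> A)"

definition op_graph :: "('a \<Rightarrow> 'a) \<Rightarrow> ('a \<times> 'a) set" where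
  "op_graph T = {(x, T x) | x. True}"

definition op_apply :: "('a \<times> 'a) set \<Rightarrow> 'a \<Rightarrow> 'a" where
  "op_apply R x = (THE y. (x, y) \<in> R)"

definition shifted :: "('a::complex_banach \<times> 'a) set \<Rightarrow> complex \<Rightarrow> ('a \<times> 'a) set" where
  "shifted A \<mu> = {(x, \<mu> *\<^sub>C x - y) | x y. (x, y) \<in> A}"

text \<open>Only real linearity of the inverse is asked for below: complex linearity is inherited from \<open>A\<close>.\<close>

definition resolvent_set :: "('a::complex_banach \<times> 'a) set \<Rightarrow> complex set" where
  "resolvent_set A = {\<mu>. \<exists>R. bounded_linear R \<and> converse (shifted A \<mu>) = op_graph R}"

definition spectrum :: "('a::complex_banach \<times> 'a) set \<Rightarrow> complex set" where
  "spectrum A = - resolvent_set A"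

definition resolvent :: "('a::complex_banach \<times> 'a) set \<Rightarrow> complex \<Rightarrow> 'a \<Rightarrow> 'a" where
  "resolvent A \<mu> = op_apply (converse (shifted A \<mu>))"


section \<open>Sectorial operators\<close>

definition sector :: "real \<Rightarrow> complex set" where
  "sector \<omega> = {z. z \<noteq> 0 \<and> \<bar>Arg z\<bar> < \<omega>}"

definition sectorial :: "real \<Rightarrow> ('a::complex_banach \<times> 'a) set \<Rightarrow> bool" where
  "sectorial \<omega> A \<longleftrightarrow> linear_operator A \<and> closed A \<and> closure (Domain A) = UNIV \<and>
     spectrum A \<subseteq> closure (sector \<omega>) \<and> closure (Range A) = UNIV \<and>
     (\<forall>\<theta>>\<omega>. \<exists>C. \<forall>\<mu>\<in>- closure (sector \<theta>). onorm (\<lambda>x. \<mu> *\<^sub>C resolvent A \<mu> x) \<le> C)"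

definition zero_sectorial :: "('a::complex_banach \<times> 'a) set \<Rightarrow> bool" where
  "zero_sectorial A \<longleftrightarrow> (\<forall>\<omega>>0. sectorial \<omega> A)"


section \<open>Holomorphic functional calculus of a 0-sectorial operator\<close>

definition Hinf :: "real \<Rightarrow> (complex \<Rightarrow> complex) set" where
  "Hinf \<omega> = {f. f holomorphic_on sector \<omega> \<and> bounded (f ` sector \<omega>)}"

definition Hinf0 :: "real \<Rightarrow> (complex \<Rightarrow> complex) set" where
  "Hinf0 \<theta> = {f \<in> Hinf \<theta>. \<exists>C \<epsilon>. \<epsilon> > 0 \<and>
     (\<forall>\<mu>\<in>sector \<theta>. cmod (f \<mu>) \<le> C * (1 + cmod (Ln \<mu>)) powr (- 1 - \<epsilon>))}"

text \<open>Integral of \<open>f(\<mu>) (\<mu> - A)\<^sup>-\<^sup>1 x\<close> along the ray from \<open>0\<close> to \<open>\<infinity>\<close> at angle \<open>\<tau>\<close>,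
  parametrized by \<open>\<mu> = exp (s + \<i>\<tau>)\<close> with \<open>s\<close> in the real line, whence the factor \<open>d\<mu>/ds = \<mu>\<close>.\<close>

definition ray_integral ::
    "('a::complex_banach \<times> 'a) set \<Rightarrow> (complex \<Rightarrow> complex) \<Rightarrow> real \<Rightarrow> 'a \<Rightarrow> 'a" where
  "ray_integral A f \<tau> x =
     integral UNIV (\<lambda>s::real. let \<mu> = exp (Complex s \<tau>) in (f \<mu> * \<mu>) *\<^sub>C resolvent A \<mu> x)"

text \<open>The boundary of the sector, with the sector on its left, comes in from \<open>\<infinity>\<close> along the upper
  ray and leaves along the lower one.\<close>

definition sector_integral ::
    "('a::complex_banach \<times> 'a) set \<Rightarrow> (complex \<Rightarrow> complex) \<Rightarrow> real \<Rightarrow> 'a \<Rightarrow> 'a" where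
  "sector_integral A f \<sigma> x =
     (1 / (2 * complex_of_real pi * \<i>)) *\<^sub>C (ray_integral A f (- \<sigma>) x - ray_integral A f \<sigma> x)"

text \<open>For \<open>f\<close> in some \<^term>\<open>Hinf0 \<theta>\<close> the value does not depend on the angle of the contour.\<close>

definition dunford ::
    "('a::complex_banach \<times> 'a) set \<Rightarrow> (complex \<Rightarrow> complex) \<Rightarrow> 'a \<Rightarrow> 'a" where
  "dunford A f x = (THE y. \<exists>\<theta>. 0 < \<theta> \<and> \<theta> < pi \<and> f \<in> Hinf0 \<theta> \<and>
     (\<forall>\<sigma>. 0 < \<sigma> \<and> \<sigma> < \<theta> \<longrightarrow> y = sector_integral A f \<sigma> x))"

definition rho :: "complex \<Rightarrow> complex" where
  "rho \<mu> = \<mu> / (1 + \<mu>)\<^sup>2"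

definition regularizes :: "nat \<Rightarrow> (complex \<Rightarrow> complex) \<Rightarrow> bool" where
  "regularizes n f \<longleftrightarrow> (\<exists>\<theta>. 0 < \<theta> \<and> \<theta> < pi \<and> f holomorphic_on sector \<theta> \<and>
     (\<lambda>\<mu>. rho \<mu> ^ n * f \<mu>) \<in> Hinf0 \<theta>)"

text \<open>\<open>f(A) = \<rho>(A)\<^sup>-\<^sup>n (\<rho>\<^sup>n f)(A)\<close> with its natural domain. Every regularizing \<open>n\<close> gives the same
  operator; the least one is taken. Note that \<open>R O S\<close> first applies \<open>R\<close>.\<close>

definition fcalc ::
    "('a::complex_banach \<times> 'a) set \<Rightarrow> (complex \<Rightarrow> complex) \<Rightarrow> ('a \<times> 'a) set" where
  "fcalc A f = (let n = (LEAST n. regularizes n f) in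
     op_graph (dunford A (\<lambda>\<mu>. rho \<mu> ^ n * f \<mu>)) O (converse (op_graph (dunford A rho)) ^^ n))"


section \<open>Besov spaces and Mihlin classes\<close>

definition smooth :: "(real \<Rightarrow> complex) \<Rightarrow> bool" where
  "smooth f \<longleftrightarrow> (\<forall>k. ((\<lambda>g x. vector_derivative g (at x)) ^^ k) f differentiable_on UNIV)"

definition supp :: "(real \<Rightarrow> complex) \<Rightarrow> real set" where
  "supp f = closure {x. f x \<noteq> 0}"

definition besov_partition :: "(int \<Rightarrow> real \<Rightarrow> complex) \<Rightarrow> bool" where
  "besov_partition \<phi> \<longleftrightarrow>
     smooth (\<phi> 0) \<and> smooth (\<phi> 1) \<and> supp (\<phi> 1) \<subseteq> {1/2..2} \<and> supp (\<phi> 0) \<subseteq> {-1..1} \<and>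
     (\<forall>n\<ge>2. \<forall>x. \<phi> n x = \<phi> 1 (2 powi (1 - n) * x)) \<and>
     (\<forall>n\<le>-1. \<forall>x. \<phi> n x = \<phi> (- n) (- x)) \<and>
     (\<forall>x. ((\<lambda>n. \<phi> n x) has_sum 1) UNIV)"

text \<open>The normalization is the one for which summing \<open>\<phi>\<^sub>n\<close> to \<open>1\<close> means summing the convolutions
  \<open>f * inv_fourier \<phi>\<^sub>n\<close> to \<open>f\<close>.\<close>

definition inv_fourier :: "(real \<Rightarrow> complex) \<Rightarrow> real \<Rightarrow> complex" where
  "inv_fourier g x = (1 / (2 * complex_of_real pi)) *
     (\<integral>\<xi>. g \<xi> * exp (\<i> * complex_of_real (x * \<xi>)) \<partial>lborel)"

definition convol :: "(real \<Rightarrow> complex) \<Rightarrow> (real \<Rightarrow> complex) \<Rightarrow> real \<Rightarrow> complex" where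
  "convol f g x = (\<integral>y. f y * g (x - y) \<partial>lborel)"

text \<open>Weighted size of the \<open>n\<close>-th block in the norm of the Besov space with indices
  \<open>\<alpha>\<close>, \<open>\<infinity>\<close>, \<open>1\<close>. For bounded \<open>f\<close> the supremum is finite.\<close>

definition besov_block ::
    "(int \<Rightarrow> real \<Rightarrow> complex) \<Rightarrow> real \<Rightarrow> (real \<Rightarrow> complex) \<Rightarrow> int \<Rightarrow> real" where
  "besov_block \<phi> \<alpha> f n =
     2 powr (real_of_int \<bar>n\<bar> * \<alpha>) * (SUP x. cmod (convol f (inv_fourier (\<phi> n)) x))"

definition besov ::
    "(int \<Rightarrow> real \<Rightarrow> complex) \<Rightarrow> real \<Rightarrow> (real \<Rightarrow> complex) set" where
  "besov \<phi> \<alpha> = {f. bounded (range f) \<and> uniformly_continuous_on UNIV f \<and>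
     besov_block \<phi> \<alpha> f summable_on UNIV}"

definition besov_norm ::
    "(int \<Rightarrow> real \<Rightarrow> complex) \<Rightarrow> real \<Rightarrow> (real \<Rightarrow> complex) \<Rightarrow> real" where
  "besov_norm \<phi> \<alpha> f = (\<Sum>\<^sub>\<infinity>n. besov_block \<phi> \<alpha> f n)"

text \<open>Functions on the open half line \<open>(0,\<infinity>)\<close> are represented by functions on the real line
  whose values outside \<open>(0,\<infinity>)\<close> are irrelevant.\<close>

definition mihlin ::
    "(int \<Rightarrow> real \<Rightarrow> complex) \<Rightarrow> real \<Rightarrow> (real \<Rightarrow> complex) set" where
  "mihlin \<phi> \<alpha> = {f. (\<lambda>x. f (exp x)) \<in> besov \<phi> \<alpha>}"

definition mihlin_norm ::
    "(int \<Rightarrow> real \<Rightarrow> complex) \<Rightarrow> real \<Rightarrow> (real \<Rightarrow> complex) \<Rightarrow> real" where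
  "mihlin_norm \<phi> \<alpha> f = besov_norm \<phi> \<alpha> (\<lambda>x. f (exp x))"

definition on_reals :: "(complex \<Rightarrow> complex) \<Rightarrow> real \<Rightarrow> complex" where
  "on_reals F t = F (complex_of_real t)"

definition mihlin_hol ::
    "(int \<Rightarrow> real \<Rightarrow> complex) \<Rightarrow> real \<Rightarrow> (complex \<Rightarrow> complex) set" where
  "mihlin_hol \<phi> \<alpha> = {F. (\<forall>\<omega>. 0 < \<omega> \<and> \<omega> < pi \<longrightarrow> F \<in> Hinf \<omega>) \<and> on_reals F \<in> mihlin \<phi> \<alpha>}"

definition has_mihlin_calculus ::
    "(int \<Rightarrow> real \<Rightarrow> complex) \<Rightarrow> real \<Rightarrow> ('a::complex_banach \<times> 'a) set \<Rightarrow> bool" where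
  "has_mihlin_calculus \<phi> \<alpha> A \<longleftrightarrow> (\<exists>C. \<forall>F\<in>mihlin_hol \<phi> \<alpha>. \<exists>T.
     bounded_linear T \<and> fcalc A F = op_graph T \<and> onorm T \<le> C * mihlin_norm \<phi> \<alpha> (on_reals F))"

text \<open>The continuous extension of the calculus from the dense subset \<^const>\<open>mihlin_hol\<close>
  to the whole Mihlin class.\<close>

definition mihlin_calc ::
    "(int \<Rightarrow> real \<Rightarrow> complex) \<Rightarrow> real \<Rightarrow> ('a::complex_banach \<times> 'a) set
       \<Rightarrow> (real \<Rightarrow> complex) \<Rightarrow> 'a \<Rightarrow> 'a" where
  "mihlin_calc \<phi> \<alpha> A f x = (THE y. \<exists>F::nat \<Rightarrow> complex \<Rightarrow> complex.
     (\<forall>k. F k \<in> mihlin_hol \<phi> \<alpha>) \<and>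
     (\<lambda>k. mihlin_norm \<phi> \<alpha> (\<lambda>t. on_reals (F k) t - f t)) \<longlonglongrightarrow> 0 \<and>
     (\<lambda>k. op_apply (fcalc A (F k)) x) \<longlonglongrightarrow> y)"


section \<open>Dyadic partitions of unity on the half line\<close>

definition homogeneous_partition :: "(int \<Rightarrow> real \<Rightarrow> complex) \<Rightarrow> bool" where
  "homogeneous_partition \<phi> \<longleftrightarrow> (\<exists>\<psi>. smooth \<psi> \<and> supp \<psi> \<subseteq> {1/2..2} \<and>
     (\<forall>n. \<forall>t>0. \<phi> n t = \<psi> (2 powi (- n) * t)) \<and>
     (\<forall>t>0. ((\<lambda>n::int. \<psi> (2 powi (- n) * t)) has_sum 1) UNIV))"

definition inhomogeneous_partition :: "(nat \<Rightarrow> real \<Rightarrow> complex) \<Rightarrow> bool" where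
  "inhomogeneous_partition \<phi> \<longleftrightarrow> (\<exists>\<psi>. homogeneous_partition \<psi> \<and>
     (\<forall>n\<ge>1. \<forall>t>0. \<phi> n t = \<psi> (int n) t) \<and>
     (\<forall>t>0. \<phi> 0 t = (\<Sum>\<^sub>\<infinity>k\<in>{..0}. \<psi> k t)))"


section \<open>Rademacher variables and equivalent norms\<close>

definition rademacher :: "'w measure \<Rightarrow> ('i \<Rightarrow> 'w \<Rightarrow> real) \<Rightarrow> bool" where
  "rademacher M \<epsilon> \<longleftrightarrow> prob_space M \<and> prob_space.indep_vars M (\<lambda>_. borel) \<epsilon> UNIV \<and>
     (\<forall>n. measure M {w \<in> space M. \<epsilon> n w = 1} = 1/2 \<and>
          measure M {w \<in> space M. \<epsilon> n w = - 1} = 1/2)"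

text \<open>The following quantities are \<^typ>\<open>ennreal\<close>-valued, so that bounding them from above by the
  norm includes their finiteness.\<close>

definition random_norm ::
    "'w measure \<Rightarrow> ('i \<Rightarrow> 'w \<Rightarrow> real) \<Rightarrow> ('i \<Rightarrow> 'a::complex_banach) \<Rightarrow> ennreal" where
  "random_norm M \<epsilon> u = (\<integral>\<^sup>+w. ennreal (norm (\<Sum>\<^sub>\<infinity>n. \<epsilon> n w *\<^sub>R u n)) \<partial>M)"

definition multiplier_norm :: "('i \<Rightarrow> 'a::complex_banach) \<Rightarrow> ennreal" where
  "multiplier_norm u = (SUP a\<in>{a. \<forall>n. cmod (a n) \<le> 1}. ennreal (norm (\<Sum>\<^sub>\<infinity>n. a n *\<^sub>C u n)))"

definition norm_equivalent :: "('a \<Rightarrow> ennreal) \<Rightarrow> ('a \<Rightarrow> ennreal) \<Rightarrow> bool" where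
  "norm_equivalent p q \<longleftrightarrow>
     (\<exists>c::real. c > 0 \<and> (\<forall>x. ennreal (inverse c) * p x \<le> q x \<and> q x \<le> ennreal c * p x))"

end

theory Submission
  imports Defs
begin

text \<open>Let \<open>\<psi>\<close> be the function whose dyadic dilations form the partition of unity. For a bounded sequence \<open>a\<close> on
the integers put \<open>S a = \<Sum>n. a n \<psi>(2\<^sup>-\<^sup>n \<sqdot>)\<close>. In the coordinate \<open>x = ln t\<close> this is a locally finite sum of
translates of one smooth function with compact support, so each derivative is bounded by a multiple of
\<open>sup |a n|\<close> (\<open>S_derivs_bounded\<close>); and a function with sufficiently many bounded derivatives belongs to the Mihlin
class (\<open>derivs_bounded_besov\<close>). The operators \<open>\<Phi> a = (S a)(A)\<close> therefore satisfy
\<open>norm (\<Phi> a) \<le> C sup |a n|\<close>. Since \<open>\<Sum>n. \<epsilon>\<^sub>n \<psi>\<^sub>n(A) x = \<Phi> \<epsilon> x\<close>, this bounds the random sums and the sums with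
multipliers by \<open>norm x\<close>.

For the converse, let \<open>U i\<close> be the operators of the partition and \<open>W i\<close> those of the enlarged pieces obtained
by adding the neighbours, so that \<open>W i (U i x) = U i x\<close>. Independence of the signs gives
\<open>\<Sum>i. U i x = E (\<Sum>i. \<epsilon>\<^sub>i W i) (\<Sum>j. \<epsilon>\<^sub>j U j x)\<close>, and the first factor has norm at most \<open>3 C\<close>. As
\<open>W i U j = 0\<close> unless \<open>i\<close> and \<open>j\<close> are close, only finitely many signs matter for each finite piece of the sum, and
the expectation is a mean over sign patterns (\<open>random_norm_lower_finite\<close>). Both partitions are treated at once: the
pieces are \<open>U i = \<Phi>\<close> of the indicator of \<open>{k. \<pi> k = i}\<close>, with \<open>\<pi>\<close> the identity or the truncation \<open>nat\<close>.

Unconditional convergence to \<open>x\<close> follows from the uniform bound and convergence on a dense set. This set is the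
range of \<open>\<rho>(A)\<close>: the function \<open>\<rho>(e\<^sup>x)\<close> and its derivatives decay exponentially, so the tails of
\<open>\<Phi> a \<rho>(A)\<close> tend to \<open>0\<close> in norm (\<open>\<Phi>_tail\<close>).

These arguments need that the calculus is linear and multiplicative. For holomorphic functions this is derived from
the contour integrals, in the coordinate \<open>\<mu> = e\<^sup>w\<close>, which turns sectors into strips: Cauchy's theorem and the
resolvent identity give \<open>R(\<mu>) f(A)\<close> (\<open>Q_D\<close>), and Fubini's theorem and Cauchy's formula give products (\<open>D_mult\<close>).
With \<open>J = (1 + A)\<^sup>-\<^sup>1\<close> one obtains \<open>\<rho>(A) = J - J\<^sup>2\<close>, whence its range is dense; it is injective because otherwise
\<open>1(A) = \<rho>(A)\<^sup>-\<^sup>1 \<rho>(A)\<close> would not be single-valued. The extended calculus inherits the algebraic rules because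
convolution with Gaussians in the coordinate \<open>x\<close> yields functions that are bounded on every sector and that
approximate with all required derivatives (\<open>mollify_error\<close>), a mode of convergence that respects products.\<close>

section \<open>Integrals of functions with values in a Banach space\<close>

lemma tail_integral_small:
  fixes b :: "real \<Rightarrow> real"
  assumes "b integrable_on UNIV" and "e > 0"
  shows "\<exists>B>0. \<forall>N\<ge>B. \<bar>integral UNIV b - integral {-N..N} b\<bar> < e"
proof -
  have "(b has_integral integral UNIV b) UNIV" using assms by (simp add: integrable_integral)
  then obtain B where "B > 0" and B: "\<And>c d. ball 0 B \<subseteq> cbox c d \<Longrightarrow> norm (integral (cbox c d) b - integral UNIV b) < e"
    using assms(2) unfolding has_integral_alt' by auto
  have "\<bar>integral UNIV b - integral {-N..N} b\<bar> < e" if "N \<ge> B" for N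
    using B[of "-N" N] that by (force simp: abs_minus_commute)
  then show ?thesis using \<open>B > 0\<close> by blast
qed

lemma ball_in_interval: "0 < B \<Longrightarrow> ball 0 B \<subseteq> {c..d} \<longleftrightarrow> c \<le> - B \<and> B \<le> (d::real)"
proof
  assume "0 < B" and *: "ball 0 B \<subseteq> {c..d}"
  have "closure (ball 0 B) \<subseteq> {c..d}" using * closed_atLeastAtMost closure_minimal by blast
  then have "cball (0::real) B \<subseteq> {c..d}" using \<open>0 < B\<close> by simp
  then show "c \<le> - B \<and> B \<le> d" using \<open>0 < B\<close> by (auto simp: subset_iff dist_norm)
qed (auto simp: subset_iff dist_norm)

text \<open>The two outer intervals carry the difference, and there the majorant is integrated.\<close>

lemma integral_interval_difference:
  fixes F :: "real \<Rightarrow> 'a::banach"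
  assumes F: "continuous_on UNIV F" and b: "b integrable_on UNIV" and dom: "\<And>s. norm (F s) \<le> b s"
    and le: "c \<le> - N" "0 \<le> N" "N \<le> d"
  shows "norm (integral {c..d} F - integral {-N..N} F) \<le> integral {c..d} b - integral {-N..N} b"
proof -
  have Fi: "F integrable_on {u..v}" for u v
    by (rule integrable_continuous_interval) (use F continuous_on_subset in blast)
  have bi: "b integrable_on {u..v}" for u v
    using b by (metis box_real(2) integrable_on_subcbox subset_UNIV)
  have n: "norm (integral {u..v} F) \<le> integral {u..v} b" for u v
    by (rule integral_norm_bound_integral) (use Fi bi dom in auto)
  have "integral {c..d} F = integral {c..-N} F + integral {-N..N} F + integral {N..d} F"
    using le Fi by (smt (verit) Henstock_Kurzweil_Integration.integral_combine)
  moreover have "integral {c..d} b = integral {c..-N} b + integral {-N..N} b + integral {N..d} b"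
    using le bi by (smt (verit) Henstock_Kurzweil_Integration.integral_combine)
  ultimately show ?thesis
    using n[of c "-N"] n[of N d] norm_triangle_ineq[of "integral {c..-N} F" "integral {N..d} F"] by simp
qed

lemma integral_interval_le:
  fixes b :: "real \<Rightarrow> real"
  assumes b: "b integrable_on UNIV" and dom: "\<And>s. 0 \<le> b s"
  shows "integral {c..d} b \<le> integral UNIV b"
  by (rule integral_subset_le)
    (use b dom integrable_on_subcbox[OF b, of c d] in \<open>auto simp: box_real\<close>)

text \<open>The values need not lie in a separable space; integrability is obtained from the Cauchy criterion for integrals
over growing intervals, whose differences are controlled by the tails of the majorant.\<close>

lemma dominated_integrable:
  fixes F :: "real \<Rightarrow> 'a::banach"
  assumes F: "continuous_on UNIV F" and b: "b integrable_on UNIV" and dom: "\<And>s. norm (F s) \<le> b s"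
  shows "F integrable_on UNIV"
proof (subst integrable_alt, intro conjI allI impI)
  fix c d :: real
  show "(\<lambda>x. if x \<in> UNIV then F x else 0) integrable_on cbox c d"
    using F continuous_on_subset by (auto intro!: integrable_continuous_interval)
next
  fix e :: real assume "e > 0"
  have pos: "0 \<le> b s" for s using dom norm_ge_zero order_trans by blast
  obtain B where "B > 0" and B: "\<bar>integral UNIV b - integral {-B..B} b\<bar> < e/2"
    using tail_integral_small[OF b, of "e/2"] \<open>e > 0\<close> by auto
  have *: "norm (integral {c..d} F - integral {-B..B} F) < e/2" if "ball 0 B \<subseteq> {c..d}" for c d
    using integral_interval_difference[OF F b dom, of c B d] that \<open>B > 0\<close> B integral_interval_le[OF b pos, of c d]
    unfolding ball_in_interval[OF \<open>B > 0\<close>] by linarith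
  show "\<exists>B>0. \<forall>a b c d. ball 0 B \<subseteq> cbox a b \<and> ball 0 B \<subseteq> cbox c d \<longrightarrow>
          norm (integral (cbox a b) (\<lambda>x. if x \<in> UNIV then F x else 0) -
            integral (cbox c d) (\<lambda>x. if x \<in> UNIV then F x else 0)) < e"
    using \<open>B > 0\<close> norm_triangle_half_l[OF * *] by (intro exI[of _ B]) auto
qed

lemma dominated_tail:
  fixes F :: "real \<Rightarrow> 'a::banach"
  assumes F: "continuous_on UNIV F" and b: "b integrable_on UNIV" and dom: "\<And>s. norm (F s) \<le> b s"
    and "0 \<le> N"
  shows "norm (integral UNIV F - integral {-N..N} F) \<le> integral UNIV b - integral {-N..N} b"
proof (rule field_le_epsilon)
  fix e :: real assume "e > 0"
  have pos: "0 \<le> b s" for s using dom norm_ge_zero order_trans by blast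
  have "(F has_integral integral UNIV F) UNIV"
    using dominated_integrable[OF F b dom] by (simp add: integrable_integral)
  then obtain B where "B > 0" and B: "\<And>c d. ball 0 B \<subseteq> cbox c d \<Longrightarrow> norm (integral (cbox c d) F - integral UNIV F) < e"
    using \<open>e > 0\<close> unfolding has_integral_alt' by auto
  define M where "M = max B N"
  have "norm (integral {-M..M} F - integral UNIV F) < e"
    using B[of "-M" M] ball_in_interval[OF \<open>B > 0\<close>, of "-M" M] by (simp add: M_def)
  moreover have "norm (integral {-M..M} F - integral {-N..N} F) \<le> integral {-M..M} b - integral {-N..N} b"
    by (rule integral_interval_difference[OF F b dom]) (use \<open>0 \<le> N\<close> in \<open>auto simp: M_def\<close>)
  moreover have "integral {-M..M} b \<le> integral UNIV b" by (rule integral_interval_le[OF b pos])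
  moreover have "norm (integral UNIV F - integral {-N..N} F)
      \<le> norm (integral {-M..M} F - integral UNIV F) + norm (integral {-M..M} F - integral {-N..N} F)"
    by (metis norm_minus_commute norm_triangle_sub diff_diff_eq2 add_diff_cancel_left' diff_add_cancel norm_triangle_ineq)
  ultimately show "norm (integral UNIV F - integral {-N..N} F) \<le> integral UNIV b - integral {-N..N} b + e"
    by linarith
qed

text \<open>The complement of the square is covered by the parts \<open>|s| > N\<close> and \<open>|s| \<le> N < |t|\<close>, and on each of them one
factor of the majorant is a tail.\<close>

lemma double_integral_truncation:
  fixes K :: "real \<Rightarrow> real \<Rightarrow> 'a::banach"
  assumes K: "continuous_on UNIV (\<lambda>(s, t). K s t)" and a: "a integrable_on UNIV" and b: "b integrable_on UNIV"
    and dom: "\<And>s t. norm (K s t) \<le> a s * b t" and apos: "\<And>s. 0 \<le> a s" and bpos: "\<And>t. 0 \<le> b t"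
    and in1: "continuous_on UNIV (\<lambda>s. integral UNIV (K s))" and "0 \<le> N"
  shows "norm (integral UNIV (\<lambda>s. integral UNIV (K s)) - integral {-N..N} (\<lambda>s. integral {-N..N} (K s)))
     \<le> (integral UNIV a - integral {-N..N} a) * integral UNIV b
       + integral UNIV a * (integral UNIV b - integral {-N..N} b)"
proof -
  have Ks: "continuous_on UNIV (K s)" for s
    using continuous_on_compose2[OF K, of UNIV "\<lambda>t. (s, t)"] by (simp add: continuous_on_Pair continuous_on_const continuous_on_id)
  have bs: "(\<lambda>t. a s * b t) integrable_on UNIV" for s using b by (rule integrable_on_mult_right)
  have n1: "norm (integral UNIV (K s)) \<le> a s * integral UNIV b" for s
    using integral_norm_bound_integral[OF dominated_integrable[OF Ks bs dom] bs] dom by auto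
  have t1: "norm (integral UNIV (K s) - integral {-N..N} (K s)) \<le> a s * (integral UNIV b - integral {-N..N} b)" for s
    using dominated_tail[OF Ks bs dom \<open>0 \<le> N\<close>] by (simp add: right_diff_distrib)
  have as: "(\<lambda>s. a s * c) integrable_on UNIV" for c using a by (rule integrable_on_mult_left)
  have asN: "(\<lambda>s. a s * c) integrable_on {-N..N}" for c
    using as by (metis box_real(2) integrable_on_subcbox subset_UNIV)
  have 1: "norm (integral UNIV (\<lambda>s. integral UNIV (K s)) - integral {-N..N} (\<lambda>s. integral UNIV (K s)))
     \<le> (integral UNIV a - integral {-N..N} a) * integral UNIV b"
    using dominated_tail[OF in1 as n1 \<open>0 \<le> N\<close>] by (simp add: left_diff_distrib)
  have c2: "continuous_on UNIV (\<lambda>s. integral {-N..N} (K s))"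
    using integral_continuous_on_param[of UNIV "-N" N K] continuous_on_subset[OF K] by simp
  have "norm (integral {-N..N} (\<lambda>s. integral UNIV (K s) - integral {-N..N} (K s)))
       \<le> integral {-N..N} (\<lambda>s. a s * (integral UNIV b - integral {-N..N} b))"
    by (rule integral_norm_bound_integral)
       (use in1 c2 asN t1 in \<open>auto intro!: integrable_continuous_interval continuous_intros intro: continuous_on_subset\<close>)
  also have "\<dots> = integral {-N..N} a * (integral UNIV b - integral {-N..N} b)" by simp
  also have "\<dots> \<le> integral UNIV a * (integral UNIV b - integral {-N..N} b)"
    by (intro mult_right_mono) (auto simp: integral_interval_le[OF a apos] integral_interval_le[OF b bpos])
  also have "integral {-N..N} (\<lambda>s. integral UNIV (K s) - integral {-N..N} (K s)) =
     integral {-N..N} (\<lambda>s. integral UNIV (K s)) - integral {-N..N} (\<lambda>s. integral {-N..N} (K s))"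
    by (rule integral_diff) (use in1 c2 in \<open>auto intro!: integrable_continuous_interval intro: continuous_on_subset\<close>)
  finally have 2: "norm (integral {-N..N} (\<lambda>s. integral UNIV (K s)) - integral {-N..N} (\<lambda>s. integral {-N..N} (K s)))
     \<le> integral UNIV a * (integral UNIV b - integral {-N..N} b)" .
  show ?thesis using norm_triangle_mono[OF 1 2] by simp
qed

text \<open>Squares are exchanged first; the truncation error is small for both orders. Continuity of the inner
integrals is an assumption since it is evident in the application, where both are known explicitly.\<close>

lemma Fubini_dominated:
  fixes K :: "real \<Rightarrow> real \<Rightarrow> 'a::banach"
  assumes K: "continuous_on UNIV (\<lambda>(s, t). K s t)" and a: "a integrable_on UNIV" and b: "b integrable_on UNIV"
    and dom: "\<And>s t. norm (K s t) \<le> a s * b t" and apos: "\<And>s. 0 \<le> a s" and bpos: "\<And>t. 0 \<le> b t"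
    and in1: "continuous_on UNIV (\<lambda>s. integral UNIV (K s))"
    and in2: "continuous_on UNIV (\<lambda>t. integral UNIV (\<lambda>s. K s t))"
  shows "integral UNIV (\<lambda>s. integral UNIV (K s)) = integral UNIV (\<lambda>t. integral UNIV (\<lambda>s. K s t))"
proof -
  let ?I = "integral UNIV (\<lambda>s. integral UNIV (K s))" and ?J = "integral UNIV (\<lambda>t. integral UNIV (\<lambda>s. K s t))"
  let ?a = "integral UNIV a" and ?b = "integral UNIV b"
  have K': "continuous_on UNIV (\<lambda>(t, s). K s t)"
    using continuous_on_compose2[OF K, of UNIV "\<lambda>(t,s). (s, t)"] by (simp add: case_prod_unfold continuous_on_Pair continuous_on_fst continuous_on_snd continuous_on_id)
  have dom': "norm (K s t) \<le> b t * a s" for s t using dom[of s t] by (simp add: mult.commute)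
  have "norm (?I - ?J) \<le> 0 + e" if "e > 0" for e
  proof -
    have ab: "?a \<ge> 0" "?b \<ge> 0" using apos bpos by (auto intro!: Henstock_Kurzweil_Integration.integral_nonneg a b)
    define d where "d = e / (2 * (?a + ?b + 1))"
    have "d > 0" using \<open>e > 0\<close> ab by (auto simp: d_def)
    obtain A where "A > 0" and A: "\<And>N. N \<ge> A \<Longrightarrow> \<bar>?a - integral {-N..N} a\<bar> < d"
      using tail_integral_small[OF a \<open>d > 0\<close>] by blast
    obtain B where "B > 0" and B: "\<And>N. N \<ge> B \<Longrightarrow> \<bar>?b - integral {-N..N} b\<bar> < d"
      using tail_integral_small[OF b \<open>d > 0\<close>] by blast
    define N where "N = max A B"
    have N: "N \<ge> 0" "\<bar>?a - integral {-N..N} a\<bar> < d" "\<bar>?b - integral {-N..N} b\<bar> < d"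
      using A B \<open>A > 0\<close> by (auto simp: N_def)
    have "integral {-N..N} (\<lambda>s. integral {-N..N} (K s)) = integral {-N..N} (\<lambda>t. integral {-N..N} (\<lambda>s. K s t))"
      using integral_swap_continuous[of "-N" "-N" N N K] continuous_on_subset[OF K] by simp
    with double_integral_truncation[OF K a b dom apos bpos in1 N(1)]
      double_integral_truncation[OF K' b a dom' bpos apos in2 N(1)]
    have "norm (?I - ?J) \<le> 2 * ((?a - integral {-N..N} a) * ?b + ?a * (?b - integral {-N..N} b))"
      using norm_triangle_ineq4[of "?I - integral {-N..N} (\<lambda>s. integral {-N..N} (K s))"
         "?J - integral {-N..N} (\<lambda>s. integral {-N..N} (K s))"]
      by (simp add: algebra_simps)
    also have "\<dots> \<le> 2 * (d * ?b + ?a * d)"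
      using N ab by (intro mult_left_mono add_mono mult_right_mono) auto
    also have "\<dots> = 2 * d * (?a + ?b)" by (simp add: algebra_simps)
    also have "\<dots> \<le> 2 * d * (?a + ?b + 1)" using \<open>d > 0\<close> by simp
    also have "\<dots> = e" using ab by (simp add: d_def field_simps)
    finally show ?thesis by simp
  qed
  then have "norm (?I - ?J) \<le> 0" by (rule field_le_epsilon)
  then show ?thesis by simp
qed

lemma bounded_bilinear_scaleC: "bounded_bilinear ((*\<^sub>C) :: complex \<Rightarrow> 'a::complex_banach \<Rightarrow> 'a)"
proof (rule bounded_bilinear.intro)
  show "\<exists>K. \<forall>a b. norm (a *\<^sub>C b::'a) \<le> norm a * norm b * K"
    by (rule exI[of _ 1]) (simp add: norm_scaleC)
qed (auto simp: scaleC_add_left scaleC_add_right scaleR_scaleC scaleC_scaleC scaleC_complex_def mult.commute)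

lemmas scaleC_continuous[continuous_intros] = bounded_bilinear.continuous_on[OF bounded_bilinear_scaleC]
lemmas scaleC_has_derivative = bounded_bilinear.FDERIV[OF bounded_bilinear_scaleC]
lemmas bounded_linear_scaleC = bounded_bilinear.bounded_linear_right[OF bounded_bilinear_scaleC]
lemmas scaleC_diff_left = bounded_bilinear.diff_left[OF bounded_bilinear_scaleC]
lemmas scaleC_diff_right = bounded_bilinear.diff_right[OF bounded_bilinear_scaleC]
lemmas scaleC_minus_left = bounded_bilinear.minus_left[OF bounded_bilinear_scaleC]
lemmas scaleC_zero_left[simp] = bounded_bilinear.zero_left[OF bounded_bilinear_scaleC]
lemmas scaleC_zero_right[simp] = bounded_bilinear.zero_right[OF bounded_bilinear_scaleC]

lemma scaleC_one[simp]: "1 *\<^sub>C x = (x::'a::complex_banach)"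
  using scaleR_scaleC[of 1 x] by simp

text \<open>Complex differentiability of a vector-valued function is expressed by a derivative of the form
\<open>d \<mapsto> d *\<^sub>C F'\<close>.\<close>

lemma has_derivative_along_line:
  fixes F :: "complex \<Rightarrow> 'a::complex_banach"
  assumes "(F has_derivative (\<lambda>d. d *\<^sub>C F' (g t))) (at (g t))" and "(g has_vector_derivative c) (at t)"
  shows "((\<lambda>t. F (g t)) has_vector_derivative c *\<^sub>C F' (g t)) (at t)"
proof -
  have "((\<lambda>t. F (g t)) has_derivative (\<lambda>h. (h *\<^sub>R c) *\<^sub>C F' (g t))) (at t)"
    using has_derivative_compose[OF assms(2)[unfolded has_vector_derivative_def] assms(1)] .
  then show ?thesis
    unfolding has_vector_derivative_def by (simp add: scaleR_scaleC scaleC_scaleC scaleC_complex_def)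
qed

text \<open>Cauchy's theorem for a strip: the integral of \<open>F'\<close> over a rectangle, computed in both orders by
the fundamental theorem of calculus, relates the horizontal sides to the vertical ones, which vanish in the
limit.\<close>

lemma strip_contour_shift:
  fixes F F' :: "complex \<Rightarrow> 'a::complex_banach"
  assumes der: "\<And>w. \<tau>1 \<le> Im w \<Longrightarrow> Im w \<le> \<tau>2 \<Longrightarrow> (F has_derivative (\<lambda>d. d *\<^sub>C F' w)) (at w)"
    and F': "continuous_on {w. \<tau>1 \<le> Im w \<and> Im w \<le> \<tau>2} F'"
    and dom: "\<And>w. \<tau>1 \<le> Im w \<Longrightarrow> Im w \<le> \<tau>2 \<Longrightarrow> norm (F w) \<le> b (Re w)"
    and b: "b integrable_on UNIV" "(b \<longlongrightarrow> 0) at_top" "(b \<longlongrightarrow> 0) at_bot" and "\<tau>1 \<le> \<tau>2"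
  shows "integral UNIV (\<lambda>s. F (Complex s \<tau>1)) = integral UNIV (\<lambda>s. F (Complex s \<tau>2))"
proof -
  have dx: "((\<lambda>s. F (Complex s \<tau>)) has_vector_derivative F' (Complex s \<tau>)) (at s)" if "\<tau>1 \<le> \<tau>" "\<tau> \<le> \<tau>2" for s \<tau>
  proof -
    have "((\<lambda>s. Complex s \<tau>) has_vector_derivative 1) (at s)"
      unfolding Complex_eq by (auto intro!: derivative_eq_intros)
    from has_derivative_along_line[OF _ this, of F F'] show ?thesis using der that by simp
  qed
  have dy: "((\<lambda>\<tau>. F (Complex s \<tau>)) has_vector_derivative \<i> *\<^sub>C F' (Complex s \<tau>)) (at \<tau>)" if "\<tau>1 \<le> \<tau>" "\<tau> \<le> \<tau>2" for s \<tau>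
  proof -
    have "((\<lambda>\<tau>. Complex s \<tau>) has_vector_derivative \<i>) (at \<tau>)"
      unfolding Complex_eq by (auto intro!: derivative_eq_intros)
    from has_derivative_along_line[OF _ this, of F F'] show ?thesis using der that by simp
  qed
  have cont: "continuous_on UNIV (\<lambda>s. F (Complex s \<tau>))" if "\<tau>1 \<le> \<tau>" "\<tau> \<le> \<tau>2" for \<tau>
    using dx[OF that] has_vector_derivative_continuous continuous_at_imp_continuous_on by blast
  have ci: "integral {-N..N} (\<lambda>s. F (Complex s \<tau>2)) - integral {-N..N} (\<lambda>s. F (Complex s \<tau>1))
      = integral {\<tau>1..\<tau>2} (\<lambda>\<tau>. \<i> *\<^sub>C (F (Complex N \<tau>) - F (Complex (-N) \<tau>)))" if "N \<ge> 0" for N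
  proof -
    have cc: "continuous_on (cbox (-N, \<tau>1) (N, \<tau>2)) (\<lambda>(s, \<tau>). \<i> *\<^sub>C F' (Complex s \<tau>))"
      unfolding case_prod_unfold Complex_eq
      by (intro continuous_intros continuous_on_compose2[OF F']) (auto simp: cbox_Pair_iff)
    have "integral {-N..N} (\<lambda>s. integral {\<tau>1..\<tau>2} (\<lambda>\<tau>. \<i> *\<^sub>C F' (Complex s \<tau>)))
       = integral {-N..N} (\<lambda>s. F (Complex s \<tau>2) - F (Complex s \<tau>1))"
      by (intro integral_cong integral_unique fundamental_theorem_of_calculus
            has_vector_derivative_at_within[OF dy] \<open>\<tau>1 \<le> \<tau>2\<close>) simp_all
    also have "\<dots> = integral {-N..N} (\<lambda>s. F (Complex s \<tau>2)) - integral {-N..N} (\<lambda>s. F (Complex s \<tau>1))"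
      by (rule integral_diff) (use cont \<open>\<tau>1 \<le> \<tau>2\<close> in \<open>auto intro!: integrable_continuous_interval intro: continuous_on_subset\<close>)
    finally have 1: "integral {-N..N} (\<lambda>s. integral {\<tau>1..\<tau>2} (\<lambda>\<tau>. \<i> *\<^sub>C F' (Complex s \<tau>))) = \<dots>" .
    have "integral {\<tau>1..\<tau>2} (\<lambda>\<tau>. integral {-N..N} (\<lambda>s. \<i> *\<^sub>C F' (Complex s \<tau>)))
       = integral {\<tau>1..\<tau>2} (\<lambda>\<tau>. \<i> *\<^sub>C F (Complex N \<tau>) - \<i> *\<^sub>C F (Complex (-N) \<tau>))"
      by (intro integral_cong integral_unique fundamental_theorem_of_calculus
            bounded_linear.has_vector_derivative[OF bounded_linear_scaleC] has_vector_derivative_at_within[OF dx])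
         (use \<open>N \<ge> 0\<close> in simp_all)
    then show ?thesis
      using 1 integral_swap_continuous[OF cc] by (simp add: scaleC_diff_right)
  qed
  let ?I = "\<lambda>\<tau>. integral UNIV (\<lambda>s. F (Complex s \<tau>))"
  have b0: "b s \<ge> 0" for s using dom[of "Complex s \<tau>1"] \<open>\<tau>1 \<le> \<tau>2\<close> by (simp add: order_trans[OF norm_ge_zero])
  have "norm (?I \<tau>2 - ?I \<tau>1) \<le> 0 + e" if "e > 0" for e
  proof -
    define d where "d = e / (2 + 2 * (\<tau>2 - \<tau>1))"
    have "d > 0" using \<open>e > 0\<close> \<open>\<tau>1 \<le> \<tau>2\<close> by (auto simp: d_def intro!: divide_pos_pos)
    obtain B where "B > 0" and B: "\<And>N. N \<ge> B \<Longrightarrow> \<bar>integral UNIV b - integral {-N..N} b\<bar> < d"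
      using tail_integral_small[OF b(1) \<open>d > 0\<close>] by blast
    obtain N1 where N1: "\<And>N. N \<ge> N1 \<Longrightarrow> b N < d"
      using order_tendstoD(2)[OF b(2) \<open>d > 0\<close>] by (auto simp: eventually_at_top_linorder)
    obtain N2 where N2: "\<And>N. N \<le> N2 \<Longrightarrow> b N < d"
      using order_tendstoD(2)[OF b(3) \<open>d > 0\<close>] by (auto simp: eventually_at_bot_linorder)
    define N where "N = max B (max N1 (-N2))"
    have "N \<ge> B" "N \<ge> N1" "- N \<le> N2" by (auto simp: N_def)
    then have N: "N \<ge> 0" "b N < d" "b (-N) < d" "\<bar>integral UNIV b - integral {-N..N} b\<bar> < d"
      using N1[of N] N2[of "-N"] B[of N] \<open>B > 0\<close> by auto
    have t: "norm (?I \<tau> - integral {-N..N} (\<lambda>s. F (Complex s \<tau>))) \<le> d" if "\<tau>1 \<le> \<tau>" "\<tau> \<le> \<tau>2" for \<tau>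
    proof -
      have "norm (F (Complex s \<tau>)) \<le> b s" for s using dom[of "Complex s \<tau>"] that by simp
      from dominated_tail[OF cont[OF that] b(1) this N(1)] show ?thesis using N(4) by linarith
    qed
    have "norm (integral {\<tau>1..\<tau>2} (\<lambda>\<tau>. \<i> *\<^sub>C (F (Complex N \<tau>) - F (Complex (-N) \<tau>)))) \<le> (2*d) * (\<tau>2 - \<tau>1)"
    proof (rule integral_bound)
      show "continuous_on {\<tau>1..\<tau>2} (\<lambda>\<tau>. \<i> *\<^sub>C (F (Complex N \<tau>) - F (Complex (- N) \<tau>)))"
        by (intro continuous_intros continuous_at_imp_continuous_on ballI)
           (use dy has_vector_derivative_continuous in force)+
      fix \<tau> assume "\<tau> \<in> {\<tau>1..\<tau>2}"
      then have "norm (F (Complex N \<tau>)) \<le> b N" "norm (F (Complex (-N) \<tau>)) \<le> b (-N)"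
        using dom[of "Complex N \<tau>"] dom[of "Complex (-N) \<tau>"] by auto
      then show "norm (\<i> *\<^sub>C (F (Complex N \<tau>) - F (Complex (- N) \<tau>))) \<le> 2 * d"
        using N norm_triangle_ineq4[of "F (Complex N \<tau>)" "F (Complex (- N) \<tau>)"] by (simp add: norm_scaleC)
    qed (use \<open>\<tau>1 \<le> \<tau>2\<close> in auto)
    with ci[OF N(1)] have c: "norm (integral {-N..N} (\<lambda>s. F (Complex s \<tau>2)) - integral {-N..N} (\<lambda>s. F (Complex s \<tau>1))) \<le> (2*d) * (\<tau>2 - \<tau>1)"
      by simp
    have "?I \<tau>2 - ?I \<tau>1 = (?I \<tau>2 - integral {-N..N} (\<lambda>s. F (Complex s \<tau>2))) +
       (integral {-N..N} (\<lambda>s. F (Complex s \<tau>2)) - integral {-N..N} (\<lambda>s. F (Complex s \<tau>1)))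
       - (?I \<tau>1 - integral {-N..N} (\<lambda>s. F (Complex s \<tau>1)))" by simp
    then have "norm (?I \<tau>2 - ?I \<tau>1) \<le> d + (2*d) * (\<tau>2 - \<tau>1) + d"
      using t[of \<tau>1] t[of \<tau>2] c \<open>\<tau>1 \<le> \<tau>2\<close>
      by (smt (verit, ccfv_threshold) norm_triangle_ineq norm_triangle_ineq4)
    also have "\<dots> = d * (2 + 2 * (\<tau>2 - \<tau>1))" by (simp add: algebra_simps)
    also have "\<dots> = e" using \<open>\<tau>1 \<le> \<tau>2\<close> by (simp add: d_def)
    finally show ?thesis by simp
  qed
  then have "norm (?I \<tau>2 - ?I \<tau>1) \<le> 0" by (rule field_le_epsilon)
  then show ?thesis by simp
qed

section \<open>The resolvent in logarithmic coordinates\<close>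

text \<open>The sector is described by \<open>Re z > |z| cos \<theta>\<close>, and the weak inequality is a closed condition.\<close>

lemma closure_sector_subset:
  assumes "0 < \<theta>" "\<theta> < pi"
  shows "closure (sector \<theta>) \<subseteq> {z. cmod z * cos \<theta> \<le> Re z}"
proof (rule closure_minimal)
  show "sector \<theta> \<subseteq> {z. cmod z * cos \<theta> \<le> Re z}"
  proof
    fix z assume "z \<in> sector \<theta>"
    then have "z \<noteq> 0" "\<bar>Arg z\<bar> < \<theta>" by (auto simp: sector_def)
    then have "cos \<theta> \<le> cos \<bar>Arg z\<bar>" using assms by (intro cos_monotone_0_pi_le) auto
    moreover have "Re z = cmod z * cos (Arg z)"
      using Arg_eq[OF \<open>z \<noteq> 0\<close>] by (metis Re_exp Re_complex_of_real cis.sel(1) cis_conv_exp is_Arg_def is_Arg_Arg complex_of_real_mult_Complex Re_rcis rcis_def)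
    ultimately show "z \<in> {z. cmod z * cos \<theta> \<le> Re z}" by (simp add: mult_left_mono)
  qed
  show "closed {z. cmod z * cos \<theta> \<le> Re z}"
    by (intro closed_Collect_le continuous_intros)
qed

lemma exp_not_in_closure_sector:
  assumes "0 < \<theta>" "\<theta> < \<bar>Im w\<bar>" "\<bar>Im w\<bar> \<le> pi"
  shows "exp w \<notin> closure (sector \<theta>)"
proof -
  have "cos \<bar>Im w\<bar> < cos \<theta>" using assms by (intro cos_monotone_0_pi) auto
  then have "cmod (exp w) * cos \<theta> > Re (exp w)" by (simp add: Re_exp)
  then show ?thesis using closure_sector_subset[of \<theta>] assms by auto
qed

lemma exp_in_sector_iff:
  assumes "\<bar>Im w\<bar> < pi"
  shows "exp w \<in> sector \<theta> \<longleftrightarrow> \<bar>Im w\<bar> < \<theta>"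
  using assms by (simp add: sector_def Arg_exp)

locale zero_sectorial_operator =
  fixes A :: "('a::complex_banach \<times> 'a) set"
  assumes zero_sectorial: "zero_sectorial A"
begin

lemma operator_properties:
  shows "linear_operator A" and "closure (Domain A) = UNIV" and "closure (Range A) = UNIV"
  using zero_sectorial by (auto simp: zero_sectorial_def sectorial_def dest!: spec[of _ 1])

lemma exp_in_resolvent_set:
  assumes "0 < \<bar>Im w\<bar>" "\<bar>Im w\<bar> \<le> pi"
  shows "exp w \<in> resolvent_set A"
proof -
  have "sectorial (\<bar>Im w\<bar>/2) A" using zero_sectorial assms by (auto simp: zero_sectorial_def)
  then have "spectrum A \<subseteq> closure (sector (\<bar>Im w\<bar>/2))" by (simp add: sectorial_def)
  with exp_not_in_closure_sector[of "\<bar>Im w\<bar>/2" w] assms show ?thesis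
    by (auto simp: spectrum_def)
qed

lemma resolvent_properties:
  assumes "\<mu> \<in> resolvent_set A"
  shows bounded_linear_resolvent: "bounded_linear (resolvent A \<mu>)"
    and resolvent_in_graph: "(resolvent A \<mu> z, \<mu> *\<^sub>C resolvent A \<mu> z - z) \<in> A"
    and resolvent_left_inverse: "(x, y) \<in> A \<Longrightarrow> resolvent A \<mu> (\<mu> *\<^sub>C x - y) = x"
proof -
  obtain R where R: "bounded_linear R" and g: "converse (shifted A \<mu>) = op_graph R"
    using assms by (auto simp: resolvent_set_def)
  have "op_apply (op_graph R) = R"
    by (auto simp: op_apply_def op_graph_def)
  then have eq: "resolvent A \<mu> = R" by (simp add: resolvent_def g)
  show "bounded_linear (resolvent A \<mu>)" using R eq by simp
  have "(R z, z) \<in> shifted A \<mu>" using g by (auto simp: op_graph_def)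
  then obtain u where "(R z, u) \<in> A" "z = \<mu> *\<^sub>C R z - u" by (auto simp: shifted_def)
  moreover from this(2) have "u = \<mu> *\<^sub>C R z - z" by (simp add: algebra_simps)
  ultimately have "(R z, \<mu> *\<^sub>C R z - z) \<in> A" by simp
  then show "(resolvent A \<mu> z, \<mu> *\<^sub>C resolvent A \<mu> z - z) \<in> A" by (simp add: eq)
  assume "(x, y) \<in> A"
  then have "(\<mu> *\<^sub>C x - y, x) \<in> converse (shifted A \<mu>)" by (auto simp: shifted_def)
  then show "resolvent A \<mu> (\<mu> *\<^sub>C x - y) = x" by (auto simp: g op_graph_def eq)
qed

lemma resolvent_scaleC:
  assumes "\<mu> \<in> resolvent_set A"
  shows "resolvent A \<mu> (c *\<^sub>C z) = c *\<^sub>C resolvent A \<mu> z"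
proof -
  let ?x = "resolvent A \<mu> z"
  have "(c *\<^sub>C ?x, c *\<^sub>C (\<mu> *\<^sub>C ?x - z)) \<in> A"
    using operator_properties(1) resolvent_in_graph[OF assms] by (auto simp: linear_operator_def)
  from resolvent_left_inverse[OF assms this] show ?thesis
    by (simp add: scaleC_diff_right scaleC_scaleC mult.commute)
qed

lemma resolvent_identity:
  assumes "\<mu> \<in> resolvent_set A" "\<kappa> \<in> resolvent_set A"
  shows "resolvent A \<kappa> z - resolvent A \<mu> z = (\<mu> - \<kappa>) *\<^sub>C resolvent A \<kappa> (resolvent A \<mu> z)"
proof -
  let ?x = "resolvent A \<mu> z"
  interpret R: bounded_linear "resolvent A \<kappa>" by (rule bounded_linear_resolvent[OF assms(2)])
  have "?x = resolvent A \<kappa> (\<kappa> *\<^sub>C ?x - (\<mu> *\<^sub>C ?x - z))"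
    using resolvent_left_inverse[OF assms(2) resolvent_in_graph[OF assms(1)]] by simp
  also have "\<dots> = (\<kappa> - \<mu>) *\<^sub>C resolvent A \<kappa> ?x + resolvent A \<kappa> z"
    by (simp add: R.diff resolvent_scaleC[OF assms(2)] scaleC_diff_left)
  finally show ?thesis by (simp add: scaleC_diff_left algebra_simps)
qed

text \<open>The resolvent in the coordinate \<open>\<mu> = e\<^sup>w\<close>, with the factor \<open>d\<mu>/dw = \<mu>\<close>. Sectoriality says that it is
bounded on \<open>\<theta> \<le> |Im w| \<le> \<pi>\<close>.\<close>

definition Q :: "complex \<Rightarrow> 'a \<Rightarrow> 'a" where
  "Q w x = exp w *\<^sub>C resolvent A (exp w) x"

lemma bounded_linear_Q:
  assumes "0 < \<bar>Im w\<bar>" "\<bar>Im w\<bar> \<le> pi"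
  shows "bounded_linear (Q w)"
  unfolding Q_def using bounded_linear_compose[OF bounded_linear_scaleC bounded_linear_resolvent[OF exp_in_resolvent_set[OF assms]]]
  by (simp add: o_def)

lemma Q_scaleC:
  assumes "0 < \<bar>Im w\<bar>" "\<bar>Im w\<bar> \<le> pi"
  shows "Q w (c *\<^sub>C x) = c *\<^sub>C Q w x"
  by (simp add: Q_def resolvent_scaleC[OF exp_in_resolvent_set[OF assms]] scaleC_scaleC mult.commute)

lemma Q_identity:
  assumes "0 < \<bar>Im w\<bar>" "\<bar>Im w\<bar> \<le> pi" "0 < \<bar>Im v\<bar>" "\<bar>Im v\<bar> \<le> pi"
  shows "exp w *\<^sub>C Q v x - exp v *\<^sub>C Q w x = (exp w - exp v) *\<^sub>C Q v (Q w x)"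
proof -
  note w = exp_in_resolvent_set[OF assms(1,2)] and v = exp_in_resolvent_set[OF assms(3,4)]
  have "exp w *\<^sub>C Q v x - exp v *\<^sub>C Q w x
      = (exp w * exp v) *\<^sub>C (resolvent A (exp v) x - resolvent A (exp w) x)"
    by (simp add: Q_def scaleC_scaleC scaleC_diff_right mult.commute)
  also have "\<dots> = (exp w * exp v) *\<^sub>C (exp w - exp v) *\<^sub>C resolvent A (exp v) (resolvent A (exp w) x)"
    using resolvent_identity[OF w v] by simp
  also have "\<dots> = (exp w - exp v) *\<^sub>C Q v (Q w x)"
    by (simp add: Q_def resolvent_scaleC[OF v] scaleC_scaleC mult_ac)
  finally show ?thesis .
qed

lemma Q_bounded:
  assumes "0 < \<theta>" "\<theta> \<le> pi"
  obtains C where "C \<ge> 0" "\<And>w x. \<theta> \<le> \<bar>Im w\<bar> \<Longrightarrow> \<bar>Im w\<bar> \<le> pi \<Longrightarrow> norm (Q w x) \<le> C * norm x"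
proof -
  have "sectorial (\<theta>/4) A" using zero_sectorial assms by (auto simp: zero_sectorial_def)
  moreover have "\<theta>/2 > \<theta>/4" using assms by simp
  ultimately have "\<exists>C. \<forall>\<mu>\<in>- closure (sector (\<theta>/2)). onorm (\<lambda>x. \<mu> *\<^sub>C resolvent A \<mu> x) \<le> C"
    unfolding sectorial_def by blast
  then obtain C where C: "\<And>\<mu>. \<mu> \<in> - closure (sector (\<theta>/2)) \<Longrightarrow> onorm (\<lambda>x. \<mu> *\<^sub>C resolvent A \<mu> x) \<le> C"
    by blast
  have "norm (Q w x) \<le> max C 0 * norm x" if "\<theta> \<le> \<bar>Im w\<bar>" "\<bar>Im w\<bar> \<le> pi" for w x
  proof -
    have "onorm (Q w) \<le> C"
      using C[of "exp w"] exp_not_in_closure_sector[of "\<theta>/2" w] that assms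
      by (simp add: Q_def[abs_def])
    then have "onorm (Q w) * norm x \<le> max C 0 * norm x" by (intro mult_right_mono) auto
    moreover have "norm (Q w x) \<le> onorm (Q w) * norm x"
      by (rule onorm[OF bounded_linear_Q]) (use that assms in auto)
    ultimately show ?thesis by (rule order_trans[rotated])
  qed
  then show ?thesis by (intro that[of "max C 0"]) auto
qed

text \<open>The resolvent identity, solved for the increment: together with boundedness it yields continuity and then the
derivative \<open>Q - Q\<^sup>2\<close>.\<close>

lemma Q_increment:
  assumes "0 < \<bar>Im w\<bar>" "\<bar>Im w\<bar> \<le> pi" "0 < \<bar>Im v\<bar>" "\<bar>Im v\<bar> \<le> pi"
  shows "Q v x - Q w x = (exp (v - w) - 1) *\<^sub>C (Q w x - Q v (Q w x))"
proof -
  have eq: "exp (-w) *\<^sub>C (exp w *\<^sub>C Q v x - exp v *\<^sub>C Q w x) = exp (-w) *\<^sub>C ((exp w - exp v) *\<^sub>C Q v (Q w x))"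
    using Q_identity[OF assms] by metis
  have e: "exp (-w) * exp w = 1" "exp (-w) * exp v = exp (v - w)"
    by (simp_all add: exp_diff exp_minus field_simps)
  have "Q v x - exp (v - w) *\<^sub>C Q w x = (1 - exp (v - w)) *\<^sub>C Q v (Q w x)"
    using eq unfolding scaleC_diff_right scaleC_scaleC right_diff_distrib e scaleC_one .
  then show ?thesis by (simp add: scaleC_diff_left scaleC_diff_right algebra_simps)
qed

lemma eventually_Q_bounded:
  assumes "0 < \<bar>Im w\<bar>" "\<bar>Im w\<bar> < pi"
  obtains C where "C \<ge> 0" "\<forall>\<^sub>F v in at w. 0 < \<bar>Im v\<bar> \<and> \<bar>Im v\<bar> < pi \<and> (\<forall>x. norm (Q v x) \<le> C * norm x)"
proof -
  obtain C where C: "C \<ge> 0" "\<And>v x. \<bar>Im w\<bar>/2 \<le> \<bar>Im v\<bar> \<Longrightarrow> \<bar>Im v\<bar> \<le> pi \<Longrightarrow> norm (Q v x) \<le> C * norm x"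
    using Q_bounded[of "\<bar>Im w\<bar>/2"] assms by auto
  have t: "((\<lambda>v. \<bar>Im v\<bar>) \<longlongrightarrow> \<bar>Im w\<bar>) (at w)" by (intro tendsto_intros)
  have "\<forall>\<^sub>F v in at w. \<bar>Im w\<bar>/2 < \<bar>Im v\<bar>" "\<forall>\<^sub>F v in at w. \<bar>Im v\<bar> < pi"
    using order_tendstoD(1)[OF t, of "\<bar>Im w\<bar>/2"] order_tendstoD(2)[OF t, of pi] assms by auto
  then have "\<forall>\<^sub>F v in at w. 0 < \<bar>Im v\<bar> \<and> \<bar>Im v\<bar> < pi \<and> (\<forall>x. norm (Q v x) \<le> C * norm x)"
    by eventually_elim (use C assms in auto)
  with C(1) show ?thesis by (rule that)
qed

lemma isCont_Q:
  assumes "0 < \<bar>Im w\<bar>" "\<bar>Im w\<bar> < pi"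
  shows "isCont (\<lambda>v. Q v x) w"
proof -
  obtain C where C: "C \<ge> 0" and ev: "\<forall>\<^sub>F v in at w. 0 < \<bar>Im v\<bar> \<and> \<bar>Im v\<bar> < pi \<and> (\<forall>x. norm (Q v x) \<le> C * norm x)"
    using eventually_Q_bounded[OF assms] by blast
  have "((\<lambda>v. Q v x - Q w x) \<longlongrightarrow> 0) (at w)"
  proof (rule Lim_null_comparison)
    show "\<forall>\<^sub>F v in at w. norm (Q v x - Q w x) \<le> cmod (exp (v - w) - 1) * (norm (Q w x) + C * norm (Q w x))"
      using ev
    proof eventually_elim
      case (elim v)
      have "norm (Q w x - Q v (Q w x)) \<le> norm (Q w x) + C * norm (Q w x)"
        using elim by (meson add_left_mono norm_triangle_ineq4 order_trans)
      then show ?case using Q_increment[of w v x] elim assms by (auto simp: norm_scaleC intro!: mult_left_mono)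
    qed
    show "((\<lambda>v. cmod (exp (v - w) - 1) * (norm (Q w x) + C * norm (Q w x))) \<longlongrightarrow> 0) (at w)"
      by (auto intro!: tendsto_eq_intros)
  qed
  then show ?thesis by (simp add: isCont_def LIM_zero_iff)
qed

lemma isCont_Q_compose:
  assumes "0 < \<bar>Im w\<bar>" "\<bar>Im w\<bar> < pi" "isCont P w"
  shows "isCont (\<lambda>v. Q v (P v)) w"
proof -
  obtain C where C: "C \<ge> 0" and ev: "\<forall>\<^sub>F v in at w. 0 < \<bar>Im v\<bar> \<and> \<bar>Im v\<bar> < pi \<and> (\<forall>x. norm (Q v x) \<le> C * norm x)"
    using eventually_Q_bounded[OF assms(1,2)] by blast
  have "((\<lambda>v. Q v (P v) - Q v (P w)) \<longlongrightarrow> 0) (at w)"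
  proof (rule Lim_null_comparison)
    show "\<forall>\<^sub>F v in at w. norm (Q v (P v) - Q v (P w)) \<le> C * norm (P v - P w)"
      using ev
    proof eventually_elim
      case (elim v)
      then interpret Qv: bounded_linear "Q v" by (intro bounded_linear_Q) auto
      show ?case using elim by (metis Qv.diff)
    qed
    show "((\<lambda>v. C * norm (P v - P w)) \<longlongrightarrow> 0) (at w)"
      using assms(3) by (auto intro!: tendsto_eq_intros simp: isCont_def)
  qed
  from tendsto_add[OF this isCont_Q[OF assms(1,2), unfolded isCont_def, of "P w"]]
  show ?thesis by (simp add: isCont_def)
qed

lemma Q_has_derivative:
  assumes "0 < \<bar>Im w\<bar>" "\<bar>Im w\<bar> < pi"
  shows "((\<lambda>v. Q v x) has_derivative (\<lambda>d. d *\<^sub>C (Q w x - Q w (Q w x)))) (at w)"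
proof -
  let ?P = "\<lambda>v. Q w x - Q v (Q w x)"
  have "\<forall>\<^sub>F v in at w. norm (((exp (v - w) - 1) / (v - w)) *\<^sub>C ?P v - ?P w) = norm (Q v x - Q w x - (v - w) *\<^sub>C ?P w) / norm (v - w)"
  proof -
    obtain C where ev: "\<forall>\<^sub>F v in at w. 0 < \<bar>Im v\<bar> \<and> \<bar>Im v\<bar> < pi \<and> (\<forall>x. norm (Q v x) \<le> C * norm x)"
      using eventually_Q_bounded[OF assms] by blast
    show ?thesis using ev eventually_at_ball'[OF zero_less_one, of w UNIV]
    proof eventually_elim
      case (elim v)
      have "(v - w) *\<^sub>C (((exp (v - w) - 1) / (v - w)) *\<^sub>C ?P v - ?P w) = Q v x - Q w x - (v - w) *\<^sub>C ?P w"
        using Q_increment[of w v x] elim assms by (simp add: scaleC_diff_right scaleC_scaleC)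
      then have "norm (v - w) * norm (((exp (v - w) - 1) / (v - w)) *\<^sub>C ?P v - ?P w) = norm (Q v x - Q w x - (v - w) *\<^sub>C ?P w)"
        by (metis norm_scaleC)
      then show ?case using elim by (simp add: field_simps)
    qed
  qed
  moreover have "((\<lambda>v. norm (((exp (v - w) - 1) / (v - w)) *\<^sub>C ?P v - ?P w)) \<longlongrightarrow> 0) (at w)"
  proof -
    have "((\<lambda>v. exp (v - w)) has_field_derivative 1) (at w)" by (auto intro!: derivative_eq_intros)
    then have 1: "((\<lambda>v. (exp (v - w) - 1) / (v - w)) \<longlongrightarrow> 1) (at w)"
      by (simp add: has_field_derivative_iff)
    have 2: "(?P \<longlongrightarrow> ?P w) (at w)" 
      using isCont_Q[OF assms, unfolded isCont_def, of "Q w x"] by (intro tendsto_intros)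
    have "((\<lambda>v. ((exp (v - w) - 1) / (v - w)) *\<^sub>C ?P v - ?P w) \<longlongrightarrow> 1 *\<^sub>C ?P w - ?P w) (at w)"
      by (intro tendsto_diff tendsto_const bounded_bilinear.tendsto[OF bounded_bilinear_scaleC 1 2])
    then show ?thesis by (simp add: tendsto_norm_zero)
  qed
  ultimately have "((\<lambda>v. norm (Q v x - Q w x - (v - w) *\<^sub>C ?P w) / norm (v - w)) \<longlongrightarrow> 0) (at w)"
    by (rule Lim_transform_eventually[rotated])
  then show ?thesis
    unfolding has_derivative_iff_norm using bounded_bilinear.bounded_linear_left[OF bounded_bilinear_scaleC] by blast
qed

end

section \<open>Contour integrals in a strip\<close>

text \<open>Functions on a horizontal strip with an integrable majorant on every horizontal line; in
  logarithmic coordinates these are the functions to which the Dunford integral applies.\<close>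

definition dominated :: "real \<Rightarrow> (real \<Rightarrow> real) \<Rightarrow> (complex \<Rightarrow> complex) \<Rightarrow> bool" where
  "dominated \<theta> b h \<longleftrightarrow> h holomorphic_on {w. \<bar>Im w\<bar> < \<theta>} \<and> (\<forall>w. \<bar>Im w\<bar> < \<theta> \<longrightarrow> cmod (h w) \<le> b (Re w)) \<and>
     b integrable_on UNIV \<and> (b \<longlongrightarrow> 0) at_top \<and> (b \<longlongrightarrow> 0) at_bot \<and> (\<forall>s. 0 \<le> b s)"

lemma open_strip: "open {w. \<bar>Im w\<bar> < \<theta>}"
  by (intro open_Collect_less continuous_intros)

lemma dominatedD:
  assumes "dominated \<theta> b h"
  shows "h holomorphic_on {w. \<bar>Im w\<bar> < \<theta>}" "\<And>w. \<bar>Im w\<bar> < \<theta> \<Longrightarrow> cmod (h w) \<le> b (Re w)"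
    "b integrable_on UNIV" "(b \<longlongrightarrow> 0) at_top" "(b \<longlongrightarrow> 0) at_bot" "\<And>s. 0 \<le> b s"
  using assms by (auto simp: dominated_def)

lemma dominated_mult:
  assumes "dominated \<theta> b h" "k holomorphic_on {w. \<bar>Im w\<bar> < \<theta>'}" "\<theta>' \<le> \<theta>" "C \<ge> 0"
    and "\<And>w. \<bar>Im w\<bar> < \<theta>' \<Longrightarrow> cmod (k w) \<le> C"
  shows "dominated \<theta>' (\<lambda>s. C * b s) (\<lambda>w. k w * h w)"
  unfolding dominated_def
proof (intro conjI allI impI)
  note d = dominatedD[OF assms(1)]
  have "h holomorphic_on {w. \<bar>Im w\<bar> < \<theta>'}" using d(1) by (rule holomorphic_on_subset) (use assms in auto)
  then show "(\<lambda>w. k w * h w) holomorphic_on {w. \<bar>Im w\<bar> < \<theta>'}" using assms by (intro holomorphic_intros)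
  show "cmod (k w * h w) \<le> C * b (Re w)" if "\<bar>Im w\<bar> < \<theta>'" for w
    unfolding norm_mult using that d assms by (intro mult_mono) auto
  show "(\<lambda>s. C * b s) integrable_on UNIV" using d by (intro integrable_on_mult_right) auto
  show "((\<lambda>s. C * b s) \<longlongrightarrow> 0) at_top" using tendsto_mult_right_zero[OF d(4)] .
  show "((\<lambda>s. C * b s) \<longlongrightarrow> 0) at_bot" using tendsto_mult_right_zero[OF d(5)] .
  show "0 \<le> C * b s" for s using d assms by auto
qed

lemma continuous_on_line:
  assumes "dominated \<theta> b h" "\<bar>\<tau>\<bar> < \<theta>"
  shows "continuous_on UNIV (\<lambda>s. h (Complex s \<tau>))"
  unfolding Complex_eq
  by (rule continuous_on_compose2[OF holomorphic_on_imp_continuous_on[OF dominatedD(1)[OF assms(1)]]])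
     (use assms in \<open>auto intro!: continuous_intros\<close>)

text \<open>The point \<open>1\<close> has distance at least \<open>sin d\<close> from every ray whose angle to the positive axis is at least \<open>d\<close>.\<close>

lemma norm_exp_minus_one_ge:
  assumes "0 < d" "d \<le> pi/2" "d \<le> \<bar>Im z\<bar>" "\<bar>Im z\<bar> \<le> 2*pi - d"
  shows "sin d \<le> cmod (exp z - 1)"
proof -
  have "cos (Im z) \<le> cos d"
  proof (cases "\<bar>Im z\<bar> \<le> pi")
    case True
    then have "cos \<bar>Im z\<bar> \<le> cos d" using assms by (intro cos_monotone_0_pi_le) auto
    then show ?thesis by simp
  next
    case False
    then have "cos (2*pi - \<bar>Im z\<bar>) \<le> cos d" using assms by (intro cos_monotone_0_pi_le) auto
    then show ?thesis by (simp add: cos_diff)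
  qed
  then have "exp (Re z) * cos (Im z) \<le> exp (Re z) * cos d" by simp
  moreover have "(e * c - 1)\<^sup>2 + (e * s - 0)\<^sup>2 = e\<^sup>2 * (s\<^sup>2 + c\<^sup>2) - 2 * (e * c) + 1" for e c s :: real
    by (simp add: power2_eq_square algebra_simps)
  then have "(cmod (exp z - 1))\<^sup>2 = (exp (Re z))\<^sup>2 * ((sin (Im z))\<^sup>2 + (cos (Im z))\<^sup>2) - 2 * (exp (Re z) * cos (Im z)) + 1"
    by (simp only: cmod_power2 minus_complex.sel Re_exp Im_exp one_complex.sel)
  ultimately have "(cmod (exp z - 1))\<^sup>2 \<ge> (exp (Re z))\<^sup>2 - 2 * (exp (Re z) * cos d) + 1" by simp
  also have "(exp (Re z))\<^sup>2 - 2 * (exp (Re z) * cos d) + 1 = (exp (Re z) - cos d)\<^sup>2 + (sin d)\<^sup>2"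
    using sin_cos_squared_add[of d] by (simp add: power2_eq_square algebra_simps)
  finally have "(sin d)\<^sup>2 \<le> (cmod (exp z - 1))\<^sup>2" by (smt (verit) zero_le_power2)
  then show ?thesis by (rule power2_le_imp_le) simp
qed

text \<open>These are the Cauchy kernel \<open>\<mu> / (\<mu> - \<lambda>)\<close> and its companion \<open>\<lambda> / (\<mu> - \<lambda>)\<close>; both are bounded as soon as the
arguments of \<open>\<mu>\<close> and \<open>\<lambda>\<close> stay apart.\<close>

lemma quotient_exp_bound:
  assumes "0 < d" "d \<le> pi/2" "d \<le> \<bar>Im v - Im w\<bar>" "\<bar>Im v - Im w\<bar> \<le> 2*pi - d"
  shows "exp v \<noteq> exp w" "cmod (exp v / (exp v - exp w)) \<le> 1 / sin d" "cmod (exp w / (exp v - exp w)) \<le> 1 / sin d"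
proof -
  have "sin d > 0" using assms by (intro sin_gt_zero) (auto intro: less_le_trans)
  have 1: "sin d \<le> cmod (exp (w - v) - 1)" "sin d \<le> cmod (exp (v - w) - 1)"
    using norm_exp_minus_one_ge[of d "w - v"] norm_exp_minus_one_ge[of d "v - w"] assms by auto
  have e: "exp v - exp w = - (exp v * (exp (w - v) - 1))" "exp v - exp w = exp w * (exp (v - w) - 1)"
    by (simp_all add: algebra_simps exp_diff)
  show "exp v \<noteq> exp w" using 1 \<open>sin d > 0\<close> e by auto
  have "cmod (exp v / (exp v - exp w)) = 1 / cmod (exp (w - v) - 1)" unfolding e(1) by (simp add: norm_divide norm_mult)
  then show "cmod (exp v / (exp v - exp w)) \<le> 1 / sin d" using 1 \<open>sin d > 0\<close> by (simp add: frac_le)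
  have "cmod (exp w / (exp v - exp w)) = 1 / cmod (exp (v - w) - 1)" unfolding e(2) by (simp add: norm_divide norm_mult)
  then show "cmod (exp w / (exp v - exp w)) \<le> 1 / sin d" using 1 \<open>sin d > 0\<close> by (simp add: frac_le)
qed

lemma holomorphic_shift:
  fixes h :: "complex \<Rightarrow> complex"
  assumes "dominated \<theta> b h" "-\<theta> < \<tau>1" "\<tau>1 \<le> \<tau>2" "\<tau>2 < \<theta>"
  shows "integral UNIV (\<lambda>s. h (Complex s \<tau>1)) = integral UNIV (\<lambda>s. h (Complex s \<tau>2))"
proof (rule strip_contour_shift[where F' = "deriv h" and b = b])
  note d = dominatedD[OF assms(1)]
  show "(h has_derivative (\<lambda>d. d *\<^sub>C deriv h w)) (at w)" if "\<tau>1 \<le> Im w" "Im w \<le> \<tau>2" for w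
  proof -
    have "(h has_field_derivative deriv h w) (at w)"
      using holomorphic_derivI[OF d(1) open_strip] that assms by auto
    then show ?thesis by (simp add: has_field_derivative_def scaleC_complex_def mult_commute_abs)
  qed
  have "continuous_on {w. \<bar>Im w\<bar> < \<theta>} (deriv h)"
    using holomorphic_deriv[OF d(1) open_strip] holomorphic_on_imp_continuous_on by blast
  then show "continuous_on {w. \<tau>1 \<le> Im w \<and> Im w \<le> \<tau>2} (deriv h)"
    by (rule continuous_on_subset) (use assms in auto)
qed (use dominatedD[OF assms(1)] assms in auto)

context zero_sectorial_operator
begin

definition line_integral :: "(complex \<Rightarrow> complex) \<Rightarrow> real \<Rightarrow> 'a \<Rightarrow> 'a" where
  "line_integral h \<tau> x = integral UNIV (\<lambda>s. h (Complex s \<tau>) *\<^sub>C Q (Complex s \<tau>) x)"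

text \<open>The Dunford integral over the boundary of the sector of half-angle \<open>\<sigma>\<close>.\<close>

definition D :: "real \<Rightarrow> (complex \<Rightarrow> complex) \<Rightarrow> 'a \<Rightarrow> 'a" where
  "D \<sigma> h x = (1 / (2 * complex_of_real pi * \<i>)) *\<^sub>C (line_integral h (- \<sigma>) x - line_integral h \<sigma> x)"

lemma sector_integral_eq_D: "sector_integral A f \<sigma> x = D \<sigma> (\<lambda>w. f (exp w)) x"
  by (simp add: sector_integral_def D_def ray_integral_def line_integral_def Q_def scaleC_scaleC Let_def)

lemma continuous_on_Q_line:
  assumes "0 < \<bar>\<tau>\<bar>" "\<bar>\<tau>\<bar> < pi"
  shows "continuous_on S (\<lambda>s. Q (Complex s \<tau>) x)"
proof (intro continuous_at_imp_continuous_on ballI)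
  fix s
  have "isCont (\<lambda>s. Complex s \<tau>) s" unfolding Complex_eq by (intro continuous_intros)
  then show "isCont (\<lambda>s. Q (Complex s \<tau>) x) s"
    by (rule isCont_o2) (use isCont_Q assms in auto)
qed

lemma line_integrand:
  assumes "dominated \<theta> b h" "\<theta> \<le> pi" "0 < \<bar>\<tau>\<bar>" "\<bar>\<tau>\<bar> < \<theta>"
  shows line_integrand_continuous: "continuous_on UNIV (\<lambda>s. h (Complex s \<tau>) *\<^sub>C Q (Complex s \<tau>) x)"
    and line_integrand_integrable: "(\<lambda>s. h (Complex s \<tau>) *\<^sub>C Q (Complex s \<tau>) x) integrable_on UNIV"
proof -
  note d = dominatedD[OF assms(1)]
  obtain C where C: "C \<ge> 0" "\<And>w x. \<bar>\<tau>\<bar> \<le> \<bar>Im w\<bar> \<Longrightarrow> \<bar>Im w\<bar> \<le> pi \<Longrightarrow> norm (Q w x) \<le> C * norm x"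
    using Q_bounded[of "\<bar>\<tau>\<bar>"] assms by auto
  show *: "continuous_on UNIV (\<lambda>s. h (Complex s \<tau>) *\<^sub>C Q (Complex s \<tau>) x)"
    by (intro scaleC_continuous continuous_on_line[OF assms(1)] continuous_on_Q_line) (use assms in auto)
  show "(\<lambda>s. h (Complex s \<tau>) *\<^sub>C Q (Complex s \<tau>) x) integrable_on UNIV"
  proof (rule dominated_integrable[OF *])
    show "(\<lambda>s. b s * (C * norm x)) integrable_on UNIV" using d by (intro integrable_on_mult_left) auto
    show "norm (h (Complex s \<tau>) *\<^sub>C Q (Complex s \<tau>) x) \<le> b s * (C * norm x)" for s
      unfolding norm_scaleC using d(2)[of "Complex s \<tau>"] C d(6) assms by (intro mult_mono) auto
  qed
qed

lemma line_integral_shift: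
  assumes "dominated \<theta> b h" "\<theta> \<le> pi" "\<tau>1 \<le> \<tau>2" "0 < \<tau>1 \<and> \<tau>2 < \<theta> \<or> - \<theta> < \<tau>1 \<and> \<tau>2 < 0"
  shows "line_integral h \<tau>1 x = line_integral h \<tau>2 x"
  unfolding line_integral_def
proof -
  note d = dominatedD[OF assms(1)]
  define c where "c = min \<bar>\<tau>1\<bar> \<bar>\<tau>2\<bar>"
  have c: "0 < c" "c \<le> pi" "\<And>w. \<tau>1 \<le> Im w \<Longrightarrow> Im w \<le> \<tau>2 \<Longrightarrow> c \<le> \<bar>Im w\<bar> \<and> \<bar>Im w\<bar> < \<theta>"
    using assms by (auto simp: c_def)
  obtain C where C: "C \<ge> 0" "\<And>w x. c \<le> \<bar>Im w\<bar> \<Longrightarrow> \<bar>Im w\<bar> \<le> pi \<Longrightarrow> norm (Q w x) \<le> C * norm x"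
    using Q_bounded[OF c(1,2)] by blast
  let ?F' = "\<lambda>w. h w *\<^sub>C (Q w x - Q w (Q w x)) + deriv h w *\<^sub>C Q w x"
  have st: "0 < \<bar>Im w\<bar>" "\<bar>Im w\<bar> < pi" "\<bar>Im w\<bar> < \<theta>" if "\<tau>1 \<le> Im w" "Im w \<le> \<tau>2" for w
    using c(1) c(3)[OF that] assms(2) by auto
  show "integral UNIV (\<lambda>s. h (Complex s \<tau>1) *\<^sub>C Q (Complex s \<tau>1) x) = integral UNIV (\<lambda>s. h (Complex s \<tau>2) *\<^sub>C Q (Complex s \<tau>2) x)"
  proof (rule strip_contour_shift[where F = "\<lambda>w. h w *\<^sub>C Q w x" and F' = ?F' and b = "\<lambda>s. b s * (C * norm x)"])
    fix w assume w: "\<tau>1 \<le> Im w" "Im w \<le> \<tau>2"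
    have "(h has_field_derivative deriv h w) (at w)"
      using holomorphic_derivI[OF d(1) open_strip] st[OF w] by auto
    then have "(h has_derivative (\<lambda>d. deriv h w * d)) (at w)" by (simp add: has_field_derivative_def)
    from scaleC_has_derivative[OF this Q_has_derivative[OF st(1,2)[OF w], of x]]
    show "((\<lambda>w. h w *\<^sub>C Q w x) has_derivative (\<lambda>d. d *\<^sub>C ?F' w)) (at w)"
      by (simp add: scaleC_add_right scaleC_scaleC mult.commute)
    show "norm (h w *\<^sub>C Q w x) \<le> b (Re w) * (C * norm x)"
      unfolding norm_scaleC using d(2)[of w] C d(6) st[OF w] c(3)[OF w] assms by (intro mult_mono) auto
  next
    show "continuous_on {w. \<tau>1 \<le> Im w \<and> Im w \<le> \<tau>2} ?F'"
    proof (intro scaleC_continuous continuous_on_add continuous_on_diff)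
      have h: "continuous_on {w. \<bar>Im w\<bar> < \<theta>} h" "continuous_on {w. \<bar>Im w\<bar> < \<theta>} (deriv h)"
        using holomorphic_deriv[OF d(1) open_strip] d(1) holomorphic_on_imp_continuous_on by blast+
      show "continuous_on {w. \<tau>1 \<le> Im w \<and> Im w \<le> \<tau>2} h" "continuous_on {w. \<tau>1 \<le> Im w \<and> Im w \<le> \<tau>2} (deriv h)"
        using st by (auto intro: continuous_on_subset[OF h(1)] continuous_on_subset[OF h(2)])
      show "continuous_on {w. \<tau>1 \<le> Im w \<and> Im w \<le> \<tau>2} (\<lambda>w. Q w x)" "continuous_on {w. \<tau>1 \<le> Im w \<and> Im w \<le> \<tau>2} (\<lambda>w. Q w x)"
        using st by (auto intro!: continuous_at_imp_continuous_on isCont_Q)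
      show "continuous_on {w. \<tau>1 \<le> Im w \<and> Im w \<le> \<tau>2} (\<lambda>w. Q w (Q w x))"
        using st by (auto intro!: continuous_at_imp_continuous_on isCont_Q_compose isCont_Q)
    qed
    show "(\<lambda>s. b s * (C * norm x)) integrable_on UNIV" using d by (intro integrable_on_mult_left) auto
    show "((\<lambda>s. b s * (C * norm x)) \<longlongrightarrow> 0) at_top" using tendsto_mult_left_zero[OF d(4)] .
    show "((\<lambda>s. b s * (C * norm x)) \<longlongrightarrow> 0) at_bot" using tendsto_mult_left_zero[OF d(5)] .
  qed (use assms in auto)
qed

lemma D_independent:
  assumes "dominated \<theta> b h" "\<theta> \<le> pi" "0 < \<sigma>" "\<sigma> < \<theta>" "0 < \<sigma>'" "\<sigma>' < \<theta>"
  shows "D \<sigma> h x = D \<sigma>' h x"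
proof -
  have *: "line_integral h \<sigma> x = line_integral h \<sigma>' x \<and> line_integral h (-\<sigma>) x = line_integral h (-\<sigma>') x"
    if "\<sigma> \<le> \<sigma>'" "0 < \<sigma>" "\<sigma>' < \<theta>" for \<sigma> \<sigma>'
  proof
    show "line_integral h \<sigma> x = line_integral h \<sigma>' x"
      by (rule line_integral_shift[OF assms(1,2)]) (use that in auto)
    show "line_integral h (-\<sigma>) x = line_integral h (-\<sigma>') x"
      by (rule line_integral_shift[OF assms(1,2), symmetric]) (use that in auto)
  qed
  show ?thesis
  proof (cases "\<sigma> \<le> \<sigma>'")
    case True
    then show ?thesis using *[of \<sigma> \<sigma>'] assms by (simp add: D_def)
  next
    case False
    then show ?thesis using *[of \<sigma>' \<sigma>] assms by (simp add: D_def)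
  qed
qed

lemma D_bounded_linear:
  assumes "dominated \<theta> b h" "\<theta> \<le> pi" "0 < \<sigma>" "\<sigma> < \<theta>"
  shows "bounded_linear (D \<sigma> h)"
proof -
  note d = dominatedD[OF assms(1)]
  have "bounded_linear (line_integral h \<tau>)" if "0 < \<bar>\<tau>\<bar>" "\<bar>\<tau>\<bar> < \<theta>" for \<tau>
  proof -
    note int = line_integrand_integrable[OF assms(1,2) that]
    have bl: "bounded_linear (\<lambda>x. h (Complex s \<tau>) *\<^sub>C Q (Complex s \<tau>) x)" for s
      using bounded_linear_compose[OF bounded_linear_scaleC bounded_linear_Q[of "Complex s \<tau>"]] that assms(2) by (simp add: o_def)
    have "\<bar>\<tau>\<bar> \<le> pi" using that assms(2) by linarith
    from Q_bounded[OF that(1) this] obtain C where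
      C: "C \<ge> 0" "\<And>w x. \<bar>\<tau>\<bar> \<le> \<bar>Im w\<bar> \<Longrightarrow> \<bar>Im w\<bar> \<le> pi \<Longrightarrow> norm (Q w x) \<le> C * norm x"
      by blast
    show ?thesis
    proof (rule bounded_linear_intro)
      show "line_integral h \<tau> (x + y) = line_integral h \<tau> x + line_integral h \<tau> y" for x y
        unfolding line_integral_def linear_add[OF bounded_linear.linear[OF bl]] by (rule integral_add[OF int int])
      show "line_integral h \<tau> (r *\<^sub>R x) = r *\<^sub>R line_integral h \<tau> x" for x r
        unfolding line_integral_def linear_scale[OF bounded_linear.linear[OF bl]] by simp
      show "norm (line_integral h \<tau> x) \<le> norm x * (integral UNIV b * C)" for x
      proof -
        have "norm (line_integral h \<tau> x) \<le> integral UNIV (\<lambda>s. b s * (C * norm x))"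
          unfolding line_integral_def
        proof (rule integral_norm_bound_integral[OF int])
          show "(\<lambda>s. b s * (C * norm x)) integrable_on UNIV" using d by (intro integrable_on_mult_left) auto
          show "norm (h (Complex s \<tau>) *\<^sub>C Q (Complex s \<tau>) x) \<le> b s * (C * norm x)" for s
            unfolding norm_scaleC using d(2)[of "Complex s \<tau>"] C d(6) assms that by (intro mult_mono) auto
        qed
        then show ?thesis by (simp add: mult_ac)
      qed
    qed
  qed
  from this[of \<sigma>] this[of "-\<sigma>"] show ?thesis
    unfolding D_def[abs_def] using assms
    by (auto intro!: bounded_linear_compose[OF bounded_linear_scaleC] bounded_linear_sub)
qed

lemma D_add:
  assumes "dominated \<theta> b h" "dominated \<theta> c k" "\<theta> \<le> pi" "0 < \<sigma>" "\<sigma> < \<theta>"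
  shows "D \<sigma> (\<lambda>w. h w + k w) x = D \<sigma> h x + D \<sigma> k x"
proof -
  have "line_integral (\<lambda>w. h w + k w) \<tau> x = line_integral h \<tau> x + line_integral k \<tau> x" if "0 < \<bar>\<tau>\<bar>" "\<bar>\<tau>\<bar> < \<theta>" for \<tau>
    unfolding line_integral_def using line_integrand_integrable[OF assms(1,3) that] line_integrand_integrable[OF assms(2,3) that]
    by (simp add: scaleC_add_left integral_add)
  then show ?thesis using assms by (simp add: D_def scaleC_add_right scaleC_diff_right)
qed

lemma line_integral_linear:
  assumes "dominated \<theta> b h" "\<theta> \<le> pi" "0 < \<bar>\<tau>\<bar>" "\<bar>\<tau>\<bar> < \<theta>" "bounded_linear T"
  shows "T (line_integral h \<tau> x) = integral UNIV (\<lambda>s. T (h (Complex s \<tau>) *\<^sub>C Q (Complex s \<tau>) x))"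
  unfolding line_integral_def
  using integral_linear[OF line_integrand_integrable[OF assms(1-4)] assms(5)] by (simp add: o_def)

lemma D_cmult:
  assumes "dominated \<theta> b h" "\<theta> \<le> pi" "0 < \<sigma>" "\<sigma> < \<theta>"
  shows "D \<sigma> (\<lambda>w. c * h w) x = c *\<^sub>C D \<sigma> h x"
proof -
  have "line_integral (\<lambda>w. c * h w) \<tau> x = c *\<^sub>C line_integral h \<tau> x" if "0 < \<bar>\<tau>\<bar>" "\<bar>\<tau>\<bar> < \<theta>" for \<tau>
    using line_integral_linear[OF assms(1,2) that bounded_linear_scaleC] by (simp add: line_integral_def scaleC_scaleC)
  then show ?thesis using assms by (simp add: D_def scaleC_diff_right scaleC_scaleC mult.commute)
qed

text \<open>The strip is narrowed so that it stays away from \<open>v\<close>; the Cauchy kernel is bounded there.\<close>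

lemma dominated_quotient:
  assumes "dominated \<theta> b h" "0 < \<sigma>" "\<sigma> < \<theta>" "\<theta> \<le> pi" "\<sigma> < \<bar>Im v\<bar>" "\<bar>Im v\<bar> \<le> pi"
  obtains \<theta>' C where "\<sigma> < \<theta>'" "\<theta>' \<le> \<theta>" "\<And>w. \<bar>Im w\<bar> < \<theta>' \<Longrightarrow> exp v \<noteq> exp w"
    "dominated \<theta>' (\<lambda>s. C * b s) (\<lambda>w. exp v / (exp v - exp w) * h w)"
    "dominated \<theta>' (\<lambda>s. C * b s) (\<lambda>w. exp w / (exp v - exp w) * h w)"
proof -
  \<comment> \<open>a half-width strictly between \<open>\<sigma>\<close> and \<open>|Im v|\<close>\<close>
  define \<theta>' where "\<theta>' = min \<theta> ((\<sigma> + \<bar>Im v\<bar>) / 2)"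
  define d where "d = min (pi/2) (\<bar>Im v\<bar> - \<theta>')"
  have "(\<sigma> + \<bar>Im v\<bar>) / 2 < \<bar>Im v\<bar> \<and> \<sigma> < (\<sigma> + \<bar>Im v\<bar>) / 2" using assms(5) by (simp add: field_simps)
  then have \<theta>': "\<sigma> < \<theta>'" "\<theta>' \<le> \<theta>" "\<theta>' < \<bar>Im v\<bar>"
    using assms by (auto simp: \<theta>'_def simp del: divide_less_eq_numeral1 less_divide_eq_numeral1)
  have d: "0 < d" "d \<le> pi/2" "d \<le> \<bar>Im v\<bar> - \<theta>'"
    using \<theta>' by (simp add: d_def) (simp_all only: d_def min.cobounded1 min.cobounded2)
  have i: "d \<le> \<bar>Im v - Im w\<bar>" "\<bar>Im v - Im w\<bar> \<le> 2*pi - d" if "\<bar>Im w\<bar> < \<theta>'" for w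
    using that d \<theta>' assms by linarith+
  note q = quotient_exp_bound[OF d(1,2) i]
  have "sin d > 0" using d by (intro sin_gt_zero) (auto intro: less_le_trans)
  show ?thesis
  proof (rule that[OF \<theta>'(1,2)])
    show "dominated \<theta>' (\<lambda>s. 1 / sin d * b s) (\<lambda>w. exp v / (exp v - exp w) * h w)"
      using q \<open>sin d > 0\<close> \<theta>' by (intro dominated_mult[OF assms(1)]) (auto intro!: holomorphic_intros)
    show "dominated \<theta>' (\<lambda>s. 1 / sin d * b s) (\<lambda>w. exp w / (exp v - exp w) * h w)"
      using q \<open>sin d > 0\<close> \<theta>' by (intro dominated_mult[OF assms(1)]) (auto intro!: holomorphic_intros)
  qed (use q in auto)
qed

text \<open>By the resolvent identity, \<open>Q v (Q w x)\<close> is the combination of \<open>Q w x\<close> and \<open>Q v x\<close> with the two kernels as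
coefficients. The coefficient of \<open>Q v x\<close> is holomorphic in the strip, hence contributes the same on both lines and
cancels.\<close>

lemma Q_D:
  assumes "dominated \<theta> b h" "0 < \<sigma>" "\<sigma> < \<theta>" "\<theta> \<le> pi" "\<sigma> < \<bar>Im v\<bar>" "\<bar>Im v\<bar> \<le> pi"
  shows "Q v (D \<sigma> h x) = D \<sigma> (\<lambda>w. exp v / (exp v - exp w) * h w) x"
proof -
  have v: "0 < \<bar>Im v\<bar>" "\<bar>Im v\<bar> \<le> pi" using assms by auto
  interpret Qv: bounded_linear "Q v" by (rule bounded_linear_Q[OF v])
  obtain \<theta>' C where \<theta>': "\<sigma> < \<theta>'" "\<theta>' \<le> \<theta>" "\<And>w. \<bar>Im w\<bar> < \<theta>' \<Longrightarrow> exp v \<noteq> exp w"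
    and d1: "dominated \<theta>' (\<lambda>s. C * b s) (\<lambda>w. exp v / (exp v - exp w) * h w)"
    and d2: "dominated \<theta>' (\<lambda>s. C * b s) (\<lambda>w. exp w / (exp v - exp w) * h w)"
    using dominated_quotient[OF assms] by blast
  let ?j = "\<lambda>\<tau>. integral UNIV (\<lambda>s. exp (Complex s \<tau>) / (exp v - exp (Complex s \<tau>)) * h (Complex s \<tau>))"
  have l: "Q v (line_integral h \<tau> x) = line_integral (\<lambda>w. exp v / (exp v - exp w) * h w) \<tau> x - ?j \<tau> *\<^sub>C Q v x"
    if "\<bar>\<tau>\<bar> = \<sigma>" for \<tau>
  proof -
    have \<tau>: "0 < \<bar>\<tau>\<bar>" "\<bar>\<tau>\<bar> < \<theta>" "\<bar>\<tau>\<bar> < \<theta>'" "\<theta>' \<le> pi" using that assms \<theta>' by auto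
    have "Q v (line_integral h \<tau> x) = integral UNIV (\<lambda>s. Q v (h (Complex s \<tau>) *\<^sub>C Q (Complex s \<tau>) x))"
      using line_integral_linear[OF assms(1,4) \<tau>(1,2) bounded_linear_Q[OF v]] .
    also have "(\<lambda>s. Q v (h (Complex s \<tau>) *\<^sub>C Q (Complex s \<tau>) x)) =
       (\<lambda>s. (exp v / (exp v - exp (Complex s \<tau>)) * h (Complex s \<tau>)) *\<^sub>C Q (Complex s \<tau>) x -
            (exp (Complex s \<tau>) / (exp v - exp (Complex s \<tau>)) * h (Complex s \<tau>)) *\<^sub>C Q v x)"
    proof
      fix s
      let ?w = "Complex s \<tau>"
      have ne: "exp v - exp ?w \<noteq> 0" using \<theta>'(3)[of ?w] \<tau> by simp
      have "(h ?w / (exp v - exp ?w)) *\<^sub>C (exp ?w *\<^sub>C Q v x - exp v *\<^sub>C Q ?w x) = 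
          (h ?w / (exp v - exp ?w)) *\<^sub>C (exp ?w - exp v) *\<^sub>C Q v (Q ?w x)"
        using Q_identity[of ?w v x] v \<tau> by simp
      also have "\<dots> = - (h ?w *\<^sub>C Q v (Q ?w x))"
      proof -
        have "h ?w / (exp v - exp ?w) * (exp ?w - exp v) = - h ?w" using ne by (simp add: field_simps)
        then show ?thesis by (simp only: scaleC_scaleC scaleC_minus_left)
      qed
      finally show "Q v (h ?w *\<^sub>C Q ?w x) = (exp v / (exp v - exp ?w) * h ?w) *\<^sub>C Q ?w x -
            (exp ?w / (exp v - exp ?w) * h ?w) *\<^sub>C Q v x"
        by (simp add: Q_scaleC[OF v] scaleC_diff_right scaleC_scaleC mult_ac)
           (metis (no_types, lifting) add.inverse_inverse minus_diff_eq)
    qed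
    also have "integral UNIV \<dots> = line_integral (\<lambda>w. exp v / (exp v - exp w) * h w) \<tau> x - ?j \<tau> *\<^sub>C Q v x"
    proof -
      have i: "(\<lambda>s. exp (Complex s \<tau>) / (exp v - exp (Complex s \<tau>)) * h (Complex s \<tau>)) integrable_on UNIV"
        by (rule dominated_integrable[OF continuous_on_line[OF d2 \<tau>(3)] dominatedD(3)[OF d2]])
           (use dominatedD(2)[OF d2, of "Complex _ \<tau>"] \<tau> in auto)
      have bl: "bounded_linear (\<lambda>c. c *\<^sub>C Q v x)" by (rule bounded_bilinear.bounded_linear_left[OF bounded_bilinear_scaleC])
      show ?thesis
        unfolding line_integral_def
        using integral_diff[OF line_integrand_integrable[OF d1 \<tau>(4,1,3)] integrable_linear[OF i bl, unfolded o_def]] integral_linear[OF i bl]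
        by (simp add: o_def)
    qed
    finally show ?thesis .
  qed
  have "?j (-\<sigma>) = ?j \<sigma>" using holomorphic_shift[OF d2, of "-\<sigma>" \<sigma>] \<theta>' assms by simp
  then show ?thesis using l[of \<sigma>] l[of "-\<sigma>"] assms by (simp add: D_def Q_scaleC[OF v] Qv.diff)
qed

end

lemma dominated_tendsto:
  fixes F :: "real \<Rightarrow> 'a::banach"
  assumes F: "continuous_on UNIV F" and b: "b integrable_on UNIV" and dom: "\<And>s. norm (F s) \<le> b s"
  shows "((\<lambda>N. integral {-N..N} F) \<longlongrightarrow> integral UNIV F) at_top"
proof (rule tendstoI)
  fix e :: real assume "e > 0"
  obtain B where "B > 0" and B: "\<And>N. N \<ge> B \<Longrightarrow> \<bar>integral UNIV b - integral {-N..N} b\<bar> < e"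
    using tail_integral_small[OF b \<open>e > 0\<close>] by blast
  show "\<forall>\<^sub>F N in at_top. dist (integral {-N..N} F) (integral UNIV F) < e"
    using eventually_ge_at_top[of B]
  proof eventually_elim
    case (elim N)
    then show ?case using dominated_tail[OF F b dom, of N] B[of N] \<open>B > 0\<close>
      by (auto simp: dist_norm norm_minus_commute)
  qed
qed

lemma connected_strip: "connected {w. \<bar>Im w\<bar> < \<theta>}"
proof -
  have "{w. \<bar>Im w\<bar> < \<theta>} = {w. Im w < \<theta>} \<inter> {w. Im w > - \<theta>}" by auto
  then show ?thesis
    by (metis convex_connected convex_Int convex_halfspace_Im_lt convex_halfspace_Im_gt)
qed

lemma contour_integral_horizontal:
  assumes "a < b"
  shows "contour_integral (linepath (Complex a c) (Complex b c)) f = integral {a..b} (\<lambda>t. f (Complex t c))"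
proof -
  have "contour_integral (linepath (Complex a c) (Complex b c)) f
      = contour_integral (linepath (complex_of_real a) (complex_of_real b)) (\<lambda>z. f (z + \<i> * c))"
    by (simp add: contour_integral_integral linepath_def Complex_eq algebra_simps)
  also have "\<dots> = integral {a..b} (\<lambda>t. f (Complex t c))"
    using assms by (subst contour_integral_linepath_Reals_eq) (auto simp: Complex_eq)
  finally show ?thesis .
qed

text \<open>This is Cauchy's formula for the sector with \<open>\<mu> = e\<^sup>v\<close>: the kernel \<open>e\<^sup>v / (e\<^sup>v - e\<^sup>w)\<close> has in the strip a
single pole, at \<open>w\<close>, with residue \<open>1\<close>. The residue theorem is applied to long rectangles.\<close>

lemma strip_Cauchy_formula:
  assumes g: "dominated \<theta> c g" and "0 < \<sigma>" "\<sigma> < \<theta>" "\<theta> \<le> pi" "\<bar>Im w\<bar> < \<sigma>"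
  shows "integral UNIV (\<lambda>t. exp (Complex t (-\<sigma>)) / (exp (Complex t (-\<sigma>)) - exp w) * g (Complex t (-\<sigma>)))
       - integral UNIV (\<lambda>t. exp (Complex t \<sigma>) / (exp (Complex t \<sigma>) - exp w) * g (Complex t \<sigma>)) = 2 * pi * \<i> * g w"
proof -
  note d = dominatedD[OF g]
  let ?S = "{v. \<bar>Im v\<bar> < \<theta>}"
  define G where "G v = exp v * g v / (exp v - exp w)" for v
  have ne: "exp v \<noteq> exp w" if "v \<in> ?S - {w}" for v
  proof
    assume "exp v = exp w"
    moreover have "\<bar>Im v\<bar> < \<theta>" using that by simp
    then have "\<bar>Im v - Im w\<bar> < 2 * pi" using assms by linarith
    ultimately have "v = w" using exp_complex_eqI by blast
    then show False using that by simp
  qed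
  have Gh: "G holomorphic_on ?S - {w}"
    unfolding G_def using ne by (intro holomorphic_intros holomorphic_on_subset[OF d(1)]) auto
  have Gc: "continuous_on (?S - {w}) G" by (rule holomorphic_on_imp_continuous_on[OF Gh])
  have res: "residue G w = g w"
  proof (rule residue_simple'[OF open_strip _ Gh])
    show "w \<in> ?S" using assms by simp
    have "(exp has_field_derivative exp w) (at w)" by (rule DERIV_exp)
    then have "((\<lambda>v. (exp v - exp w) / (v - w)) \<longlongrightarrow> exp w) (at w)" by (simp add: has_field_derivative_iff)
    moreover have "((\<lambda>v. exp v * g v) \<longlongrightarrow> exp w * g w) (at w)"
    proof -
      have "continuous (at w) g"
        using holomorphic_on_imp_continuous_on[OF d(1)] \<open>w \<in> ?S\<close>
        by (simp only: continuous_on_eq_continuous_at[OF open_strip])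
      then show ?thesis by (intro tendsto_intros) (auto simp: isCont_def)
    qed
    ultimately have "((\<lambda>v. (exp v * g v) / ((exp v - exp w) / (v - w))) \<longlongrightarrow> exp w * g w / exp w) (at w)"
      by (intro tendsto_divide) auto
    then show "((\<lambda>v. G v * (v - w)) \<longlongrightarrow> g w) (at w)" by (simp add: G_def)
  qed
  have main: "integral {-N..N} (\<lambda>t. G (Complex t (-\<sigma>))) - integral {-N..N} (\<lambda>t. G (Complex t \<sigma>))
      + (contour_integral (linepath (Complex N (-\<sigma>)) (Complex N \<sigma>)) G + contour_integral (linepath (Complex (-N) \<sigma>) (Complex (-N) (-\<sigma>))) G)
      = 2 * pi * \<i> * g w" and vertical: "cmod (contour_integral (linepath (Complex N (-\<sigma>)) (Complex N \<sigma>)) G + contour_integral (linepath (Complex (-N) \<sigma>) (Complex (-N) (-\<sigma>))) G)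
      \<le> 4 * \<sigma> * (c N + c (-N))" if "N > \<bar>Re w\<bar> + 1" for N
  proof -
    let ?a = "Complex (-N) (-\<sigma>)" and ?b = "Complex N \<sigma>"
    have N: "N > 0" using that by auto
    have P: "path_image (rectpath ?a ?b) \<subseteq> ?S - {w}"
      using that assms by (subst path_image_rectpath) auto
    have "contour_integral (rectpath ?a ?b) G = 2 * pi * \<i> * (\<Sum>p\<in>{w}. winding_number (rectpath ?a ?b) p * residue G p)"
    proof (rule Residue_theorem[OF open_strip _ _ Gh _ _ P])
      show "connected ?S"
        by (rule connected_strip)
      show "\<forall>z. z \<notin> ?S \<longrightarrow> winding_number (rectpath ?a ?b) z = 0"
        using assms N by (auto intro!: winding_number_rectpath_outside simp: in_cbox_complex_iff)
    qed (auto simp: rectpath_def Let_def)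
    also have "\<dots> = 2 * pi * \<i> * g w"
    proof -
      have "w \<in> box ?a ?b" using that assms by (auto simp: in_box_complex_iff)
      then show ?thesis by (simp add: res winding_number_rectpath)
    qed
    finally have 1: "contour_integral (rectpath ?a ?b) G = 2 * pi * \<i> * g w" .
    have seg: "closed_segment ?a (Complex N (-\<sigma>)) \<subseteq> ?S - {w}" "closed_segment (Complex N (-\<sigma>)) ?b \<subseteq> ?S - {w}"
        "closed_segment (Complex (-N) \<sigma>) ?b \<subseteq> ?S - {w}"  "closed_segment (Complex (-N) \<sigma>) ?a \<subseteq> ?S - {w}"
      using that assms N by (auto simp: closed_segment_same_Re closed_segment_same_Im closed_segment_eq_real_ivl)
    note ci = contour_integrable_continuous_linepath[OF continuous_on_subset[OF Gc]]
    have ints: "G contour_integrable_on linepath ?a (Complex N (-\<sigma>))" "G contour_integrable_on linepath (Complex N (-\<sigma>)) ?b"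
       "G contour_integrable_on linepath (Complex (-N) \<sigma>) ?b" "G contour_integrable_on linepath ?b (Complex (-N) \<sigma>)"
       "G contour_integrable_on linepath (Complex (-N) \<sigma>) ?a"
      using seg by (auto intro!: ci simp: closed_segment_commute[of ?b])
    have "contour_integral (rectpath ?a ?b) G = contour_integral (linepath ?a (Complex N (-\<sigma>))) G
       + (contour_integral (linepath (Complex N (-\<sigma>)) ?b) G + (contour_integral (linepath ?b (Complex (-N) \<sigma>)) G
       + contour_integral (linepath (Complex (-N) \<sigma>) ?a) G))"
      unfolding rectpath_def Let_def using ints by simp
    moreover have "contour_integral (linepath ?b (Complex (-N) \<sigma>)) G = - contour_integral (linepath (Complex (-N) \<sigma>) ?b) G"
      by (rule contour_integral_reverse_linepath) (use continuous_on_subset[OF Gc seg(3)] in \<open>simp add: closed_segment_commute\<close>)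
    ultimately show "integral {-N..N} (\<lambda>t. G (Complex t (-\<sigma>))) - integral {-N..N} (\<lambda>t. G (Complex t \<sigma>))
      + (contour_integral (linepath (Complex N (-\<sigma>)) (Complex N \<sigma>)) G + contour_integral (linepath (Complex (-N) \<sigma>) (Complex (-N) (-\<sigma>))) G)
      = 2 * pi * \<i> * g w"
      using 1 N by (simp add: contour_integral_horizontal algebra_simps)
    \<comment> \<open>one unit away from the pole in the real direction the kernel is at most \<open>2\<close>\<close>
    have bd: "cmod (G v) \<le> 2 * c (Re v)" if v: "1 \<le> \<bar>Re v - Re w\<bar>" "\<bar>Im v\<bar> < \<theta>" for v
    proof -
      have "1/2 \<le> \<bar>exp (Re w - Re v) - 1\<bar>"
      proof (cases "Re w - Re v \<ge> 0")
        case True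
        then have "exp 1 \<le> exp (Re w - Re v)" using v(1) by simp
        then show ?thesis using exp_ge_add_one_self[of 1] by linarith
      next
        case False
        then have "exp (Re w - Re v) \<le> exp (-1)" using v(1) by simp
        moreover have "exp (-1::real) \<le> 1/2" using exp_ge_add_one_self[of 1] by (simp add: exp_minus field_simps)
        ultimately show ?thesis by linarith
      qed
      also have "\<dots> \<le> cmod (exp (w - v) - 1)"
        using norm_triangle_ineq3[of "exp (w - v)" 1] by simp
      finally have lb: "1/2 \<le> cmod (exp (w - v) - 1)" .
      have "exp v - exp w = - (exp v * (exp (w - v) - 1))" by (simp add: algebra_simps exp_diff)
      then have "cmod (G v) = cmod (g v) / cmod (exp (w - v) - 1)"
        unfolding G_def by (simp add: norm_mult norm_divide)
      also have "\<dots> \<le> cmod (g v) / (1/2)" using lb by (intro divide_left_mono) auto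
      also have "\<dots> \<le> 2 * c (Re v)" using d(2)[OF v(2)] by simp
      finally show ?thesis .
    qed
    have "cmod (contour_integral (linepath (Complex N (-\<sigma>)) ?b) G) \<le> (2 * c N) * cmod (?b - Complex N (-\<sigma>))"
    proof (rule contour_integral_bound_linepath[OF ints(2)])
      fix v assume "v \<in> closed_segment (Complex N (-\<sigma>)) ?b"
      then have "Re v = N" "\<bar>Im v\<bar> < \<theta>" using assms by (auto simp: closed_segment_same_Re closed_segment_eq_real_ivl)
      then show "cmod (G v) \<le> 2 * c N" using bd[of v] that by auto
    qed (use d(6) in auto)
    moreover have "cmod (contour_integral (linepath (Complex (-N) \<sigma>) ?a) G) \<le> (2 * c (-N)) * cmod (?a - Complex (-N) \<sigma>)"
    proof (rule contour_integral_bound_linepath[OF ints(5)])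
      fix v assume "v \<in> closed_segment (Complex (-N) \<sigma>) ?a"
      then have "Re v = -N" "\<bar>Im v\<bar> < \<theta>" using assms by (auto simp: closed_segment_same_Re closed_segment_eq_real_ivl)
      then show "cmod (G v) \<le> 2 * c (-N)" using bd[of v] that by auto
    qed (use d(6) in auto)
    moreover have "cmod (?b - Complex N (-\<sigma>)) = 2 * \<sigma>" "cmod (?a - Complex (-N) \<sigma>) = 2 * \<sigma>"
      using assms by (simp_all add: cmod_def real_sqrt_mult)
    ultimately show "cmod (contour_integral (linepath (Complex N (-\<sigma>)) (Complex N \<sigma>)) G + contour_integral (linepath (Complex (-N) \<sigma>) (Complex (-N) (-\<sigma>))) G)
      \<le> 4 * \<sigma> * (c N + c (-N))"
      by (intro order_trans[OF norm_triangle_ineq]) (simp add: algebra_simps)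
  qed
  have tend: "((\<lambda>N. integral {-N..N} (\<lambda>t. G (Complex t \<tau>))) \<longlongrightarrow> integral UNIV (\<lambda>t. G (Complex t \<tau>))) at_top" if \<tau>: "\<bar>\<tau>\<bar> = \<sigma>" for \<tau>
  proof -
    define e where "e = min (pi/2) (\<sigma> - \<bar>Im w\<bar>)"
    have e: "0 < e" "e \<le> pi/2" "e \<le> \<sigma> - \<bar>Im w\<bar>"
      using assms by (simp add: e_def) (simp_all only: e_def min.cobounded1 min.cobounded2)
    have "sin e > 0" using e by (intro sin_gt_zero) (auto intro: less_le_trans)
    show ?thesis
    proof (rule dominated_tendsto[where b = "\<lambda>t. (1 / sin e) * c t"])
      show "continuous_on UNIV (\<lambda>t. G (Complex t \<tau>))"
        unfolding Complex_eq by (rule continuous_on_compose2[OF Gc]) (use assms \<tau> in \<open>auto intro!: continuous_intros simp: complex_eq_iff\<close>)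
      show "(\<lambda>t. (1 / sin e) * c t) integrable_on UNIV" using d(3) by (rule integrable_on_mult_right)
      fix t
      have "e \<le> \<bar>Im (Complex t \<tau>) - Im w\<bar>" "\<bar>Im (Complex t \<tau>) - Im w\<bar> \<le> 2*pi - e" using e \<tau> assms by auto
      note q = quotient_exp_bound(2)[OF e(1,2) this]
      have "cmod (G (Complex t \<tau>)) = cmod (exp (Complex t \<tau>) / (exp (Complex t \<tau>) - exp w)) * cmod (g (Complex t \<tau>))"
        by (simp add: G_def norm_mult norm_divide)
      also have "\<dots> \<le> (1 / sin e) * c t" using q d(2)[of "Complex t \<tau>"] \<tau> assms \<open>sin e > 0\<close> by (intro mult_mono) auto
      finally show "cmod (G (Complex t \<tau>)) \<le> (1 / sin e) * c t" .
    qed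
  qed
  let ?I = "\<lambda>\<tau>. integral UNIV (\<lambda>t. G (Complex t \<tau>))"
  have "((\<lambda>N. 2 * pi * \<i> * g w - (integral {-N..N} (\<lambda>t. G (Complex t (-\<sigma>))) - integral {-N..N} (\<lambda>t. G (Complex t \<sigma>)))) \<longlongrightarrow>
      2 * pi * \<i> * g w - (?I (-\<sigma>) - ?I \<sigma>)) at_top"
    using tend[of \<sigma>] tend[of "-\<sigma>"] assms by (intro tendsto_intros) auto
  moreover have "((\<lambda>N. 2 * pi * \<i> * g w - (integral {-N..N} (\<lambda>t. G (Complex t (-\<sigma>))) - integral {-N..N} (\<lambda>t. G (Complex t \<sigma>)))) \<longlongrightarrow> 0) at_top"
  proof (rule Lim_null_comparison)
    show "\<forall>\<^sub>F N in at_top. cmod (2 * pi * \<i> * g w - (integral {-N..N} (\<lambda>t. G (Complex t (-\<sigma>))) - integral {-N..N} (\<lambda>t. G (Complex t \<sigma>)))) \<le> 4 * \<sigma> * (c N + c (-N))"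
      using eventually_gt_at_top[of "\<bar>Re w\<bar> + 1"]
    proof eventually_elim
      case (elim N)
      show ?case unfolding main[OF elim, symmetric] using vertical[OF elim] by simp
    qed
    have "((\<lambda>N. c (-N)) \<longlongrightarrow> 0) at_top" using d(5) by (simp add: filterlim_at_bot_mirror)
    from tendsto_mult_right_zero[OF tendsto_add_zero[OF d(4) this]]
    show "((\<lambda>N. 4 * \<sigma> * (c N + c (-N))) \<longlongrightarrow> 0) at_top" .
  qed
  ultimately have "2 * pi * \<i> * g w - (?I (-\<sigma>) - ?I \<sigma>) = 0"
    using tendsto_unique[OF trivial_limit_at_top_linorder] by blast
  then show ?thesis by (simp add: G_def)
qed

context zero_sectorial_operator
begin

text \<open>In the outer integral \<open>Q v (D \<sigma> h x)\<close> is replaced by a contour integral over \<open>w\<close> with the kernel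
\<open>e\<^sup>v / (e\<^sup>v - e\<^sup>w)\<close>. After exchanging the integrals, Cauchy's formula evaluates the one over \<open>v\<close> to \<open>g w\<close>, because
the contour of \<open>w\<close> lies inside that of \<open>v\<close>.\<close>

lemma D_mult:
  assumes h: "dominated \<theta> b h" and g: "dominated \<theta> c g" and \<sigma>: "0 < \<sigma>" "\<sigma> < \<sigma>'" "\<sigma>' < \<theta>" "\<theta> \<le> pi"
    and M: "M \<ge> 0" "\<And>w. \<bar>Im w\<bar> < \<theta> \<Longrightarrow> cmod (g w) \<le> M"
  shows "D \<sigma>' g (D \<sigma> h x) = D \<sigma> (\<lambda>w. g w * h w) x"
proof -
  note dh = dominatedD[OF h] and dg = dominatedD[OF g]
  define y where "y = D \<sigma> h x"
  define ker where "ker v w = exp v / (exp v - exp w)" for v w :: complex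
  define e where "e = min (pi/2) (min (\<sigma>' - \<sigma>) (2 * (pi - \<sigma>')))"
  have e: "0 < e" "e \<le> pi/2" "e \<le> \<sigma>' - \<sigma>"
    using \<sigma> by (simp add: e_def) (simp only: e_def min.cobounded1, simp add: e_def min.coboundedI2)
  have "sin e > 0" using e by (intro sin_gt_zero) (auto intro: less_le_trans)
  have ker: "exp v \<noteq> exp w" "cmod (ker v w) \<le> 1 / sin e" if "\<bar>Im v\<bar> = \<sigma>'" "\<bar>Im w\<bar> = \<sigma>" for v w
  proof -
    have 1: "e \<le> \<bar>Im v - Im w\<bar>" "\<bar>Im v - Im w\<bar> \<le> 2*pi - e" using that e \<sigma> by linarith+
    show "exp v \<noteq> exp w" "cmod (ker v w) \<le> 1 / sin e" 
      using quotient_exp_bound[OF e(1,2) 1] by (auto simp: ker_def)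
  qed
  have "\<sigma> \<le> pi" using \<sigma> by linarith
  from Q_bounded[OF \<sigma>(1) this] obtain C where
    C: "C \<ge> 0" "\<And>w x. \<sigma> \<le> \<bar>Im w\<bar> \<Longrightarrow> \<bar>Im w\<bar> \<le> pi \<Longrightarrow> norm (Q w x) \<le> C * norm x"
    by blast
  define L where "L \<tau>' \<tau> s t = (g (Complex t \<tau>') * ker (Complex t \<tau>') (Complex s \<tau>) * h (Complex s \<tau>)) *\<^sub>C Q (Complex s \<tau>) x" for \<tau>' \<tau> s t
  \<comment> \<open>the four pairs of lines together: only for this combination are both inner integrals explicit\<close>
  define K where "K s t = (L (-\<sigma>') (-\<sigma>) s t - L (-\<sigma>') \<sigma> s t) - (L \<sigma>' (-\<sigma>) s t - L \<sigma>' \<sigma> s t)" for s t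
  have Lb: "norm (L \<tau>' \<tau> s t) \<le> (1 / sin e * C * norm x * b s) * c t" if "\<bar>\<tau>'\<bar> = \<sigma>'" "\<bar>\<tau>\<bar> = \<sigma>" for \<tau>' \<tau> s t
  proof -
    have "norm (L \<tau>' \<tau> s t) \<le> c t * (1 / sin e) * b s * (C * norm x)"
      unfolding L_def norm_scaleC norm_mult
      using dg(2)[of "Complex t \<tau>'"] dh(2)[of "Complex s \<tau>"] dg(6) dh(6) C ker(2)[of "Complex t \<tau>'" "Complex s \<tau>"] that \<sigma> \<open>sin e > 0\<close>
      by (intro mult_mono mult_nonneg_nonneg) auto
    then show ?thesis by (simp add: mult_ac)
  qed
  have Lc: "continuous_on UNIV (\<lambda>(s, t). L \<tau>' \<tau> s t)" if "\<bar>\<tau>'\<bar> = \<sigma>'" "\<bar>\<tau>\<bar> = \<sigma>" for \<tau>' \<tau>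
  proof -
    have "continuous_on UNIV (\<lambda>p. g (Complex (snd p) \<tau>'))" for p :: "real \<times> real"
      by (rule continuous_on_compose2[OF continuous_on_line[OF g]]) (use that \<sigma> in \<open>auto intro!: continuous_intros\<close>)
    moreover have "continuous_on UNIV (\<lambda>p. h (Complex (fst p) \<tau>))" for p :: "real \<times> real"
      by (rule continuous_on_compose2[OF continuous_on_line[OF h]]) (use that \<sigma> in \<open>auto intro!: continuous_intros\<close>)
    moreover have "continuous_on UNIV (\<lambda>p. Q (Complex (fst p) \<tau>) x)" for p :: "real \<times> real"
      by (rule continuous_on_compose2[OF continuous_on_Q_line[of \<tau> UNIV]]) (use that \<sigma> in \<open>auto intro!: continuous_intros\<close>)
    moreover have "continuous_on UNIV (\<lambda>p. ker (Complex (snd p) \<tau>') (Complex (fst p) \<tau>))" for p :: "real \<times> real"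
      unfolding ker_def Complex_eq using ker(1)[of "Complex _ \<tau>'" "Complex _ \<tau>"] that
      by (intro continuous_intros) (auto simp: Complex_eq)
    ultimately show ?thesis
      unfolding L_def case_prod_unfold by (intro scaleC_continuous continuous_on_mult) auto
  qed
  have Lcs: "continuous_on UNIV (\<lambda>s. L \<tau>' \<tau> s t)" "continuous_on UNIV (\<lambda>t. L \<tau>' \<tau> s t)" if "\<bar>\<tau>'\<bar> = \<sigma>'" "\<bar>\<tau>\<bar> = \<sigma>" for \<tau>' \<tau> s t
    using continuous_on_compose2[OF Lc[OF that], of UNIV "\<lambda>s. (s, t)"] continuous_on_compose2[OF Lc[OF that], of UNIV "\<lambda>t. (s, t)"]
    by (simp_all add: continuous_on_Pair continuous_on_const continuous_on_id)
  have Lis: "(\<lambda>s. L \<tau>' \<tau> s t) integrable_on UNIV" if "\<bar>\<tau>'\<bar> = \<sigma>'" "\<bar>\<tau>\<bar> = \<sigma>" for \<tau>' \<tau> t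
    by (rule dominated_integrable[OF Lcs(1)[OF that] _ Lb[OF that]]) (intro integrable_on_mult_left integrable_on_mult_right dh(3))
  have Lit: "(\<lambda>t. L \<tau>' \<tau> s t) integrable_on UNIV" if "\<bar>\<tau>'\<bar> = \<sigma>'" "\<bar>\<tau>\<bar> = \<sigma>" for \<tau>' \<tau> s
    by (rule dominated_integrable[OF Lcs(2)[OF that] _ Lb[OF that]]) (intro integrable_on_mult_right dg(3))
  let ?c = "2 * complex_of_real pi * \<i>"
  have Q: "?c *\<^sub>C (g (Complex t \<tau>') *\<^sub>C Q (Complex t \<tau>') y) = integral UNIV (\<lambda>s. L \<tau>' (-\<sigma>) s t) - integral UNIV (\<lambda>s. L \<tau>' \<sigma> s t)"
    if "\<bar>\<tau>'\<bar> = \<sigma>'" for \<tau>' t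
  proof -
    let ?v = "Complex t \<tau>'"
    have v: "\<sigma> < \<bar>Im ?v\<bar>" "\<bar>Im ?v\<bar> \<le> pi" using that \<sigma> by auto
    obtain \<theta>' C' where \<theta>': "\<sigma> < \<theta>'" "\<theta>' \<le> \<theta>"
      and d1: "dominated \<theta>' (\<lambda>s. C' * b s) (\<lambda>w. exp ?v / (exp ?v - exp w) * h w)"
      using dominated_quotient[OF h \<sigma>(1) _ \<sigma>(4) v] \<sigma> by (metis order.strict_trans)
    have l: "g ?v *\<^sub>C line_integral (\<lambda>w. exp ?v / (exp ?v - exp w) * h w) \<tau> x = integral UNIV (\<lambda>s. L \<tau>' \<tau> s t)" if "\<bar>\<tau>\<bar> = \<sigma>" for \<tau>
      using line_integral_linear[OF d1 _ _ _ bounded_linear_scaleC, of \<tau> "g ?v" x] that \<theta>' \<sigma>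
      by (simp add: L_def ker_def scaleC_scaleC mult_ac)
    have "Q ?v y = D \<sigma> (\<lambda>w. exp ?v / (exp ?v - exp w) * h w) x"
      unfolding y_def by (rule Q_D[OF h _ _ _ v]) (use \<sigma> in auto)
    then show ?thesis
      using l[of \<sigma>] l[of "-\<sigma>"] \<sigma> by (simp add: D_def scaleC_scaleC scaleC_diff_right mult_ac)
  qed
  have cauchy: "integral UNIV (\<lambda>t. L (-\<sigma>') \<tau> s t) - integral UNIV (\<lambda>t. L \<sigma>' \<tau> s t) = ?c *\<^sub>C ((g (Complex s \<tau>) * h (Complex s \<tau>)) *\<^sub>C Q (Complex s \<tau>) x)"
    if "\<bar>\<tau>\<bar> = \<sigma>" for \<tau> s
  proof -
    let ?w = "Complex s \<tau>"
    have bl: "bounded_linear (\<lambda>z. z *\<^sub>C (h ?w *\<^sub>C Q ?w x))" by (rule bounded_bilinear.bounded_linear_left[OF bounded_bilinear_scaleC])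
    have i: "(\<lambda>t. ker (Complex t \<tau>') ?w * g (Complex t \<tau>')) integrable_on UNIV" if \<tau>': "\<bar>\<tau>'\<bar> = \<sigma>'" for \<tau>'
    proof (rule dominated_integrable)
      show "continuous_on UNIV (\<lambda>t. ker (Complex t \<tau>') ?w * g (Complex t \<tau>'))"
        unfolding ker_def using ker(1)[of "Complex _ \<tau>'" ?w] \<tau>' \<open>\<bar>\<tau>\<bar> = \<sigma>\<close> \<sigma>
        by (intro continuous_intros continuous_on_line[OF g]) (auto simp: Complex_eq intro!: continuous_intros)
      show "(\<lambda>t. 1 / sin e * c t) integrable_on UNIV" using dg(3) by (rule integrable_on_mult_right)
      show "cmod (ker (Complex t \<tau>') ?w * g (Complex t \<tau>')) \<le> 1 / sin e * c t" for t
        unfolding norm_mult using ker(2)[of "Complex t \<tau>'" ?w] dg(2)[of "Complex t \<tau>'"] \<tau>' \<open>\<bar>\<tau>\<bar> = \<sigma>\<close> \<sigma> \<open>sin e > 0\<close> by (intro mult_mono) auto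
    qed
    have l: "integral UNIV (\<lambda>t. L \<tau>' \<tau> s t) = integral UNIV (\<lambda>t. ker (Complex t \<tau>') ?w * g (Complex t \<tau>')) *\<^sub>C (h ?w *\<^sub>C Q ?w x)" if \<tau>': "\<bar>\<tau>'\<bar> = \<sigma>'" for \<tau>'
      using integral_linear[OF i[OF \<tau>'] bl] by (simp add: o_def L_def scaleC_scaleC mult_ac)
    have "\<sigma>' > 0" using \<sigma> by simp
    then have "integral UNIV (\<lambda>t. ker (Complex t (-\<sigma>')) ?w * g (Complex t (-\<sigma>'))) - integral UNIV (\<lambda>t. ker (Complex t \<sigma>') ?w * g (Complex t \<sigma>')) = ?c * g ?w"
      using strip_Cauchy_formula[OF g, of \<sigma>' ?w] \<sigma> that by (simp add: ker_def)
    moreover have "integral UNIV (\<lambda>t. L (-\<sigma>') \<tau> s t) - integral UNIV (\<lambda>t. L \<sigma>' \<tau> s t)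
      = (integral UNIV (\<lambda>t. ker (Complex t (-\<sigma>')) ?w * g (Complex t (-\<sigma>'))) - integral UNIV (\<lambda>t. ker (Complex t \<sigma>') ?w * g (Complex t \<sigma>'))) *\<^sub>C (h ?w *\<^sub>C Q ?w x)"
      using \<open>\<sigma>' > 0\<close> by (simp add: l scaleC_diff_left)
    ultimately show ?thesis by (simp add: scaleC_scaleC mult.assoc)
  qed
  have sg: "\<bar>\<sigma>\<bar> = \<sigma>" "\<bar>-\<sigma>\<bar> = \<sigma>" "\<bar>\<sigma>'\<bar> = \<sigma>'" "\<bar>-\<sigma>'\<bar> = \<sigma>'" "\<sigma>' > 0" using \<sigma> by auto
  have IS: "integral UNIV (\<lambda>s. K s t) = ?c *\<^sub>C (g (Complex t (-\<sigma>')) *\<^sub>C Q (Complex t (-\<sigma>')) y - g (Complex t \<sigma>') *\<^sub>C Q (Complex t \<sigma>') y)" for t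
    unfolding K_def using sg Lis by (simp add: integral_diff integrable_diff scaleC_diff_right Q)
  have IT: "integral UNIV (K s) = ?c *\<^sub>C ((g (Complex s (-\<sigma>)) * h (Complex s (-\<sigma>))) *\<^sub>C Q (Complex s (-\<sigma>)) x - (g (Complex s \<sigma>) * h (Complex s \<sigma>)) *\<^sub>C Q (Complex s \<sigma>) x)" for s
  proof -
    have "integral UNIV (K s) = (integral UNIV (\<lambda>t. L (-\<sigma>') (-\<sigma>) s t) - integral UNIV (\<lambda>t. L \<sigma>' (-\<sigma>) s t)) -
       (integral UNIV (\<lambda>t. L (-\<sigma>') \<sigma> s t) - integral UNIV (\<lambda>t. L \<sigma>' \<sigma> s t))"
      unfolding K_def[abs_def] using sg Lit by (simp add: integral_diff integrable_diff)
    then show ?thesis using sg by (simp add: cauchy scaleC_diff_right)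
  qed
  have gQ: "continuous_on UNIV (\<lambda>t. g (Complex t \<tau>') *\<^sub>C Q (Complex t \<tau>') y)" "(\<lambda>t. g (Complex t \<tau>') *\<^sub>C Q (Complex t \<tau>') y) integrable_on UNIV"
    if "\<bar>\<tau>'\<bar> = \<sigma>'" for \<tau>'
    using line_integrand[OF g \<sigma>(4), of \<tau>'] that \<sigma> by auto
  have gh: "dominated \<theta> (\<lambda>s. M * b s) (\<lambda>w. g w * h w)"
    by (rule dominated_mult[OF h]) (use M dg(1) in auto)
  have ghQ: "continuous_on UNIV (\<lambda>s. (g (Complex s \<tau>) * h (Complex s \<tau>)) *\<^sub>C Q (Complex s \<tau>) x)"
     "(\<lambda>s. (g (Complex s \<tau>) * h (Complex s \<tau>)) *\<^sub>C Q (Complex s \<tau>) x) integrable_on UNIV" if "\<bar>\<tau>\<bar> = \<sigma>" for \<tau>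
    using line_integrand[OF gh \<sigma>(4), of \<tau>] that \<sigma> by auto
  have scale: "integral UNIV (\<lambda>t. z *\<^sub>C f t) = z *\<^sub>C integral UNIV f" if "f integrable_on UNIV" for z and f :: "real \<Rightarrow> 'a"
    using integral_linear[OF that bounded_linear_scaleC] by (simp add: o_def)
  have "integral UNIV (\<lambda>s. integral UNIV (K s)) = integral UNIV (\<lambda>t. integral UNIV (\<lambda>s. K s t))"
  proof (rule Fubini_dominated)
    show "continuous_on UNIV (\<lambda>(s, t). K s t)"
      using sg Lc unfolding K_def case_prod_unfold by (intro continuous_on_diff) auto
    show "(\<lambda>s. 4 * (1 / sin e * C * norm x * b s)) integrable_on UNIV" by (intro integrable_on_mult_right dh(3))
    show "c integrable_on UNIV" by (rule dg(3))
    show "norm (K s t) \<le> 4 * (1 / sin e * C * norm x * b s) * c t" for s t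
    proof -
      have "norm (K s t) \<le> (norm (L (-\<sigma>') (-\<sigma>) s t) + norm (L (-\<sigma>') \<sigma> s t)) + (norm (L \<sigma>' (-\<sigma>) s t) + norm (L \<sigma>' \<sigma> s t))"
        unfolding K_def by (intro order_trans[OF norm_triangle_ineq4] add_mono norm_triangle_ineq4)
      also have "\<dots> \<le> 4 * ((1 / sin e * C * norm x * b s) * c t)"
        using Lb[OF sg(4,2), of s t] Lb[OF sg(4,1), of s t] Lb[OF sg(3,2), of s t] Lb[OF sg(3,1), of s t] by linarith
      finally show ?thesis by simp
    qed
    show "0 \<le> 4 * (1 / sin e * C * norm x * b s)" for s using C(1) dh(6) \<open>sin e > 0\<close> by simp
    show "continuous_on UNIV (\<lambda>s. integral UNIV (K s))"
      unfolding IT using sg by (intro scaleC_continuous continuous_on_diff continuous_on_const ghQ)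
    show "continuous_on UNIV (\<lambda>t. integral UNIV (\<lambda>s. K s t))"
      unfolding IS using sg by (intro scaleC_continuous continuous_on_diff continuous_on_const gQ)
  qed (use dg in auto)
  also have "integral UNIV (\<lambda>t. integral UNIV (\<lambda>s. K s t)) = ?c *\<^sub>C (line_integral g (-\<sigma>') y - line_integral g \<sigma>' y)"
    unfolding IS line_integral_def using sg gQ by (simp add: scale integral_diff integrable_diff)
  also have "integral UNIV (\<lambda>s. integral UNIV (K s)) = ?c *\<^sub>C (line_integral (\<lambda>w. g w * h w) (-\<sigma>) x - line_integral (\<lambda>w. g w * h w) \<sigma> x)"
    unfolding IT line_integral_def using sg ghQ by (simp add: scale integral_diff integrable_diff)
  finally have "(1 / ?c) *\<^sub>C ((1 / ?c) *\<^sub>C ?c *\<^sub>C (line_integral (\<lambda>w. g w * h w) (-\<sigma>) x - line_integral (\<lambda>w. g w * h w) \<sigma> x))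
      = (1 / ?c) *\<^sub>C ((1 / ?c) *\<^sub>C ?c *\<^sub>C (line_integral g (-\<sigma>') y - line_integral g \<sigma>' y))"
    by simp
  then show ?thesis by (simp add: scaleC_scaleC D_def y_def)
qed

end

section \<open>The holomorphic functional calculus\<close>

text \<open>The majorant is integrable because it is dominated by the sum of \<open>x\<^sup>-\<^sup>1\<^sup>-\<^sup>\<epsilon>\<close> on \<open>[1,\<infinity>)\<close>, shifted, and its
reflection.\<close>

lemma decay_integrable:
  assumes "\<epsilon> > 0"
  shows "(\<lambda>s::real. (1 + \<bar>s\<bar>) powr (-1 - \<epsilon>)) integrable_on UNIV"
proof -
  define f where "f x = indicator {1..} x * x powr (-1 - \<epsilon>)" for x :: real
  have "(\<lambda>x. x powr (-1 - \<epsilon>)) integrable_on {1..}"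
    using has_integral_powr_to_inf[of "-1 - \<epsilon>" 1] assms by auto
  then have "set_integrable lebesgue {1..} (\<lambda>x. x powr (-1 - \<epsilon>))"
    by (intro nonnegative_absolutely_integrable_1) auto
  then have "integrable lebesgue f"
    by (simp add: set_integrable_def f_def[abs_def])
  then have f: "integrable lborel f"
    by (subst (asm) integrable_completion) (auto simp: f_def[abs_def])
  have "integrable lborel (\<lambda>s. f (1 + 1 * s) + f (1 + (-1) * s))"
    by (intro Bochner_Integration.integrable_add lborel_integrable_real_affine f) auto
  then have b: "(\<lambda>s. f (1 + 1 * s) + f (1 + (-1) * s)) integrable_on UNIV" by (rule integrable_on_lborel)
  show ?thesis
  proof (rule dominated_integrable[OF _ b])
    show "continuous_on UNIV (\<lambda>s::real. (1 + \<bar>s\<bar>) powr (-1 - \<epsilon>))"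
      by (intro continuous_intros) (auto simp: add_pos_nonneg)
    show "norm ((1 + \<bar>s\<bar>) powr (-1 - \<epsilon>)) \<le> f (1 + 1 * s) + f (1 + (-1) * s)" for s
      by (cases "s \<ge> 0") (auto simp: f_def)
  qed
qed

lemma Hinf0_dominated:
  assumes "f \<in> Hinf0 \<theta>" "\<theta> \<le> pi"
  shows "\<exists>b. dominated \<theta> b (\<lambda>w. f (exp w))"
proof -
  obtain C \<epsilon> where f: "f holomorphic_on sector \<theta>" and "\<epsilon> > 0"
    and C: "\<And>\<mu>. \<mu> \<in> sector \<theta> \<Longrightarrow> cmod (f \<mu>) \<le> C * (1 + cmod (Ln \<mu>)) powr (- 1 - \<epsilon>)"
    using assms(1) by (auto simp: Hinf0_def Hinf_def)
  let ?p = "\<lambda>s::real. (1 + \<bar>s\<bar>) powr (-1 - \<epsilon>)"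
  have "dominated \<theta> (\<lambda>s. max C 0 * ?p s) (\<lambda>w. f (exp w))"
    unfolding dominated_def
  proof (intro conjI allI impI)
    have "exp w \<in> sector \<theta>" if "\<bar>Im w\<bar> < \<theta>" for w
      using that assms exp_in_sector_iff[of w \<theta>] by simp
    then show "(\<lambda>w. f (exp w)) holomorphic_on {w. \<bar>Im w\<bar> < \<theta>}"
      by (intro holomorphic_on_compose_gen[of exp _ f "sector \<theta>", unfolded o_def] f holomorphic_intros) auto
    show "cmod (f (exp w)) \<le> max C 0 * ?p (Re w)" if "\<bar>Im w\<bar> < \<theta>" for w
    proof -
      have "exp w \<in> sector \<theta>" "Ln (exp w) = w"
        using that assms exp_in_sector_iff[of w \<theta>] by auto
      then have "cmod (f (exp w)) \<le> C * (1 + cmod w) powr (- 1 - \<epsilon>)" using C[of "exp w"] by simp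
      also have "\<dots> \<le> max C 0 * (1 + cmod w) powr (- 1 - \<epsilon>)" by (intro mult_right_mono) auto
      also have "\<dots> \<le> max C 0 * ?p (Re w)"
        using \<open>\<epsilon> > 0\<close> abs_Re_le_cmod[of w] by (intro mult_left_mono powr_mono2') auto
      finally show ?thesis .
    qed
    show "(\<lambda>s. max C 0 * ?p s) integrable_on UNIV" by (intro integrable_on_mult_right decay_integrable \<open>\<epsilon> > 0\<close>)
    have "(?p \<longlongrightarrow> 0) at_top" "(?p \<longlongrightarrow> 0) at_bot" using \<open>\<epsilon> > 0\<close> by real_asymp+
    then show "((\<lambda>s. max C 0 * ?p s) \<longlongrightarrow> 0) at_top" "((\<lambda>s. max C 0 * ?p s) \<longlongrightarrow> 0) at_bot"
      by (auto intro: tendsto_mult_right_zero)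
  qed auto
  then show ?thesis by blast
qed

lemma sector_mono: "\<theta>' \<le> \<theta> \<Longrightarrow> sector \<theta>' \<subseteq> sector \<theta>"
  by (auto simp: sector_def)

lemma Hinf_mono: "\<theta>' \<le> \<theta> \<Longrightarrow> f \<in> Hinf \<theta> \<Longrightarrow> f \<in> Hinf \<theta>'"
  using sector_mono[of \<theta>' \<theta>] by (auto simp: Hinf_def intro: holomorphic_on_subset bounded_subset)

lemma Hinf_mult:
  assumes "f \<in> Hinf \<theta>" "g \<in> Hinf \<theta>"
  shows "(\<lambda>\<mu>. f \<mu> * g \<mu>) \<in> Hinf \<theta>"
proof -
  obtain B C where B: "\<And>\<mu>. \<mu> \<in> sector \<theta> \<Longrightarrow> cmod (f \<mu>) \<le> B" and C: "\<And>\<mu>. \<mu> \<in> sector \<theta> \<Longrightarrow> cmod (g \<mu>) \<le> C"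
    using assms unfolding Hinf_def bounded_iff by auto
  have "cmod (f \<mu> * g \<mu>) \<le> \<bar>B\<bar> * \<bar>C\<bar>" if "\<mu> \<in> sector \<theta>" for \<mu>
    unfolding norm_mult by (intro mult_mono) (use B[OF that] C[OF that] in auto)
  then have "bounded ((\<lambda>\<mu>. f \<mu> * g \<mu>) ` sector \<theta>)" unfolding bounded_iff by blast
  then show ?thesis using assms by (auto simp: Hinf_def intro!: holomorphic_intros)
qed

lemma Hinf0_mult:
  assumes "f \<in> Hinf0 \<theta>" "g \<in> Hinf \<theta>"
  shows "(\<lambda>\<mu>. f \<mu> * g \<mu>) \<in> Hinf0 \<theta>"
proof -
  obtain C \<epsilon> where "\<epsilon> > 0"
    and C: "\<And>\<mu>. \<mu> \<in> sector \<theta> \<Longrightarrow> cmod (f \<mu>) \<le> C * (1 + cmod (Ln \<mu>)) powr (- 1 - \<epsilon>)"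
    using assms(1) by (auto simp: Hinf0_def)
  obtain B where B: "\<And>\<mu>. \<mu> \<in> sector \<theta> \<Longrightarrow> cmod (g \<mu>) \<le> B"
    using assms unfolding Hinf_def bounded_iff by auto
  have "cmod (f \<mu> * g \<mu>) \<le> (C * \<bar>B\<bar>) * (1 + cmod (Ln \<mu>)) powr (- 1 - \<epsilon>)" if "\<mu> \<in> sector \<theta>" for \<mu>
  proof -
    have "cmod (f \<mu> * g \<mu>) \<le> (C * (1 + cmod (Ln \<mu>)) powr (- 1 - \<epsilon>)) * \<bar>B\<bar>"
      unfolding norm_mult by (intro mult_mono) (use B[OF that] C[OF that] in \<open>auto intro: order_trans[OF norm_ge_zero]\<close>)
    then show ?thesis by (simp add: mult_ac)
  qed
  then show ?thesis using \<open>\<epsilon> > 0\<close> Hinf_mult[of f \<theta> g] assms by (auto simp: Hinf0_def)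
qed

lemma Hinf_add:
  assumes "f \<in> Hinf \<theta>" "g \<in> Hinf \<theta>"
  shows "(\<lambda>\<mu>. f \<mu> + g \<mu>) \<in> Hinf \<theta>"
  using assms by (auto simp: Hinf_def intro!: holomorphic_intros bounded_plus_comp)

lemma Hinf_const: "(\<lambda>\<mu>. c) \<in> Hinf \<theta>"
  by (auto simp: Hinf_def bounded_iff)

lemma sector_exp_Ln: "\<mu> \<in> sector \<theta> \<Longrightarrow> \<mu> = exp (Ln \<mu>) \<and> \<bar>Im (Ln \<mu>)\<bar> < \<theta>"
  by (auto simp: sector_def Arg_def)

text \<open>Apply the distance estimate for rays to \<open>-\<mu>\<close>, and to \<open>-1/\<mu>\<close> for the second inequality.\<close>

lemma one_plus_sector:
  assumes "0 < \<theta>" "\<theta> < pi"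
  obtains c where "c > 0" "\<And>\<mu>. \<mu> \<in> sector \<theta> \<Longrightarrow> c \<le> cmod (1 + \<mu>) \<and> c * cmod \<mu> \<le> cmod (1 + \<mu>)"
proof -
  define d where "d = min (pi/2) (pi - \<theta>)"
  have d: "0 < d" "d \<le> pi/2" "d \<le> pi - \<theta>"
    using assms by (simp add: d_def) (simp_all only: d_def min.cobounded1 min.cobounded2)
  have "sin d > 0" using d by (intro sin_gt_zero) (auto intro: less_le_trans)
  have *: "sin d \<le> cmod (1 + exp w)" if "\<bar>Im w\<bar> < \<theta>" for w
  proof -
    have "d \<le> \<bar>Im (w + \<i> * pi)\<bar>" "\<bar>Im (w + \<i> * pi)\<bar> \<le> 2 * pi - d" using that d assms by auto
    from norm_exp_minus_one_ge[OF d(1,2) this]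
    have "sin d \<le> cmod (- exp w - 1)" by (simp add: exp_add mult.commute)
    then show ?thesis by (metis norm_minus_cancel minus_diff_commute add.commute minus_add_distrib uminus_add_conv_diff add.inverse_inverse diff_minus_eq_add)
  qed
  show ?thesis
  proof (rule that[OF \<open>sin d > 0\<close>])
    fix \<mu> assume "\<mu> \<in> sector \<theta>"
    from sector_exp_Ln[OF this] obtain w where w: "\<mu> = exp w" "\<bar>Im w\<bar> < \<theta>" by blast
    have "sin d \<le> cmod (1 + exp (-w))" using *[of "-w"] w by simp
    then have "sin d * cmod \<mu> \<le> cmod (1 + exp (-w)) * cmod \<mu>" by (intro mult_right_mono) auto
    also have "\<dots> = cmod ((1 + exp (-w)) * \<mu>)" by (rule norm_mult[symmetric])
    also have "(1 + exp (-w)) * \<mu> = 1 + \<mu>" by (simp add: w distrib_right exp_minus)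
    finally show "sin d \<le> cmod (1 + \<mu>) \<and> sin d * cmod \<mu> \<le> cmod (1 + \<mu>)" using *[OF w(2)] w by simp
  qed
qed

lemma one_plus_sector_nonzero: "\<theta> \<le> pi \<Longrightarrow> \<mu> \<in> sector \<theta> \<Longrightarrow> 1 + \<mu> \<noteq> 0"
proof
  assume "\<theta> \<le> pi" "\<mu> \<in> sector \<theta>" "1 + \<mu> = 0"
  then have "\<mu> = -1" by (simp add: add_eq_0_iff)
  then have "Arg \<mu> = pi" by (simp add: Arg_eq_pi)
  then show False using \<open>\<mu> \<in> sector \<theta>\<close> \<open>\<theta> \<le> pi\<close> by (simp add: sector_def)
qed

lemma resolvent_function_Hinf:
  assumes "0 < \<theta>" "\<theta> < pi"
  shows "(\<lambda>\<mu>. 1 / (1 + \<mu>)) \<in> Hinf \<theta>"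
proof -
  obtain c where c: "c > 0" "\<And>\<mu>. \<mu> \<in> sector \<theta> \<Longrightarrow> c \<le> cmod (1 + \<mu>)"
    using one_plus_sector[OF assms] by metis
  then have "cmod (1 / (1 + \<mu>)) \<le> 1 / c" if "\<mu> \<in> sector \<theta>" for \<mu>
    using c(2)[OF that] c(1) by (simp add: norm_divide frac_le)
  then have "bounded ((\<lambda>\<mu>. 1 / (1 + \<mu>)) ` sector \<theta>)" unfolding bounded_iff by blast
  then show ?thesis
    using one_plus_sector_nonzero[of \<theta>] assms by (auto simp: Hinf_def intro!: holomorphic_intros)
qed

text \<open>On a sector \<open>|\<rho>(e\<^sup>w)|\<close> is at most a multiple of \<open>exp (-|Re w|)\<close>, which is smaller than any power of
\<open>1 + |w|\<close>.\<close>

lemma rho_Hinf0: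
  assumes "0 < \<theta>" "\<theta> < pi"
  shows "rho \<in> Hinf0 \<theta>"
proof -
  obtain c where c: "c > 0" "\<And>\<mu>. \<mu> \<in> sector \<theta> \<Longrightarrow> c \<le> cmod (1 + \<mu>)" "\<And>\<mu>. \<mu> \<in> sector \<theta> \<Longrightarrow> c * cmod \<mu> \<le> cmod (1 + \<mu>)"
    using one_plus_sector[OF assms] by metis
  have 1: "cmod (rho \<mu>) \<le> exp (- \<bar>Re (Ln \<mu>)\<bar>) / c\<^sup>2" if "\<mu> \<in> sector \<theta>" for \<mu>
  proof -
    from sector_exp_Ln[OF that] obtain w where w: "\<mu> = exp w" "Ln \<mu> = w" by blast
    have m: "cmod \<mu> = exp (Re w)" by (simp add: w)
    have p: "cmod (1 + \<mu>) > 0" using c that by (meson less_le_trans)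
    have "cmod (rho \<mu>) = exp (Re w) / (cmod (1 + \<mu>))\<^sup>2" by (simp add: rho_def norm_divide norm_power m)
    also have "\<dots> \<le> exp (- \<bar>Re w\<bar>) / c\<^sup>2"
    proof (cases "Re w \<ge> 0")
      case True
      have "(c * exp (Re w))\<^sup>2 \<le> (cmod (1 + \<mu>))\<^sup>2" using c(3)[OF that] c(1) m by (intro power_mono) auto
      then have "exp (Re w) / (cmod (1 + \<mu>))\<^sup>2 \<le> exp (Re w) / (c * exp (Re w))\<^sup>2" using c(1) p by (intro divide_left_mono) auto
      also have "\<dots> = exp (- \<bar>Re w\<bar>) / c\<^sup>2" using True by (simp add: exp_minus field_simps power2_eq_square)
      finally show ?thesis .
    next
      case False
      have "c\<^sup>2 \<le> (cmod (1 + \<mu>))\<^sup>2" using c(2)[OF that] c(1) by (intro power_mono) auto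
      then show ?thesis using False c(1) p by (intro frac_le) auto
    qed
    finally show ?thesis by (simp add: w)
  qed
  have 2: "exp (- \<bar>Re (Ln \<mu>)\<bar>) \<le> 25 * (1 + cmod (Ln \<mu>)) powr (- 1 - 1)" if "\<mu> \<in> sector \<theta>" for \<mu>
  proof -
    define s where "s = \<bar>Re (Ln \<mu>)\<bar>"
    have "s \<ge> 0" by (simp add: s_def)
    have "cmod (Ln \<mu>) \<le> \<bar>Re (Ln \<mu>)\<bar> + \<bar>Im (Ln \<mu>)\<bar>" by (rule cmod_le)
    also have "\<dots> \<le> s + 4" using sector_exp_Ln[OF that] assms pi_less_4 by (simp add: s_def)
    \<comment> \<open>\<open>4\<close> bounds the imaginary part, and \<open>25\<close> makes the quadratic Taylor polynomial of \<open>exp\<close> dominate\<close>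
    finally have "(1 + cmod (Ln \<mu>))\<^sup>2 \<le> (5 + s)\<^sup>2" by (intro power_mono) auto
    also have "\<dots> \<le> 25 * (1 + s + s\<^sup>2 / 2)" 
    proof -
      have "(5 + s)\<^sup>2 = 25 + 10 * s + s\<^sup>2" by (simp add: power2_sum)
      moreover have "25 + 10 * s + q \<le> 25 * (1 + s + q / 2)" if "q \<ge> 0" for q :: real
        using \<open>s \<ge> 0\<close> that by (simp add: distrib_left)
      ultimately show ?thesis by simp
    qed
    also have "\<dots> \<le> 25 * exp s" using exp_lower_Taylor_quadratic[OF \<open>s \<ge> 0\<close>] by simp
    finally have "(1 + cmod (Ln \<mu>))\<^sup>2 \<le> 25 * exp s" .
    moreover have "(1 + cmod (Ln \<mu>)) powr (- 1 - 1) = inverse ((1 + cmod (Ln \<mu>))\<^sup>2)"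
    proof -
      have "t powr (- 1 - 1) = inverse (t\<^sup>2)" if "t > 0" for t :: real
      proof -
        have "t powr (- 1 - 1) = t powr (- 2)" by simp
        also have "\<dots> = inverse (t powr 2)" by (rule powr_minus)
        also have "\<dots> = inverse (t\<^sup>2)" using that by (simp add: powr_numeral)
        finally show ?thesis .
      qed
      then show ?thesis by (simp add: add_pos_nonneg)
    qed
    moreover have "(1 + cmod (Ln \<mu>))\<^sup>2 > 0" by (metis norm_ge_zero add_pos_nonneg zero_less_one zero_less_power)
    moreover have "inverse E \<le> 25 * inverse q" if "q > 0" "q \<le> 25 * E" "E > 0" for q E :: real
      using that by (simp add: field_simps)
    ultimately show ?thesis by (simp only: s_def[symmetric] exp_minus exp_gt_zero)
  qed
  have "cmod (rho \<mu>) \<le> (25 / c\<^sup>2) * (1 + cmod (Ln \<mu>)) powr (- 1 - 1)" if "\<mu> \<in> sector \<theta>" for \<mu>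
    using 1[OF that] divide_right_mono[OF 2[OF that], of "c\<^sup>2"] by simp
  moreover have "bounded (rho ` sector \<theta>)"
  proof -
    have "cmod (rho \<mu>) \<le> 1 / c\<^sup>2" if "\<mu> \<in> sector \<theta>" for \<mu>
      using 1[OF that] divide_right_mono[of "exp (- \<bar>Re (Ln \<mu>)\<bar>)" 1 "c\<^sup>2"] by simp
    then show ?thesis unfolding bounded_iff by blast
  qed
  moreover have "rho holomorphic_on sector \<theta>"
    unfolding rho_def[abs_def] using one_plus_sector_nonzero[of \<theta>] assms by (auto intro!: holomorphic_intros)
  ultimately show ?thesis unfolding Hinf0_def Hinf_def
    by (simp) (intro exI[of _ "25 / c\<^sup>2"] exI[of _ "1::real"], simp)
qed

context zero_sectorial_operator
begin

lemma dunford_eq_D: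
  assumes "f \<in> Hinf0 \<theta>" "0 < \<theta>" "\<theta> < pi" "0 < \<sigma>" "\<sigma> < \<theta>"
  shows "dunford A f x = D \<sigma> (\<lambda>w. f (exp w)) x"
  unfolding dunford_def sector_integral_eq_D
proof (rule the_equality)
  obtain b where b: "dominated \<theta> b (\<lambda>w. f (exp w))" using Hinf0_dominated[OF assms(1)] assms by auto
  show "\<exists>\<theta>>0. \<theta> < pi \<and> f \<in> Hinf0 \<theta> \<and> (\<forall>\<sigma>'. 0 < \<sigma>' \<and> \<sigma>' < \<theta> \<longrightarrow> D \<sigma> (\<lambda>w. f (exp w)) x = D \<sigma>' (\<lambda>w. f (exp w)) x)"
    using assms(1-3) D_independent[OF b less_imp_le[OF assms(3)] assms(4,5)] by blast
  fix y assume "\<exists>\<theta>>0. \<theta> < pi \<and> f \<in> Hinf0 \<theta> \<and> (\<forall>\<sigma>. 0 < \<sigma> \<and> \<sigma> < \<theta> \<longrightarrow> y = D \<sigma> (\<lambda>w. f (exp w)) x)"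
  then obtain \<theta>' where \<theta>': "\<theta>' > 0" "\<And>\<sigma>. 0 < \<sigma> \<Longrightarrow> \<sigma> < \<theta>' \<Longrightarrow> y = D \<sigma> (\<lambda>w. f (exp w)) x" by blast
  define \<sigma>' where "\<sigma>' = min \<theta> \<theta>' / 2"
  have "0 < \<sigma>'" "\<sigma>' < \<theta>" "\<sigma>' < \<theta>'" using assms \<theta>' by (auto simp: \<sigma>'_def)
  then show "y = D \<sigma> (\<lambda>w. f (exp w)) x"
    using \<theta>'(2)[of \<sigma>'] D_independent[OF b less_imp_le[OF assms(3)] \<open>0 < \<sigma>'\<close> \<open>\<sigma>' < \<theta>\<close> assms(4,5)] by metis
qed

lemma dunford_bounded_linear:
  assumes "f \<in> Hinf0 \<theta>" "0 < \<theta>" "\<theta> < pi"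
  shows "bounded_linear (dunford A f)"
proof -
  obtain b where b: "dominated \<theta> b (\<lambda>w. f (exp w))" using Hinf0_dominated[OF assms(1)] assms by auto
  have "dunford A f = D (\<theta>/2) (\<lambda>w. f (exp w))" using dunford_eq_D[OF assms] assms by (intro ext) auto
  then show ?thesis using D_bounded_linear[OF b] assms by simp
qed

lemma dunford_add:
  assumes "f \<in> Hinf0 \<theta>" "g \<in> Hinf0 \<theta>" "(\<lambda>\<mu>. f \<mu> + g \<mu>) \<in> Hinf0 \<theta>" "0 < \<theta>" "\<theta> < pi"
  shows "dunford A (\<lambda>\<mu>. f \<mu> + g \<mu>) x = dunford A f x + dunford A g x"
proof -
  obtain b where b: "dominated \<theta> b (\<lambda>w. f (exp w))" using Hinf0_dominated[OF assms(1)] assms by auto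
  obtain c where c: "dominated \<theta> c (\<lambda>w. g (exp w))" using Hinf0_dominated[OF assms(2)] assms by auto
  show ?thesis
    using D_add[OF b c, of "\<theta>/2" x] assms
    by (simp add: dunford_eq_D[OF assms(1,4,5), of "\<theta>/2"] dunford_eq_D[OF assms(2,4,5), of "\<theta>/2"] dunford_eq_D[OF assms(3,4,5), of "\<theta>/2"])
qed

lemma dunford_cmult:
  assumes "f \<in> Hinf0 \<theta>" "0 < \<theta>" "\<theta> < pi"
  shows "dunford A (\<lambda>\<mu>. c * f \<mu>) x = c *\<^sub>C dunford A f x"
proof -
  obtain b where b: "dominated \<theta> b (\<lambda>w. f (exp w))" using Hinf0_dominated[OF assms(1)] assms by auto
  have "(\<lambda>\<mu>. c * f \<mu>) \<in> Hinf0 \<theta>" using Hinf0_mult[OF assms(1) Hinf_const[of c]] by (simp add: mult.commute)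
  from dunford_eq_D[OF this assms(2,3), of "\<theta>/2"] show ?thesis
    using D_cmult[OF b, of "\<theta>/2" c x] assms by (simp add: dunford_eq_D[OF assms, of "\<theta>/2"])
qed

lemma dunford_mult:
  assumes f: "f \<in> Hinf0 \<theta>" and g: "g \<in> Hinf0 \<theta>" and \<theta>: "0 < \<theta>" "\<theta> < pi"
  shows "dunford A g (dunford A f x) = dunford A (\<lambda>\<mu>. g \<mu> * f \<mu>) x"
proof -
  obtain b where b: "dominated \<theta> b (\<lambda>w. f (exp w))" using Hinf0_dominated[OF f] \<theta> by auto
  obtain c where c: "dominated \<theta> c (\<lambda>w. g (exp w))" using Hinf0_dominated[OF g] \<theta> by auto
  obtain B where B: "\<And>\<mu>. \<mu> \<in> sector \<theta> \<Longrightarrow> cmod (g \<mu>) \<le> B"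
    using g unfolding Hinf0_def Hinf_def bounded_iff by auto
  have "cmod (g (exp w)) \<le> \<bar>B\<bar>" if "\<bar>Im w\<bar> < \<theta>" for w
    using B[of "exp w"] exp_in_sector_iff[of w \<theta>] that \<theta> by auto
  note m = D_mult[OF b c, of "\<theta>/3" "\<theta>/2" "\<bar>B\<bar>" x, OF _ _ _ _ _ this]
  have gf: "(\<lambda>\<mu>. g \<mu> * f \<mu>) \<in> Hinf0 \<theta>" using Hinf0_mult[OF g] f by (auto simp: Hinf0_def)
  show ?thesis
    using m \<theta> dunford_eq_D[OF f \<theta>, of "\<theta>/3"] dunford_eq_D[OF g \<theta>, of "\<theta>/2"] dunford_eq_D[OF gf \<theta>, of "\<theta>/3"] by simp
qed

text \<open>The case \<open>v = \<i>\<pi>\<close>, that is \<open>\<mu> = -1\<close>, of the formula for \<open>Q v\<close> applied to a Dunford integral.\<close>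

lemma dunford_resolvent:
  assumes f: "f \<in> Hinf0 \<theta>" and \<theta>: "0 < \<theta>" "\<theta> < pi"
  shows "- resolvent A (-1) (dunford A f x) = dunford A (\<lambda>\<mu>. f \<mu> * (1 / (1 + \<mu>))) x"
proof -
  obtain b where b: "dominated \<theta> b (\<lambda>w. f (exp w))" using Hinf0_dominated[OF f] \<theta> by auto
  let ?v = "Complex 0 pi"
  have v: "exp ?v = -1" by (simp add: Complex_eq mult.commute)
  have Q1: "Q ?v y = - resolvent A (-1) y" for y
    using scaleC_minus_left[of 1 "resolvent A (-1) y"] by (simp add: Q_def v)
  have "Q ?v (D (\<theta>/2) (\<lambda>w. f (exp w)) x) = D (\<theta>/2) (\<lambda>w. exp ?v / (exp ?v - exp w) * f (exp w)) x"
    by (rule Q_D[OF b]) (use \<theta> in auto)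
  also have "(\<lambda>w. exp ?v / (exp ?v - exp w) * f (exp w)) = (\<lambda>w. f (exp w) * (1 / (1 + exp w)))"
  proof
    fix w :: complex
    have "- 1 - exp w = - (1 + exp w)" by simp
    then show "exp ?v / (exp ?v - exp w) * f (exp w) = f (exp w) * (1 / (1 + exp w))"
      unfolding v by (metis (no_types, lifting) minus_divide_divide mult.commute)
  qed
  finally show ?thesis
    using \<theta> dunford_eq_D[OF f \<theta>, of "\<theta>/2"] dunford_eq_D[OF Hinf0_mult[OF f resolvent_function_Hinf[OF \<theta>]] \<theta>, of "\<theta>/2"]
    by (simp add: Q1)
qed

end

text \<open>The domain of the holomorphic calculus. It suffices that \<open>\<rho> F\<close> is integrable along the contours; \<open>F\<close> itself need
not be.\<close>

definition bounded_on_sectors :: "(complex \<Rightarrow> complex) set" where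
  "bounded_on_sectors = {F. \<forall>\<omega>. 0 < \<omega> \<and> \<omega> < pi \<longrightarrow> F \<in> Hinf \<omega>}"

lemma bounded_on_sectors_mult: "F \<in> bounded_on_sectors \<Longrightarrow> G \<in> bounded_on_sectors \<Longrightarrow> (\<lambda>\<mu>. F \<mu> * G \<mu>) \<in> bounded_on_sectors"
  by (auto simp: bounded_on_sectors_def Hinf_mult)

lemma bounded_on_sectors_add: "F \<in> bounded_on_sectors \<Longrightarrow> G \<in> bounded_on_sectors \<Longrightarrow> (\<lambda>\<mu>. F \<mu> + G \<mu>) \<in> bounded_on_sectors"
  by (auto simp: bounded_on_sectors_def Hinf_add)

lemma bounded_on_sectors_const: "(\<lambda>\<mu>. c) \<in> bounded_on_sectors"
  by (auto simp: bounded_on_sectors_def Hinf_const)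

lemma rho_bounded_on_sectors: "rho \<in> bounded_on_sectors"
  using rho_Hinf0 by (auto simp: bounded_on_sectors_def Hinf0_def)

lemma rho_mult_Hinf0: "F \<in> bounded_on_sectors \<Longrightarrow> (\<lambda>\<mu>. rho \<mu> * F \<mu>) \<in> Hinf0 1"
  using Hinf0_mult[OF rho_Hinf0[of 1], of F] pi_gt3 by (auto simp: bounded_on_sectors_def)

text \<open>Consequently \<open>1(A)\<close> is defined with the regularizing factor \<open>\<rho>\<close>, which makes it a statement about the kernel of
\<open>\<rho>(A)\<close>.\<close>

lemma one_not_Hinf0:
  assumes "0 < \<theta>"
  shows "(\<lambda>\<mu>. 1) \<notin> Hinf0 \<theta>"
proof
  assume "(\<lambda>\<mu>. 1) \<in> Hinf0 \<theta>"
  then obtain C \<epsilon> where "\<epsilon> > 0" and C: "\<And>\<mu>. \<mu> \<in> sector \<theta> \<Longrightarrow> 1 \<le> C * (1 + cmod (Ln \<mu>)) powr (- 1 - \<epsilon>)"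
    by (auto simp: Hinf0_def)
  have "1 \<le> C * (1 + s) powr (- 1 - \<epsilon>)" if "s \<ge> 0" for s :: real
    using C[of "exp (of_real s)"] that assms by (simp add: exp_in_sector_iff)
  moreover have "((\<lambda>s. C * (1 + s) powr (- 1 - \<epsilon>)) \<longlongrightarrow> 0) at_top"
    using \<open>\<epsilon> > 0\<close> by (intro tendsto_mult_right_zero) real_asymp
  ultimately have "(1::real) \<le> 0"
    by (intro tendsto_lowerbound[of _ "0::real" at_top]) (auto simp: eventually_at_top_linorder intro!: exI[of _ 0])
  then show False by simp
qed

lemma dense_range_compose:
  fixes f g :: "'a::metric_space \<Rightarrow> 'a"
  assumes "continuous_on UNIV f" "closure (range f) = UNIV" "closure (range g) = UNIV"
  shows "closure (range (\<lambda>x. f (g x))) = UNIV"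
proof -
  have "f ` closure (range g) \<subseteq> closure (f ` range g)"
    by (rule continuous_image_closure_subset[OF assms(1)]) simp
  then have "range f \<subseteq> closure (range (\<lambda>x. f (g x)))" using assms(3) by (simp add: image_image)
  then have "closure (range f) \<subseteq> closure (range (\<lambda>x. f (g x)))" by (simp add: closure_minimal)
  then show ?thesis using assms(2) by auto
qed

lemma scaleC_minus_one [simp]: "(-1) *\<^sub>C x = - (x :: 'a::complex_banach)"
  using scaleC_minus_left[of 1 x] by simp

lemma exp_i_pi: "exp (Complex 0 pi) = -1"
  by (simp add: Complex_eq mult.commute)

context zero_sectorial_operator
begin

lemma Q_commute:
  assumes "0 < \<bar>Im w\<bar>" "\<bar>Im w\<bar> \<le> pi" "0 < \<bar>Im v\<bar>" "\<bar>Im v\<bar> \<le> pi"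
  shows "Q v (Q w x) = Q w (Q v x)"
proof (cases "exp w = exp v")
  case True
  then show ?thesis by (simp add: Q_def)
next
  case False
  have "(exp w - exp v) *\<^sub>C Q v (Q w x) = - ((exp v - exp w) *\<^sub>C Q w (Q v x))"
    unfolding Q_identity[OF assms, symmetric] Q_identity[OF assms(3,4,1,2), symmetric] by simp
  then have "(exp w - exp v) *\<^sub>C Q v (Q w x) = (exp w - exp v) *\<^sub>C Q w (Q v x)"
    by (simp add: scaleC_diff_left)
  then have "(1 / (exp w - exp v)) *\<^sub>C (exp w - exp v) *\<^sub>C Q v (Q w x) = (1 / (exp w - exp v)) *\<^sub>C (exp w - exp v) *\<^sub>C Q w (Q v x)"
    by simp
  then show ?thesis using False by (simp add: scaleC_scaleC)
qed

text \<open>The bounded operator \<open>(1 + A)\<^sup>-\<^sup>1\<close>.\<close>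

definition J :: "'a \<Rightarrow> 'a" where
  "J x = - resolvent A (-1) x"

lemma J_eq_Q: "J = Q (Complex 0 pi)"
  by (auto simp: J_def Q_def exp_i_pi)

lemma J_bounded_linear: "bounded_linear J"
  unfolding J_eq_Q by (rule bounded_linear_Q) auto

lemma J_scaleC: "J (c *\<^sub>C x) = c *\<^sub>C J x"
  unfolding J_eq_Q by (rule Q_scaleC) auto

lemma minus_one_resolvent_set: "-1 \<in> resolvent_set A"
  using exp_in_resolvent_set[of "Complex 0 pi"] by (simp add: exp_i_pi)

lemma J_graph: "(J z, z - J z) \<in> A"
proof -
  have "(resolvent A (-1) z, - resolvent A (-1) z - z) \<in> A"
    using resolvent_in_graph[OF minus_one_resolvent_set, of z] by simp
  then have "((-1) *\<^sub>C resolvent A (-1) z, (-1) *\<^sub>C (- resolvent A (-1) z - z)) \<in> A"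
    using operator_properties(1) unfolding linear_operator_def by blast
  then show ?thesis by (simp add: J_def add.commute)
qed

lemma J_inverse: "(x, y) \<in> A \<Longrightarrow> J (x + y) = x"
proof -
  assume "(x, y) \<in> A"
  then have "resolvent A (-1) ((-1) *\<^sub>C x - y) = x" by (rule resolvent_left_inverse[OF minus_one_resolvent_set])
  moreover have "(-1) *\<^sub>C x - y = - (x + y)" by simp
  ultimately show ?thesis
    using linear_neg[OF bounded_linear.linear[OF J_bounded_linear], of "x + y"]
      linear_neg[OF bounded_linear.linear[OF bounded_linear_resolvent[OF minus_one_resolvent_set]], of "x + y"] by (simp add: J_def)
qed

lemma range_J: "range J = Domain A"
proof
  show "range J \<subseteq> Domain A" using J_graph by auto
  show "Domain A \<subseteq> range J"
  proof
    fix x assume "x \<in> Domain A"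
    then obtain y where "(x, y) \<in> A" by auto
    from J_inverse[OF this] show "x \<in> range J" by (metis rangeI)
  qed
qed

lemma range_one_minus_J: "range (\<lambda>x. x - J x) = Range A"
proof
  show "range (\<lambda>x. x - J x) \<subseteq> Range A" using J_graph by auto
  show "Range A \<subseteq> range (\<lambda>x. x - J x)"
  proof
    fix y assume "y \<in> Range A"
    then obtain x where "(x, y) \<in> A" by auto
    from J_inverse[OF this] show "y \<in> range (\<lambda>x. x - J x)" by (intro range_eqI[of _ _ "x + y"]) simp
  qed
qed

text \<open>The operator is \<open>J (1 - J) = (1 + A)\<^sup>-\<^sup>1 A (1 + A)\<^sup>-\<^sup>1\<close>, and the ranges of \<open>J\<close> and \<open>1 - J\<close> are the domain and the
range of \<open>A\<close>.\<close>

lemma dense_range_J_minus_J2: "closure (range (\<lambda>x. J x - J (J x))) = UNIV"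
proof -
  have "closure (range (\<lambda>x. J (x - J x))) = UNIV"
    by (rule dense_range_compose)
       (use operator_properties(2,3) linear_continuous_on[OF J_bounded_linear] in \<open>simp_all add: range_J range_one_minus_J\<close>)
  then show ?thesis by (simp add: linear_diff[OF bounded_linear.linear[OF J_bounded_linear]])
qed

lemma dunford_J_commute:
  assumes f: "f \<in> Hinf0 \<theta>" and \<theta>: "0 < \<theta>" "\<theta> < pi"
  shows "dunford A f (J x) = J (dunford A f x)"
proof -
  obtain b where b: "dominated \<theta> b (\<lambda>w. f (exp w))" using Hinf0_dominated[OF f] \<theta> by auto
  have *: "J (line_integral (\<lambda>w. f (exp w)) \<tau> x) = line_integral (\<lambda>w. f (exp w)) \<tau> (J x)" if "\<bar>\<tau>\<bar> = \<theta>/2" for \<tau>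
    using line_integral_linear[OF b _ _ _ J_bounded_linear, of \<tau> x] that \<theta>
    by (simp add: line_integral_def J_scaleC) (simp add: J_eq_Q Q_commute[of "Complex _ \<tau>" "Complex 0 pi"])
  show ?thesis
    unfolding dunford_eq_D[OF f \<theta>, of "\<theta>/2", OF _ _] using \<theta> *[of "\<theta>/2"] *[of "-(\<theta>/2)"]
      dunford_eq_D[OF f \<theta>, of "\<theta>/2"] 
    by (simp add: D_def linear_diff[OF bounded_linear.linear[OF J_bounded_linear]] J_scaleC)
qed

definition rhoA :: "'a \<Rightarrow> 'a" where
  "rhoA = dunford A rho"

text \<open>The relation \<open>\<rho>(A) T = (\<rho> F)(A)\<close> determines \<open>T\<close> when \<open>\<rho>(A)\<close> is injective. It avoids the distinction whether
\<open>F\<close> needs a regularizing factor, and the algebraic rules for \<open>F(A)\<close> follow from those for Dunford integrals.\<close>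

definition is_calc :: "(complex \<Rightarrow> complex) \<Rightarrow> ('a \<Rightarrow> 'a) \<Rightarrow> bool" where
  "is_calc F T \<longleftrightarrow> F \<in> bounded_on_sectors \<and> (\<forall>x. rhoA (T x) = dunford A (\<lambda>\<mu>. rho \<mu> * F \<mu>) x)"

lemma one_less_pi: "(1::real) < pi"
  using pi_gt3 by simp

lemmas rho1 = rho_Hinf0[OF zero_less_one one_less_pi]

lemma rhoA_bounded_linear: "bounded_linear rhoA"
  unfolding rhoA_def using dunford_bounded_linear[OF rho1 zero_less_one one_less_pi] .

text \<open>The least regularizing exponent is \<open>1\<close>, and the relation holds by definition, or \<open>0\<close>, and it is multiplicativity
of the Dunford integral.\<close>

lemma fcalc_is_calc:
  assumes F: "F \<in> bounded_on_sectors" and T: "fcalc A F = op_graph T"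
  shows "is_calc F T"
  unfolding is_calc_def
proof (intro conjI allI F)
  fix x
  define n where "n = (LEAST n. regularizes n F)"
  have F1: "F holomorphic_on sector 1" using F one_less_pi by (auto simp: bounded_on_sectors_def Hinf_def)
  have "regularizes 1 F"
    unfolding regularizes_def using rho_mult_Hinf0[OF F] F1 one_less_pi by (intro exI[of _ 1]) simp
  then have n: "regularizes n F" "n \<le> 1" unfolding n_def by (rule LeastI, rule Least_le)
  have fc: "op_graph (dunford A (\<lambda>\<mu>. rho \<mu> ^ n * F \<mu>)) O (converse (op_graph (dunford A rho)) ^^ n) = op_graph T"
    using T by (simp add: fcalc_def n_def Let_def)
  have Tx: "(x, T x) \<in> op_graph T" by (simp add: op_graph_def)
  show "rhoA (T x) = dunford A (\<lambda>\<mu>. rho \<mu> * F \<mu>) x"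
  proof (cases "n = 0")
    case True
    then have Tx: "T x = dunford A F x" using Tx unfolding fc[symmetric] by (auto simp: op_graph_def)
    from n(1) obtain \<theta> where \<theta>: "0 < \<theta>" "\<theta> < pi" "F \<in> Hinf0 \<theta>" by (auto simp: regularizes_def True)
    show ?thesis unfolding Tx rhoA_def by (rule dunford_mult[OF \<theta>(3) rho_Hinf0]) (use \<theta> in auto)
  next
    case False
    then have "n = 1" using n by simp
    then show ?thesis using Tx unfolding fc[symmetric] by (auto simp: op_graph_def rhoA_def)
  qed
qed

text \<open>If \<open>\<rho>(A) z = 0\<close> then \<open>\<rho>(A)\<^sup>-\<^sup>1 \<rho>(A)\<close> relates \<open>0\<close> to both \<open>0\<close> and \<open>z\<close>.\<close>

lemma rhoA_injective:
  assumes "fcalc A (\<lambda>\<mu>. 1) = op_graph T" and "rhoA z = 0"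
  shows "z = 0"
proof -
  define n where "n = (LEAST n. regularizes n (\<lambda>\<mu>. 1))"
  have "regularizes 1 (\<lambda>\<mu>. 1)"
    unfolding regularizes_def using rho1 one_less_pi by (intro exI[of _ 1]) simp
  then have n: "regularizes n (\<lambda>\<mu>. 1)" "n \<le> 1" unfolding n_def by (rule LeastI, rule Least_le)
  have "n \<noteq> 0" 
  proof
    assume "n = 0"
    with n(1) show False using one_not_Hinf0 by (auto simp: regularizes_def)
  qed
  then have "n = 1" using n by simp
  then have "op_graph rhoA O converse (op_graph rhoA) = op_graph T"
    using assms(1) by (simp add: fcalc_def n_def[symmetric] rhoA_def)
  moreover have "(0, 0) \<in> op_graph rhoA O converse (op_graph rhoA)" "(0, z) \<in> op_graph rhoA O converse (op_graph rhoA)"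
    using assms(2) linear_0[OF bounded_linear.linear[OF rhoA_bounded_linear]] by (auto simp: op_graph_def relcomp_unfold)
  ultimately have "T 0 = 0" "T 0 = z" by (auto simp: op_graph_def)
  then show ?thesis by simp
qed

end

locale injective_rho_operator = zero_sectorial_operator +
  assumes rhoA_zero: "rhoA z = 0 \<Longrightarrow> z = 0"
begin

lemma rhoA_cancel: "rhoA x = rhoA y \<Longrightarrow> x = y"
  using rhoA_zero[of "x - y"] linear_diff[OF bounded_linear.linear[OF rhoA_bounded_linear]] by simp

lemma is_calc_unique: "is_calc F T \<Longrightarrow> is_calc F S \<Longrightarrow> T x = S x"
  by (rule rhoA_cancel) (simp add: is_calc_def)

lemma is_calc_add:
  assumes "is_calc F T" "is_calc G S"
  shows "is_calc (\<lambda>\<mu>. F \<mu> + G \<mu>) (\<lambda>x. T x + S x)"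
  using assms dunford_add[OF rho_mult_Hinf0[of F] rho_mult_Hinf0[of G] _ zero_less_one one_less_pi]
    rho_mult_Hinf0[OF bounded_on_sectors_add[of F G]]
  by (simp add: is_calc_def bounded_on_sectors_add distrib_left linear_add[OF bounded_linear.linear[OF rhoA_bounded_linear]])

lemma is_calc_cmult:
  assumes "is_calc F T"
  shows "is_calc (\<lambda>\<mu>. c * F \<mu>) (\<lambda>x. c *\<^sub>C T x)"
proof -
  have F: "F \<in> bounded_on_sectors" using assms by (simp add: is_calc_def)
  obtain b where b: "dominated 1 b (\<lambda>w. rho (exp w))" using Hinf0_dominated[OF rho1] one_less_pi by auto
  have "rhoA (c *\<^sub>C y) = c *\<^sub>C rhoA y" for y
  proof -
    have Qc: "Q (Complex s \<tau>) (c *\<^sub>C y) = c *\<^sub>C Q (Complex s \<tau>) y" if "\<bar>\<tau>\<bar> = 1/2" for s \<tau>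
      using that one_less_pi by (intro Q_scaleC) auto
    have "line_integral (\<lambda>w. rho (exp w)) \<tau> (c *\<^sub>C y) = c *\<^sub>C line_integral (\<lambda>w. rho (exp w)) \<tau> y" if "\<bar>\<tau>\<bar> = 1/2" for \<tau>
      using line_integral_linear[OF b _ _ _ bounded_linear_scaleC, of \<tau> c y] that one_less_pi
      by (simp add: line_integral_def Qc scaleC_scaleC mult.commute)
    then show ?thesis
      unfolding rhoA_def using dunford_eq_D[OF rho1 zero_less_one one_less_pi, of "1/2"]
      by (simp add: D_def scaleC_diff_right scaleC_scaleC mult.commute)
  qed
  then show ?thesis
    using assms dunford_cmult[OF rho_mult_Hinf0[OF F] zero_less_one one_less_pi, of c]
      bounded_on_sectors_mult[OF bounded_on_sectors_const F]
    by (simp add: is_calc_def mult.left_commute)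
qed

text \<open>Both sides agree after applying \<open>\<rho>(A)\<close> twice, because one factor \<open>\<rho>(A)\<close> can be moved past \<open>(\<rho> F)(A)\<close> to
\<open>S\<close>.\<close>

lemma is_calc_mult:
  assumes T: "is_calc F T" and S: "is_calc G S"
  shows "is_calc (\<lambda>\<mu>. F \<mu> * G \<mu>) (\<lambda>x. T (S x))"
proof -
  have F: "F \<in> bounded_on_sectors" and G: "G \<in> bounded_on_sectors" using assms by (auto simp: is_calc_def)
  note FG = bounded_on_sectors_mult[OF F G]
  note rF = rho_mult_Hinf0[OF F] and rG = rho_mult_Hinf0[OF G] and rFG = rho_mult_Hinf0[OF FG]
  note mult = dunford_mult[OF _ _ zero_less_one one_less_pi]
  have "rhoA (T (S x)) = dunford A (\<lambda>\<mu>. rho \<mu> * (F \<mu> * G \<mu>)) x" for x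
  proof (rule rhoA_cancel)
    have "rhoA (rhoA (T (S x))) = rhoA (dunford A (\<lambda>\<mu>. rho \<mu> * F \<mu>) (S x))"
      using T by (simp add: is_calc_def)
    also have "\<dots> = dunford A (\<lambda>\<mu>. rho \<mu> * F \<mu>) (rhoA (S x))"
      unfolding rhoA_def mult[OF rF rho1] mult[OF rho1 rF] by (simp add: mult_ac)
    also have "\<dots> = dunford A (\<lambda>\<mu>. rho \<mu> * F \<mu>) (dunford A (\<lambda>\<mu>. rho \<mu> * G \<mu>) x)"
      using S by (simp add: is_calc_def)
    also have "\<dots> = rhoA (dunford A (\<lambda>\<mu>. rho \<mu> * (F \<mu> * G \<mu>)) x)"
      unfolding rhoA_def mult[OF rG rF] mult[OF rFG rho1] by (simp add: mult_ac)
    finally show "rhoA (rhoA (T (S x))) = rhoA (dunford A (\<lambda>\<mu>. rho \<mu> * (F \<mu> * G \<mu>)) x)" .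
  qed
  then show ?thesis using FG by (simp add: is_calc_def)
qed

lemma is_calc_one: "is_calc (\<lambda>\<mu>. 1) (\<lambda>x. x)"
  by (simp add: is_calc_def bounded_on_sectors_const rhoA_def)

lemma is_calc_rho: "is_calc rho rhoA"
  using dunford_mult[OF rho1 rho1 zero_less_one one_less_pi] rho_bounded_on_sectors by (simp add: is_calc_def rhoA_def)

text \<open>With \<open>u = 1 / (1 + \<mu>)\<close> one has \<open>\<rho> = u - u\<^sup>2\<close>, and \<open>J\<close> acts as \<open>u(A)\<close>. Since \<open>u\<close> is not integrable along the
contours, the identity is multiplied by \<open>\<rho>\<close> and \<open>\<rho>(A)\<close> is cancelled.\<close>

lemma rhoA_eq: "rhoA x = J x - J (J x)"
proof (rule rhoA_cancel)
  let ?r = "\<lambda>\<mu>. rho \<mu> * (1 / (1 + \<mu>))"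
  note \<theta> = zero_less_one one_less_pi
  have r: "?r \<in> Hinf0 1" by (rule Hinf0_mult[OF rho1 resolvent_function_Hinf[OF \<theta>]])
  have rr: "(\<lambda>\<mu>. ?r \<mu> * (1 / (1 + \<mu>))) \<in> Hinf0 1" by (rule Hinf0_mult[OF r resolvent_function_Hinf[OF \<theta>]])
  have mrr: "(\<lambda>\<mu>. (-1) * (?r \<mu> * (1 / (1 + \<mu>)))) \<in> Hinf0 1"
    using Hinf0_mult[OF rr Hinf_const[of "-1"]] by simp
  have J1: "dunford A ?r x = J (rhoA x)" using dunford_resolvent[OF rho1 \<theta>] by (simp add: J_def rhoA_def)
  have J2: "dunford A (\<lambda>\<mu>. ?r \<mu> * (1 / (1 + \<mu>))) x = J (J (rhoA x))"
    using dunford_resolvent[OF r \<theta>, of x] J1 by (simp add: J_def)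
  have eq: "rho \<mu> * rho \<mu> = ?r \<mu> + (-1) * (?r \<mu> * (1 / (1 + \<mu>)))" for \<mu>
  proof (cases "1 + \<mu> = 0")
    case False
    define n where "n = 1 / (1 + \<mu>)"
    have "rho \<mu> = n * (1 - n)" using False by (simp add: rho_def n_def field_simps power2_eq_square)
    then show ?thesis unfolding n_def[symmetric] \<open>rho \<mu> = n * (1 - n)\<close> by (simp add: algebra_simps)
  qed (simp add: rho_def)
  have "(\<lambda>\<mu>. rho \<mu> * rho \<mu>) \<in> Hinf0 1" using rho_mult_Hinf0[OF rho_bounded_on_sectors] .
  then have "rhoA (rhoA x) = dunford A ?r x + dunford A (\<lambda>\<mu>. (-1) * (?r \<mu> * (1 / (1 + \<mu>)))) x"
    unfolding rhoA_def dunford_mult[OF rho1 rho1 \<theta>] eq by (intro dunford_add[OF r mrr _ \<theta>])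
  also have "\<dots> = J (rhoA x) - J (J (rhoA x))"
    unfolding dunford_cmult[OF rr \<theta>] J1 J2 by simp
  also have "\<dots> = rhoA (J x) - rhoA (J (J x))"
    by (simp add: rhoA_def dunford_J_commute[OF rho1 \<theta>])
  also have "\<dots> = rhoA (J x - J (J x))"
    by (simp add: linear_diff[OF bounded_linear.linear[OF rhoA_bounded_linear]])
  finally show "rhoA (rhoA x) = rhoA (J x - J (J x))" .
qed

lemma dense_range_rhoA: "closure (range rhoA) = UNIV"
  using dense_range_J_minus_J2 by (simp add: rhoA_eq)

end

section \<open>Functions with bounded derivatives\<close>

text \<open>All derivatives up to order \<open>m\<close> have the pointwise bound \<open>w\<close>. A constant weight controls the Besov norm; weights
that vanish outside an interval encode supports, and exponential weights encode decay.\<close>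

primrec derivs_bounded :: "nat \<Rightarrow> (real \<Rightarrow> real) \<Rightarrow> (real \<Rightarrow> complex) \<Rightarrow> bool" where
  "derivs_bounded 0 w f \<longleftrightarrow> (\<forall>x. cmod (f x) \<le> w x)"
| "derivs_bounded (Suc m) w f \<longleftrightarrow> (\<forall>x. cmod (f x) \<le> w x) \<and>
     (\<exists>f'. (\<forall>x. (f has_vector_derivative f' x) (at x)) \<and> derivs_bounded m w f')"

lemma derivs_boundedD: "derivs_bounded m w f \<Longrightarrow> cmod (f x) \<le> w x"
  by (cases m) auto

lemma derivs_bounded_weight_nonneg: "derivs_bounded m w f \<Longrightarrow> 0 \<le> w x"
  using derivs_boundedD norm_ge_zero order_trans by blast

lemma derivs_bounded_Suc: "derivs_bounded (Suc m) w f \<Longrightarrow> derivs_bounded m w f"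
  by (induction m arbitrary: f) auto

lemma derivs_bounded_le: "derivs_bounded m w f \<Longrightarrow> m' \<le> m \<Longrightarrow> derivs_bounded m' w f"
  by (induction m) (auto dest: derivs_bounded_Suc simp: le_Suc_eq simp del: derivs_bounded.simps)

lemma derivs_bounded_continuous: "derivs_bounded (Suc m) w f \<Longrightarrow> continuous_on S f"
  using has_vector_derivative_continuous by (auto intro!: continuous_at_imp_continuous_on) blast

lemma derivs_bounded_weight:
  "derivs_bounded m w f \<Longrightarrow> (\<And>x. w x \<le> v x) \<Longrightarrow> derivs_bounded m v f"
  by (induction m arbitrary: f) (auto intro: order_trans; meson order_trans)+

lemma derivs_bounded_zero: "(\<And>x. 0 \<le> w x) \<Longrightarrow> derivs_bounded m w (\<lambda>x. 0)"
  by (induction m) (auto intro!: exI[of _ "\<lambda>x. 0"])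

lemma derivs_bounded_const: "derivs_bounded m (\<lambda>x. cmod c) (\<lambda>x. c)"
  by (cases m) (auto intro!: exI[of _ "\<lambda>x. 0"] derivs_bounded_zero)

lemma derivs_bounded_add:
  "derivs_bounded m w f \<Longrightarrow> derivs_bounded m v g \<Longrightarrow> derivs_bounded m (\<lambda>x. w x + v x) (\<lambda>x. f x + g x)"
proof (induction m arbitrary: f g)
  case 0
  then show ?case by (auto intro: norm_triangle_mono)
next
  case (Suc m)
  obtain f' where f': "\<And>x. (f has_vector_derivative f' x) (at x)" "derivs_bounded m w f'" using Suc.prems by auto
  obtain g' where g': "\<And>x. (g has_vector_derivative g' x) (at x)" "derivs_bounded m v g'" using Suc.prems by auto
  have "\<forall>x. ((\<lambda>x. f x + g x) has_vector_derivative (f' x + g' x)) (at x)"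
    using f'(1) g'(1) by (auto intro!: has_vector_derivative_add)
  moreover have "\<forall>x. cmod (f x + g x) \<le> w x + v x" using Suc.prems by (auto intro: norm_triangle_mono)
  ultimately show ?case using Suc.IH[OF f'(2) g'(2)] by auto
qed

lemma derivs_bounded_cmult:
  "derivs_bounded m w f \<Longrightarrow> derivs_bounded m (\<lambda>x. cmod c * w x) (\<lambda>x. c * f x)"
proof (induction m arbitrary: f)
  case 0
  then show ?case by (auto simp: norm_mult mult_left_mono)
next
  case (Suc m)
  obtain f' where f': "\<And>x. (f has_vector_derivative f' x) (at x)" "derivs_bounded m w f'" using Suc.prems by auto
  have "\<forall>x. ((\<lambda>x. c * f x) has_vector_derivative (c * f' x)) (at x)"
    using f'(1) by (auto intro!: derivative_intros)
  moreover have "\<forall>x. cmod (c * f x) \<le> cmod c * w x" using Suc.prems by (auto simp: norm_mult mult_left_mono)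
  ultimately show ?case using Suc.IH[OF f'(2)] by auto
qed

lemma derivs_bounded_sum:
  "finite S \<Longrightarrow> (\<And>i. i \<in> S \<Longrightarrow> derivs_bounded m (w i) (f i)) \<Longrightarrow>
    derivs_bounded m (\<lambda>x. \<Sum>i\<in>S. w i x) (\<lambda>x. \<Sum>i\<in>S. f i x)"
  by (induction S rule: finite_induct) (auto intro: derivs_bounded_zero derivs_bounded_add)

text \<open>Leibniz' rule; the binomial coefficients of order \<open>m\<close> add up to \<open>2 ^ m\<close>.\<close>

lemma derivs_bounded_mult:
  "derivs_bounded m w f \<Longrightarrow> derivs_bounded m v g \<Longrightarrow> derivs_bounded m (\<lambda>x. 2 ^ m * (w x * v x)) (\<lambda>x. f x * g x)"
proof (induction m arbitrary: f g)
  case 0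
  then show ?case by (auto simp: norm_mult intro!: mult_mono order_trans[OF norm_ge_zero])
next
  case (Suc m)
  have pos: "0 \<le> w x" "0 \<le> v x" for x using Suc.prems derivs_bounded_weight_nonneg by blast+
  obtain f' where f': "\<And>x. (f has_vector_derivative f' x) (at x)" "derivs_bounded m w f'" using Suc.prems by auto
  obtain g' where g': "\<And>x. (g has_vector_derivative g' x) (at x)" "derivs_bounded m v g'" using Suc.prems by auto
  have "\<forall>x. ((\<lambda>x. f x * g x) has_vector_derivative (f x * g' x + f' x * g x)) (at x)"
    using f'(1) g'(1) by (auto intro!: has_vector_derivative_mult)
  moreover have "\<forall>x. cmod (f x * g x) \<le> 2 ^ Suc m * (w x * v x)"
  proof
    fix x
    have "cmod (f x * g x) \<le> 1 * (w x * v x)"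
      unfolding norm_mult mult_1 using derivs_boundedD[OF Suc.prems(1)] derivs_boundedD[OF Suc.prems(2)] pos
      by (intro mult_mono) auto
    also have "\<dots> \<le> 2 ^ Suc m * (w x * v x)" using pos[of x] by (intro mult_right_mono) (auto simp del: power_Suc)
    finally show "cmod (f x * g x) \<le> 2 ^ Suc m * (w x * v x)" .
  qed
  moreover have "derivs_bounded m (\<lambda>x. 2 ^ Suc m * (w x * v x)) (\<lambda>x. f x * g' x + f' x * g x)"
    using derivs_bounded_add[OF Suc.IH[OF derivs_bounded_Suc[OF Suc.prems(1)] g'(2)] Suc.IH[OF f'(2) derivs_bounded_Suc[OF Suc.prems(2)]]]
    by (simp add: mult_ac)
  ultimately show ?case unfolding derivs_bounded.simps(2) by (intro conjI exI[of _ "\<lambda>x. f x * g' x + f' x * g x"])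
qed

lemma derivs_bounded_shift:
  "derivs_bounded m w f \<Longrightarrow> derivs_bounded m (\<lambda>x. w (x - c)) (\<lambda>x. f (x - c))"
proof (induction m arbitrary: f)
  case (Suc m)
  obtain f' where f': "\<And>x. (f has_vector_derivative f' x) (at x)" "derivs_bounded m w f'" using Suc.prems by auto
  have "\<forall>x. ((\<lambda>x. f (x - c)) has_vector_derivative (f' (x - c))) (at x)"
  proof
    fix x
    have "((\<lambda>x. x - c) has_vector_derivative 1) (at x)" by (auto intro!: derivative_eq_intros)
    from vector_diff_chain_at[OF this f'(1)] show "((\<lambda>x. f (x - c)) has_vector_derivative (f' (x - c))) (at x)"
      by (simp add: o_def)
  qed
  then show ?case using Suc.IH[OF f'(2)] Suc.prems by auto
qed auto

text \<open>This reduces locally finite sums to finite ones.\<close>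

lemma derivs_bounded_local:
  assumes "\<And>x0. \<exists>g e. e > 0 \<and> (\<forall>x. \<bar>x - x0\<bar> < e \<longrightarrow> f x = g x) \<and> derivs_bounded m w g"
  shows "derivs_bounded m w f"
  using assms
proof (induction m arbitrary: f)
  case 0
  show ?case
    unfolding derivs_bounded.simps
  proof
    fix x
    obtain g e where "e > 0" "\<forall>y. \<bar>y - x\<bar> < e \<longrightarrow> f y = g y" "derivs_bounded 0 w g" using 0 by blast
    then show "cmod (f x) \<le> w x" by auto
  qed
next
  case (Suc m)
  have loc: "\<exists>g g' e. e > 0 \<and> (\<forall>x. \<bar>x - x0\<bar> < e \<longrightarrow> f x = g x) \<and> (\<forall>x. \<bar>x - x0\<bar> < e \<longrightarrow> (f has_vector_derivative g' x) (at x))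
      \<and> (\<forall>x. cmod (g x) \<le> w x) \<and> derivs_bounded m w g'" for x0
  proof -
    obtain g e where g: "e > 0" "\<And>x. \<bar>x - x0\<bar> < e \<Longrightarrow> f x = g x" "derivs_bounded (Suc m) w g" using Suc.prems by blast
    then obtain g' where g': "\<And>x. (g has_vector_derivative g' x) (at x)" "derivs_bounded m w g'" by auto
    have "(f has_vector_derivative g' x) (at x)" if "\<bar>x - x0\<bar> < e" for x
    proof (rule has_vector_derivative_transform_within_open[OF g'(1)])
      show "open (ball x0 e)" "x \<in> ball x0 e" using that by (auto simp: dist_real_def)
      show "g y = f y" if "y \<in> ball x0 e" for y using g(2)[of y] that by (simp add: dist_real_def abs_minus_commute)
    qed
    then show ?thesis using g g' by (intro exI[of _ g] exI[of _ g'] exI[of _ e]) auto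
  qed
  define f' where "f' x = vector_derivative f (at x)" for x
  have f': "(f has_vector_derivative f' x) (at x)" for x
  proof -
    obtain g' e where "e > 0" "\<forall>y. \<bar>y - x\<bar> < e \<longrightarrow> (f has_vector_derivative g' y) (at y)" using loc[of x] by blast
    then have "(f has_vector_derivative g' x) (at x)" by auto
    then show ?thesis unfolding f'_def using vector_derivative_at by fastforce
  qed
  have "derivs_bounded m w f'"
  proof (rule Suc.IH)
    fix x0
    obtain g' e where g': "e > 0" "\<And>y. \<bar>y - x0\<bar> < e \<Longrightarrow> (f has_vector_derivative g' y) (at y)" "derivs_bounded m w g'"
      using loc[of x0] by blast
    have "f' x = g' x" if "\<bar>x - x0\<bar> < e" for x
      unfolding f'_def using vector_derivative_at[OF g'(2)[OF that]] .
    with g' show "\<exists>g e. e > 0 \<and> (\<forall>x. \<bar>x - x0\<bar> < e \<longrightarrow> f' x = g x) \<and> derivs_bounded m w g" by blast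
  qed
  moreover have "cmod (f x) \<le> w x" for x
  proof -
    obtain g e where "e > 0" "\<forall>y. \<bar>y - x\<bar> < e \<longrightarrow> f y = g y" "\<forall>x. cmod (g x) \<le> w x" using loc[of x] by blast
    then show ?thesis by auto
  qed
  ultimately show ?case using f' by auto
qed

abbreviation nth_deriv :: "nat \<Rightarrow> (real \<Rightarrow> complex) \<Rightarrow> real \<Rightarrow> complex" where
  "nth_deriv k f \<equiv> ((\<lambda>g x. vector_derivative g (at x)) ^^ k) f"

lemma smooth_nth_deriv:
  assumes "smooth f"
  shows "(nth_deriv k f has_vector_derivative nth_deriv (Suc k) f x) (at x)"
proof -
  have "nth_deriv k f differentiable (at x)"
    using assms unfolding smooth_def differentiable_on_def by simp
  then show ?thesis by (simp add: vector_derivative_works)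
qed

lemma nth_deriv_zero_outside:
  assumes "supp f \<subseteq> {a..b}" "t \<notin> {a..b}"
  shows "nth_deriv k f t = 0"
  using assms(2)
proof (induction k arbitrary: t)
  case 0
  then have "t \<notin> supp f" using assms by auto
  then show ?case using closure_subset[of "{x. f x \<noteq> 0}"] by (auto simp: supp_def)
next
  case (Suc k)
  have "(nth_deriv k f has_vector_derivative 0) (at t)"
  proof (rule has_vector_derivative_transform_within_open[of "\<lambda>x. 0" _ _ "- {a..b}"])
    show "open (- {a..b})" by auto
  qed (use Suc in auto)
  then show ?case by (simp add: vector_derivative_at)
qed

text \<open>The set where a continuous function does not vanish is open, so it lies even in the interior of the interval. The
strict inequalities make the supports of pieces with distance \<open>2\<close> disjoint.\<close>

lemma nth_deriv_zero:
  assumes "smooth f" "supp f \<subseteq> {a..b}" "t \<notin> {a<..<b}"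
  shows "nth_deriv k f t = 0"
proof (rule ccontr)
  assume nz: "nth_deriv k f t \<noteq> 0"
  have "continuous_on UNIV (nth_deriv k f)"
    using smooth_nth_deriv[OF assms(1)] has_vector_derivative_continuous by (auto intro!: continuous_at_imp_continuous_on) blast
  then have "open {x. nth_deriv k f x \<noteq> 0}" by (intro open_Collect_neq) auto
  moreover have "{x. nth_deriv k f x \<noteq> 0} \<subseteq> {a..b}" using nth_deriv_zero_outside[OF assms(2)] by blast
  ultimately have "{x. nth_deriv k f x \<noteq> 0} \<subseteq> interior {a..b}" by (rule interior_maximal[rotated])
  then show False using nz assms(3) by auto
qed

lemma compact_support_bounded:
  fixes f :: "real \<Rightarrow> complex"
  assumes "continuous_on UNIV f" "\<And>t. t \<notin> {a<..<b} \<Longrightarrow> f t = 0"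
  obtains K where "K \<ge> 0" "\<And>t. cmod (f t) \<le> (if t \<in> {a<..<b} then K else 0)"
proof -
  have "compact (f ` {a..b})"
    by (rule compact_continuous_image[OF continuous_on_subset[OF assms(1)]]) auto
  then obtain K where K: "\<And>t. t \<in> {a..b} \<Longrightarrow> cmod (f t) \<le> K"
    using compact_imp_bounded[OF \<open>compact (f ` {a..b})\<close>] by (fastforce simp: bounded_iff)
  have "cmod (f t) \<le> (if t \<in> {a<..<b} then max K 0 else 0)" for t
  proof (cases "t \<in> {a<..<b}")
    case True
    then have "cmod (f t) \<le> K" by (intro K) auto
    then show ?thesis using True by simp
  next
    case False
    then show ?thesis using assms(2)[OF False] by simp
  qed
  then show ?thesis by (intro that[of "max K 0"]) auto
qed

lemma smooth_derivs_bounded: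
  assumes "smooth f" "supp f \<subseteq> {a..b}"
  shows "\<exists>K\<ge>0. derivs_bounded m (\<lambda>t. if t \<in> {a<..<b} then K else 0) (nth_deriv k f)"
proof (induction m arbitrary: k)
  have bdd: "\<exists>K\<ge>0. \<forall>t. cmod (nth_deriv k f t) \<le> (if t \<in> {a<..<b} then K else 0)" for k
  proof -
    have "continuous_on UNIV (nth_deriv k f)"
      using smooth_nth_deriv[OF assms(1)] has_vector_derivative_continuous by (auto intro!: continuous_at_imp_continuous_on) blast
    from compact_support_bounded[OF this nth_deriv_zero[OF assms]] show ?thesis by metis
  qed
  {
    case 0
    then show ?case using bdd[of k] by auto
  next
    case (Suc m)
    obtain K1 where K1: "K1 \<ge> 0" "\<And>t. cmod (nth_deriv k f t) \<le> (if t \<in> {a<..<b} then K1 else 0)" using bdd by blast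
    obtain K2 where K2: "K2 \<ge> 0" "derivs_bounded m (\<lambda>t. if t \<in> {a<..<b} then K2 else 0) (nth_deriv (Suc k) f)" using Suc by blast
    have "derivs_bounded m (\<lambda>t. if t \<in> {a<..<b} then K1 + K2 else 0) (nth_deriv (Suc k) f)"
      by (rule derivs_bounded_weight[OF K2(2)]) (use K1 in auto)
    moreover have "cmod (nth_deriv k f t) \<le> (if t \<in> {a<..<b} then K1 + K2 else 0)" for t
      by (rule order_trans[OF K1(2)]) (use K2 in auto)
    ultimately show ?case using smooth_nth_deriv[OF assms(1), of k] K1 K2
      by (intro exI[of _ "K1 + K2"]) (auto simp del: funpow.simps)
  }
qed

text \<open>The functions \<open>G\<^sub>k(x) = f\<^sup>(\<^sup>k\<^sup>)(e\<^sup>x) e\<^sup>k\<^sup>x\<close> satisfy \<open>G\<^sub>k' = G\<^sub>k\<^sub>+\<^sub>1 + k G\<^sub>k\<close>, so the induction has to run over all \<open>k\<close>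
simultaneously.\<close>

lemma smooth_exp_derivs_bounded_aux:
  assumes "smooth f" "supp f \<subseteq> {1/2..2}"
  shows "\<exists>K\<ge>0. derivs_bounded m (\<lambda>x. if \<bar>x\<bar> < ln 2 then K else 0) (\<lambda>x. nth_deriv k f (exp x) * exp (of_real x) ^ k)"
proof (induction m arbitrary: k)
  let ?G = "\<lambda>k x. nth_deriv k f (exp x) * exp (of_real x) ^ k"
  have ivl: "exp x \<in> {1/2<..<2} \<longleftrightarrow> \<bar>x\<bar> < ln 2" for x :: real
  proof -
    have "exp x < 2 \<longleftrightarrow> x < ln 2" by (metis exp_less_cancel_iff exp_ln zero_less_numeral)
    moreover have "1/2 < exp x \<longleftrightarrow> - ln 2 < x"
      by (metis exp_less_cancel_iff exp_ln exp_minus inverse_eq_divide zero_less_numeral)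
    ultimately show ?thesis by auto
  qed
  have der: "(?G k has_vector_derivative (?G (Suc k) x + of_nat k * ?G k x)) (at x)" for k x
  proof -
    have e: "(exp has_vector_derivative exp x) (at x)"
      by (simp add: has_real_derivative_iff_has_vector_derivative[symmetric])
    have 1: "((\<lambda>x. nth_deriv k f (exp x)) has_vector_derivative exp x *\<^sub>R nth_deriv (Suc k) f (exp x)) (at x)"
      using vector_diff_chain_at[OF e smooth_nth_deriv[OF assms(1)]] by (simp add: o_def del: funpow.simps)
    have 2: "((\<lambda>x. exp (of_real x) ^ k :: complex) has_vector_derivative of_nat k * exp (of_real x) ^ k) (at x)"
    proof -
      have "((\<lambda>z. exp z ^ k) has_field_derivative of_nat k * exp (of_real x) ^ k) (at (complex_of_real x))"
        unfolding exp_of_nat_mult[symmetric] by (auto intro!: derivative_eq_intros)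
      from has_vector_derivative_real_field[OF this] show ?thesis .
    qed
    show ?thesis
      using has_vector_derivative_mult[OF 1 2]
      by (rule has_vector_derivative_eq_rhs) (simp add: scaleR_conv_of_real exp_of_real[symmetric] algebra_simps del: funpow.simps)
  qed
  have bdd: "\<exists>K\<ge>0. \<forall>x. cmod (?G k x) \<le> (if \<bar>x\<bar> < ln 2 then K else 0)" for k
  proof -
    have "continuous_on UNIV (?G k)"
      using der has_vector_derivative_continuous by (intro continuous_at_imp_continuous_on ballI) blast
    moreover have "?G k x = 0" if "x \<notin> {-ln 2<..<ln 2}" for x
      using nth_deriv_zero[OF assms, of "exp x"] ivl[of x] that by auto
    ultimately obtain K where "K \<ge> 0" "\<And>x. cmod (?G k x) \<le> (if x \<in> {-ln 2<..<ln 2} then K else 0)"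
      using compact_support_bounded[of "?G k" "-ln 2" "ln 2"] by blast
    moreover have "x \<in> {-ln 2<..<ln 2} \<longleftrightarrow> \<bar>x\<bar> < ln 2" for x :: real by auto
    ultimately show ?thesis by (intro exI[of _ K]) simp
  qed
  {
    case 0
    then show ?case using bdd[of k] by auto
  next
    case (Suc m)
    obtain K1 where K1: "K1 \<ge> 0" "\<And>x. cmod (?G k x) \<le> (if \<bar>x\<bar> < ln 2 then K1 else 0)" using bdd[of k] by blast
    obtain K2 where K2: "K2 \<ge> 0" "derivs_bounded m (\<lambda>x. if \<bar>x\<bar> < ln 2 then K2 else 0) (?G (Suc k))" using Suc[of "Suc k"] by blast
    obtain K3 where K3: "K3 \<ge> 0" "derivs_bounded m (\<lambda>x. if \<bar>x\<bar> < ln 2 then K3 else 0) (?G k)" using Suc[of k] by blast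
    define K where "K = K1 + K2 + k * K3"
    have "derivs_bounded m (\<lambda>x. if \<bar>x\<bar> < ln 2 then K else 0) (\<lambda>x. ?G (Suc k) x + of_nat k * ?G k x)"
      by (rule derivs_bounded_weight[OF derivs_bounded_add[OF K2(2) derivs_bounded_cmult[OF K3(2), of "of_nat k"]]])
         (use K1 in \<open>auto simp: K_def\<close>)
    moreover have "cmod (?G k x) \<le> (if \<bar>x\<bar> < ln 2 then K else 0)" for x
      by (rule order_trans[OF K1(2)]) (use K2 K3 in \<open>auto simp: K_def\<close>)
    moreover have "K \<ge> 0" using K1 K2 K3 by (auto simp: K_def)
    ultimately show ?case using der[of k]
      unfolding derivs_bounded.simps(2)
      by (intro exI[of _ K] conjI exI[of _ "\<lambda>x. ?G (Suc k) x + of_nat k * ?G k x"] allI)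
  }
qed

lemma smooth_exp_derivs_bounded:
  assumes "smooth f" "supp f \<subseteq> {1/2..2}"
  shows "\<exists>K\<ge>0. derivs_bounded m (\<lambda>x. if \<bar>x\<bar> < ln 2 then K else 0) (\<lambda>x. f (exp x))"
  using smooth_exp_derivs_bounded_aux[OF assms, of m 0] by simp

section \<open>Fourier multipliers and the Besov norm\<close>

lemma compact_support_integral:
  fixes f :: "real \<Rightarrow> complex"
  assumes "continuous_on UNIV f" "\<And>t. t \<notin> {a..b} \<Longrightarrow> f t = 0"
  shows "integrable lborel f" "integral\<^sup>L lborel f = integral {a..b} f"
proof -
  have f: "f = (\<lambda>x. indicator {a..b} x *\<^sub>R f x)" using assms(2) by (auto simp: fun_eq_iff indicator_def)
  have s: "set_integrable lborel {a..b} f"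
    by (rule borel_integrable_atLeastAtMost') (rule continuous_on_subset[OF assms(1)], simp)
  then show "integrable lborel f" using f by (simp add: set_integrable_def)
  have "integral\<^sup>L lborel f = (LINT x:{a..b}|lborel. f x)" unfolding set_lebesgue_integral_def using f by simp
  then show "integral\<^sup>L lborel f = integral {a..b} f" using set_borel_integral_eq_integral(2)[OF s] by simp
qed

lemma integral_derivative_zero:
  fixes F f :: "real \<Rightarrow> complex"
  assumes der: "\<And>x. (F has_vector_derivative f x) (at x)" and "continuous_on UNIV f" "integrable lborel f"
    and "(F \<longlongrightarrow> 0) at_top" "(F \<longlongrightarrow> 0) at_bot"
  shows "integral\<^sup>L lborel f = 0"
proof -
  have "(LBINT x=-\<infinity>..\<infinity>. f x) = 0 - 0"
  proof (rule interval_integral_FTC_integrable)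
    show "isCont f x" for x using assms(2) by (simp add: continuous_on_eq_continuous_at)
    show "set_integrable lborel (einterval (-\<infinity>) \<infinity>) f" using assms(3) by (simp add: set_integrable_def)
    show "((F \<circ> real_of_ereal) \<longlongrightarrow> 0) (at_right (-\<infinity>))" "((F \<circ> real_of_ereal) \<longlongrightarrow> 0) (at_left \<infinity>)"
      using assms(4,5) by (simp_all add: ereal_tendsto_simps)
  qed (use der in auto)
  then show ?thesis by (simp add: interval_lebesgue_integral_def set_lebesgue_integral_def)
qed

definition FT :: "(real \<Rightarrow> complex) \<Rightarrow> real \<Rightarrow> complex" where
  "FT u x = (\<integral>\<xi>. u \<xi> * exp (\<i> * complex_of_real (x * \<xi>)) \<partial>lborel)"

lemma inv_fourier_FT: "inv_fourier u x = (1 / (2 * complex_of_real pi)) * FT u x"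
  by (simp add: inv_fourier_def FT_def)

abbreviation window :: "real \<Rightarrow> real \<Rightarrow> real \<Rightarrow> real \<Rightarrow> real" where
  "window a b K \<equiv> (\<lambda>t. if t \<in> {a<..<b} then K else 0)"

lemma window_zero: "derivs_bounded m (window a b K) u \<Longrightarrow> t \<notin> {a<..<b} \<Longrightarrow> u t = 0"
  using derivs_boundedD[of m "window a b K" u t] by auto

lemma FT_eq:
  assumes "derivs_bounded (Suc m) (window a b K) u"
  shows "FT u x = integral {a..b} (\<lambda>\<xi>. u \<xi> * exp (\<i> * complex_of_real (x * \<xi>)))"
    and "integrable lborel (\<lambda>\<xi>. u \<xi> * exp (\<i> * complex_of_real (x * \<xi>)))"
proof -
  have c: "continuous_on UNIV (\<lambda>\<xi>. u \<xi> * exp (\<i> * complex_of_real (x * \<xi>)))"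
    by (intro continuous_intros derivs_bounded_continuous[OF assms])
  have "u t * exp (\<i> * complex_of_real (x * t)) = 0" if "t \<notin> {a..b}" for t
    using window_zero[OF assms, of t] that by auto
  from compact_support_integral[OF c this] show "FT u x = integral {a..b} (\<lambda>\<xi>. u \<xi> * exp (\<i> * complex_of_real (x * \<xi>)))"
    "integrable lborel (\<lambda>\<xi>. u \<xi> * exp (\<i> * complex_of_real (x * \<xi>)))" by (auto simp: FT_def)
qed

lemma exp_has_vector_derivative:
  "((\<lambda>x. exp (\<i> * complex_of_real (x * t))) has_vector_derivative exp (\<i> * complex_of_real (x * t)) * (\<i> * of_real t)) (at x)"
proof -
  have "((\<lambda>z. exp (\<i> * (z * of_real t))) has_field_derivative exp (\<i> * (of_real x * of_real t)) * (\<i> * of_real t)) (at (complex_of_real x))"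
    by (auto intro!: derivative_eq_intros)
  from has_vector_derivative_real_field[OF this] show ?thesis by simp
qed

lemma FT_bound:
  assumes "derivs_bounded (Suc m) (window a b K) u" "a < b"
  shows "cmod (FT u x) \<le> K * (b - a)"
  unfolding FT_eq(1)[OF assms(1)]
proof (rule integral_bound[OF less_imp_le[OF assms(2)]])
  show "continuous_on {a..b} (\<lambda>\<xi>. u \<xi> * exp (\<i> * complex_of_real (x * \<xi>)))"
    by (intro continuous_intros derivs_bounded_continuous[OF assms(1)])
  show "cmod (u t * exp (\<i> * complex_of_real (x * t))) \<le> K" if "t \<in> {a..b}" for t
  proof -
    have "0 \<le> K" using derivs_bounded_weight_nonneg[OF assms(1), of "(a+b)/2"] assms(2) by simp
    moreover have "cmod (u t) \<le> (window a b K) t" by (rule derivs_boundedD[OF assms(1)])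
    ultimately have "cmod (u t) \<le> K" by (auto split: if_splits)
    then show ?thesis by (simp add: norm_mult)
  qed
qed

lemma FT_has_derivative:
  assumes "derivs_bounded (Suc m) (window a b K) u"
  shows "(FT u has_vector_derivative FT (\<lambda>\<xi>. \<i> * of_real \<xi> * u \<xi>) x) (at x)"
proof -
  note c = derivs_bounded_continuous[OF assms]
  have z: "u t = 0" if "t \<notin> {a..b}" for t using window_zero[OF assms, of t] that by auto
  have eq: "FT u = (\<lambda>x. integral (cbox a b) (\<lambda>\<xi>. u \<xi> * exp (\<i> * complex_of_real (x * \<xi>))))"
    using FT_eq(1)[OF assms] by auto
  have eq': "FT (\<lambda>\<xi>. \<i> * of_real \<xi> * u \<xi>) x = integral (cbox a b) (\<lambda>\<xi>. u \<xi> * (exp (\<i> * complex_of_real (x * \<xi>)) * (\<i> * of_real \<xi>)))"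
  proof -
    have "integral\<^sup>L lborel (\<lambda>\<xi>. u \<xi> * (exp (\<i> * complex_of_real (x * \<xi>)) * (\<i> * of_real \<xi>))) = integral {a..b} (\<lambda>\<xi>. u \<xi> * (exp (\<i> * complex_of_real (x * \<xi>)) * (\<i> * of_real \<xi>)))"
      by (rule compact_support_integral(2)) (use z in \<open>auto intro!: continuous_intros c\<close>)
    then show ?thesis by (simp add: FT_def mult_ac)
  qed
  show ?thesis unfolding eq eq'
  proof (rule leibniz_rule_vector_derivative[where U = UNIV, OF _ _ _ UNIV_I convex_UNIV])
    show "((\<lambda>x. u t * exp (\<i> * complex_of_real (x * t))) has_vector_derivative u t * (exp (\<i> * complex_of_real (x * t)) * (\<i> * of_real t))) (at x)" for x t
      by (intro has_vector_derivative_mult_right exp_has_vector_derivative)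
    show "(\<lambda>\<xi>. u \<xi> * exp (\<i> * complex_of_real (x * \<xi>))) integrable_on cbox a b" for x
      by (intro integrable_continuous continuous_intros derivs_bounded_continuous[OF assms])
    show "continuous_on (UNIV \<times> cbox a b) (\<lambda>(x, t). u t * (exp (\<i> * complex_of_real (x * t)) * (\<i> * complex_of_real t)))"
      unfolding case_prod_unfold by (intro continuous_intros continuous_on_compose2[OF c]) auto
  qed
qed

lemma FT_derivative:
  assumes "derivs_bounded (Suc (Suc m)) (window a b K) u" "\<And>x. (u has_vector_derivative u' x) (at x)"
    and u': "derivs_bounded (Suc m) (window a b K) u'"
  shows "FT u' x = - (\<i> * of_real x * FT u x)"
proof -
  note c = derivs_bounded_continuous[OF assms(1)] and c' = derivs_bounded_continuous[OF u']
  let ?e = "\<lambda>t. exp (\<i> * complex_of_real (x * t))"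
  have "integral\<^sup>L lborel (\<lambda>t. u t * (?e t * (\<i> * of_real x)) + u' t * ?e t) = 0"
  proof (rule integral_derivative_zero)
    show "((\<lambda>t. u t * ?e t) has_vector_derivative (u t * (?e t * (\<i> * of_real x)) + u' t * ?e t)) (at t)" for t
      using has_vector_derivative_mult[OF assms(2) exp_has_vector_derivative[of x t]] by (simp add: mult.commute[of _ x])
    show "continuous_on UNIV (\<lambda>t. u t * (?e t * (\<i> * of_real x)) + u' t * ?e t)"
      by (intro continuous_intros c c')
    then show "integrable lborel (\<lambda>t. u t * (?e t * (\<i> * of_real x)) + u' t * ?e t)"
      by (rule compact_support_integral(1)[of _ a b]) (use window_zero[OF assms(1)] window_zero[OF u'] in auto)
    show "((\<lambda>t. u t * ?e t) \<longlongrightarrow> 0) at_top"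
      by (rule tendsto_eventually, rule eventually_at_top_linorderI[of b]) (use window_zero[OF assms(1)] in auto)
    show "((\<lambda>t. u t * ?e t) \<longlongrightarrow> 0) at_bot"
      by (rule tendsto_eventually, rule eventually_at_bot_linorderI[of a]) (use window_zero[OF assms(1)] in auto)
  qed
  also have "(\<lambda>t. u t * (?e t * (\<i> * of_real x)) + u' t * ?e t) = (\<lambda>t. (\<i> * of_real x) * (u t * ?e t) + u' t * ?e t)"
    by (auto simp: mult_ac)
  also have "integral\<^sup>L lborel \<dots> = \<i> * of_real x * FT u x + FT u' x"
    using FT_eq(2)[OF assms(1)] FT_eq(2)[OF u'] by (simp add: FT_def)
  finally show ?thesis by (simp add: add_eq_0_iff)
qed

text \<open>Two integrations by parts turn the factor \<open>x\<^sup>2\<close> into a second derivative of \<open>u\<close>.\<close>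

lemma FT_decay:
  assumes "derivs_bounded 3 (window a b K) u" "a < b"
  shows "cmod (FT u x) * (1 + x\<^sup>2) \<le> 2 * (K * (b - a))"
proof -
  have u: "derivs_bounded (Suc (Suc (Suc 0))) (window a b K) u" using assms by (simp add: numeral_3_eq_3)
  then obtain u' where u': "\<And>x. (u has_vector_derivative u' x) (at x)" "derivs_bounded (Suc (Suc 0)) (window a b K) u'"
    by (auto simp only: derivs_bounded.simps(2)[of "Suc (Suc 0)"])
  then obtain u'' where u'': "\<And>x. (u' has_vector_derivative u'' x) (at x)" "derivs_bounded (Suc 0) (window a b K) u''"
    by (auto simp only: derivs_bounded.simps(2)[of "Suc 0"])
  have "FT u'' x = - (\<i> * of_real x * - (\<i> * of_real x * FT u x))"
    using FT_derivative[OF u u'] FT_derivative[OF u'(2) u''] by simp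
  then have "FT u'' x = - (of_real (x\<^sup>2) * FT u x)" by (simp add: power2_eq_square mult_ac)
  then have "cmod (FT u x) * x\<^sup>2 = cmod (FT u'' x)" by (simp add: norm_mult norm_power)
  then show ?thesis
    using FT_bound[OF u assms(2), of x] FT_bound[OF u''(2) assms(2), of x] by (simp add: distrib_left)
qed

lemma integrable_inverse_quadratic: "integrable lborel (\<lambda>x::real. inverse (1 + x\<^sup>2))"
  using integrable_inverse_1_plus_square by (simp add: set_integrable_def)

lemma FT_integrable:
  assumes "derivs_bounded 3 (window a b K) u" "a < b"
  shows "integrable lborel (FT u)" "(FT u \<longlongrightarrow> 0) at_top" "(FT u \<longlongrightarrow> 0) at_bot" "continuous_on UNIV (FT u)"
proof -
  have b: "cmod (FT u x) \<le> 2 * (K * (b - a)) * inverse (1 + x\<^sup>2)" for x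
  proof -
    have "1 + x\<^sup>2 > 0" by (rule add_pos_nonneg) auto
    then show ?thesis using FT_decay[OF assms, of x] by (simp add: field_simps)
  qed
  show c: "continuous_on UNIV (FT u)"
    using FT_has_derivative[of 2 a b K u] assms(1) has_vector_derivative_continuous
    by (auto simp: numeral_3_eq_3 numeral_2_eq_2 simp del: derivs_bounded.simps intro!: continuous_at_imp_continuous_on) blast
  show "integrable lborel (FT u)"
  proof (rule Bochner_Integration.integrable_bound)
    show "integrable lborel (\<lambda>x. 2 * (K * (b - a)) * inverse (1 + x\<^sup>2))"
      using integrable_inverse_quadratic by simp
    show "FT u \<in> borel_measurable lborel" using c by (simp add: borel_measurable_continuous_onI)
  qed (use b in \<open>auto intro: order_trans[OF _ abs_ge_self]\<close>)
  have "((\<lambda>x::real. 2 * (K * (b - a)) * inverse (1 + x\<^sup>2)) \<longlongrightarrow> 0) at_top" "((\<lambda>x::real. 2 * (K * (b - a)) * inverse (1 + x\<^sup>2)) \<longlongrightarrow> 0) at_bot"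
    by (intro tendsto_mult_right_zero; real_asymp)+
  note lim = this
  show "(FT u \<longlongrightarrow> 0) at_top" by (rule Lim_null_comparison[OF always_eventually lim(1)]) (use b in blast)
  show "(FT u \<longlongrightarrow> 0) at_bot" by (rule Lim_null_comparison[OF always_eventually lim(2)]) (use b in blast)
qed

text \<open>The Fourier transform of \<open>antideriv u\<close> is a primitive of that of \<open>u\<close>. Division by \<open>\<xi>\<close> is harmless for functions
supported in \<open>[1/2, 2]\<close>; at \<open>0\<close> the quotient is \<open>0\<close>.\<close>

definition antideriv :: "(real \<Rightarrow> complex) \<Rightarrow> real \<Rightarrow> complex" where
  "antideriv u \<xi> = u \<xi> / (\<i> * of_real \<xi>)"

lemma antideriv_derivs_bounded:
  assumes "derivs_bounded m (window (1/2) 2 K) u"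
  shows "\<exists>K'. derivs_bounded m (window (1/2) 2 K') (antideriv u)"
  using assms
proof (induction m arbitrary: u K)
  have bdd: "cmod (antideriv u t) \<le> (window (1/2) 2 (2 * K)) t" if "\<And>t. cmod (u t) \<le> (window (1/2) 2 K) t" for u K t
  proof (cases "t \<in> {1/2<..<2}")
    case True
    then have "cmod (antideriv u t) = cmod (u t) / t" by (simp add: antideriv_def norm_divide norm_mult)
    also have "\<dots> \<le> cmod (u t) / (1/2)" using True by (intro divide_left_mono) auto
    also have "\<dots> \<le> 2 * K" using that[of t] True by simp
    finally show ?thesis using True by auto
  next
    case False
    then have "u t = 0" using that[of t] by (simp split: if_splits)
    then have "antideriv u t = 0" by (simp add: antideriv_def)
    then show ?thesis using False by (simp only: if_False norm_zero order_refl)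
  qed
  {
    case 0
    have "derivs_bounded 0 (window (1/2) 2 (2 * K)) (antideriv u)"
      unfolding derivs_bounded.simps(1) by (intro allI bdd derivs_boundedD[OF 0])
    then show ?case by blast
  next
    case (Suc m)
    obtain u' where u': "\<And>x. (u has_vector_derivative u' x) (at x)" "derivs_bounded m (window (1/2) 2 K) u'"
      using Suc.prems by auto
    obtain K1 where K1: "derivs_bounded m (window (1/2) 2 K1) (antideriv u)"
      using Suc.IH[OF derivs_bounded_Suc[OF Suc.prems]] by blast
    obtain K2 where K2: "derivs_bounded m (window (1/2) 2 K2) (antideriv (antideriv u))"
      using Suc.IH[OF K1] by blast
    obtain K3 where K3: "derivs_bounded m (window (1/2) 2 K3) (antideriv u')"
      using Suc.IH[OF u'(2)] by blast
    let ?d = "\<lambda>t. antideriv u' t + (- \<i>) * antideriv (antideriv u) t"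
    have der: "(antideriv u has_vector_derivative ?d t) (at t)" for t
    proof (cases "t < 1/2")
      case True
      have zu: "u s = 0" "u' s = 0" if "s < 1/2" for s
        using window_zero[OF Suc.prems, of s] window_zero[OF u'(2), of s] that by auto
      have "(antideriv u has_vector_derivative 0) (at t)"
        by (rule has_vector_derivative_transform_within_open[of "\<lambda>x. 0" _ _ "{..<1/2}"])
           (use True zu in \<open>auto simp: antideriv_def\<close>)
      then show ?thesis using zu[OF True] by (simp add: antideriv_def)
    next
      case False
      then have "t \<noteq> 0" by auto
      have "((\<lambda>z. 1 / (\<i> * z)) has_field_derivative (- \<i>) / (\<i> * of_real t)\<^sup>2) (at (of_real t))"
        using \<open>t \<noteq> 0\<close> by (auto intro!: derivative_eq_intros simp: field_simps power2_eq_square)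
      from has_vector_derivative_mult[OF u'(1) has_vector_derivative_real_field[OF this]]
      have "((\<lambda>x. u x * (1 / (\<i> * of_real x))) has_vector_derivative u t * (- \<i> / (\<i> * of_real t)\<^sup>2) + u' t * (1 / (\<i> * of_real t))) (at t)" .
      moreover have "u t * (- \<i> / (\<i> * of_real t)\<^sup>2) + u' t * (1 / (\<i> * of_real t)) = ?d t"
        by (simp add: antideriv_def power2_eq_square)
      ultimately show ?thesis by (simp add: antideriv_def[abs_def])
    qed
    have "derivs_bounded m (\<lambda>t. window (1/2) 2 K3 t + cmod (- \<i>) * window (1/2) 2 K2 t) ?d"
      by (rule derivs_bounded_add[OF K3 derivs_bounded_cmult[OF K2]])
    then have 1: "derivs_bounded m (window (1/2) 2 (\<bar>K3\<bar> + \<bar>K2\<bar> + 2 * \<bar>K\<bar>)) ?d"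
      by (rule derivs_bounded_weight) auto
    have "cmod (antideriv u t) \<le> window (1/2) 2 (\<bar>K3\<bar> + \<bar>K2\<bar> + 2 * \<bar>K\<bar>) t" for t
      using bdd[of u K t, OF derivs_boundedD[OF Suc.prems]] by (auto split: if_splits)
    with 1 der show ?case unfolding derivs_bounded.simps(2)
      by (intro exI[of _ "\<bar>K3\<bar> + \<bar>K2\<bar> + 2 * \<bar>K\<bar>"] conjI exI[of _ ?d] allI)
  }
qed

lemma antideriv_inverse:
  assumes "derivs_bounded m (window (1/2) 2 K) u"
  shows "(\<lambda>\<xi>. \<i> * of_real \<xi> * antideriv u \<xi>) = u"
proof
  fix \<xi>
  show "\<i> * of_real \<xi> * antideriv u \<xi> = u \<xi>"
    using window_zero[OF assms, of 0] by (cases "\<xi> = 0") (auto simp: antideriv_def)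
qed

text \<open>Since \<open>u\<close> vanishes near \<open>0\<close>, its Fourier transform is an \<open>m\<close>-th derivative of an integrable function.
Integration by parts moves these derivatives to \<open>f\<close>, and each of them produces a factor \<open>c\<close>. One further
derivative of \<open>f\<close> ensures that the integrands are continuous.\<close>

lemma Bernstein_estimate:
  assumes "derivs_bounded (Suc m) (\<lambda>_. K) f" "derivs_bounded 3 (window (1/2) 2 L) u"
  shows "cmod (\<integral>z. f (x - c * z) * FT u z \<partial>lborel) \<le> \<bar>c\<bar> ^ m * K * (\<integral>z. cmod (FT ((antideriv ^^ m) u) z) \<partial>lborel)"
  using assms
proof (induction m arbitrary: f u L)
  case 0
  have "(1/2::real) < 2" by simp
  note int = FT_integrable(1)[OF 0(2) this] and cont = FT_integrable(4)[OF 0(2) this]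
  have fc: "continuous_on UNIV (\<lambda>z. f (x - c * z))"
    using derivs_bounded_continuous[OF 0(1)] by (rule continuous_on_compose2) (auto intro!: continuous_intros)
  have "cmod (\<integral>z. f (x - c * z) * FT u z \<partial>lborel) \<le> (\<integral>z. K * cmod (FT u z) \<partial>lborel)"
  proof (rule Bochner_Integration.integral_norm_bound_integral)
    show "integrable lborel (\<lambda>z. f (x - c * z) * FT u z)"
    proof (rule Bochner_Integration.integrable_bound)
      show "integrable lborel (\<lambda>z. K * cmod (FT u z))" using int by simp
      show "(\<lambda>z. f (x - c * z) * FT u z) \<in> borel_measurable lborel"
        using cont fc by (auto intro!: borel_measurable_continuous_onI continuous_on_mult)
    qed (use derivs_boundedD[OF 0(1)] in \<open>auto simp: norm_mult intro!: mult_right_mono order_trans[OF _ abs_ge_self]\<close>)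
    show "integrable lborel (\<lambda>z. K * cmod (FT u z))" using int by simp
    show "cmod (f (x - c * z) * FT u z) \<le> K * cmod (FT u z)" for z
      using derivs_boundedD[OF 0(1)] by (auto simp: norm_mult intro!: mult_right_mono)
  qed
  then show ?case by simp
next
  case (Suc m)
  obtain f' where f': "\<And>x. (f has_vector_derivative f' x) (at x)" "derivs_bounded (Suc m) (\<lambda>_. K) f'"
    using Suc.prems(1) by (auto simp only: derivs_bounded.simps(2)[of "Suc m"])
  obtain L' where L': "derivs_bounded 3 (window (1/2) 2 L') (antideriv u)"
    using antideriv_derivs_bounded[OF Suc.prems(2)] by blast
  let ?v = "antideriv u"
  have dv: "(FT ?v has_vector_derivative FT u z) (at z)" for z
    using FT_has_derivative[of 2 "1/2" 2 L' ?v z] L' antideriv_inverse[OF Suc.prems(2)] by (simp add: numeral_3_eq_3 numeral_2_eq_2 del: derivs_bounded.simps)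
  have "(1/2::real) < 2" by simp
  note u = FT_integrable[OF Suc.prems(2) this] and v = FT_integrable[OF L' this]
  have df: "((\<lambda>z. f (x - c * z)) has_vector_derivative - (of_real c * f' (x - c * z))) (at z)" for z
  proof -
    have "((\<lambda>z. x - c * z) has_vector_derivative (- c)) (at z)" by (auto intro!: derivative_eq_intros)
    from vector_diff_chain_at[OF this f'(1)] show ?thesis by (simp add: o_def scaleR_conv_of_real)
  qed
  have fc: "continuous_on UNIV (\<lambda>z. f (x - c * z))" "continuous_on UNIV (\<lambda>z. f' (x - c * z))"
    by (rule continuous_on_compose2[OF derivs_bounded_continuous[OF Suc.prems(1)]], auto intro!: continuous_intros)
       (rule continuous_on_compose2[OF derivs_bounded_continuous[OF f'(2)]], auto intro!: continuous_intros)
  have i: "integrable lborel (\<lambda>z. g (x - c * z) * FT w z)"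
    if "continuous_on UNIV (\<lambda>z. g (x - c * z))" "\<And>x. cmod (g x) \<le> K" "integrable lborel (FT w)" "continuous_on UNIV (FT w)" for g w
  proof (rule Bochner_Integration.integrable_bound)
    show "integrable lborel (\<lambda>z. K * cmod (FT w z))" using that by simp
    show "(\<lambda>z. g (x - c * z) * FT w z) \<in> borel_measurable lborel"
      using that by (auto intro!: borel_measurable_continuous_onI continuous_on_mult)
  qed (use that in \<open>auto simp: norm_mult intro!: mult_right_mono order_trans[OF _ abs_ge_self]\<close>)
  note ifd = i[OF fc(2) derivs_boundedD[OF f'(2)] v(1,4)] and if0 = i[OF fc(1) derivs_boundedD[OF Suc.prems(1)] u(1,4)]
  have fb: "cmod (f y) \<le> K" for y by (rule derivs_boundedD[OF Suc.prems(1)])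
  have "integral\<^sup>L lborel (\<lambda>z. f (x - c * z) * FT u z + - (of_real c * f' (x - c * z)) * FT ?v z) = 0"
  proof (rule integral_derivative_zero)
    show "((\<lambda>z. f (x - c * z) * FT ?v z) has_vector_derivative (f (x - c * z) * FT u z + - (of_real c * f' (x - c * z)) * FT ?v z)) (at z)" for z
      by (rule has_vector_derivative_mult[OF df dv])
    show "continuous_on UNIV (\<lambda>z. f (x - c * z) * FT u z + - (of_real c * f' (x - c * z)) * FT ?v z)"
      by (intro continuous_intros fc u(4) v(4))
    show "integrable lborel (\<lambda>z. f (x - c * z) * FT u z + - (of_real c * f' (x - c * z)) * FT ?v z)"
      using if0 integrable_mult_right[OF ifd, of "- of_real c"] by (simp add: mult_ac)
    have *: "cmod (f (x - c * z) * FT ?v z) \<le> K * cmod (FT ?v z)" for z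
      using fb by (auto simp: norm_mult intro!: mult_right_mono)
    show "((\<lambda>z. f (x - c * z) * FT ?v z) \<longlongrightarrow> 0) at_top"
      using * by (intro Lim_null_comparison[OF always_eventually tendsto_mult_right_zero[OF tendsto_norm_zero[OF v(2)]]]) auto
    show "((\<lambda>z. f (x - c * z) * FT ?v z) \<longlongrightarrow> 0) at_bot"
      using * by (intro Lim_null_comparison[OF always_eventually tendsto_mult_right_zero[OF tendsto_norm_zero[OF v(3)]]]) auto
  qed
  then have "(\<integral>z. f (x - c * z) * FT u z \<partial>lborel) = of_real c * (\<integral>z. f' (x - c * z) * FT ?v z \<partial>lborel)"
    using if0 ifd by (simp add: mult.assoc)
  then have "cmod (\<integral>z. f (x - c * z) * FT u z \<partial>lborel) = \<bar>c\<bar> * cmod (\<integral>z. f' (x - c * z) * FT ?v z \<partial>lborel)"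
    by (simp add: norm_mult)
  also have "\<dots> \<le> \<bar>c\<bar> * (\<bar>c\<bar> ^ m * K * (\<integral>z. cmod (FT ((antideriv ^^ m) ?v) z) \<partial>lborel))"
    by (intro mult_left_mono Suc.IH[OF f'(2) L']) auto
  finally show ?case by (simp add: funpow_swap1 mult_ac)
qed

lemma FT_scale:
  assumes "d \<noteq> 0"
  shows "FT (\<lambda>\<xi>. u (d * \<xi>)) x = of_real (1 / \<bar>d\<bar>) * FT u (x / d)"
proof -
  have "FT u (x / d) = \<bar>d\<bar> *\<^sub>R (\<integral>\<xi>. u (0 + d * \<xi>) * exp (\<i> * complex_of_real (x / d * (0 + d * \<xi>))) \<partial>lborel)"
    unfolding FT_def by (rule lborel_integral_real_affine[OF assms])
  also have "\<dots> = \<bar>d\<bar> *\<^sub>R FT (\<lambda>\<xi>. u (d * \<xi>)) x" using assms by (simp add: FT_def)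
  finally show ?thesis using assms by (simp add: scaleR_conv_of_real)
qed

text \<open>Rescaling the variable of integration moves the dilation from the kernel to the function, so that one integrable
kernel serves for all blocks.\<close>

lemma convol_scaled_kernel:
  assumes "d \<noteq> 0"
  shows "convol f (inv_fourier (\<lambda>\<xi>. u (d * \<xi>))) x = (1 / (2 * complex_of_real pi)) * (\<integral>z. f (x - d * z) * FT u z \<partial>lborel)"
proof -
  have "convol f (inv_fourier (\<lambda>\<xi>. u (d * \<xi>))) x = (\<integral>y. f y * ((1 / (2 * complex_of_real pi)) * (of_real (1 / \<bar>d\<bar>) * FT u ((x - y) / d))) \<partial>lborel)"
    by (simp add: convol_def inv_fourier_FT FT_scale[OF assms])
  also have "\<dots> = \<bar>- d\<bar> *\<^sub>R (\<integral>z. f (x + (- d) * z) * ((1 / (2 * complex_of_real pi)) * (of_real (1 / \<bar>d\<bar>) * FT u ((x - (x + (- d) * z)) / d))) \<partial>lborel)"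
    by (rule lborel_integral_real_affine) (use assms in simp)
  also have "(\<lambda>z. f (x + (- d) * z) * ((1 / (2 * complex_of_real pi)) * (of_real (1 / \<bar>d\<bar>) * FT u ((x - (x + (- d) * z)) / d))))
     = (\<lambda>z. ((1 / (2 * complex_of_real pi)) * of_real (1 / \<bar>d\<bar>)) * (f (x - d * z) * FT u z))"
    using assms by (auto simp: fun_eq_iff)
  finally show ?thesis using assms by (simp add: scaleR_conv_of_real)
qed

lemma summable_geometric_int:
  fixes r :: real
  assumes "0 \<le> r" "r < 1"
  shows "(\<lambda>n::int. r ^ nat \<bar>n\<bar>) summable_on UNIV"
proof -
  have s: "(\<lambda>n::nat. r ^ n) summable_on UNIV"
    using assms by (intro norm_summable_imp_summable_on) (simp add: summable_geometric)
  have "(\<lambda>n::int. r ^ nat \<bar>n\<bar>) summable_on range int"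
    by (subst summable_on_reindex) (use s in \<open>auto simp: o_def\<close>)
  moreover have "(\<lambda>n::int. r ^ nat \<bar>n\<bar>) summable_on range (\<lambda>n. - int n)"
    by (subst summable_on_reindex) (use s in \<open>auto simp: o_def inj_on_def\<close>)
  ultimately have "(\<lambda>n::int. r ^ nat \<bar>n\<bar>) summable_on (range int \<union> range (\<lambda>n. - int n))"
    using summable_on_union by blast
  moreover have "range int \<union> range (\<lambda>n. - int n) = UNIV"
    by (auto simp: image_iff) (metis nonneg_int_cases nonpos_int_cases linear)
  ultimately show ?thesis by simp
qed

context
  fixes \<phi> :: "int \<Rightarrow> real \<Rightarrow> complex"
  assumes \<phi>: "besov_partition \<phi>"
begin

text \<open>Every block of the partition is a dilation, for negative indices also a reflection, of one of the two functions
\<open>\<phi> 0\<close> and \<open>\<phi> 1\<close>.\<close>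

definition dilation :: "int \<Rightarrow> real" where
  "dilation n = (if n = 0 then 1 else sgn (of_int n) * 2 powi (1 - \<bar>n\<bar>))"

definition mother :: "int \<Rightarrow> real \<Rightarrow> complex" where
  "mother n = (if n = 0 then \<phi> 0 else \<phi> 1)"

lemma dilation_nonzero: "dilation n \<noteq> 0"
  by (simp add: dilation_def sgn_if)

lemma partition_eq: "\<phi> n = (\<lambda>\<xi>. mother n (dilation n * \<xi>))"
proof -
  have pos: "\<phi> n = (\<lambda>\<xi>. \<phi> 1 (2 powi (1 - n) * \<xi>))" if "n \<ge> 1" for n
  proof (cases "n = 1")
    case False
    then have "n \<ge> 2" using that by simp
    then show ?thesis using \<phi> by (auto simp: besov_partition_def)
  qed simp
  consider "n = 0" | "n \<ge> 1" | "n \<le> -1" by linarith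
  then show ?thesis
  proof cases
    case 2
    then show ?thesis by (subst pos) (auto simp: mother_def dilation_def)
  next
    case 3
    then have "\<phi> n = (\<lambda>\<xi>. \<phi> (- n) (- \<xi>))" using \<phi> by (auto simp: besov_partition_def)
    also have "\<phi> (- n) = (\<lambda>\<xi>. \<phi> 1 (2 powi (1 - (- n)) * \<xi>))" by (rule pos) (use 3 in simp)
    finally show ?thesis using 3 by (simp add: mother_def dilation_def)
  qed (simp add: mother_def dilation_def)
qed

lemma mother_derivs_bounded: "\<exists>a b L. a < b \<and> derivs_bounded 3 (window a b L) (mother n)"
proof (cases "n = 0")
  case True
  have "smooth (\<phi> 0)" "supp (\<phi> 0) \<subseteq> {-1..1}" using \<phi> by (auto simp: besov_partition_def)
  from smooth_derivs_bounded[OF this, of 3 0] obtain L where "derivs_bounded 3 (window (-1) 1 L) (nth_deriv 0 (\<phi> 0))" by blast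
  then have "derivs_bounded 3 (window (-1) 1 L) (mother n)" using True by (simp only: mother_def funpow_0 if_True simp_thms)
  moreover have "-1 < (1::real)" by simp
  ultimately show ?thesis by blast
next
  case False
  have "smooth (\<phi> 1)" "supp (\<phi> 1) \<subseteq> {1/2..2}" using \<phi> by (auto simp: besov_partition_def)
  from smooth_derivs_bounded[OF this, of 3 0] obtain L where "derivs_bounded 3 (window (1/2) 2 L) (nth_deriv 0 (\<phi> 1))" by blast
  then have "derivs_bounded 3 (window (1/2) 2 L) (mother n)" using False by (simp only: mother_def funpow_0 if_False)
  moreover have "1/2 < (2::real)" by simp
  ultimately show ?thesis by blast
qed

lemma FT_mother: "integrable lborel (FT (mother n))" "continuous_on UNIV (FT (mother n))"
  using mother_derivs_bounded[of n] FT_integrable by blast+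

lemma convol_block: "convol f (inv_fourier (\<phi> n)) x = (1 / (2 * complex_of_real pi)) * (\<integral>z. f (x - dilation n * z) * FT (mother n) z \<partial>lborel)"
  by (subst partition_eq) (rule convol_scaled_kernel[OF dilation_nonzero])

lemma block_integrable:
  assumes "continuous_on UNIV f" "\<And>y. cmod (f y) \<le> B"
  shows "integrable lborel (\<lambda>z. f (x - dilation n * z) * FT (mother n) z)"
    and "cmod (\<integral>z. f (x - dilation n * z) * FT (mother n) z \<partial>lborel) \<le> B * (\<integral>z. cmod (FT (mother n) z) \<partial>lborel)"
proof -
  have fc: "continuous_on UNIV (\<lambda>z. f (x - dilation n * z))"
    using assms(1) by (rule continuous_on_compose2) (auto intro!: continuous_intros)
  have i: "integrable lborel (\<lambda>z. B * cmod (FT (mother n) z))" using FT_mother(1)[of n] by simp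
  show int: "integrable lborel (\<lambda>z. f (x - dilation n * z) * FT (mother n) z)"
  proof (rule Bochner_Integration.integrable_bound[OF i])
    show "(\<lambda>z. f (x - dilation n * z) * FT (mother n) z) \<in> borel_measurable lborel"
      using fc FT_mother(2)[of n] by (auto intro!: borel_measurable_continuous_onI continuous_on_mult)
  qed (use assms(2) in \<open>auto simp: norm_mult intro!: mult_right_mono order_trans[OF _ abs_ge_self]\<close>)
  have "cmod (\<integral>z. f (x - dilation n * z) * FT (mother n) z \<partial>lborel) \<le> (\<integral>z. B * cmod (FT (mother n) z) \<partial>lborel)"
    by (rule Bochner_Integration.integral_norm_bound_integral[OF int i])
       (use assms(2) in \<open>auto simp: norm_mult intro!: mult_right_mono\<close>)
  then show "cmod (\<integral>z. f (x - dilation n * z) * FT (mother n) z \<partial>lborel) \<le> B * (\<integral>z. cmod (FT (mother n) z) \<partial>lborel)" by simp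
qed

lemma bdd_above_block:
  assumes "continuous_on UNIV f" "bounded (range f)"
  shows "bdd_above (range (\<lambda>x. cmod (convol f (inv_fourier (\<phi> n)) x)))"
proof -
  obtain B where B: "\<And>y. cmod (f y) \<le> B" using assms(2) by (auto simp: bounded_iff)
  show ?thesis
  proof (rule bdd_aboveI2)
    show "cmod (convol f (inv_fourier (\<phi> n)) x) \<le> cmod (1 / (2 * complex_of_real pi)) * (B * (\<integral>z. cmod (FT (mother n) z) \<partial>lborel))" for x
      unfolding convol_block norm_mult by (intro mult_left_mono block_integrable(2)[OF assms(1) B]) auto
  qed
qed

lemma besov_block_nonneg:
  assumes "continuous_on UNIV f" "bounded (range f)"
  shows "0 \<le> besov_block \<phi> \<alpha> f n"
proof -
  have "0 \<le> cmod (convol f (inv_fourier (\<phi> n)) 0)" by simp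
  also have "\<dots> \<le> (SUP x. cmod (convol f (inv_fourier (\<phi> n)) x))"
    by (rule cSUP_upper[OF UNIV_I bdd_above_block[OF assms]])
  finally show ?thesis by (simp add: besov_block_def)
qed

lemma besov_block_diff:
  assumes "continuous_on UNIV f" "bounded (range f)" "continuous_on UNIV g" "bounded (range g)"
  shows "besov_block \<phi> \<alpha> (\<lambda>x. f x - g x) n \<le> besov_block \<phi> \<alpha> f n + besov_block \<phi> \<alpha> g n"
proof -
  obtain B where B: "\<And>y. cmod (f y) \<le> B" using assms(2) by (auto simp: bounded_iff)
  obtain C where C: "\<And>y. cmod (g y) \<le> C" using assms(4) by (auto simp: bounded_iff)
  let ?k = "inv_fourier (\<phi> n)"
  have "(SUP x. cmod (convol (\<lambda>x. f x - g x) ?k x)) \<le> (SUP x. cmod (convol f ?k x)) + (SUP x. cmod (convol g ?k x))"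
  proof (rule cSUP_least)
    fix x
    have "convol (\<lambda>x. f x - g x) ?k x = convol f ?k x - convol g ?k x"
      unfolding convol_block using block_integrable(1)[OF assms(1) B, of x n] block_integrable(1)[OF assms(3) C, of x n]
      by (simp add: left_diff_distrib right_diff_distrib)
    then have "cmod (convol (\<lambda>x. f x - g x) ?k x) \<le> cmod (convol f ?k x) + cmod (convol g ?k x)"
      by (simp add: norm_triangle_ineq4)
    also have "\<dots> \<le> (SUP x. cmod (convol f ?k x)) + (SUP x. cmod (convol g ?k x))"
      using assms by (intro add_mono cSUP_upper bdd_above_block) auto
    finally show "cmod (convol (\<lambda>x. f x - g x) ?k x) \<le> \<dots>" .
  qed simp
  then have "2 powr (real_of_int \<bar>n\<bar> * \<alpha>) * (SUP x. cmod (convol (\<lambda>x. f x - g x) ?k x))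
     \<le> 2 powr (real_of_int \<bar>n\<bar> * \<alpha>) * ((SUP x. cmod (convol f ?k x)) + (SUP x. cmod (convol g ?k x)))"
    by (intro mult_left_mono) auto
  then show ?thesis by (simp add: besov_block_def distrib_left)
qed

lemma besov_diff:
  assumes f: "f \<in> besov \<phi> \<alpha>" and g: "g \<in> besov \<phi> \<alpha>"
  shows "(\<lambda>x. f x - g x) \<in> besov \<phi> \<alpha>" "besov_norm \<phi> \<alpha> (\<lambda>x. f x - g x) \<le> besov_norm \<phi> \<alpha> f + besov_norm \<phi> \<alpha> g"
proof -
  have fb: "bounded (range f)" "uniformly_continuous_on UNIV f" "besov_block \<phi> \<alpha> f summable_on UNIV"
    and gb: "bounded (range g)" "uniformly_continuous_on UNIV g" "besov_block \<phi> \<alpha> g summable_on UNIV"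
    using f g by (auto simp: besov_def)
  have fc: "continuous_on UNIV f" "continuous_on UNIV g" using fb(2) gb(2) uniformly_continuous_imp_continuous by blast+
  have dc: "continuous_on UNIV (\<lambda>x. f x - g x)" using fc by (intro continuous_intros)
  have db: "bounded (range (\<lambda>x. f x - g x))" by (rule bounded_minus_comp[OF fb(1) gb(1)])
  have s: "(\<lambda>n. besov_block \<phi> \<alpha> f n + besov_block \<phi> \<alpha> g n) summable_on UNIV" by (rule summable_on_add[OF fb(3) gb(3)])
  have sd: "besov_block \<phi> \<alpha> (\<lambda>x. f x - g x) summable_on UNIV"
    by (rule summable_on_comparison_test[OF s]) (use besov_block_diff[OF fc(1) fb(1) fc(2) gb(1)] besov_block_nonneg[OF dc db] in auto)
  show "(\<lambda>x. f x - g x) \<in> besov \<phi> \<alpha>"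
    using db sd uniformly_continuous_on_diff[OF fb(2) gb(2)] by (simp add: besov_def)
  show "besov_norm \<phi> \<alpha> (\<lambda>x. f x - g x) \<le> besov_norm \<phi> \<alpha> f + besov_norm \<phi> \<alpha> g"
    unfolding besov_norm_def infsum_add[OF fb(3) gb(3), symmetric]
    by (rule infsum_mono[OF sd s]) (use besov_block_diff[OF fc(1) fb(1) fc(2) gb(1)] in auto)
qed

lemma besov_norm_nonneg:
  assumes "f \<in> besov \<phi> \<alpha>"
  shows "0 \<le> besov_norm \<phi> \<alpha> f"
  unfolding besov_norm_def using assms
  by (intro infsum_nonneg besov_block_nonneg) (auto simp: besov_def intro: uniformly_continuous_imp_continuous)

text \<open>The \<open>n\<close>-th block is at most a multiple of \<open>2\<^sup>-\<^sup>m\<^sup>|\<^sup>n\<^sup>|\<close> by the Bernstein estimate, so that the weighted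
blocks are dominated by a geometric series when \<open>m > \<alpha>\<close>.\<close>

lemma derivs_bounded_besov:
  assumes "\<alpha> < real m"
  shows "\<exists>C\<ge>0. \<forall>K f. derivs_bounded (Suc m) (\<lambda>_. K) f \<longrightarrow> f \<in> besov \<phi> \<alpha> \<and> besov_norm \<phi> \<alpha> f \<le> C * K"
proof -
  have "smooth (\<phi> 1)" "supp (\<phi> 1) \<subseteq> {1/2..2}" using \<phi> by (auto simp: besov_partition_def)
  from smooth_derivs_bounded[OF this, of 3 0] obtain L where L: "derivs_bounded 3 (window (1/2) 2 L) (\<phi> 1)" by auto
  define I0 where "I0 = (\<integral>z. cmod (FT (mother 0) z) \<partial>lborel)"
  define I1 where "I1 = (\<integral>z. cmod (FT ((antideriv ^^ m) (\<phi> 1)) z) \<partial>lborel)"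
  \<comment> \<open>the ratio of the geometric series that dominates the blocks\<close>
  define r where "r = 2 powr (\<alpha> - real m)"
  define B where "B = (I0 + 2 ^ m * I1) / (2 * pi)"
  have I: "0 \<le> I0" "0 \<le> I1" by (auto simp: I0_def I1_def intro!: Bochner_Integration.integral_nonneg)
  have r: "0 \<le> r" "r < 1"
    unfolding r_def using assms powr_less_mono[of "\<alpha> - real m" 0 2] by auto
  have B: "0 \<le> B" using I by (simp add: B_def)
  define C where "C = (\<Sum>\<^sub>\<infinity>n. B * r ^ nat \<bar>n::int\<bar>)"
  have sB: "(\<lambda>n. K * (B * r ^ nat \<bar>n::int\<bar>)) summable_on UNIV" for K
    using summable_geometric_int[OF r] by (intro summable_on_cmult_right)
  have "C \<ge> 0" unfolding C_def using B r by (intro infsum_nonneg) auto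
  moreover have "f \<in> besov \<phi> \<alpha> \<and> besov_norm \<phi> \<alpha> f \<le> C * K" if f: "derivs_bounded (Suc m) (\<lambda>_. K) f" for K f
  proof -
    have K: "K \<ge> 0" using derivs_bounded_weight_nonneg[OF f] .
    have fc: "continuous_on UNIV f" by (rule derivs_bounded_continuous[OF f])
    have fK: "cmod (f x) \<le> K" for x by (rule derivs_boundedD[OF f])
    then have fb: "bounded (range f)" by (auto simp: bounded_iff)
    obtain f' where f': "\<And>x. (f has_vector_derivative f' x) (at x)" "derivs_bounded m (\<lambda>_. K) f'" using f by auto
    have lip: "norm (f y - f x) \<le> K * norm (y - x)" for x y
    proof (rule differentiable_bound[of UNIV f "\<lambda>x h. h *\<^sub>R f' x"])
      show "(f has_derivative (\<lambda>h. h *\<^sub>R f' x)) (at x within UNIV)" for x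
        using f'(1) by (simp add: has_vector_derivative_def)
      show "onorm (\<lambda>h. h *\<^sub>R f' x) \<le> K" for x
        by (rule onorm_le) (use derivs_boundedD[OF f'(2), of x] in \<open>simp add: mult.commute[of K] mult_left_mono\<close>)
    qed auto
    have uc: "uniformly_continuous_on UNIV f"
      unfolding uniformly_continuous_on_def
    proof (intro allI impI)
      fix e :: real assume "e > 0"
      have "dist (f x') (f x) < e" if "dist x' x < e / (K + 1)" for x x'
      proof -
        have "norm (f x' - f x) \<le> K * norm (x' - x)" by (rule lip)
        also have "\<dots> \<le> (K + 1) * norm (x' - x)" by (intro mult_right_mono) auto
        also have "\<dots> < e" using that K by (simp add: dist_norm field_simps)
        finally show ?thesis by (simp add: dist_norm)
      qed
      then show "\<exists>d>0. \<forall>x\<in>UNIV. \<forall>x'\<in>UNIV. dist x' x < d \<longrightarrow> dist (f x') (f x) < e"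
        using \<open>e > 0\<close> K by (intro exI[of _ "e / (K + 1)"]) auto
    qed
    have bl: "besov_block \<phi> \<alpha> f n \<le> K * (B * r ^ nat \<bar>n\<bar>)" for n
    proof (cases "n = 0")
      case True
      have "(SUP x. cmod (convol f (inv_fourier (\<phi> 0)) x)) \<le> K * B"
      proof (rule cSUP_least)
        fix x
        have "cmod (convol f (inv_fourier (\<phi> 0)) x) \<le> (1 / (2 * pi)) * (K * I0)"
          unfolding convol_block norm_mult I0_def
          by (intro mult_mono block_integrable(2)[OF fc fK]) (auto simp: norm_divide)
        also have "\<dots> \<le> K * B" using I K by (simp add: B_def field_simps)
        finally show "cmod (convol f (inv_fourier (\<phi> 0)) x) \<le> K * B" .
      qed simp
      then show ?thesis using True by (simp add: besov_block_def)
    next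
      case False
      let ?q = "2 powr (real_of_int (1 - \<bar>n\<bar>))"
      have "\<bar>sgn (real_of_int n)\<bar> = 1" using False by (simp add: sgn_if)
      moreover have "2 powi (1 - \<bar>n\<bar>) = ?q" by (rule powr_real_of_int'[symmetric]) simp_all
      moreover have "\<bar>?q\<bar> = ?q" by (rule abs_of_nonneg) simp
      ultimately have d: "\<bar>dilation n\<bar> = ?q"
        by (simp only: dilation_def if_False False abs_mult mult_1)
      have "(SUP x. cmod (convol f (inv_fourier (\<phi> n)) x)) \<le> (1 / (2 * pi)) * (?q ^ m * K * I1)"
      proof (rule cSUP_least)
        fix x
        show "cmod (convol f (inv_fourier (\<phi> n)) x) \<le> (1 / (2 * pi)) * (?q ^ m * K * I1)"
          unfolding convol_block norm_mult I1_def d[symmetric] using Bernstein_estimate[OF f L, of x "dilation n"] False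
          by (intro mult_mono) (auto simp: norm_divide mother_def)
      qed simp
      then have "besov_block \<phi> \<alpha> f n \<le> 2 powr (real_of_int \<bar>n\<bar> * \<alpha>) * ((1 / (2 * pi)) * (?q ^ m * K * I1))"
        unfolding besov_block_def by (intro mult_left_mono) auto
      also have "\<dots> = (2 powr (real_of_int \<bar>n\<bar> * \<alpha>) * ?q ^ m) * (K * I1 / (2 * pi))" by simp
      also have "2 powr (real_of_int \<bar>n\<bar> * \<alpha>) * ?q ^ m = 2 ^ m * r ^ nat \<bar>n\<bar>"
      proof -
        have "r ^ nat \<bar>n\<bar> = 2 powr ((\<alpha> - real m) * real_of_int \<bar>n\<bar>)"
          by (simp add: r_def powr_power mult.commute)
        moreover have "?q ^ m = 2 powr (real_of_int (1 - \<bar>n\<bar>) * real m)" by (simp add: powr_power mult.commute)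
        moreover have "(2::real) ^ m = 2 powr (real m)" by (simp add: powr_realpow)
        ultimately show ?thesis by (simp add: powr_add[symmetric] algebra_simps)
      qed
      also have "2 ^ m * r ^ nat \<bar>n\<bar> * (K * I1 / (2 * pi)) = K * ((2 ^ m * I1 / (2 * pi)) * r ^ nat \<bar>n\<bar>)" by simp
      also have "\<dots> \<le> K * (B * r ^ nat \<bar>n\<bar>)"
        using I K r by (intro mult_left_mono mult_right_mono) (auto simp: B_def divide_right_mono)
      finally show ?thesis .
    qed
    have s: "besov_block \<phi> \<alpha> f summable_on UNIV"
      by (rule summable_on_comparison_test[OF sB[of K]]) (use bl besov_block_nonneg[OF fc fb] in auto)
    have "besov_norm \<phi> \<alpha> f \<le> (\<Sum>\<^sub>\<infinity>n. K * (B * r ^ nat \<bar>n::int\<bar>))"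
      unfolding besov_norm_def by (rule infsum_mono[OF s sB]) (use bl in auto)
    also have "\<dots> = C * K" unfolding C_def by (subst infsum_cmult_right') simp
    finally show ?thesis using s uc fb by (simp add: besov_def)
  qed
  ultimately show ?thesis by blast
qed

end

section \<open>Approximation by Gaussian mollification\<close>

text \<open>Up to a constant factor, the convolution of \<open>f\<close> with a Gaussian of variance \<open>1/k\<^sup>2\<close>. It makes sense at complex
arguments because the Gaussian is entire and integrable along every horizontal line.\<close>

definition gaussian_extension :: "(real \<Rightarrow> complex) \<Rightarrow> real \<Rightarrow> complex \<Rightarrow> complex" where
  "gaussian_extension f k w = integral UNIV (\<lambda>y. f y * exp (- ((of_real k * (w - of_real y))\<^sup>2 / 2)))"

definition mollify :: "(real \<Rightarrow> complex) \<Rightarrow> real \<Rightarrow> real \<Rightarrow> complex" where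
  "mollify f k x = (\<integral>s. std_normal_density s *\<^sub>R f (x - s / k) \<partial>lborel)"

lemma gaussian_norm:
  "cmod (exp (- ((of_real k * (w - of_real y))\<^sup>2 / 2))) = exp (k\<^sup>2 * (Im w)\<^sup>2 / 2) * exp (- (k * (Re w - y))\<^sup>2 / 2)"
  by (simp add: power2_eq_square exp_add[symmetric] algebra_simps diff_divide_distrib add_divide_distrib)

lemma gaussian_integrable:
  assumes "k > 0"
  shows "integrable lborel (\<lambda>y::real. exp (- (k * (u - y))\<^sup>2 / 2))" 
    "integral UNIV (\<lambda>y::real. exp (- (k * (u - y))\<^sup>2 / 2)) = sqrt (2 * pi) / k"
proof -
  have eq: "exp (- (k * (u - y))\<^sup>2 / 2) = (sqrt (2 * pi) / k) * normal_density u (1/k) y" for y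
  proof -
    have "(k * (u - y))\<^sup>2 = k\<^sup>2 * (y - u)\<^sup>2" by (simp add: power_mult_distrib power2_commute)
    moreover have "normal_density u (1/k) y = k / sqrt (2 * pi) * exp (- (k\<^sup>2 * (y - u)\<^sup>2) / 2)"
      using assms by (simp add: normal_density_def real_sqrt_mult real_sqrt_divide power_divide field_simps)
    ultimately show ?thesis using assms by simp
  qed
  show i: "integrable lborel (\<lambda>y::real. exp (- (k * (u - y))\<^sup>2 / 2))"
    unfolding eq using integrable_normal_density[of "1/k" u] assms by simp
  show "integral UNIV (\<lambda>y::real. exp (- (k * (u - y))\<^sup>2 / 2)) = sqrt (2 * pi) / k"
    unfolding integral_lborel[OF i] unfolding eq using integral_normal_density[of "1/k" u] assms by simp
qed

context
  fixes f :: "real \<Rightarrow> complex" and K k :: real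
  assumes fc: "continuous_on UNIV f" and fK: "\<And>y. cmod (f y) \<le> K" and k: "k > 0"
begin

lemma gaussian_integrand:
  shows gaussian_integrand_continuous: "continuous_on UNIV (\<lambda>y. f y * exp (- ((of_real k * (w - of_real y))\<^sup>2 / 2)))"
    and gaussian_integrand_bound: "cmod (f y * exp (- ((of_real k * (w - of_real y))\<^sup>2 / 2))) \<le> K * exp (k\<^sup>2 * (Im w)\<^sup>2 / 2) * exp (- (k * (Re w - y))\<^sup>2 / 2)"
  subgoal by (intro continuous_intros fc) auto
  subgoal unfolding norm_mult gaussian_norm mult.assoc using fK by (intro mult_right_mono) auto
  done

lemma gaussian_extension_bound:
  "cmod (gaussian_extension f k w) \<le> K * exp (k\<^sup>2 * (Im w)\<^sup>2 / 2) * (sqrt (2 * pi) / k)"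
proof -
  have b: "(\<lambda>y. K * exp (k\<^sup>2 * (Im w)\<^sup>2 / 2) * exp (- (k * (Re w - y))\<^sup>2 / 2)) integrable_on UNIV"
    using gaussian_integrable(1)[OF k, of "Re w"] by (intro integrable_on_mult_right integrable_on_lborel)
  have "cmod (gaussian_extension f k w) \<le> integral UNIV (\<lambda>y. K * exp (k\<^sup>2 * (Im w)\<^sup>2 / 2) * exp (- (k * (Re w - y))\<^sup>2 / 2))"
    unfolding gaussian_extension_def
    using dominated_integrable[OF gaussian_integrand_continuous b gaussian_integrand_bound] b gaussian_integrand_bound
    by (intro Henstock_Kurzweil_Integration.integral_norm_bound_integral) auto
  also have "\<dots> = K * exp (k\<^sup>2 * (Im w)\<^sup>2 / 2) * (sqrt (2 * pi) / k)"
    by (simp only: integral_mult_right gaussian_integrable(2)[OF k])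
  finally show ?thesis .
qed

text \<open>The integrals over \<open>[-n, n]\<close> are holomorphic and converge uniformly on discs, where \<open>|Re w|\<close> and \<open>|Im w|\<close> are
bounded and the integrand has a Gaussian majorant.\<close>

lemma gaussian_extension_holomorphic: "gaussian_extension f k holomorphic_on UNIV"
proof (rule holomorphic_uniform_sequence)
  define E where "E w y = f y * exp (- ((of_real k * (w - of_real y))\<^sup>2 / 2))" for w y
  define F where "F n w = integral {-real n..real n} (E w)" for n w
  show "F n holomorphic_on UNIV" for n
    unfolding F_def[abs_def] E_def[abs_def]
    unfolding cbox_interval[symmetric]
  proof (rule leibniz_rule_holomorphic)
    let ?fx = "\<lambda>w t. f t * (exp (- ((of_real k * (w - of_real t))\<^sup>2 / 2)) * (- (of_real k * (of_real k * (w - of_real t)))))"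
    show "((\<lambda>w. f t * exp (- ((of_real k * (w - of_real t))\<^sup>2 / 2))) has_field_derivative ?fx w t) (at w within UNIV)" for w t
      by (auto intro!: derivative_eq_intros simp: field_simps)
    show "(\<lambda>y. f y * exp (- ((of_real k * (w - of_real y))\<^sup>2 / 2))) integrable_on cbox (- real n) (real n)" for w
      by (rule integrable_continuous) (rule continuous_on_subset[OF gaussian_integrand_continuous], simp)
    show "continuous_on (UNIV \<times> cbox (- real n) (real n)) (\<lambda>(w, t). ?fx w t)"
      unfolding case_prod_unfold by (intro continuous_intros continuous_on_compose2[OF fc]) auto
  qed auto
  fix z :: complex
  define R where "R = cmod z + 1"
  define b where "b y = K * exp (k\<^sup>2 * R\<^sup>2) * exp (- (k / sqrt 2 * (0 - y))\<^sup>2 / 2)" for y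
  have K: "K \<ge> 0" using fK[of 0] norm_ge_zero order_trans by blast
  have bi: "b integrable_on UNIV" unfolding b_def[abs_def]
    by (intro integrable_on_mult_right integrable_on_lborel gaussian_integrable(1)) (use k in auto)
  have dom: "cmod (E w y) \<le> b y" if "w \<in> cball z 1" for w y
  proof -
    have "cmod w \<le> R" using that norm_triangle_sub[of w z] by (simp add: R_def dist_norm norm_minus_commute)
    then have R: "(Re w)\<^sup>2 + (Im w)\<^sup>2 \<le> R\<^sup>2" by (metis cmod_power2 norm_ge_zero power_mono)
    have "y\<^sup>2 \<le> 2 * (Re w - y)\<^sup>2 + 2 * (Re w)\<^sup>2"
    proof -
      have "0 \<le> (y - 2 * Re w)\<^sup>2" by simp
      also have "(y - 2 * Re w)\<^sup>2 = 2 * (Re w - y)\<^sup>2 + 2 * (Re w)\<^sup>2 - y\<^sup>2" by (simp add: power2_eq_square algebra_simps)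
      finally show ?thesis by simp
    qed
    then have "k\<^sup>2 * y\<^sup>2 \<le> k\<^sup>2 * (2 * (Re w - y)\<^sup>2 + 2 * (Re w)\<^sup>2)" by (intro mult_left_mono) auto
    moreover have "k\<^sup>2 * ((Re w)\<^sup>2 + (Im w)\<^sup>2) \<le> k\<^sup>2 * R\<^sup>2" using R by (intro mult_left_mono) auto
    moreover have "0 \<le> k\<^sup>2 * (Im w)\<^sup>2" "0 \<le> k\<^sup>2 * R\<^sup>2" by auto
    moreover have "(k / sqrt 2 * (0 - y))\<^sup>2 = k\<^sup>2 * y\<^sup>2 / 2" by (simp add: power_mult_distrib power_divide)
    moreover have "(k * (Re w - y))\<^sup>2 = k\<^sup>2 * (Re w - y)\<^sup>2" by (simp add: power_mult_distrib)
    moreover have "0 \<le> k\<^sup>2 * (Re w)\<^sup>2" by simp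
    ultimately have ex: "k\<^sup>2 * (Im w)\<^sup>2 / 2 + - (k * (Re w - y))\<^sup>2 / 2 \<le> k\<^sup>2 * R\<^sup>2 + - (k / sqrt 2 * (0 - y))\<^sup>2 / 2"
      unfolding distrib_left by (simp only:)
    have "cmod (E w y) \<le> K * exp (k\<^sup>2 * (Im w)\<^sup>2 / 2) * exp (- (k * (Re w - y))\<^sup>2 / 2)"
      unfolding E_def by (rule gaussian_integrand_bound)
    also have "\<dots> = K * exp (k\<^sup>2 * (Im w)\<^sup>2 / 2 + - (k * (Re w - y))\<^sup>2 / 2)" by (simp only: exp_add mult.assoc)
    also have "\<dots> \<le> K * exp (k\<^sup>2 * R\<^sup>2 + - (k / sqrt 2 * (0 - y))\<^sup>2 / 2)" using K ex by (intro mult_left_mono) auto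
    also have "\<dots> = b y" by (simp only: b_def exp_add mult.assoc)
    finally show ?thesis .
  qed
  have "uniform_limit (cball z 1) F (gaussian_extension f k) sequentially"
    unfolding uniform_limit_iff
  proof (intro allI impI)
    fix e :: real assume "e > 0"
    obtain B where B: "\<And>N. N \<ge> B \<Longrightarrow> \<bar>integral UNIV b - integral {-N..N} b\<bar> < e"
      using tail_integral_small[OF bi \<open>e > 0\<close>] by blast
    show "\<forall>\<^sub>F n in sequentially. \<forall>w\<in>cball z 1. dist (F n w) (gaussian_extension f k w) < e"
      using eventually_ge_at_top[of "nat \<lceil>B\<rceil>"]
    proof eventually_elim
      case (elim n)
      then have "B \<le> real n" by linarith
      have "dist (F n w) (gaussian_extension f k w) < e" if "w \<in> cball z 1" for w
        using dominated_tail[OF _ bi dom[OF that], of "real n"] B[OF \<open>B \<le> real n\<close>] gaussian_integrand_continuous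
        unfolding F_def gaussian_extension_def E_def by (auto simp: dist_norm norm_minus_commute)
      then show ?case by blast
    qed
  qed
  then show "\<exists>d>0. cball z d \<subseteq> UNIV \<and> uniform_limit (cball z d) F (gaussian_extension f k) sequentially"
    by (intro exI[of _ 1]) auto
qed auto



lemma mollify_integrable: "integrable lborel (\<lambda>s. std_normal_density s *\<^sub>R f (x - s / k))"
proof (rule Bochner_Integration.integrable_bound)
  show "integrable lborel (\<lambda>s. K * std_normal_density s)" by simp
  have "continuous_on UNIV (\<lambda>s. f (x - s / k))"
    by (rule continuous_on_compose2[OF fc]) (use k in \<open>auto intro!: continuous_intros\<close>)
  then show "(\<lambda>s. std_normal_density s *\<^sub>R f (x - s / k)) \<in> borel_measurable lborel"
    by (intro borel_measurable_scaleR) (auto intro: borel_measurable_continuous_onI)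
qed (use fK in \<open>auto simp: mult.commute[of K] intro!: mult_left_mono order_trans[OF _ abs_ge_self]\<close>)

lemma mollify_eq: "mollify f k x = of_real (k / sqrt (2 * pi)) * gaussian_extension f k (of_real x)"
proof -
  have i: "integrable lborel (\<lambda>y. f y * exp (- ((of_real k * (of_real x - of_real y))\<^sup>2 / 2)))"
  proof (rule Bochner_Integration.integrable_bound)
    show "integrable lborel (\<lambda>y. K * exp (k\<^sup>2 * (Im (of_real x))\<^sup>2 / 2) * exp (- (k * (Re (of_real x) - y))\<^sup>2 / 2))"
      using gaussian_integrable(1)[OF k, of x] by simp
    show "(\<lambda>y. f y * exp (- ((of_real k * (of_real x - of_real y))\<^sup>2 / 2))) \<in> borel_measurable lborel"
      using gaussian_integrand_continuous by (simp add: borel_measurable_continuous_onI)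
    show "AE y in lborel. norm (f y * exp (- ((of_real k * (of_real x - of_real y))\<^sup>2 / 2)))
       \<le> norm (K * exp (k\<^sup>2 * (Im (of_real x))\<^sup>2 / 2) * exp (- (k * (Re (of_real x) - y))\<^sup>2 / 2))"
      unfolding real_norm_def by (intro AE_I2 order_trans[OF gaussian_integrand_bound abs_ge_self])
  qed
  have "gaussian_extension f k (of_real x) = (\<integral>y. f y * exp (- ((of_real k * (of_real x - of_real y))\<^sup>2 / 2)) \<partial>lborel)"
    unfolding gaussian_extension_def by (rule integral_lborel[OF i])
  also have "\<dots> = \<bar>- 1 / k\<bar> *\<^sub>R (\<integral>s. f (x + (- 1 / k) * s) * exp (- ((of_real k * (of_real x - of_real (x + (- 1 / k) * s)))\<^sup>2 / 2)) \<partial>lborel)"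
    by (rule lborel_integral_real_affine) (use k in simp)
  also have "(\<lambda>s. f (x + (- 1 / k) * s) * exp (- ((of_real k * (of_real x - of_real (x + (- 1 / k) * s)))\<^sup>2 / 2)))
     = (\<lambda>s. of_real (sqrt (2 * pi)) * (std_normal_density s *\<^sub>R f (x - s / k)))"
  proof
    fix s
    have "complex_of_real k * (of_real x - of_real (x + (- 1 / k) * s)) = of_real s" using k by simp
    then have "exp (- ((of_real k * (of_real x - of_real (x + (- 1 / k) * s)))\<^sup>2 / 2)) = complex_of_real (exp (- s\<^sup>2 / 2))"
      by (simp add: exp_of_real[symmetric])
    then show "f (x + (- 1 / k) * s) * exp (- ((of_real k * (of_real x - of_real (x + (- 1 / k) * s)))\<^sup>2 / 2))
       = of_real (sqrt (2 * pi)) * (std_normal_density s *\<^sub>R f (x - s / k))"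
      using k by (simp add: std_normal_density_def scaleR_conv_of_real)
  qed
  also have "(\<integral>s. of_real (sqrt (2 * pi)) * (std_normal_density s *\<^sub>R f (x - s / k)) \<partial>lborel) = of_real (sqrt (2 * pi)) * mollify f k x"
    unfolding mollify_def by (rule integral_mult_right_zero)
  finally show ?thesis using k by (simp add: scaleR_conv_of_real)
qed

end

text \<open>This form of differentiability passes through the integral over the Gaussian without a limit theorem.\<close>

lemma has_vector_derivative_quadratic:
  fixes F :: "real \<Rightarrow> complex"
  assumes "\<And>h. cmod (F (x + h) - F x - h *\<^sub>R D) \<le> K * h\<^sup>2"
  shows "(F has_vector_derivative D) (at x)"
  unfolding has_vector_derivative_def has_derivative_iff_norm
proof (intro conjI)
  show "((\<lambda>y. cmod (F y - F x - (y - x) *\<^sub>R D) / norm (y - x)) \<longlongrightarrow> 0) (at x)"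
  proof (rule Lim_null_comparison)
    show "\<forall>\<^sub>F y in at x. norm (cmod (F y - F x - (y - x) *\<^sub>R D) / norm (y - x)) \<le> K * \<bar>y - x\<bar>"
      using eventually_at_ball'[OF zero_less_one, of x UNIV]
    proof eventually_elim
      case (elim y)
      have "cmod (F y - F x - (y - x) *\<^sub>R D) \<le> K * \<bar>y - x\<bar> * \<bar>y - x\<bar>"
        using assms[of "y - x"] by (simp add: power2_eq_square mult.assoc abs_mult_self_eq)
      then show ?case using elim by (simp add: divide_le_eq)
    qed
    show "((\<lambda>y. K * \<bar>y - x\<bar>) \<longlongrightarrow> 0) (at x)" by (auto intro!: tendsto_eq_intros)
  qed
qed (rule bounded_linear_scaleR_left)

lemma first_order_bound:
  fixes f f' :: "real \<Rightarrow> complex"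
  assumes f: "\<And>x. (f has_vector_derivative f' x) (at x)" and "\<And>x. x \<in> closed_segment a b \<Longrightarrow> cmod (f' x) \<le> K"
  shows "cmod (f b - f a) \<le> K * \<bar>b - a\<bar>"
proof -
  have "norm (f b - f a) \<le> K * norm (b - a)"
  proof (rule differentiable_bound[of "closed_segment a b" f "\<lambda>x h. h *\<^sub>R f' x"])
    show "(f has_derivative (\<lambda>h. h *\<^sub>R f' x)) (at x within closed_segment a b)" for x
      using f has_vector_derivative_at_within unfolding has_vector_derivative_def by blast
    show "onorm (\<lambda>h. h *\<^sub>R f' x) \<le> K" if "x \<in> closed_segment a b" for x
      by (rule onorm_le) (use assms(2)[OF that] in \<open>simp add: mult.commute[of K] mult_left_mono\<close>)
  qed auto
  then show ?thesis by simp
qed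

lemma second_order_bound:
  fixes f f' f'' :: "real \<Rightarrow> complex"
  assumes f: "\<And>x. (f has_vector_derivative f' x) (at x)" and f': "\<And>x. (f' has_vector_derivative f'' x) (at x)"
    and K: "\<And>x. cmod (f'' x) \<le> K"
  shows "cmod (f (y + h) - f y - h *\<^sub>R f' y) \<le> K * h\<^sup>2"
proof -
  have K0: "K \<ge> 0" using K[of 0] norm_ge_zero order_trans by blast
  have "cmod ((f (y + h) - (y + h) *\<^sub>R f' y) - (f y - y *\<^sub>R f' y)) \<le> (K * \<bar>h\<bar>) * \<bar>(y + h) - y\<bar>"
  proof (rule first_order_bound[where f' = "\<lambda>x. f' x - f' y"])
    show "((\<lambda>x. f x - x *\<^sub>R f' y) has_vector_derivative f' x - f' y) (at x)" for x
      by (auto intro!: derivative_eq_intros f)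
    fix x assume "x \<in> closed_segment y (y + h)"
    then have "\<bar>x - y\<bar> \<le> \<bar>h\<bar>" by (auto simp: closed_segment_eq_real_ivl split: if_splits)
    have "cmod (f' x - f' y) \<le> K * \<bar>x - y\<bar>" by (rule first_order_bound[OF f' K])
    also have "\<dots> \<le> K * \<bar>h\<bar>" using \<open>\<bar>x - y\<bar> \<le> \<bar>h\<bar>\<close> K0 by (intro mult_left_mono)
    finally show "cmod (f' x - f' y) \<le> K * \<bar>h\<bar>" .
  qed
  then show ?thesis by (simp add: algebra_simps power2_eq_square abs_mult_self_eq)
qed

lemma mollify_has_derivative:
  assumes "continuous_on UNIV f" "\<And>x. cmod (f x) \<le> K" "\<And>x. (f has_vector_derivative f' x) (at x)"
    "derivs_bounded 1 (\<lambda>_. K) f'" "k > 0"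
  shows "(mollify f k has_vector_derivative mollify f' k x) (at x)"
proof (rule has_vector_derivative_quadratic)
  fix h
  have f'c: "continuous_on UNIV f'" using derivs_bounded_continuous[of 0] assms(4) by (metis One_nat_def)
  have f'b: "cmod (f' x) \<le> K" for x using derivs_boundedD[OF assms(4)] .
  obtain f'' where f'': "\<And>x. (f' has_vector_derivative f'' x) (at x)" "\<And>x. cmod (f'' x) \<le> K"
    using assms(4) by auto
  note i = mollify_integrable[OF assms(1,2,5)] and i' = mollify_integrable[OF f'c f'b assms(5)]
  let ?r = "\<lambda>s. f ((x - s / k) + h) - f (x - s / k) - h *\<^sub>R f' (x - s / k)"
  have eq: "std_normal_density s *\<^sub>R ?r s = std_normal_density s *\<^sub>R f (x + h - s / k) - std_normal_density s *\<^sub>R f (x - s / k)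
     - h *\<^sub>R (std_normal_density s *\<^sub>R f' (x - s / k))" for s
    by (simp add: scaleR_diff_right algebra_simps)
  have int: "integrable lborel (\<lambda>s. std_normal_density s *\<^sub>R ?r s)"
    unfolding eq using i[of "x + h"] i[of x] i'[of x] by (intro Bochner_Integration.integrable_diff integrable_scaleR_right)
  have main: "mollify f k (x + h) - mollify f k x - h *\<^sub>R mollify f' k x = (\<integral>s. std_normal_density s *\<^sub>R ?r s \<partial>lborel)"
    unfolding eq mollify_def using i[of "x + h"] i[of x] integrable_scaleR_right[OF i'[of x], of h]
    by (simp del: scaleR_scaleR)
  have "cmod (\<integral>s. std_normal_density s *\<^sub>R ?r s \<partial>lborel) \<le> (\<integral>s. std_normal_density s * (K * h\<^sup>2) \<partial>lborel)"
    by (rule Bochner_Integration.integral_norm_bound_integral[OF int])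
       (use second_order_bound[OF assms(3) f''] in \<open>auto intro!: mult_left_mono\<close>)
  also have "\<dots> = K * h\<^sup>2" by simp
  finally show "cmod (mollify f k (x + h) - mollify f k x - h *\<^sub>R mollify f' k x) \<le> K * h\<^sup>2"
    unfolding main .
qed

definition normal_abs_moment :: real where
  "normal_abs_moment = (\<integral>s. std_normal_density s * \<bar>s\<bar> \<partial>lborel)"

text \<open>Mollification commutes with differentiation, so it is enough to estimate \<open>mollify f k - f\<close>, which is a mean of
increments of \<open>f\<close>. Two more derivatives are required because \<open>f''\<close> controls the differentiation of the
mollified function.\<close>

lemma mollify_error:
  assumes "derivs_bounded (Suc (Suc m)) (\<lambda>_. K) f" "k > 0"
  shows "derivs_bounded m (\<lambda>_. normal_abs_moment * K / k) (\<lambda>x. mollify f k x - f x)"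
  using assms(1)
proof (induction m arbitrary: f)
  have err: "cmod (mollify f k x - f x) \<le> normal_abs_moment * K / k" if f: "derivs_bounded (Suc (Suc m)) (\<lambda>_. K) f" for f x m
  proof -
    have fc: "continuous_on UNIV f" by (rule derivs_bounded_continuous[OF f])
    have fb: "cmod (f x) \<le> K" for x by (rule derivs_boundedD[OF f])
    obtain f' where f': "\<And>x. (f has_vector_derivative f' x) (at x)" "derivs_bounded (Suc m) (\<lambda>_. K) f'"
      using f by (auto simp only: derivs_bounded.simps(2)[of "Suc m"])
    note i = mollify_integrable[OF fc fb assms(2)]
    have c: "integrable lborel (\<lambda>s. std_normal_density s *\<^sub>R f x)" by (rule integrable_scaleR_left) simp
    have "mollify f k x - f x = (\<integral>s. std_normal_density s *\<^sub>R f (x - s / k) - std_normal_density s *\<^sub>R f x \<partial>lborel)"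
      using i[of x] c by (simp add: mollify_def)
    also have "cmod \<dots> \<le> (\<integral>s. (std_normal_density s * \<bar>s\<bar>) * (K / k) \<partial>lborel)"
    proof (rule Bochner_Integration.integral_norm_bound_integral)
      show "integrable lborel (\<lambda>s. std_normal_density s *\<^sub>R f (x - s / k) - std_normal_density s *\<^sub>R f x)" using i[of x] c by simp
      show "integrable lborel (\<lambda>s. (std_normal_density s * \<bar>s\<bar>) * (K / k))"
        using integrable_std_normal_moment_abs[of 1] by (intro integrable_mult_left) simp
      show "cmod (std_normal_density s *\<^sub>R f (x - s / k) - std_normal_density s *\<^sub>R f x) \<le> (std_normal_density s * \<bar>s\<bar>) * (K / k)" for s
      proof -
        have "cmod (f (x - s / k) - f x) \<le> K * \<bar>(x - s / k) - x\<bar>"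
          by (rule first_order_bound[OF f'(1) derivs_boundedD[OF f'(2)]])
        then have "std_normal_density s * cmod (f (x - s / k) - f x) \<le> std_normal_density s * (K * \<bar>(x - s / k) - x\<bar>)"
          by (intro mult_left_mono) auto
        then show ?thesis using assms(2) by (simp add: scaleR_diff_right[symmetric] mult_ac)
      qed
    qed
    also have "\<dots> = normal_abs_moment * (K / k)" unfolding normal_abs_moment_def
      by (rule integral_mult_left_zero)
    finally show ?thesis by simp
  qed
  {
    case 0
    then show ?case using err[OF 0] by simp
  next
    case (Suc m)
    obtain f' where f': "\<And>x. (f has_vector_derivative f' x) (at x)" "derivs_bounded (Suc (Suc m)) (\<lambda>_. K) f'"
      using Suc.prems by (auto simp only: derivs_bounded.simps(2)[of "Suc (Suc m)"])
    have "((\<lambda>x. mollify f k x - f x) has_vector_derivative mollify f' k x - f' x) (at x)" for x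
    proof (intro has_vector_derivative_diff f'(1) mollify_has_derivative)
      show "continuous_on UNIV f" by (rule derivs_bounded_continuous[OF Suc.prems])
      show "derivs_bounded 1 (\<lambda>_. K) f'" by (rule derivs_bounded_le[OF f'(2)]) simp
    qed (use derivs_boundedD[OF Suc.prems] assms(2) in auto)
    then show ?case using err[OF Suc.prems] Suc.IH[OF f'(2)]
      unfolding derivs_bounded.simps(2) by (intro conjI allI exI[of _ "\<lambda>x. mollify f' k x - f' x"])
  }
qed

text \<open>The mollification of \<open>f(ln t)\<close>, extended to the slit plane; horizontal strips in \<open>Ln \<mu>\<close> are sectors in \<open>\<mu>\<close>.\<close>

definition holomorphic_approximation :: "(real \<Rightarrow> complex) \<Rightarrow> nat \<Rightarrow> complex \<Rightarrow> complex" where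
  "holomorphic_approximation f n \<mu> =
     of_real (real (Suc n) / sqrt (2 * pi)) * gaussian_extension f (real (Suc n)) (Ln \<mu>)"

lemma holomorphic_approximation_on_reals:
  assumes "derivs_bounded (Suc m) (\<lambda>_. K) f"
  shows "on_reals (holomorphic_approximation f n) (exp x) = mollify f (real (Suc n)) x"
  using mollify_eq[OF derivs_bounded_continuous[OF assms] derivs_boundedD[OF assms], of "real (Suc n)" x]
  by (simp add: on_reals_def holomorphic_approximation_def exp_of_real[symmetric] del: of_nat_Suc)

lemma holomorphic_approximation_bounded_on_sectors:
  assumes "derivs_bounded (Suc m) (\<lambda>_. K) f"
  shows "holomorphic_approximation f n \<in> bounded_on_sectors"
  unfolding bounded_on_sectors_def Hinf_def
proof (intro CollectI allI impI conjI)
  fix \<omega> :: real assume \<omega>: "0 < \<omega> \<and> \<omega> < pi"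
  let ?k = "real (Suc n)"
  note fc = derivs_bounded_continuous[OF assms, of UNIV] and fb = derivs_boundedD[OF assms]
  have "z \<notin> \<real>\<^sub>\<le>\<^sub>0" if "z \<in> sector \<omega>" for z
  proof
    assume "z \<in> \<real>\<^sub>\<le>\<^sub>0"
    then have "Re z < 0" "Im z = 0" using that by (auto simp: complex_nonpos_Reals_iff sector_def complex_eq_iff less_le)
    then have "Arg z = pi" by (simp add: Arg_eq_pi)
    then show False using that \<omega> by (simp add: sector_def)
  qed
  then have "Ln holomorphic_on sector \<omega>" by (intro holomorphic_on_Ln) auto
  from holomorphic_on_compose_gen[OF this gaussian_extension_holomorphic[OF fc fb, of ?k]]
  have "(\<lambda>z. gaussian_extension f ?k (Ln z)) holomorphic_on sector \<omega>" by (simp add: o_def)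
  then show "holomorphic_approximation f n holomorphic_on sector \<omega>"
    unfolding holomorphic_approximation_def[abs_def] by (intro holomorphic_intros)
  have K: "K \<ge> 0" using derivs_bounded_weight_nonneg[OF assms] .
  show "bounded (holomorphic_approximation f n ` sector \<omega>)"
    unfolding bounded_iff
  proof (intro exI ballI, elim imageE)
    fix y z assume y: "y = holomorphic_approximation f n z" and z: "z \<in> sector \<omega>"
    have "\<bar>Im (Ln z)\<bar> \<le> \<omega>" using sector_exp_Ln[OF z] by simp
    then have "(Im (Ln z))\<^sup>2 \<le> \<omega>\<^sup>2" by (metis abs_ge_zero power2_abs power_mono)
    then have "exp (?k\<^sup>2 * (Im (Ln z))\<^sup>2 / 2) \<le> exp (?k\<^sup>2 * \<omega>\<^sup>2 / 2)" by (simp add: mult_left_mono)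
    then have "K * exp (?k\<^sup>2 * (Im (Ln z))\<^sup>2 / 2) * (sqrt (2 * pi) / ?k) \<le> K * exp (?k\<^sup>2 * \<omega>\<^sup>2 / 2) * (sqrt (2 * pi) / ?k)"
      using K by (intro mult_right_mono mult_left_mono) auto
    then have "cmod (gaussian_extension f ?k (Ln z)) \<le> K * exp (?k\<^sup>2 * \<omega>\<^sup>2 / 2) * (sqrt (2 * pi) / ?k)"
      using gaussian_extension_bound[OF fc fb, of ?k "Ln z"] by simp
    then show "cmod y \<le> cmod (of_real (?k / sqrt (2 * pi))) * (K * exp (?k\<^sup>2 * \<omega>\<^sup>2 / 2) * (sqrt (2 * pi) / ?k))"
      unfolding y holomorphic_approximation_def norm_mult by (intro mult_left_mono) auto
  qed
qed

section \<open>The extended Mihlin calculus\<close>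

lemma op_apply_op_graph [simp]: "op_apply (op_graph T) = T"
  by (auto simp: op_apply_def op_graph_def)

lemma mihlin_norm_cong: "(\<And>t. t > 0 \<Longrightarrow> f t = g t) \<Longrightarrow> mihlin_norm \<phi> \<alpha> f = mihlin_norm \<phi> \<alpha> g"
  by (simp add: mihlin_norm_def)

lemma mihlin_calc_cong:
  assumes "\<And>t. t > 0 \<Longrightarrow> f t = g t"
  shows "mihlin_calc \<phi> \<alpha> A f x = mihlin_calc \<phi> \<alpha> A g x"
proof -
  have "mihlin_norm \<phi> \<alpha> (\<lambda>t. on_reals F t - f t) = mihlin_norm \<phi> \<alpha> (\<lambda>t. on_reals F t - g t)" for F
    by (rule mihlin_norm_cong) (simp add: assms)
  then show ?thesis by (simp add: mihlin_calc_def)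
qed

locale mihlin_operator = zero_sectorial_operator A
  for A :: "('a::complex_banach \<times> 'a) set" +
  fixes \<phi> :: "int \<Rightarrow> real \<Rightarrow> complex" and \<alpha> :: real
  assumes besov_partition: "besov_partition \<phi>" and calculus: "has_mihlin_calculus \<phi> \<alpha> A"
begin

text \<open>The number of bounded derivatives that ensures membership in the Mihlin class: more than \<open>\<alpha>\<close>, and one in addition
for the continuity required in the Bernstein estimate.\<close>

definition reg :: nat where
  "reg = Suc (Suc (nat \<lceil>\<alpha>\<rceil>))"

abbreviation C_reg :: "real \<Rightarrow> (real \<Rightarrow> complex) \<Rightarrow> bool" where
  "C_reg K f \<equiv> derivs_bounded reg (\<lambda>_. K) (\<lambda>x. f (exp x))"

lemma besov_constant_exists:
  "\<exists>C\<ge>0. \<forall>K f. C_reg K f \<longrightarrow> f \<in> mihlin \<phi> \<alpha> \<and> mihlin_norm \<phi> \<alpha> f \<le> C * K"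
proof -
  have "\<alpha> < real (Suc (nat \<lceil>\<alpha>\<rceil>))" by linarith
  from derivs_bounded_besov[OF besov_partition this] show ?thesis
    by (auto simp: reg_def mihlin_def mihlin_norm_def simp del: derivs_bounded.simps)
qed

definition besov_constant :: real where
  "besov_constant = (SOME C. C \<ge> 0 \<and> (\<forall>K f. C_reg K f \<longrightarrow> f \<in> mihlin \<phi> \<alpha> \<and> mihlin_norm \<phi> \<alpha> f \<le> C * K))"

lemma besov_constant: "besov_constant \<ge> 0"
  "C_reg K f \<Longrightarrow> f \<in> mihlin \<phi> \<alpha>" "C_reg K f \<Longrightarrow> mihlin_norm \<phi> \<alpha> f \<le> besov_constant * K"
  using someI_ex[OF besov_constant_exists] unfolding besov_constant_def[symmetric] by blast+

lemma C_reg_mihlin_hol: "F \<in> bounded_on_sectors \<Longrightarrow> C_reg K (on_reals F) \<Longrightarrow> F \<in> mihlin_hol \<phi> \<alpha>"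
  using besov_constant(2) by (auto simp: mihlin_hol_def bounded_on_sectors_def)

lemma mihlin_holD: "F \<in> mihlin_hol \<phi> \<alpha> \<Longrightarrow> F \<in> bounded_on_sectors" "F \<in> mihlin_hol \<phi> \<alpha> \<Longrightarrow> on_reals F \<in> mihlin \<phi> \<alpha>"
  by (auto simp: mihlin_hol_def bounded_on_sectors_def)

definition calculus_constant :: real where
  "calculus_constant = (SOME C. C \<ge> 0 \<and> (\<forall>F\<in>mihlin_hol \<phi> \<alpha>. \<exists>T. bounded_linear T \<and> fcalc A F = op_graph T \<and>
     onorm T \<le> C * mihlin_norm \<phi> \<alpha> (on_reals F)))"

abbreviation op :: "(complex \<Rightarrow> complex) \<Rightarrow> 'a \<Rightarrow> 'a" where
  "op F \<equiv> op_apply (fcalc A F)"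

lemma mihlin_norm_nonneg: "f \<in> mihlin \<phi> \<alpha> \<Longrightarrow> 0 \<le> mihlin_norm \<phi> \<alpha> f"
  using besov_norm_nonneg[OF besov_partition] by (simp add: mihlin_def mihlin_norm_def)

lemma calculus_constant: "calculus_constant \<ge> 0"
  and op: "F \<in> mihlin_hol \<phi> \<alpha> \<Longrightarrow> bounded_linear (op F)" "F \<in> mihlin_hol \<phi> \<alpha> \<Longrightarrow> fcalc A F = op_graph (op F)"
  and op_bound: "F \<in> mihlin_hol \<phi> \<alpha> \<Longrightarrow> norm (op F x) \<le> calculus_constant * mihlin_norm \<phi> \<alpha> (on_reals F) * norm x"
proof -
  obtain C where C: "\<And>F. F \<in> mihlin_hol \<phi> \<alpha> \<Longrightarrow> \<exists>T. bounded_linear T \<and> fcalc A F = op_graph T \<and> onorm T \<le> C * mihlin_norm \<phi> \<alpha> (on_reals F)"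
    using calculus by (auto simp: has_mihlin_calculus_def)
  have "\<exists>T. bounded_linear T \<and> fcalc A F = op_graph T \<and> onorm T \<le> max C 0 * mihlin_norm \<phi> \<alpha> (on_reals F)"
    if F: "F \<in> mihlin_hol \<phi> \<alpha>" for F
  proof -
    obtain T where T: "bounded_linear T" "fcalc A F = op_graph T" "onorm T \<le> C * mihlin_norm \<phi> \<alpha> (on_reals F)"
      using C[OF F] by blast
    have "C * mihlin_norm \<phi> \<alpha> (on_reals F) \<le> max C 0 * mihlin_norm \<phi> \<alpha> (on_reals F)"
      using mihlin_norm_nonneg[OF mihlin_holD(2)[OF F]] by (intro mult_right_mono) auto
    with T show ?thesis by (meson order_trans)
  qed
  then have "\<exists>C. C \<ge> 0 \<and> (\<forall>F\<in>mihlin_hol \<phi> \<alpha>. \<exists>T. bounded_linear T \<and> fcalc A F = op_graph T \<and>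
     onorm T \<le> C * mihlin_norm \<phi> \<alpha> (on_reals F))" by (intro exI[of _ "max C 0"]) auto
  from someI_ex[OF this] have c: "calculus_constant \<ge> 0"
    "\<And>F. F \<in> mihlin_hol \<phi> \<alpha> \<Longrightarrow> \<exists>T. bounded_linear T \<and> fcalc A F = op_graph T \<and>
     onorm T \<le> calculus_constant * mihlin_norm \<phi> \<alpha> (on_reals F)"
    unfolding calculus_constant_def[symmetric] by blast+
  show "calculus_constant \<ge> 0" by (rule c(1))
  assume F: "F \<in> mihlin_hol \<phi> \<alpha>"
  then obtain T where T: "bounded_linear T" "fcalc A F = op_graph T" "onorm T \<le> calculus_constant * mihlin_norm \<phi> \<alpha> (on_reals F)"
    using c(2) by blast
  then have opT: "op F = T" by simp
  show "bounded_linear (op F)" "fcalc A F = op_graph (op F)" using T opT by auto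
  have "norm (op F x) \<le> onorm T * norm x" unfolding opT by (rule onorm[OF T(1)])
  also have "\<dots> \<le> calculus_constant * mihlin_norm \<phi> \<alpha> (on_reals F) * norm x" using T(3) by (intro mult_right_mono) auto
  finally show "norm (op F x) \<le> calculus_constant * mihlin_norm \<phi> \<alpha> (on_reals F) * norm x" .
qed

lemma op_is_calc: "F \<in> mihlin_hol \<phi> \<alpha> \<Longrightarrow> is_calc F (op F)"
  by (rule fcalc_is_calc[OF mihlin_holD(1) op(2)])

text \<open>This puts the constant function into the domain of the calculus, so that \<open>1(A)\<close> is an operator and \<open>\<rho>(A)\<close> is
injective.\<close>

lemma one_mihlin_hol: "(\<lambda>\<mu>. 1) \<in> mihlin_hol \<phi> \<alpha>"
  by (rule C_reg_mihlin_hol[OF bounded_on_sectors_const]) (use derivs_bounded_const[of reg 1] in \<open>simp add: on_reals_def\<close>)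

sublocale injective_rho_operator A
  by unfold_locales (rule rhoA_injective[OF op(2)[OF one_mihlin_hol]])

text \<open>Uniform approximation with \<open>reg\<close> derivatives by functions that are bounded on all sectors. In
  contrast to convergence in the Mihlin norm, it is visibly compatible with products.\<close>

definition approx :: "(nat \<Rightarrow> complex \<Rightarrow> complex) \<Rightarrow> (real \<Rightarrow> complex) \<Rightarrow> real \<Rightarrow> bool" where
  "approx F f K \<longleftrightarrow> (\<forall>n. F n \<in> bounded_on_sectors \<and> C_reg (K / real (Suc n)) (\<lambda>t. on_reals (F n) t - f t))"

lemma approx_nonneg: "approx F f K \<Longrightarrow> 0 \<le> K"
  using derivs_bounded_weight_nonneg[of reg "\<lambda>_. K / real (Suc 0)"] unfolding approx_def by fastforce

lemma approx_C_reg: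
  assumes "approx F f K" "C_reg L f"
  shows "C_reg (K / real (Suc n) + L) (on_reals (F n))"
  using derivs_bounded_add[of reg "\<lambda>_. K / real (Suc n)" "\<lambda>x. on_reals (F n) (exp x) - f (exp x)" "\<lambda>_. L" "\<lambda>x. f (exp x)"] assms
  by (simp add: approx_def)

lemma approx_mihlin_hol: "approx F f K \<Longrightarrow> C_reg L f \<Longrightarrow> F n \<in> mihlin_hol \<phi> \<alpha>"
  using C_reg_mihlin_hol[OF _ approx_C_reg] by (auto simp: approx_def)

lemma approx_tendsto:
  assumes "approx F f K"
  shows "(\<lambda>n. mihlin_norm \<phi> \<alpha> (\<lambda>t. on_reals (F n) t - f t)) \<longlonglongrightarrow> 0"
proof (rule Lim_null_comparison)
  have C: "C_reg (K / real (Suc n)) (\<lambda>t. on_reals (F n) t - f t)" for n using assms by (simp add: approx_def)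
  show "\<forall>\<^sub>F n in sequentially. norm (mihlin_norm \<phi> \<alpha> (\<lambda>t. on_reals (F n) t - f t)) \<le> besov_constant * (K / real (Suc n))"
    using besov_constant(3)[OF C] mihlin_norm_nonneg[OF besov_constant(2)[OF C]] by (intro always_eventually) auto
  show "(\<lambda>n. besov_constant * (K / real (Suc n))) \<longlonglongrightarrow> 0"
    using tendsto_mult_right_zero[OF lim_const_over_n[THEN LIMSEQ_Suc, of K]] by simp
qed

text \<open>The difference \<open>F - G\<close> is written as \<open>(F - f) - (G - f)\<close>.\<close>

lemma op_diff_bound:
  assumes F: "F \<in> mihlin_hol \<phi> \<alpha>" and G: "G \<in> mihlin_hol \<phi> \<alpha>"
    and f: "(\<lambda>t. on_reals F t - f t) \<in> mihlin \<phi> \<alpha>" and g: "(\<lambda>t. on_reals G t - f t) \<in> mihlin \<phi> \<alpha>"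
  shows "norm (op F x - op G x) \<le> calculus_constant *
     (mihlin_norm \<phi> \<alpha> (\<lambda>t. on_reals F t - f t) + mihlin_norm \<phi> \<alpha> (\<lambda>t. on_reals G t - f t)) * norm x"
proof -
  let ?H = "\<lambda>\<mu>. F \<mu> + (-1) * G \<mu>"
  note d = besov_diff[OF besov_partition f[unfolded mihlin_def mem_Collect_eq] g[unfolded mihlin_def mem_Collect_eq]]
  have eq: "(\<lambda>x. (on_reals F (exp x) - f (exp x)) - (on_reals G (exp x) - f (exp x))) = (\<lambda>x. on_reals ?H (exp x))"
    by (auto simp: on_reals_def)
  have H: "?H \<in> mihlin_hol \<phi> \<alpha>"
    using d(1) bounded_on_sectors_add[OF mihlin_holD(1)[OF F] bounded_on_sectors_mult[OF bounded_on_sectors_const mihlin_holD(1)[OF G]], of "-1"]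
    unfolding eq by (auto simp: mihlin_hol_def mihlin_def bounded_on_sectors_def)
  have "op ?H x = op F x + (-1) *\<^sub>C op G x"
    by (rule is_calc_unique[OF op_is_calc[OF H] is_calc_add[OF op_is_calc[OF F] is_calc_cmult[OF op_is_calc[OF G]]]])
  then have "norm (op F x - op G x) = norm (op ?H x)" by simp
  also have "\<dots> \<le> calculus_constant * mihlin_norm \<phi> \<alpha> (on_reals ?H) * norm x" by (rule op_bound[OF H])
  also have "\<dots> \<le> calculus_constant *
     (mihlin_norm \<phi> \<alpha> (\<lambda>t. on_reals F t - f t) + mihlin_norm \<phi> \<alpha> (\<lambda>t. on_reals G t - f t)) * norm x"
    using d(2) calculus_constant unfolding eq mihlin_norm_def by (intro mult_right_mono mult_left_mono) auto
  finally show ?thesis .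
qed

lemma mihlin_diff: "f \<in> mihlin \<phi> \<alpha> \<Longrightarrow> g \<in> mihlin \<phi> \<alpha> \<Longrightarrow> (\<lambda>t. f t - g t) \<in> mihlin \<phi> \<alpha>"
  using besov_diff(1)[OF besov_partition] by (simp add: mihlin_def)

text \<open>Two approximating sequences of \<open>f\<close> differ by a sequence that tends to \<open>0\<close> in the Mihlin norm. Hence the operators
form a Cauchy sequence, and the limit does not depend on the approximation.\<close>

lemma mihlin_calc_tendsto:
  assumes f: "f \<in> mihlin \<phi> \<alpha>" and F: "\<And>n. F n \<in> mihlin_hol \<phi> \<alpha>"
    and lim: "(\<lambda>n. mihlin_norm \<phi> \<alpha> (\<lambda>t. on_reals (F n) t - f t)) \<longlonglongrightarrow> 0"
  shows "(\<lambda>n. op (F n) x) \<longlonglongrightarrow> mihlin_calc \<phi> \<alpha> A f x"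
proof -
  let ?e = "\<lambda>F. mihlin_norm \<phi> \<alpha> (\<lambda>t. on_reals F t - f t)"
  have mem: "(\<lambda>t. on_reals F t - f t) \<in> mihlin \<phi> \<alpha>" if "F \<in> mihlin_hol \<phi> \<alpha>" for F
    by (rule mihlin_diff[OF mihlin_holD(2)[OF that] f])
  have bound: "norm (op F x - op G x) \<le> calculus_constant * (?e F + ?e G) * norm x" if "F \<in> mihlin_hol \<phi> \<alpha>" "G \<in> mihlin_hol \<phi> \<alpha>" for F G
    by (rule op_diff_bound[OF that mem[OF that(1)] mem[OF that(2)]])
  have "Cauchy (\<lambda>n. op (F n) x)"
  proof (rule metric_CauchyI)
    fix e :: real assume "e > 0"
    define d where "d = e / (2 * (calculus_constant * norm x + 1))"
    have c: "calculus_constant * norm x \<ge> 0" using calculus_constant by simp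
    then have "0 < 2 * (calculus_constant * norm x + 1)" by (simp add: add_nonneg_pos)
    then have "d > 0" using \<open>e > 0\<close> unfolding d_def by (rule divide_pos_pos[rotated])
    obtain N where N: "\<And>n. n \<ge> N \<Longrightarrow> ?e (F n) < d"
      using order_tendstoD(2)[OF lim \<open>d > 0\<close>] by (auto simp: eventually_sequentially)
    have "dist (op (F m) x) (op (F n) x) < e" if "m \<ge> N" "n \<ge> N" for m n
    proof -
      have "dist (op (F m) x) (op (F n) x) \<le> calculus_constant * (?e (F m) + ?e (F n)) * norm x"
        unfolding dist_norm by (rule bound[OF F F])
      also have "\<dots> = (calculus_constant * norm x) * (?e (F m) + ?e (F n))" by simp
      also have "\<dots> \<le> (calculus_constant * norm x) * (d + d)"
        using N[OF that(1)] N[OF that(2)] c by (intro mult_left_mono) auto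
      also have "\<dots> < (calculus_constant * norm x + 1) * (d + d)" using \<open>d > 0\<close> by (intro mult_strict_right_mono) auto
      also have "\<dots> = e"
      proof -
        have "z * (e / (2 * z) + e / (2 * z)) = e" if "z > 0" for z :: real using that by simp
        moreover have "calculus_constant * norm x + 1 > 0" using c by simp
        ultimately show ?thesis unfolding d_def by blast
      qed
      finally show ?thesis .
    qed
    then show "\<exists>M. \<forall>m\<ge>M. \<forall>n\<ge>M. dist (op (F m) x) (op (F n) x) < e" by blast
  qed
  then obtain y where y: "(\<lambda>n. op (F n) x) \<longlonglongrightarrow> y" using Cauchy_convergent convergentD by blast
  have "mihlin_calc \<phi> \<alpha> A f x = y"
    unfolding mihlin_calc_def
  proof (rule the_equality)
    show "\<exists>F. (\<forall>k. F k \<in> mihlin_hol \<phi> \<alpha>) \<and> (\<lambda>k. ?e (F k)) \<longlonglongrightarrow> 0 \<and> (\<lambda>k. op (F k) x) \<longlonglongrightarrow> y"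
      using F lim y by blast
    fix z assume "\<exists>F. (\<forall>k. F k \<in> mihlin_hol \<phi> \<alpha>) \<and> (\<lambda>k. ?e (F k)) \<longlonglongrightarrow> 0 \<and> (\<lambda>k. op (F k) x) \<longlonglongrightarrow> z"
    then obtain G where G: "\<And>k. G k \<in> mihlin_hol \<phi> \<alpha>" "(\<lambda>k. ?e (G k)) \<longlonglongrightarrow> 0" "(\<lambda>k. op (G k) x) \<longlonglongrightarrow> z" by blast
    have "(\<lambda>k. op (G k) x - op (F k) x) \<longlonglongrightarrow> 0"
    proof (rule Lim_null_comparison)
      show "\<forall>\<^sub>F k in sequentially. norm (op (G k) x - op (F k) x) \<le> calculus_constant * (?e (G k) + ?e (F k)) * norm x"
        using bound[OF G(1) F] by (intro always_eventually) auto
      show "(\<lambda>k. calculus_constant * (?e (G k) + ?e (F k)) * norm x) \<longlonglongrightarrow> 0"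
        by (intro tendsto_mult_left_zero tendsto_mult_right_zero tendsto_add_zero G(2) lim)
    qed
    then have "z - y = 0" using tendsto_diff[OF G(3) y] LIMSEQ_unique by blast
    then show "z = y" by simp
  qed
  with y show ?thesis by simp
qed

lemma approx_calc_tendsto:
  assumes "approx F f K" "C_reg L f"
  shows "(\<lambda>n. op (F n) x) \<longlonglongrightarrow> mihlin_calc \<phi> \<alpha> A f x"
  by (rule mihlin_calc_tendsto[OF besov_constant(2)[OF assms(2)] approx_mihlin_hol[OF assms] approx_tendsto[OF assms(1)]])

lemma approx_op_bound:
  assumes "approx F f K" "C_reg L f"
  shows "norm (op (F n) x) \<le> calculus_constant * (besov_constant * (K / real (Suc n) + L)) * norm x"
proof -
  have "norm (op (F n) x) \<le> calculus_constant * mihlin_norm \<phi> \<alpha> (on_reals (F n)) * norm x"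
    by (rule op_bound[OF approx_mihlin_hol[OF assms]])
  also have "\<dots> \<le> calculus_constant * (besov_constant * (K / real (Suc n) + L)) * norm x"
    using calculus_constant besov_constant(3)[OF approx_C_reg[OF assms]] by (intro mult_right_mono mult_left_mono) auto
  finally show ?thesis .
qed

text \<open>A subalgebra of the Mihlin class that contains \<open>S a\<close> for every bounded \<open>a\<close>, and on which the calculus is linear and
multiplicative: sums and products are approximated by those of the approximations.\<close>

definition tame :: "(real \<Rightarrow> complex) \<Rightarrow> bool" where
  "tame f \<longleftrightarrow> (\<exists>K L F. C_reg L f \<and> approx F f K)"

lemma tame_bound:
  assumes "tame f" "C_reg L f"
  shows "norm (mihlin_calc \<phi> \<alpha> A f x) \<le> calculus_constant * besov_constant * L * norm x"
proof -
  obtain K F where F: "approx F f K" using assms(1) by (auto simp: tame_def)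
  have "(\<lambda>n. calculus_constant * (besov_constant * (K / real (Suc n) + L)) * norm x) \<longlonglongrightarrow> calculus_constant * (besov_constant * (0 + L)) * norm x"
    using lim_const_over_n[THEN LIMSEQ_Suc, of K] by (intro tendsto_intros)
  then show ?thesis
    using LIMSEQ_le[OF tendsto_norm[OF approx_calc_tendsto[OF F assms(2)]]] approx_op_bound[OF F assms(2)]
    by (simp add: mult.assoc)
qed

lemma tame_bounded_linear:
  assumes "tame f"
  shows "bounded_linear (mihlin_calc \<phi> \<alpha> A f)"
proof -
  obtain K L F where F: "approx F f K" "C_reg L f" using assms by (auto simp: tame_def)
  note lim = approx_calc_tendsto[OF F] and bl = op(1)[OF approx_mihlin_hol[OF F]]
  show ?thesis
  proof (rule bounded_linear_intro)
    show "mihlin_calc \<phi> \<alpha> A f (x + y) = mihlin_calc \<phi> \<alpha> A f x + mihlin_calc \<phi> \<alpha> A f y" for x y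
      using lim[of "x + y"] tendsto_add[OF lim[of x] lim[of y]] LIMSEQ_unique
      by (simp add: linear_add[OF bounded_linear.linear[OF bl]]) blast
    show "mihlin_calc \<phi> \<alpha> A f (r *\<^sub>R x) = r *\<^sub>R mihlin_calc \<phi> \<alpha> A f x" for x r
      using lim[of "r *\<^sub>R x"] tendsto_scaleR[OF tendsto_const lim[of x], of r] LIMSEQ_unique
      by (simp add: linear_scale[OF bounded_linear.linear[OF bl]]) blast
    show "norm (mihlin_calc \<phi> \<alpha> A f x) \<le> norm x * (calculus_constant * besov_constant * L)" for x
      using tame_bound[OF assms F(2), of x] by (simp add: mult_ac)
  qed
qed

lemma tame_add:
  assumes "tame f" "tame g"
  shows "tame (\<lambda>t. f t + g t)" "mihlin_calc \<phi> \<alpha> A (\<lambda>t. f t + g t) x = mihlin_calc \<phi> \<alpha> A f x + mihlin_calc \<phi> \<alpha> A g x"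
proof -
  obtain K L F where F: "approx F f K" "C_reg L f" using assms by (auto simp: tame_def)
  obtain K' L' G where G: "approx G g K'" "C_reg L' g" using assms by (auto simp: tame_def)
  have C: "C_reg (L + L') (\<lambda>t. f t + g t)" using derivs_bounded_add[OF F(2) G(2)] .
  have H: "approx (\<lambda>n \<mu>. F n \<mu> + G n \<mu>) (\<lambda>t. f t + g t) (K + K')"
    unfolding approx_def
  proof (intro allI conjI)
    fix n
    show "(\<lambda>\<mu>. F n \<mu> + G n \<mu>) \<in> bounded_on_sectors" using F(1) G(1) by (auto simp: approx_def intro: bounded_on_sectors_add)
    have "derivs_bounded reg (\<lambda>_. K / real (Suc n) + K' / real (Suc n))
       (\<lambda>x. (on_reals (F n) (exp x) - f (exp x)) + (on_reals (G n) (exp x) - g (exp x)))"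
      using F(1) G(1) by (intro derivs_bounded_add) (auto simp: approx_def)
    then show "C_reg ((K + K') / real (Suc n)) (\<lambda>t. on_reals (\<lambda>\<mu>. F n \<mu> + G n \<mu>) t - (f t + g t))"
      by (simp add: add_divide_distrib on_reals_def algebra_simps)
  qed
  show "tame (\<lambda>t. f t + g t)" unfolding tame_def using C H by blast
  have "op (\<lambda>\<mu>. F n \<mu> + G n \<mu>) x = op (F n) x + op (G n) x" for n
    by (rule is_calc_unique[OF op_is_calc[OF approx_mihlin_hol[OF H C]]
          is_calc_add[OF op_is_calc[OF approx_mihlin_hol[OF F]] op_is_calc[OF approx_mihlin_hol[OF G]]]])
  then show "mihlin_calc \<phi> \<alpha> A (\<lambda>t. f t + g t) x = mihlin_calc \<phi> \<alpha> A f x + mihlin_calc \<phi> \<alpha> A g x"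
    using approx_calc_tendsto[OF H C, of x] tendsto_add[OF approx_calc_tendsto[OF F, of x] approx_calc_tendsto[OF G, of x]]
      LIMSEQ_unique by simp blast
qed

lemma tame_cmult:
  assumes "tame f"
  shows "tame (\<lambda>t. c * f t)" "mihlin_calc \<phi> \<alpha> A (\<lambda>t. c * f t) x = c *\<^sub>C mihlin_calc \<phi> \<alpha> A f x"
proof -
  obtain K L F where F: "approx F f K" "C_reg L f" using assms by (auto simp: tame_def)
  have C: "C_reg (cmod c * L) (\<lambda>t. c * f t)" using derivs_bounded_cmult[OF F(2)] .
  have H: "approx (\<lambda>n \<mu>. c * F n \<mu>) (\<lambda>t. c * f t) (cmod c * K)"
    unfolding approx_def
  proof (intro allI conjI)
    fix n
    show "(\<lambda>\<mu>. c * F n \<mu>) \<in> bounded_on_sectors" using F(1)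
      by (auto simp: approx_def intro: bounded_on_sectors_mult[OF bounded_on_sectors_const])
    have "derivs_bounded reg (\<lambda>_. cmod c * (K / real (Suc n))) (\<lambda>x. c * (on_reals (F n) (exp x) - f (exp x)))"
      using F(1) by (intro derivs_bounded_cmult) (auto simp: approx_def)
    then show "C_reg (cmod c * K / real (Suc n)) (\<lambda>t. on_reals (\<lambda>\<mu>. c * F n \<mu>) t - c * f t)"
      by (simp add: on_reals_def right_diff_distrib)
  qed
  show "tame (\<lambda>t. c * f t)" unfolding tame_def using C H by blast
  have "op (\<lambda>\<mu>. c * F n \<mu>) x = c *\<^sub>C op (F n) x" for n
    by (rule is_calc_unique[OF op_is_calc[OF approx_mihlin_hol[OF H C]] is_calc_cmult[OF op_is_calc[OF approx_mihlin_hol[OF F]]]])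
  then show "mihlin_calc \<phi> \<alpha> A (\<lambda>t. c * f t) x = c *\<^sub>C mihlin_calc \<phi> \<alpha> A f x"
    using approx_calc_tendsto[OF H C, of x] bounded_linear.tendsto[OF bounded_linear_scaleC approx_calc_tendsto[OF F, of x], of c]
      LIMSEQ_unique by simp blast
qed

text \<open>The error of a product is \<open>(F - f)(G - g) + (F - f) g + f (G - g)\<close>. On the side of the operators, the uniform bound
for \<open>F\<^sub>n(A)\<close> allows passing to the limit in \<open>F\<^sub>n(A) G\<^sub>n(A) x\<close>.\<close>

lemma tame_mult:
  assumes "tame f" "tame g"
  shows "tame (\<lambda>t. f t * g t)" "mihlin_calc \<phi> \<alpha> A (\<lambda>t. f t * g t) x = mihlin_calc \<phi> \<alpha> A f (mihlin_calc \<phi> \<alpha> A g x)"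
proof -
  obtain K L F where F: "approx F f K" "C_reg L f" using assms by (auto simp: tame_def)
  obtain K' L' G where G: "approx G g K'" "C_reg L' g" using assms by (auto simp: tame_def)
  have pos: "0 \<le> K" "0 \<le> K'" "0 \<le> L" "0 \<le> L'"
    using approx_nonneg[OF F(1)] approx_nonneg[OF G(1)] derivs_bounded_weight_nonneg[OF F(2)] derivs_bounded_weight_nonneg[OF G(2)] by auto
  have C: "C_reg (2 ^ reg * (L * L')) (\<lambda>t. f t * g t)" using derivs_bounded_mult[OF F(2) G(2)] .
  have H: "approx (\<lambda>n \<mu>. F n \<mu> * G n \<mu>) (\<lambda>t. f t * g t) (2 ^ reg * (K * K' + K * L' + L * K'))"
    unfolding approx_def
  proof (intro allI conjI)
    fix n
    show "(\<lambda>\<mu>. F n \<mu> * G n \<mu>) \<in> bounded_on_sectors" using F(1) G(1) by (auto simp: approx_def intro: bounded_on_sectors_mult)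
    let ?N = "real (Suc n)"
    have f: "derivs_bounded reg (\<lambda>_. K / ?N) (\<lambda>x. on_reals (F n) (exp x) - f (exp x))"
      and g: "derivs_bounded reg (\<lambda>_. K' / ?N) (\<lambda>x. on_reals (G n) (exp x) - g (exp x))"
      using F(1) G(1) by (auto simp: approx_def)
    have "derivs_bounded reg (\<lambda>_. 2 ^ reg * (K / ?N * (K' / ?N)) + 2 ^ reg * (K / ?N * L') + 2 ^ reg * (L * (K' / ?N)))
       (\<lambda>x. (on_reals (F n) (exp x) - f (exp x)) * (on_reals (G n) (exp x) - g (exp x))
          + (on_reals (F n) (exp x) - f (exp x)) * g (exp x) + f (exp x) * (on_reals (G n) (exp x) - g (exp x)))"
      by (intro derivs_bounded_add derivs_bounded_mult f g F(2) G(2))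
    moreover have "2 ^ reg * (K / ?N * (K' / ?N)) + 2 ^ reg * (K / ?N * L') + 2 ^ reg * (L * (K' / ?N))
       \<le> 2 ^ reg * (K * K' + K * L' + L * K') / ?N"
    proof -
      have "K * K' / (?N * ?N) \<le> K * K' / ?N" using pos by (intro divide_left_mono) (auto simp del: of_nat_Suc simp: mult_le_cancel_left1)
      then have "K / ?N * (K' / ?N) + K / ?N * L' + L * (K' / ?N) \<le> (K * K' + K * L' + L * K') / ?N"
        by (simp add: add_divide_distrib del: of_nat_Suc)
      then have "2 ^ reg * (K / ?N * (K' / ?N) + K / ?N * L' + L * (K' / ?N)) \<le> 2 ^ reg * ((K * K' + K * L' + L * K') / ?N)"
        by (intro mult_left_mono) auto
      then show ?thesis by (simp add: distrib_left del: of_nat_Suc)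
    qed
    ultimately have "derivs_bounded reg (\<lambda>_. 2 ^ reg * (K * K' + K * L' + L * K') / ?N)
       (\<lambda>x. (on_reals (F n) (exp x) - f (exp x)) * (on_reals (G n) (exp x) - g (exp x))
          + (on_reals (F n) (exp x) - f (exp x)) * g (exp x) + f (exp x) * (on_reals (G n) (exp x) - g (exp x)))"
      by (rule derivs_bounded_weight)
    then show "C_reg (2 ^ reg * (K * K' + K * L' + L * K') / ?N) (\<lambda>t. on_reals (\<lambda>\<mu>. F n \<mu> * G n \<mu>) t - f t * g t)"
      by (simp add: on_reals_def algebra_simps del: of_nat_Suc)
  qed
  show "tame (\<lambda>t. f t * g t)" unfolding tame_def using C H by blast
  have eq: "op (\<lambda>\<mu>. F n \<mu> * G n \<mu>) x = op (F n) (op (G n) x)" for n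
    by (rule is_calc_unique[OF op_is_calc[OF approx_mihlin_hol[OF H C]]
          is_calc_mult[OF op_is_calc[OF approx_mihlin_hol[OF F]] op_is_calc[OF approx_mihlin_hol[OF G]]]])
  let ?y = "mihlin_calc \<phi> \<alpha> A g x"
  let ?B = "calculus_constant * (besov_constant * (K + L))"
  have "(\<lambda>n. op (F n) (op (G n) x - ?y)) \<longlonglongrightarrow> 0"
  proof (rule Lim_null_comparison)
    have "norm (op (F n) (op (G n) x - ?y)) \<le> ?B * norm (op (G n) x - ?y)" for n
    proof -
      have "K / real (Suc n) \<le> K" using pos by (simp add: divide_le_eq mult_le_cancel_left1 del: of_nat_Suc)
      then have "calculus_constant * (besov_constant * (K / real (Suc n) + L)) * norm (op (G n) x - ?y) \<le> ?B * norm (op (G n) x - ?y)"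
        using calculus_constant besov_constant(1) by (intro mult_right_mono mult_left_mono) auto
      then show ?thesis using approx_op_bound[OF F] order_trans by blast
    qed
    then show "\<forall>\<^sub>F n in sequentially. norm (op (F n) (op (G n) x - ?y)) \<le> ?B * norm (op (G n) x - ?y)"
      by (intro always_eventually) auto
    show "(\<lambda>n. ?B * norm (op (G n) x - ?y)) \<longlonglongrightarrow> 0"
      using approx_calc_tendsto[OF G, of x] by (intro tendsto_mult_right_zero tendsto_norm_zero) (simp add: LIM_zero_iff)
  qed
  from tendsto_add[OF this approx_calc_tendsto[OF F, of ?y]]
  have "(\<lambda>n. op (\<lambda>\<mu>. F n \<mu> * G n \<mu>) x) \<longlonglongrightarrow> mihlin_calc \<phi> \<alpha> A f ?y"
    by (simp add: eq linear_diff[OF bounded_linear.linear[OF op(1)[OF approx_mihlin_hol[OF F]]]])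
  then show "mihlin_calc \<phi> \<alpha> A (\<lambda>t. f t * g t) x = mihlin_calc \<phi> \<alpha> A f ?y"
    using approx_calc_tendsto[OF H C, of x] LIMSEQ_unique by blast
qed

lemma derivs_bounded_tame:
  assumes "derivs_bounded (Suc (Suc reg)) (\<lambda>_. K) (\<lambda>x. f (exp x))"
  shows "tame f"
proof -
  let ?f = "\<lambda>x. f (exp x)"
  have "approx (holomorphic_approximation ?f) f (normal_abs_moment * K)"
    unfolding approx_def
    using holomorphic_approximation_bounded_on_sectors[OF assms] mollify_error[OF assms]
    by (simp add: holomorphic_approximation_on_reals[OF assms] del: of_nat_Suc)
  moreover have "C_reg K f" by (rule derivs_bounded_le[OF assms]) simp
  ultimately show ?thesis unfolding tame_def by blast
qed

lemma mihlin_hol_tame: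
  assumes "F \<in> bounded_on_sectors" "C_reg K (on_reals F)" "is_calc F T"
  shows "tame (on_reals F)" "mihlin_calc \<phi> \<alpha> A (on_reals F) x = T x"
proof -
  have a: "approx (\<lambda>n. F) (on_reals F) 0"
    using assms(1) derivs_bounded_const[of reg 0] by (simp add: approx_def)
  show "tame (on_reals F)" unfolding tame_def using a assms(2) by blast
  have "op F x = T x" by (rule is_calc_unique[OF op_is_calc[OF C_reg_mihlin_hol[OF assms(1,2)]] assms(3)])
  then show "mihlin_calc \<phi> \<alpha> A (on_reals F) x = T x"
    using LIMSEQ_unique[OF approx_calc_tendsto[OF a assms(2), of x] tendsto_const] by simp
qed

lemma mihlin_calc_one: "mihlin_calc \<phi> \<alpha> A (\<lambda>t. 1) x = x"
  using mihlin_hol_tame(2)[OF bounded_on_sectors_const _ is_calc_one, of 1 x] derivs_bounded_const[of reg 1]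
  by (simp add: on_reals_def[abs_def])

end

section \<open>Dyadic sums\<close>

definition logistic :: "real \<Rightarrow> real" where
  "logistic x = exp x / (1 + exp x)"

lemma logistic_bounds: "0 < logistic x" "logistic x < 1"
  by (auto simp: logistic_def add_pos_pos divide_less_eq)

lemma logistic_derivative: "(logistic has_real_derivative logistic x * (1 - logistic x)) (at x)"
proof -
  have "1 + exp x \<noteq> 0" by (simp add: add_pos_pos less_imp_neq[symmetric])
  then show ?thesis
    unfolding logistic_def[abs_def]
    by (auto intro!: derivative_eq_intros simp: field_simps power2_eq_square)
qed

lemma logistic_product: "logistic x * (1 - logistic x) \<le> exp (- \<bar>x\<bar>)"
proof -
  have p: "1 + exp x > 0" by (simp add: add_pos_pos)
  then have eq: "logistic x * (1 - logistic x) = exp x / (1 + exp x)\<^sup>2" by (simp add: logistic_def field_simps power2_eq_square)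
  show ?thesis
  proof (cases "x \<ge> 0")
    case True
    have "exp x / (1 + exp x)\<^sup>2 \<le> exp x / (exp x)\<^sup>2"
      using p by (intro divide_left_mono power_mono) auto
    also have "exp x / (exp x)\<^sup>2 = exp (- x)" by (simp add: power2_eq_square exp_minus field_simps)
    finally show ?thesis unfolding eq using True by simp
  next
    case False
    have "exp x / (1 + exp x)\<^sup>2 \<le> exp x / 1\<^sup>2" using p by (intro divide_left_mono power_mono) auto
    then show ?thesis unfolding eq using False by simp
  qed
qed

text \<open>The derivative of \<open>u (1 - u) p(u)\<close>, for the logistic function \<open>u\<close> and a polynomial \<open>p\<close>,
  is of the same form, because \<open>u' = u (1 - u)\<close>.\<close>

lemma logistic_poly_derivs_bounded:
  "\<exists>K\<ge>0. derivs_bounded m (\<lambda>x. K * exp (- \<bar>x\<bar>)) (\<lambda>x. of_real (logistic x * (1 - logistic x) * poly p (logistic x)))"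
proof (induction m arbitrary: p)
  let ?V = "\<lambda>p x. logistic x * (1 - logistic x) * poly p (logistic x)"
  have bdd: "\<exists>K\<ge>0. \<forall>x. cmod (of_real (?V p x)) \<le> K * exp (- \<bar>x\<bar>)" for p
  proof -
    have "compact (poly p ` {0..1})" by (intro compact_continuous_image continuous_intros) auto
    then have "bounded (poly p ` {0..1})" by (rule compact_imp_bounded)
    then obtain K where K: "\<And>u. u \<in> {0..1} \<Longrightarrow> \<bar>poly p u\<bar> \<le> K" unfolding bounded_iff by fastforce
    have "K \<ge> 0" using K[of 0] by simp
    moreover have "cmod (of_real (?V p x)) \<le> K * exp (- \<bar>x\<bar>)" for x
    proof -
      have "logistic x * (1 - logistic x) * \<bar>poly p (logistic x)\<bar> \<le> exp (- \<bar>x\<bar>) * K"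
        using logistic_bounds[of x] logistic_product[of x] K[of "logistic x"] \<open>K \<ge> 0\<close> by (intro mult_mono) auto
      then show ?thesis using logistic_bounds[of x] by (simp add: norm_mult mult.commute del: of_real_mult of_real_diff) (simp add: abs_mult mult.commute)
    qed
    ultimately show ?thesis by blast
  qed
  {
    case 0
    then show ?case using bdd by simp
  next
    case (Suc m)
    define q where "q = [:1, -2:] * p + [:0, 1, -1:] * pderiv p"
    have der: "((\<lambda>x. complex_of_real (?V p x)) has_vector_derivative complex_of_real (?V q x)) (at x)" for x
    proof -
      let ?u = "logistic x"
      have "((\<lambda>x. ?V p x) has_real_derivative (?u * (1 - ?u) * (1 - ?u) + ?u * (- (?u * (1 - ?u)))) * poly p ?u
          + ?u * (1 - ?u) * (poly (pderiv p) ?u * (?u * (1 - ?u)))) (at x)"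
        by (rule derivative_eq_intros DERIV_chain2[OF poly_DERIV] logistic_derivative refl)+ (simp add: algebra_simps)
      moreover have "(?u * (1 - ?u) * (1 - ?u) + ?u * (- (?u * (1 - ?u)))) * poly p ?u
          + ?u * (1 - ?u) * (poly (pderiv p) ?u * (?u * (1 - ?u))) = ?V q x"
        by (simp add: q_def algebra_simps)
      ultimately have "((\<lambda>x. ?V p x) has_vector_derivative ?V q x) (at x)"
        by (simp add: has_real_derivative_iff_has_vector_derivative)
      from bounded_linear.has_vector_derivative[OF bounded_linear_of_real this] show ?thesis .
    qed
    obtain K1 where K1: "K1 \<ge> 0" "\<And>x. cmod (of_real (?V p x)) \<le> K1 * exp (- \<bar>x\<bar>)" using bdd by blast
    obtain K2 where K2: "K2 \<ge> 0" "derivs_bounded m (\<lambda>x. K2 * exp (- \<bar>x\<bar>)) (\<lambda>x. of_real (?V q x))" using Suc by blast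
    have "derivs_bounded m (\<lambda>x. (K1 + K2) * exp (- \<bar>x\<bar>)) (\<lambda>x. of_real (?V q x))"
      by (rule derivs_bounded_weight[OF K2(2)]) (use K1(1) in \<open>auto intro!: mult_right_mono\<close>)
    moreover have "cmod (of_real (?V p x)) \<le> (K1 + K2) * exp (- \<bar>x\<bar>)" for x
      by (rule order_trans[OF K1(2)]) (use K2(1) in \<open>auto intro!: mult_right_mono\<close>)
    ultimately show ?case using der K1(1) K2(1) unfolding derivs_bounded.simps(2)
      by (intro exI[of _ "K1 + K2"] conjI allI exI[of _ "\<lambda>x. of_real (?V q x)"]) auto
  }
qed

lemma rho_derivs_bounded:
  "\<exists>K\<ge>0. derivs_bounded m (\<lambda>x. K * exp (- \<bar>x\<bar>)) (\<lambda>x. on_reals rho (exp x))"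
proof -
  have "on_reals rho (exp x) = of_real (logistic x * (1 - logistic x) * poly 1 (logistic x))" for x
  proof -
    have "1 + exp x \<noteq> 0" by (simp add: add_pos_pos less_imp_neq[symmetric])
    then have "logistic x * (1 - logistic x) = exp x / (1 + exp x)\<^sup>2" by (simp add: logistic_def field_simps power2_eq_square)
    then show ?thesis by (simp add: on_reals_def rho_def)
  qed
  then show ?thesis using logistic_poly_derivs_bounded[of m 1] by simp
qed

locale dyadic_partition =
  fixes \<psi> :: "real \<Rightarrow> complex"
  assumes smooth_psi: "smooth \<psi>" and supp_psi: "supp \<psi> \<subseteq> {1/2..2}"
    and partition_psi: "t > 0 \<Longrightarrow> ((\<lambda>n::int. \<psi> (2 powi (- n) * t)) has_sum 1) UNIV"
begin

text \<open>At each \<open>t\<close> at most two terms are different from \<open>0\<close>.\<close>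

definition S :: "(int \<Rightarrow> complex) \<Rightarrow> real \<Rightarrow> complex" where
  "S a t = (\<Sum>\<^sub>\<infinity>n. a n * \<psi> (2 powi (- n) * t))"

lemma dyadic_exp: "2 powi (- n) * exp x = exp (x - of_int n * ln 2)" for x :: real
proof -
  have "2 powi (- n) = (2::real) powr real_of_int (- n)" by (rule powr_real_of_int'[symmetric]) auto
  also have "\<dots> = exp (- (of_int n * ln 2))" by (simp add: powr_def)
  finally show ?thesis by (simp add: exp_diff exp_minus field_simps)
qed

lemma psi_zero: "\<not> \<bar>x\<bar> < ln 2 \<Longrightarrow> \<psi> (exp x) = 0"
proof -
  assume x: "\<not> \<bar>x\<bar> < ln 2"
  obtain K where "derivs_bounded 0 (\<lambda>x. if \<bar>x\<bar> < ln 2 then K else 0) (\<lambda>x. \<psi> (exp x))"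
    using smooth_exp_derivs_bounded[OF smooth_psi supp_psi, of 0] by blast
  from derivs_boundedD[OF this, of x] x show ?thesis by simp
qed

lemma S_eq_sum:
  assumes "finite P" "\<And>n. \<bar>x - of_int n * ln 2\<bar> < ln 2 \<Longrightarrow> n \<in> P"
  shows "S a (exp x) = (\<Sum>n\<in>P. a n * \<psi> (exp (x - of_int n * ln 2)))"
proof -
  have "S a (exp x) = (\<Sum>\<^sub>\<infinity>n\<in>P. a n * \<psi> (exp (x - of_int n * ln 2)))"
    unfolding S_def dyadic_exp by (rule infsum_cong_neutral) (use assms(2) psi_zero in auto)
  then show ?thesis using assms(1) by simp
qed

text \<open>The indices whose dilated support contains \<open>e\<^sup>x\<close>.\<close>

definition active :: "real \<Rightarrow> int set" where
  "active x = {n. \<bar>x - of_int n * ln 2\<bar> < ln 2}"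

lemma active_subset: "active x \<subseteq> {\<lfloor>x / ln 2\<rfloor>, \<lfloor>x / ln 2\<rfloor> + 1}"
proof
  fix n assume "n \<in> active x"
  then have "\<bar>x - of_int n * ln 2\<bar> < ln 2" by (simp add: active_def)
  moreover have l: "ln 2 > (0::real)" by simp
  ultimately have "x / ln 2 - 1 < of_int n" "of_int n < x / ln 2 + 1"
    by (simp_all add: field_simps abs_less_iff)
  then have "n = \<lfloor>x / ln 2\<rfloor> \<or> n = \<lfloor>x / ln 2\<rfloor> + 1" by linarith
  then show "n \<in> {\<lfloor>x / ln 2\<rfloor>, \<lfloor>x / ln 2\<rfloor> + 1}" by simp
qed

lemma finite_active: "finite (active x)" and card_active: "card (active x) \<le> 2"
proof -
  show "finite (active x)" by (rule finite_subset[OF active_subset]) simp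
  show "card (active x) \<le> 2" using card_mono[OF _ active_subset[of x]] by simp
qed

lemma S_eq_active: "S a (exp x) = (\<Sum>n\<in>active x. a n * \<psi> (exp (x - of_int n * ln 2)))"
  by (rule S_eq_sum[OF finite_active]) (simp add: active_def)

lemma S_add: "t > 0 \<Longrightarrow> S (\<lambda>n. a n + b n) t = S a t + S b t"
  using S_eq_active[of "\<lambda>n. a n + b n" "ln t"] S_eq_active[of a "ln t"] S_eq_active[of b "ln t"]
  by (simp add: distrib_right sum.distrib)

lemma S_cmult: "t > 0 \<Longrightarrow> S (\<lambda>n. c * a n) t = c * S a t"
  using S_eq_active[of "\<lambda>n. c * a n" "ln t"] S_eq_active[of a "ln t"]
  by (simp add: sum_distrib_left mult.assoc)

lemma S_one: "t > 0 \<Longrightarrow> S (\<lambda>n. 1) t = 1"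
  using infsumI[OF partition_psi] by (simp add: S_def)

text \<open>Indices that are active at the same point differ by at most \<open>1\<close>.\<close>

lemma S_separated:
  assumes "t > 0" "\<And>k l. a k \<noteq> 0 \<Longrightarrow> b l \<noteq> 0 \<Longrightarrow> 2 \<le> \<bar>k - l\<bar>"
  shows "S a t * S b t = 0"
proof (rule ccontr)
  assume "S a t * S b t \<noteq> 0"
  then have nz: "S a (exp (ln t)) \<noteq> 0" "S b (exp (ln t)) \<noteq> 0" using assms(1) by auto
  obtain k where k: "k \<in> active (ln t)" "a k \<noteq> 0"
    using nz(1) unfolding S_eq_active by (metis (no_types, lifting) mult_zero_left sum.neutral)
  obtain l where l: "l \<in> active (ln t)" "b l \<noteq> 0"
    using nz(2) unfolding S_eq_active by (metis (no_types, lifting) mult_zero_left sum.neutral)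
  have "k = \<lfloor>ln t / ln 2\<rfloor> \<or> k = \<lfloor>ln t / ln 2\<rfloor> + 1" "l = \<lfloor>ln t / ln 2\<rfloor> \<or> l = \<lfloor>ln t / ln 2\<rfloor> + 1"
    using k(1) l(1) active_subset[of "ln t"] by blast+
  then have "\<bar>k - l\<bar> \<le> 1" by linarith
  then show False using assms(2)[OF k(2) l(2)] by simp
qed

text \<open>Near a point the sum is finite, and at most two of the translated windows overlap. The weight records that the sum
vanishes where no active index belongs to the support of \<open>a\<close>.\<close>

lemma S_derivs_bounded:
  "\<exists>K\<ge>0. \<forall>M a. (\<forall>n. cmod (a n) \<le> M) \<longrightarrow>
     derivs_bounded m (\<lambda>x. if \<exists>n\<in>active x. a n \<noteq> 0 then K * M else 0) (\<lambda>x. S a (exp x))"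
proof -
  obtain K where K: "K \<ge> 0" "derivs_bounded m (\<lambda>x. if \<bar>x\<bar> < ln 2 then K else 0) (\<lambda>x. \<psi> (exp x))"
    using smooth_exp_derivs_bounded[OF smooth_psi supp_psi] by blast
  have "derivs_bounded m (\<lambda>x. if \<exists>n\<in>active x. a n \<noteq> 0 then (2 * K) * M else 0) (\<lambda>x. S a (exp x))"
    if M: "\<And>n. cmod (a n) \<le> M" for a M
  proof (rule derivs_bounded_local)
    fix x0 :: real
    have M0: "M \<ge> 0" using M[of 0] norm_ge_zero order_trans by blast
    define P where "P = {\<lfloor>x0 / ln 2\<rfloor> - 1 .. \<lfloor>x0 / ln 2\<rfloor> + 2}"
    let ?g = "\<lambda>x. \<Sum>n\<in>P. a n * \<psi> (exp (x - of_int n * ln 2))"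
    let ?w = "\<lambda>x. \<Sum>n\<in>P. cmod (a n) * (if \<bar>x - of_int n * ln 2\<bar> < ln 2 then K else 0)"
    have "S a (exp x) = ?g x" if "\<bar>x - x0\<bar> < ln 2" for x
    proof (rule S_eq_sum)
      fix n :: int assume n: "\<bar>x - of_int n * ln 2\<bar> < ln 2"
      have l: "ln 2 > (0::real)" by simp
      have "\<bar>x0 - of_int n * ln 2\<bar> < 2 * ln 2" using n that by linarith
      then have "x0 / ln 2 - 2 < of_int n" "of_int n < x0 / ln 2 + 2"
        using l by (simp_all add: field_simps abs_less_iff)
      then show "n \<in> P" unfolding P_def atLeastAtMost_iff by linarith
    qed (simp add: P_def)
    moreover have "derivs_bounded m ?w ?g"
      by (intro derivs_bounded_sum derivs_bounded_cmult derivs_bounded_shift[OF K(2)]) (simp add: P_def)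
    moreover have "?w x \<le> (if \<exists>n\<in>active x. a n \<noteq> 0 then (2 * K) * M else 0)" for x
    proof (cases "\<exists>n\<in>active x. a n \<noteq> 0")
      case True
      have "?w x = (\<Sum>n\<in>P \<inter> active x. cmod (a n) * K)"
        by (rule sum.mono_neutral_cong_right) (auto simp: P_def active_def)
      also have "\<dots> \<le> (\<Sum>n\<in>P \<inter> active x. M * K)" using M K(1) by (intro sum_mono mult_right_mono) auto
      also have "\<dots> = real (card (P \<inter> active x)) * (M * K)" by simp
      also have "\<dots> \<le> 2 * (M * K)"
      proof (intro mult_right_mono)
        have "card (P \<inter> active x) \<le> card (active x)" by (rule card_mono[OF finite_active]) auto
        then show "real (card (P \<inter> active x)) \<le> 2" using card_active[of x] by linarith
      qed (use M0 K(1) in auto)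
      finally show ?thesis using True by (simp add: mult_ac)
    next
      case False
      then have "?w x = 0" by (intro sum.neutral) (auto simp: active_def)
      then show ?thesis using False by simp
    qed
    ultimately show "\<exists>g e. e > 0 \<and> (\<forall>x. \<bar>x - x0\<bar> < e \<longrightarrow> S a (exp x) = g x) \<and>
        derivs_bounded m (\<lambda>x. if \<exists>n\<in>active x. a n \<noteq> 0 then (2 * K) * M else 0) g"
      by (intro exI[of _ ?g] exI[of _ "ln 2"]) (auto intro: derivs_bounded_weight)
  qed
  then show ?thesis using K(1) by (intro exI[of _ "2 * K"]) auto
qed

end

locale mihlin_partition = mihlin_operator A \<phi> \<alpha> + dyadic_partition \<psi>
  for A :: "('a::complex_banach \<times> 'a) set" and \<phi> \<alpha> \<psi>
begin

definition \<Phi> :: "(int \<Rightarrow> complex) \<Rightarrow> 'a \<Rightarrow> 'a" where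
  "\<Phi> a = mihlin_calc \<phi> \<alpha> A (S a)"

lemma S_tame: "(\<And>n. cmod (a n) \<le> M) \<Longrightarrow> tame (S a)"
proof -
  assume M: "\<And>n. cmod (a n) \<le> M"
  then have M0: "M \<ge> 0" using norm_ge_zero order_trans by blast
  obtain K where K: "K \<ge> 0" "derivs_bounded (Suc (Suc reg)) (\<lambda>x. if \<exists>n\<in>active x. a n \<noteq> 0 then K * M else 0) (\<lambda>x. S a (exp x))"
    using S_derivs_bounded[of "Suc (Suc reg)"] M by blast
  have "derivs_bounded (Suc (Suc reg)) (\<lambda>_. K * M) (\<lambda>x. S a (exp x))"
    by (rule derivs_bounded_weight[OF K(2)]) (use K(1) M0 in auto)
  then show ?thesis by (rule derivs_bounded_tame)
qed

lemma \<Phi>_bounded: "\<exists>C\<ge>0. \<forall>M a x. (\<forall>n. cmod (a n) \<le> M) \<longrightarrow> norm (\<Phi> a x) \<le> C * M * norm x"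
proof -
  obtain K where K: "K \<ge> 0" "\<And>M a. \<forall>n. cmod (a n) \<le> M \<Longrightarrow>
      derivs_bounded reg (\<lambda>x. if \<exists>n\<in>active x. a n \<noteq> 0 then K * M else 0) (\<lambda>x. S a (exp x))"
    using S_derivs_bounded[of reg] by blast
  have "norm (\<Phi> a x) \<le> (calculus_constant * besov_constant * K) * M * norm x" if M: "\<forall>n. cmod (a n) \<le> M" for M a x
  proof -
    have M0: "M \<ge> 0" using M norm_ge_zero order_trans by blast
    have "C_reg (K * M) (S a)" by (rule derivs_bounded_weight[OF K(2)[OF M]]) (use K(1) M0 in auto)
    from tame_bound[OF S_tame this, of M x] M show ?thesis by (simp add: \<Phi>_def mult_ac)
  qed
  then show ?thesis using K(1) calculus_constant besov_constant(1)
    by (intro exI[of _ "calculus_constant * besov_constant * K"]) auto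
qed

lemma \<Phi>_bounded_linear: "(\<And>n. cmod (a n) \<le> M) \<Longrightarrow> bounded_linear (\<Phi> a)"
  unfolding \<Phi>_def by (rule tame_bounded_linear[OF S_tame])

lemma \<Phi>_add:
  assumes "\<And>n. cmod (a n) \<le> M" "\<And>n. cmod (b n) \<le> L"
  shows "\<Phi> (\<lambda>n. a n + b n) x = \<Phi> a x + \<Phi> b x"
  unfolding \<Phi>_def tame_add(2)[OF S_tame[OF assms(1)] S_tame[OF assms(2)], symmetric]
  by (rule mihlin_calc_cong) (rule S_add)

lemma \<Phi>_cmult:
  assumes "\<And>n. cmod (a n) \<le> M"
  shows "\<Phi> (\<lambda>n. c * a n) x = c *\<^sub>C \<Phi> a x"
  unfolding \<Phi>_def tame_cmult(2)[OF S_tame[OF assms], symmetric]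
  by (rule mihlin_calc_cong) (rule S_cmult)

lemma \<Phi>_one: "\<Phi> (\<lambda>n. 1) x = x"
  unfolding \<Phi>_def by (subst mihlin_calc_cong[OF S_one]) (simp_all add: mihlin_calc_one)

lemma \<Phi>_separated:
  assumes "\<And>n. cmod (a n) \<le> M" "\<And>n. cmod (b n) \<le> L" "\<And>k l. a k \<noteq> 0 \<Longrightarrow> b l \<noteq> 0 \<Longrightarrow> 2 \<le> \<bar>k - l\<bar>"
  shows "\<Phi> a (\<Phi> b x) = 0"
proof -
  have "\<Phi> a (\<Phi> b x) = mihlin_calc \<phi> \<alpha> A (\<lambda>t. S a t * S b t) x"
    unfolding \<Phi>_def by (rule tame_mult(2)[OF S_tame[OF assms(1)] S_tame[OF assms(2)], symmetric])
  also have "\<dots> = mihlin_calc \<phi> \<alpha> A (\<lambda>t. 0 * S a t) x"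
    by (rule mihlin_calc_cong) (simp add: S_separated[OF _ assms(3)])
  also have "\<dots> = 0" by (subst tame_cmult(2)[OF S_tame[OF assms(1)]]) simp
  finally show ?thesis .
qed

text \<open>On the dense range of \<open>\<rho>(A)\<close> the operator \<open>\<Phi> a\<close> acts through \<open>(S a \<rho>)(A)\<close>. If \<open>a\<close> vanishes on
\<open>[-N, N]\<close>, then \<open>S a\<close> vanishes for \<open>|ln t| \<le> N ln 2\<close>, and on the complement \<open>\<rho>\<close> and its derivatives are of size
\<open>2\<^sup>-\<^sup>N\<close>. The uniform bound for \<open>\<Phi> a\<close> extends the convergence to all \<open>x\<close>.\<close>

lemma \<Phi>_tail:
  assumes "e > 0"
  shows "\<exists>N. \<forall>a. (\<forall>n. cmod (a n) \<le> 1) \<and> (\<forall>n. \<bar>n\<bar> \<le> int N \<longrightarrow> a n = 0) \<longrightarrow> norm (\<Phi> a x) < e"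
proof -
  obtain C where C: "C \<ge> 0" "\<And>M a x. \<forall>n. cmod (a n) \<le> M \<Longrightarrow> norm (\<Phi> a x) \<le> C * M * norm x"
    using \<Phi>_bounded by blast
  define d where "d = e / (2 * (C + 1))"
  have "d > 0" using assms C(1) by (simp add: d_def)
  have "x \<in> closure (range rhoA)" using dense_range_rhoA by simp
  then obtain y where y: "dist (rhoA y) x < d" using \<open>d > 0\<close> unfolding closure_approachable by blast
  obtain K where K: "K \<ge> 0" "\<And>M a. \<forall>n. cmod (a n) \<le> M \<Longrightarrow>
      derivs_bounded reg (\<lambda>x. if \<exists>n\<in>active x. a n \<noteq> 0 then K * M else 0) (\<lambda>x. S a (exp x))"
    using S_derivs_bounded[of reg] by blast
  obtain R where R: "R \<ge> 0" "derivs_bounded reg (\<lambda>x. R * exp (- \<bar>x\<bar>)) (\<lambda>x. on_reals rho (exp x))"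
    using rho_derivs_bounded by blast
  have Cr: "C_reg R (on_reals rho)" by (rule derivs_bounded_weight[OF R(2)]) (use R(1) in \<open>simp add: mult_left_le\<close>)
  note rho_tame = mihlin_hol_tame[OF rho_bounded_on_sectors Cr is_calc_rho]
  let ?B = "calculus_constant * besov_constant * (2 ^ reg * (K * R)) * norm y"
  have "(\<lambda>N. exp (- (real N * ln 2))) \<longlonglongrightarrow> 0" by real_asymp
  then have lim: "(\<lambda>N. ?B * exp (- (real N * ln 2))) \<longlonglongrightarrow> 0" by (rule tendsto_mult_right_zero)
  have "0 < e / 2" using assms by simp
  from order_tendstoD(2)[OF lim this] obtain N where N: "?B * exp (- (real N * ln 2)) < e / 2"
    unfolding eventually_sequentially by blast
  have "norm (\<Phi> a x) < e" if a: "\<forall>n. cmod (a n) \<le> 1" "\<forall>n. \<bar>n\<bar> \<le> int N \<longrightarrow> a n = 0" for a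
  proof -
    have ta: "tame (S a)" by (rule S_tame) (use a in auto)
    have far: "exp (- \<bar>x\<bar>) \<le> exp (- (real N * ln 2))" if "n \<in> active x" "a n \<noteq> 0" for n x
    proof -
      have "\<not> \<bar>n\<bar> \<le> int N" using a(2) that(2) by blast
      then have "real N + 1 \<le> \<bar>real_of_int n\<bar>" by linarith
      then have "(real N + 1) * ln 2 \<le> \<bar>real_of_int n\<bar> * ln 2" by (intro mult_right_mono) auto
      also have "\<dots> = \<bar>real_of_int n * ln 2\<bar>" by (simp add: abs_mult)
      also have "\<dots> < \<bar>x\<bar> + ln 2" using that(1) by (simp add: active_def)
      finally show ?thesis by (simp add: distrib_right)
    qed
    have "C_reg (2 ^ reg * (K * R) * exp (- (real N * ln 2))) (\<lambda>t. S a t * on_reals rho t)"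
    proof (rule derivs_bounded_weight[OF derivs_bounded_mult[OF K(2)[OF a(1)] R(2)]])
      fix x
      show "2 ^ reg * ((if \<exists>n\<in>active x. a n \<noteq> 0 then K * 1 else 0) * (R * exp (- \<bar>x\<bar>))) \<le> 2 ^ reg * (K * R) * exp (- (real N * ln 2))"
      proof (cases "\<exists>n\<in>active x. a n \<noteq> 0")
        case True
        then have "exp (- \<bar>x\<bar>) \<le> exp (- (real N * ln 2))" using far by blast
        then have "2 ^ reg * (K * R) * exp (- \<bar>x\<bar>) \<le> 2 ^ reg * (K * R) * exp (- (real N * ln 2))"
          using K(1) R(1) by (intro mult_left_mono) auto
        then show ?thesis using True by (simp add: mult_ac)
      next
        case False
        then show ?thesis using K(1) R(1) by simp
      qed
    qed
    from tame_bound[OF tame_mult(1)[OF ta rho_tame(1)] this, of y]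
    have "norm (\<Phi> a (rhoA y)) \<le> ?B * exp (- (real N * ln 2))"
      unfolding \<Phi>_def tame_mult(2)[OF ta rho_tame(1)] rho_tame(2) by (simp add: mult_ac)
    moreover have "norm (\<Phi> a (x - rhoA y)) \<le> e / 2"
    proof -
      have "norm (\<Phi> a (x - rhoA y)) \<le> C * 1 * norm (x - rhoA y)" by (rule C(2)[OF a(1)])
      also have "\<dots> \<le> (C + 1) * d" using y C(1) by (intro mult_mono) (auto simp: dist_norm norm_minus_commute)
      also have "\<dots> = e / 2"
      proof -
        have "z * (e / (2 * z)) = e / 2" if "z > 0" for z :: real using that by simp
        moreover have "C + 1 > 0" using C(1) by simp
        ultimately show ?thesis unfolding d_def by blast
      qed
      finally show ?thesis .
    qed
    moreover have "\<Phi> a x = \<Phi> a (x - rhoA y) + \<Phi> a (rhoA y)"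
      by (simp add: linear_diff[OF bounded_linear.linear[OF \<Phi>_bounded_linear[OF a(1)[rule_format]]]])
    ultimately have "norm (\<Phi> a x) \<le> norm (\<Phi> a (x - rhoA y)) + norm (\<Phi> a (rhoA y))"
      using norm_triangle_ineq[of "\<Phi> a (x - rhoA y)" "\<Phi> a (rhoA y)"] by simp
    with \<open>norm (\<Phi> a (x - rhoA y)) \<le> e / 2\<close> \<open>norm (\<Phi> a (rhoA y)) \<le> ?B * exp (- (real N * ln 2))\<close> N
    show ?thesis by linarith
  qed
  then show ?thesis by blast
qed

end

section \<open>Unconditional sums over blocks\<close>

text \<open>What the unconditional decomposition uses of the operators \<open>\<Phi> a\<close>. Of the multiplicativity of the calculus
only the vanishing of products for separated supports remains: \<open>\<Phi>\<close> itself is not multiplicative, since neighbouring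
pieces of the partition overlap.\<close>

locale block_calculus =
  fixes \<Phi> :: "(int \<Rightarrow> complex) \<Rightarrow> 'a::complex_banach \<Rightarrow> 'a" and C :: real
  assumes C: "C \<ge> 0"
    and bound: "(\<And>n. cmod (a n) \<le> M) \<Longrightarrow> norm (\<Phi> a x) \<le> C * M * norm x"
    and blin: "(\<And>n. cmod (a n) \<le> M) \<Longrightarrow> bounded_linear (\<Phi> a)"
    and add: "(\<And>n. cmod (a n) \<le> M) \<Longrightarrow> (\<And>n. cmod (b n) \<le> L) \<Longrightarrow> \<Phi> (\<lambda>n. a n + b n) x = \<Phi> a x + \<Phi> b x"
    and cmult: "(\<And>n. cmod (a n) \<le> M) \<Longrightarrow> \<Phi> (\<lambda>n. c * a n) x = c *\<^sub>C \<Phi> a x"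
    and one: "\<Phi> (\<lambda>n. 1) x = x"
    and separated: "(\<And>n. cmod (a n) \<le> M) \<Longrightarrow> (\<And>n. cmod (b n) \<le> L) \<Longrightarrow>
       (\<And>k l. a k \<noteq> 0 \<Longrightarrow> b l \<noteq> 0 \<Longrightarrow> 2 \<le> \<bar>k - l\<bar>) \<Longrightarrow> \<Phi> a (\<Phi> b x) = 0"
    and tail: "e > 0 \<Longrightarrow> \<exists>N. \<forall>a. (\<forall>n. cmod (a n) \<le> 1) \<and> (\<forall>n. \<bar>n\<bar> \<le> int N \<longrightarrow> a n = 0) \<longrightarrow> norm (\<Phi> a x) < e"

text \<open>The integers are grouped into blocks by \<open>\<pi>\<close>. The embedding \<open>\<iota>\<close> measures distances between blocks, and by the
Lipschitz condition distant blocks consist of distant integers.\<close>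

locale blocks = block_calculus \<Phi> C for \<Phi> :: "(int \<Rightarrow> complex) \<Rightarrow> 'a::complex_banach \<Rightarrow> 'a" and C +
  fixes \<pi> :: "int \<Rightarrow> 'i" and \<iota> :: "'i \<Rightarrow> int"
  assumes inj_\<iota>: "inj \<iota>" and Lipschitz: "\<bar>\<iota> (\<pi> k) - \<iota> (\<pi> l)\<bar> \<le> \<bar>k - l\<bar>"
begin

definition U :: "'i \<Rightarrow> 'a \<Rightarrow> 'a" where
  "U i = \<Phi> (\<lambda>k. if \<pi> k = i then 1 else 0)"

text \<open>The piece \<open>i\<close> enlarged by its neighbours.\<close>

definition W :: "'i \<Rightarrow> 'a \<Rightarrow> 'a" where
  "W i = \<Phi> (\<lambda>k. if \<bar>\<iota> (\<pi> k) - \<iota> i\<bar> \<le> 1 then 1 else 0)"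

lemma zero: "\<Phi> (\<lambda>k. 0) x = 0"
  using cmult[of "\<lambda>k. 0" 0 0 x] by simp

lemma sum_blocks:
  assumes "finite F" "\<And>i. cmod (a i) \<le> M"
  shows "(\<Sum>i\<in>F. a i *\<^sub>C U i x) = \<Phi> (\<lambda>k. if \<pi> k \<in> F then a (\<pi> k) else 0) x"
  using assms(1)
proof (induction F rule: finite_induct)
  case (insert i F)
  have M: "M \<ge> 0" using assms(2) norm_ge_zero order_trans by blast
  have "(\<lambda>k. if \<pi> k \<in> insert i F then a (\<pi> k) else 0) =
     (\<lambda>k. a i * (if \<pi> k = i then 1 else 0) + (if \<pi> k \<in> F then a (\<pi> k) else 0))"
    using insert(2) by (auto simp: fun_eq_iff)
  moreover have "\<Phi> (\<lambda>k. a i * (if \<pi> k = i then 1 else 0) + (if \<pi> k \<in> F then a (\<pi> k) else 0)) x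
     = \<Phi> (\<lambda>k. a i * (if \<pi> k = i then 1 else 0)) x + \<Phi> (\<lambda>k. if \<pi> k \<in> F then a (\<pi> k) else 0) x"
    by (rule add[of _ M _ M]) (use assms(2) M in \<open>auto simp: norm_mult\<close>)
  moreover have "\<Phi> (\<lambda>k. a i * (if \<pi> k = i then 1 else 0)) x = a i *\<^sub>C U i x"
    unfolding U_def by (rule cmult[of _ 1]) simp
  ultimately show ?case using insert by simp
qed (simp add: zero)

text \<open>The remainder of a finite partial sum is \<open>\<Phi>\<close> of a sequence that vanishes on \<open>[-N, N]\<close> as soon as the partial sum
contains all blocks that meet this interval.\<close>

lemma has_sum_blocks:
  assumes a: "\<And>i. cmod (a i) \<le> 1"
  shows "((\<lambda>i. a i *\<^sub>C U i x) has_sum \<Phi> (\<lambda>k. a (\<pi> k)) x) UNIV"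
  unfolding has_sum_def tendsto_iff
proof (intro allI impI)
  fix e :: real assume "e > 0"
  obtain N where N: "\<And>b. (\<forall>n. cmod (b n) \<le> 1) \<Longrightarrow> (\<forall>n. \<bar>n\<bar> \<le> int N \<longrightarrow> b n = 0) \<Longrightarrow> norm (\<Phi> b x) < e"
    using tail[OF \<open>e > 0\<close>, of x] by blast
  let ?F0 = "\<pi> ` {-int N..int N}"
  show "\<forall>\<^sub>F F in finite_subsets_at_top UNIV. dist (\<Sum>i\<in>F. a i *\<^sub>C U i x) (\<Phi> (\<lambda>k. a (\<pi> k)) x) < e"
    unfolding eventually_finite_subsets_at_top
  proof (intro exI conjI allI impI)
    fix F assume F: "finite F \<and> ?F0 \<subseteq> F \<and> F \<subseteq> UNIV"
    have "\<Phi> (\<lambda>k. (if \<pi> k \<in> F then a (\<pi> k) else 0) + (if \<pi> k \<in> F then 0 else a (\<pi> k))) x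
      = \<Phi> (\<lambda>k. if \<pi> k \<in> F then a (\<pi> k) else 0) x + \<Phi> (\<lambda>k. if \<pi> k \<in> F then 0 else a (\<pi> k)) x"
      by (rule add[of _ 1 _ 1]) (use a in auto)
    moreover have "(\<lambda>k. (if \<pi> k \<in> F then a (\<pi> k) else 0) + (if \<pi> k \<in> F then 0 else a (\<pi> k))) = (\<lambda>k. a (\<pi> k))" by auto
    ultimately have "dist (\<Sum>i\<in>F. a i *\<^sub>C U i x) (\<Phi> (\<lambda>k. a (\<pi> k)) x) = norm (\<Phi> (\<lambda>k. if \<pi> k \<in> F then 0 else a (\<pi> k)) x)"
      using sum_blocks[of F a 1 x] F a by (simp add: dist_norm)
    also have "\<dots> < e"
    proof (rule N)
      show "\<forall>n. \<bar>n\<bar> \<le> int N \<longrightarrow> (if \<pi> n \<in> F then 0 else a (\<pi> n)) = 0"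
      proof (intro allI impI)
        fix n assume "\<bar>n\<bar> \<le> int N"
        then have "n \<in> {-int N..int N}" by auto
        then have "\<pi> n \<in> F" using F by blast
        then show "(if \<pi> n \<in> F then 0 else a (\<pi> n)) = 0" by simp
      qed
    qed (use a in auto)
    finally show "dist (\<Sum>i\<in>F. a i *\<^sub>C U i x) (\<Phi> (\<lambda>k. a (\<pi> k)) x) < e" .
  qed auto
qed

lemma infsum_blocks: "(\<And>i. cmod (a i) \<le> 1) \<Longrightarrow> (\<Sum>\<^sub>\<infinity>i. a i *\<^sub>C U i x) = \<Phi> (\<lambda>k. a (\<pi> k)) x"
  using has_sum_blocks by (rule infsumI)

lemma norm_infsum_blocks: "(\<And>i. cmod (a i) \<le> 1) \<Longrightarrow> norm (\<Sum>\<^sub>\<infinity>i. a i *\<^sub>C U i x) \<le> C * norm x"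
  using bound[of "\<lambda>k. a (\<pi> k)" 1 x] by (simp add: infsum_blocks)

lemma blocks_sum_identity: "((\<lambda>i. U i x) has_sum x) UNIV"
  using has_sum_blocks[of "\<lambda>i. 1" x] by (simp add: one)

lemma W_linear: "bounded_linear (W i)"
  unfolding W_def by (rule blin[of _ 1]) simp

text \<open>The complement of the enlarged piece is separated from the piece, and \<open>\<Phi> 1\<close> is the identity.\<close>

lemma W_U: "W i (U i x) = U i x"
proof -
  let ?a = "\<lambda>k. if \<bar>\<iota> (\<pi> k) - \<iota> i\<bar> \<le> 1 then 1 else 0" and ?b = "\<lambda>k. if \<bar>\<iota> (\<pi> k) - \<iota> i\<bar> \<le> 1 then 0 else 1"
  have "\<Phi> (\<lambda>k. ?a k + ?b k) (U i x) = \<Phi> ?a (U i x) + \<Phi> ?b (U i x)"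
    by (rule add[of _ 1 _ 1]) auto
  moreover have "(\<lambda>k. ?a k + ?b k) = (\<lambda>k. 1 :: complex)" by auto
  moreover have "\<Phi> ?b (U i x) = 0"
    unfolding U_def
  proof (rule separated[of _ 1 _ 1])
    fix k l assume "?b k \<noteq> (0::complex)" "(if \<pi> l = i then 1 else 0) \<noteq> (0::complex)"
    then have "\<not> \<bar>\<iota> (\<pi> k) - \<iota> (\<pi> l)\<bar> \<le> 1" by (auto split: if_splits)
    then show "2 \<le> \<bar>k - l\<bar>" using Lipschitz[of k l] by linarith
  qed auto
  ultimately show ?thesis by (simp add: one W_def)
qed

definition near :: "'i set \<Rightarrow> 'i set" where
  "near F = {j. \<exists>i\<in>F. \<bar>\<iota> j - \<iota> i\<bar> \<le> 2}"

lemma finite_near: "finite F \<Longrightarrow> finite (near F)"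
proof -
  assume F: "finite F"
  have "near F \<subseteq> \<iota> -` (\<Union>i\<in>F. {\<iota> i - 2..\<iota> i + 2})" by (force simp: near_def abs_le_iff)
  moreover have "finite (\<iota> -` (\<Union>i\<in>F. {\<iota> i - 2..\<iota> i + 2}))" by (rule finite_vimageI[OF _ inj_\<iota>]) (use F in auto)
  ultimately show ?thesis by (rule finite_subset)
qed

text \<open>The blocks outside \<open>near F\<close> are separated from the enlarged piece \<open>i\<close>, so that \<open>W i\<close> sees only a finite part of the
series.\<close>

lemma W_infsum:
  assumes F: "finite F" "i \<in> F" and a: "\<And>i. cmod (a i) \<le> 1"
  shows "W i (\<Phi> (\<lambda>k. a (\<pi> k)) x) = (\<Sum>j\<in>near F. W i (a j *\<^sub>C U j x))"
proof -
  let ?in = "\<lambda>k. if \<pi> k \<in> near F then a (\<pi> k) else 0" and ?out = "\<lambda>k. if \<pi> k \<in> near F then 0 else a (\<pi> k)"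
  have "\<Phi> (\<lambda>k. ?in k + ?out k) x = \<Phi> ?in x + \<Phi> ?out x" by (rule add[of _ 1 _ 1]) (use a in auto)
  moreover have "(\<lambda>k. ?in k + ?out k) = (\<lambda>k. a (\<pi> k))" by auto
  ultimately have "W i (\<Phi> (\<lambda>k. a (\<pi> k)) x) = W i (\<Phi> ?in x) + W i (\<Phi> ?out x)"
    by (simp add: linear_add[OF bounded_linear.linear[OF W_linear]])
  moreover have "W i (\<Phi> ?out x) = 0"
    unfolding W_def
  proof (rule separated[of _ 1 _ 1])
    fix k l assume "(if \<bar>\<iota> (\<pi> k) - \<iota> i\<bar> \<le> 1 then 1 else 0) \<noteq> (0::complex)" "?out l \<noteq> 0"
    then have "\<bar>\<iota> (\<pi> k) - \<iota> i\<bar> \<le> 1" "\<pi> l \<notin> near F" by (auto split: if_splits)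
    moreover from this have "\<not> \<bar>\<iota> (\<pi> l) - \<iota> i\<bar> \<le> 2" using F(2) by (auto simp: near_def)
    ultimately show "2 \<le> \<bar>k - l\<bar>" using Lipschitz[of k l] by linarith
  qed (use a in auto)
  moreover have "\<Phi> ?in x = (\<Sum>j\<in>near F. a j *\<^sub>C U j x)" using sum_blocks[OF finite_near[OF F(1)], of a 1 x] a by simp
  ultimately show ?thesis by (simp add: linear_sum[OF bounded_linear.linear[OF W_linear]])
qed

text \<open>Each integer belongs to at most three enlarged pieces.\<close>

lemma signed_sum_W_bound:
  assumes F: "finite F" and c: "\<And>i. cmod (c i) \<le> 1"
  shows "norm (\<Sum>i\<in>F. c i *\<^sub>C W i y) \<le> 3 * C * norm y"
proof -
  let ?w = "\<lambda>i k. if \<bar>\<iota> (\<pi> k) - \<iota> i\<bar> \<le> 1 then 1 else (0 :: complex)"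
  have eq: "(\<Sum>i\<in>F'. c i *\<^sub>C W i y) = \<Phi> (\<lambda>k. \<Sum>i\<in>F'. c i * ?w i k) y" if "finite F'" for F'
    using that
  proof (induction F' rule: finite_induct)
    case (insert i F')
    have "\<Phi> (\<lambda>k. c i * ?w i k + (\<Sum>i\<in>F'. c i * ?w i k)) y = \<Phi> (\<lambda>k. c i * ?w i k) y + \<Phi> (\<lambda>k. \<Sum>i\<in>F'. c i * ?w i k) y"
    proof (rule add[of _ 1 _ "real (card F')"])
      show "cmod (c i * ?w i k) \<le> 1" for k using c by (auto simp: norm_mult)
      have "cmod (\<Sum>i\<in>F'. c i * ?w i k) \<le> (\<Sum>i\<in>F'. 1)" for k
        by (rule sum_norm_le) (use c in \<open>auto simp: norm_mult\<close>)
      then show "cmod (\<Sum>i\<in>F'. c i * ?w i k) \<le> real (card F')" for k by simp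
    qed
    moreover have "\<Phi> (\<lambda>k. c i * ?w i k) y = c i *\<^sub>C W i y" unfolding W_def by (rule cmult[of _ 1]) simp
    ultimately show ?case using insert by simp
  qed (simp add: zero)
  have "cmod (\<Sum>i\<in>F. c i * ?w i k) \<le> 3" for k
  proof -
    have "cmod (\<Sum>i\<in>F. c i * ?w i k) \<le> (\<Sum>i\<in>F. if \<bar>\<iota> (\<pi> k) - \<iota> i\<bar> \<le> 1 then 1 else 0)"
      by (rule sum_norm_le) (use c in \<open>auto simp: norm_mult\<close>)
    also have "\<dots> = real (card (F \<inter> {i. \<bar>\<iota> (\<pi> k) - \<iota> i\<bar> \<le> 1}))" using F by (simp add: sum.If_cases)
    also have "card (F \<inter> {i. \<bar>\<iota> (\<pi> k) - \<iota> i\<bar> \<le> 1}) = card (\<iota> ` (F \<inter> {i. \<bar>\<iota> (\<pi> k) - \<iota> i\<bar> \<le> 1}))"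
      by (rule card_image[symmetric]) (use inj_\<iota> inj_on_subset in blast)
    also have "\<dots> \<le> card {\<iota> (\<pi> k) - 1..\<iota> (\<pi> k) + 1}" by (rule card_mono) auto
    finally show ?thesis by simp
  qed
  from bound[where x = y, OF this] show ?thesis using eq[OF F] by (simp add: mult_ac)
qed

end

text \<open>Sign patterns on \<open>J\<close> are encoded by the subsets of \<open>J\<close>, the indices with sign \<open>+1\<close>.\<close>

definition pattern :: "'i set \<Rightarrow> 'i \<Rightarrow> real" where
  "pattern S i = (if i \<in> S then 1 else -1)"

lemma rademacher_AE:
  fixes \<epsilon> :: "'i \<Rightarrow> 'w \<Rightarrow> real"
  assumes "rademacher M \<epsilon>" "countable (UNIV :: 'i set)"
  shows "AE w in M. \<forall>i. \<epsilon> i w = 1 \<or> \<epsilon> i w = -1"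
proof -
  interpret prob_space M using assms(1) by (simp add: rademacher_def)
  have "AE w in M. \<epsilon> i w = 1 \<or> \<epsilon> i w = -1" for i
  proof -
    have rv: "random_variable borel (\<epsilon> i)" using assms(1) by (auto simp: rademacher_def indep_vars_def)
    have m: "{w \<in> space M. \<epsilon> i w = c} \<in> sets M" for c using rv by measurable
    have "prob ({w \<in> space M. \<epsilon> i w = 1} \<union> {w \<in> space M. \<epsilon> i w = -1}) = prob {w \<in> space M. \<epsilon> i w = 1} + prob {w \<in> space M. \<epsilon> i w = -1}"
      by (rule finite_measure_Union) (use m in auto)
    also have "\<dots> = 1/2 + 1/2"
      using assms(1) unfolding rademacher_def by (intro arg_cong2[of _ _ _ _ "(+)"]) auto
    also have "{w \<in> space M. \<epsilon> i w = 1} \<union> {w \<in> space M. \<epsilon> i w = -1} = {w \<in> space M. \<epsilon> i w = 1 \<or> \<epsilon> i w = -1}" by auto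
    finally have "prob {w \<in> space M. \<epsilon> i w = 1 \<or> \<epsilon> i w = -1} = 1" by simp
    then have "AE w in M. w \<in> {w \<in> space M. \<epsilon> i w = 1 \<or> \<epsilon> i w = -1}" by (rule AE_prob_1)
    then show ?thesis by (rule AE_mp) auto
  qed
  then have "AE w in M. \<forall>i\<in>UNIV. \<epsilon> i w = 1 \<or> \<epsilon> i w = -1"
    by (subst AE_ball_countable[OF assms(2)]) auto
  then show ?thesis by simp
qed

lemma rademacher_pattern_probability:
  fixes \<epsilon> :: "'i \<Rightarrow> 'w \<Rightarrow> real"
  assumes "rademacher M \<epsilon>" "finite J"
  shows "measure M {w \<in> space M. \<forall>i\<in>J. \<epsilon> i w = pattern S i} = (1/2) ^ card J"
    and "{w \<in> space M. \<forall>i\<in>J. \<epsilon> i w = pattern S i} \<in> sets M"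
proof -
  interpret prob_space M using assms(1) by (simp add: rademacher_def)
  have iv: "indep_vars (\<lambda>_. borel) \<epsilon> UNIV" using assms(1) by (simp add: rademacher_def)
  have rv: "random_variable borel (\<epsilon> i)" for i using iv by (auto simp: indep_vars_def)
  show s: "{w \<in> space M. \<forall>i\<in>J. \<epsilon> i w = pattern S i} \<in> sets M"
  proof -
    have "{w \<in> space M. \<epsilon> i w = pattern S i} \<in> sets M" for i using rv by measurable
    then show ?thesis using assms(2) by (intro sets.sets_Collect_finite_All) auto
  qed
  show "prob {w \<in> space M. \<forall>i\<in>J. \<epsilon> i w = pattern S i} = (1/2) ^ card J"
  proof (cases "J = {}")
    case True
    then show ?thesis by (simp add: prob_space)
  next
    case False
    have "prob (\<Inter>i\<in>J. \<epsilon> i -` {pattern S i} \<inter> space M) = (\<Prod>i\<in>J. prob (\<epsilon> i -` {pattern S i} \<inter> space M))"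
      by (rule indep_varsD[OF iv False assms(2)]) auto
    also have "(\<Inter>i\<in>J. \<epsilon> i -` {pattern S i} \<inter> space M) = {w \<in> space M. \<forall>i\<in>J. \<epsilon> i w = pattern S i}" using False by auto
    also have "(\<Prod>i\<in>J. prob (\<epsilon> i -` {pattern S i} \<inter> space M)) = (\<Prod>i\<in>J. 1/2)"
    proof (rule prod.cong[OF refl])
      fix i
      have "\<epsilon> i -` {pattern S i} \<inter> space M = {w \<in> space M. \<epsilon> i w = pattern S i}" by auto
      then show "prob (\<epsilon> i -` {pattern S i} \<inter> space M) = 1/2"
        using assms(1) by (simp add: pattern_def rademacher_def)
    qed
    finally show ?thesis by (simp add: power_divide)
  qed
qed

text \<open>For \<open>i \<noteq> j\<close>, switching the sign of \<open>i\<close> permutes the patterns and changes the sign of the summand.\<close>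

lemma pattern_orthogonal:
  assumes "finite J" "i \<in> J" "j \<in> J"
  shows "(\<Sum>S\<in>Pow J. pattern S i * pattern S j) = (if i = j then 2 ^ card J else 0)"
proof (cases "i = j")
  case True
  have "pattern S i * pattern S j = 1" for S using True by (simp add: pattern_def)
  then show ?thesis using True assms(1) by (simp add: card_Pow)
next
  case False
  let ?t = "\<lambda>S. if i \<in> S then S - {i} else insert i S"
  have bij: "bij_betw ?t (Pow J) (Pow J)"
    by (rule bij_betwI[of _ _ _ ?t]) (use assms(2) in \<open>auto split: if_splits\<close>)
  have "(\<Sum>S\<in>Pow J. pattern S i * pattern S j) = (\<Sum>S\<in>Pow J. pattern (?t S) i * pattern (?t S) j)"
    by (rule sum.reindex_bij_betw[OF bij, symmetric])
  also have "\<dots> = (\<Sum>S\<in>Pow J. - (pattern S i * pattern S j))"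
    by (rule sum.cong) (use False in \<open>auto simp: pattern_def\<close>)
  finally show ?thesis using False by (simp add: sum_negf)
qed

text \<open>Independence makes the patterns equally likely. The integrand \<open>f\<close> is arbitrary, in particular possibly not
measurable, and is compared with a simple function.\<close>

lemma rademacher_integral_ge:
  fixes \<epsilon> :: "'i \<Rightarrow> 'w \<Rightarrow> real"
  assumes r: "rademacher M \<epsilon>" "finite J" and f: "AE w in M. \<forall>S\<in>Pow J. (\<forall>i\<in>J. \<epsilon> i w = pattern S i) \<longrightarrow> ennreal (g S) \<le> f w"
    and g: "\<And>S. 0 \<le> g S"
  shows "ennreal ((1/2) ^ card J * (\<Sum>S\<in>Pow J. g S)) \<le> (\<integral>\<^sup>+w. f w \<partial>M)"
proof -
  interpret prob_space M using r by (simp add: rademacher_def)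
  let ?E = "\<lambda>S. {w \<in> space M. \<forall>i\<in>J. \<epsilon> i w = pattern S i}"
  note E = rademacher_pattern_probability[OF r]
  have "(\<integral>\<^sup>+w. (\<Sum>S\<in>Pow J. ennreal (g S) * indicator (?E S) w) \<partial>M) = (\<Sum>S\<in>Pow J. ennreal (g S) * emeasure M (?E S))"
    using E(2) by (simp add: nn_integral_sum nn_integral_cmult_indicator)
  also have "\<dots> = (\<Sum>S\<in>Pow J. ennreal (g S * (1/2) ^ card J))"
    using E(1) g by (simp add: emeasure_eq_measure ennreal_mult'')
  also have "\<dots> = ennreal ((1/2) ^ card J * (\<Sum>S\<in>Pow J. g S))"
    using g by (subst sum_ennreal) (auto simp: sum_distrib_right mult.commute)
  finally have eq: "ennreal ((1/2) ^ card J * (\<Sum>S\<in>Pow J. g S)) = (\<integral>\<^sup>+w. (\<Sum>S\<in>Pow J. ennreal (g S) * indicator (?E S) w) \<partial>M)" by simp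
  show ?thesis unfolding eq
  proof (rule nn_integral_mono_AE)
    show "AE w in M. (\<Sum>S\<in>Pow J. ennreal (g S) * indicator (?E S) w) \<le> f w"
      using f
    proof (eventually_elim)
      case (elim w)
      show ?case
      proof (cases "\<exists>S\<in>Pow J. w \<in> ?E S")
        case True
        then obtain S where S: "S \<in> Pow J" "w \<in> ?E S" by blast
        have "T = S" if T: "T \<in> Pow J" "w \<in> ?E T" for T
        proof -
          have "pattern T i = pattern S i" if "i \<in> J" for i using T(2) S(2) that by simp
          then have "i \<in> T \<longleftrightarrow> i \<in> S" if "i \<in> J" for i using that unfolding pattern_def by (metis one_neq_neg_one)
          then show ?thesis using S(1) T(1) by blast
        qed
        then have "(\<Sum>S\<in>Pow J. ennreal (g S) * indicator (?E S) w) = (\<Sum>T\<in>{S}. ennreal (g T) * indicator (?E T) w)"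
          using r(2) S(1) by (intro sum.mono_neutral_right) (auto simp: indicator_def)
        also have "\<dots> \<le> f w" using elim S by auto
        finally show ?thesis .
      next
        case False
        then have "(\<Sum>S\<in>Pow J. ennreal (g S) * indicator (?E S) w) = 0" by (intro sum.neutral) (auto simp: indicator_def)
        then show ?thesis by simp
      qed
    qed
  qed
qed

context blocks
begin

lemma rademacher_sum:
  fixes \<epsilon> :: "'i \<Rightarrow> 'w \<Rightarrow> real"
  assumes "\<forall>i. \<epsilon> i w = 1 \<or> \<epsilon> i w = -1"
  shows "(\<Sum>\<^sub>\<infinity>i. \<epsilon> i w *\<^sub>R U i x) = \<Phi> (\<lambda>k. of_real (\<epsilon> (\<pi> k) w)) x"
    and "norm (\<Sum>\<^sub>\<infinity>i. \<epsilon> i w *\<^sub>R U i x) \<le> C * norm x"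
proof -
  have b: "cmod (of_real (\<epsilon> i w)) \<le> 1" for i using assms[rule_format, of i] by auto
  show "(\<Sum>\<^sub>\<infinity>i. \<epsilon> i w *\<^sub>R U i x) = \<Phi> (\<lambda>k. of_real (\<epsilon> (\<pi> k) w)) x"
    unfolding scaleR_scaleC by (rule infsum_blocks[OF b])
  show "norm (\<Sum>\<^sub>\<infinity>i. \<epsilon> i w *\<^sub>R U i x) \<le> C * norm x"
    unfolding scaleR_scaleC by (rule norm_infsum_blocks[OF b])
qed

lemma countable_index: "countable (UNIV :: 'i set)"
  using inj_\<iota> countable_def by (metis countableI_type countable_image_inj_on countable_subset top_greatest)

lemma random_norm_upper:
  assumes "rademacher M \<epsilon>"
  shows "random_norm M \<epsilon> (\<lambda>i. U i x) \<le> ennreal (C * norm x)"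
proof -
  interpret prob_space M using assms by (simp add: rademacher_def)
  have "random_norm M \<epsilon> (\<lambda>i. U i x) \<le> (\<integral>\<^sup>+w. ennreal (C * norm x) \<partial>M)"
    unfolding random_norm_def
    by (rule nn_integral_mono_AE, use rademacher_AE[OF assms countable_index] in eventually_elim)
       (intro ennreal_leI rademacher_sum(2))
  then show ?thesis by (simp add: emeasure_space_1)
qed

text \<open>On the event with pattern \<open>S\<close> the vector \<open>G S\<close> is \<open>(\<Sum>i\<in>F. \<epsilon>\<^sub>i W i)\<close> applied to the random sum, so it is bounded by
\<open>3 C\<close> times the norm of the random sum. The mean of \<open>G\<close> over all patterns is \<open>\<Sum>i\<in>F. W i (U i x)\<close>, because the
mixed terms cancel.\<close>

lemma random_norm_lower_finite:
  assumes r: "rademacher M \<epsilon>" and F: "finite F"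
  shows "ennreal (norm (\<Sum>i\<in>F. U i x)) \<le> ennreal (3 * C) * random_norm M \<epsilon> (\<lambda>i. U i x)"
proof -
  interpret prob_space M using r by (simp add: rademacher_def)
  define J where "J = near F"
  have J: "finite J" using finite_near[OF F] by (simp add: J_def)
  have FJ: "F \<subseteq> J" unfolding J_def near_def by force
  define G where "G S = (\<Sum>i\<in>F. \<Sum>j\<in>J. (pattern S i * pattern S j) *\<^sub>R W i (U j x))" for S
  let ?s = "\<lambda>w. \<Sum>\<^sub>\<infinity>i. \<epsilon> i w *\<^sub>R U i x"
  have key: "norm (G S) \<le> 3 * C * norm (?s w)" if w: "\<forall>i. \<epsilon> i w = 1 \<or> \<epsilon> i w = -1" "\<forall>i\<in>J. \<epsilon> i w = pattern S i" for S w
  proof -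
    have b: "cmod (of_real (\<epsilon> i w)) \<le> 1" for i using w(1)[rule_format, of i] by auto
    have "W i (?s w) = (\<Sum>j\<in>J. pattern S j *\<^sub>R W i (U j x))" if "i \<in> F" for i
    proof -
      have "W i (?s w) = (\<Sum>j\<in>J. W i (of_real (\<epsilon> j w) *\<^sub>C U j x))"
        unfolding rademacher_sum(1)[where \<epsilon> = \<epsilon> and w = w, OF w(1)] J_def by (rule W_infsum[OF F that b])
      also have "\<dots> = (\<Sum>j\<in>J. \<epsilon> j w *\<^sub>R W i (U j x))"
        by (simp add: scaleR_scaleC[symmetric] linear_scale[OF bounded_linear.linear[OF W_linear]])
      finally show ?thesis using w(2) by simp
    qed
    then have "G S = (\<Sum>i\<in>F. of_real (\<epsilon> i w) *\<^sub>C W i (?s w))"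
      using w(2) FJ by (auto simp: G_def scaleR_scaleC[symmetric] scaleR_sum_right intro!: sum.cong)
    then show ?thesis using signed_sum_W_bound[where y = "?s w", OF F b] by simp
  qed
  have "(\<Sum>S\<in>Pow J. G S) = (\<Sum>i\<in>F. \<Sum>j\<in>J. (\<Sum>S\<in>Pow J. pattern S i * pattern S j) *\<^sub>R W i (U j x))"
    unfolding G_def scaleR_sum_left by (subst sum.swap, rule sum.cong[OF refl], rule sum.swap)
  also have "\<dots> = (\<Sum>i\<in>F. \<Sum>j\<in>J. (if i = j then 2 ^ card J *\<^sub>R W i (U j x) else 0))"
    using FJ pattern_orthogonal[OF J] by (intro sum.cong refl) auto
  also have "\<dots> = (\<Sum>i\<in>F. 2 ^ card J *\<^sub>R U i x)"
    using J FJ by (intro sum.cong refl) (auto simp: sum.delta W_U)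
  finally have avg: "(\<Sum>i\<in>F. U i x) = (1/2) ^ card J *\<^sub>R (\<Sum>S\<in>Pow J. G S)"
    by (simp add: scaleR_sum_right power_mult_distrib[symmetric])
  have "norm (\<Sum>i\<in>F. U i x) \<le> (1/2) ^ card J * (\<Sum>S\<in>Pow J. norm (G S))"
    unfolding avg norm_scaleR by (simp add: norm_sum mult_left_mono)
  show ?thesis
  proof (cases "C = 0")
    case True
    have "norm (\<Sum>i\<in>F. U i x) \<le> 0"
      using sum_blocks[OF F, of "\<lambda>_. 1" 1 x] bound[of "\<lambda>k. if \<pi> k \<in> F then 1 else 0" 1 x] True by simp
    then show ?thesis by simp
  next
    case False
    then have C3: "3 * C > 0" using C by simp
    have "ennreal ((1/2) ^ card J * (\<Sum>S\<in>Pow J. norm (G S) / (3 * C))) \<le> random_norm M \<epsilon> (\<lambda>i. U i x)"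
      unfolding random_norm_def
    proof (rule rademacher_integral_ge[OF r J])
      show "AE w in M. \<forall>S\<in>Pow J. (\<forall>i\<in>J. \<epsilon> i w = pattern S i) \<longrightarrow> ennreal (norm (G S) / (3 * C)) \<le> ennreal (norm (?s w))"
        using rademacher_AE[OF r countable_index]
      proof eventually_elim
        case (elim w)
        show ?case using key[OF elim] C3 by (auto intro!: ennreal_leI simp: divide_le_eq mult.commute)
      qed
    qed (use C3 in auto)
    then have "ennreal (3 * C) * ennreal ((1/2) ^ card J * (\<Sum>S\<in>Pow J. norm (G S) / (3 * C))) \<le> ennreal (3 * C) * random_norm M \<epsilon> (\<lambda>i. U i x)"
      by (rule mult_left_mono) simp
    moreover have "ennreal (3 * C) * ennreal ((1/2) ^ card J * (\<Sum>S\<in>Pow J. norm (G S) / (3 * C))) = ennreal ((1/2) ^ card J * (\<Sum>S\<in>Pow J. norm (G S)))"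
      using C3 by (subst ennreal_mult[symmetric]) (auto simp: sum_divide_distrib[symmetric] intro!: sum_nonneg divide_nonneg_pos mult_nonneg_nonneg)
    ultimately show ?thesis
      using \<open>norm (\<Sum>i\<in>F. U i x) \<le> (1/2) ^ card J * (\<Sum>S\<in>Pow J. norm (G S))\<close>
      by (metis ennreal_leI order_trans)
  qed
qed

lemma random_norm_lower:
  assumes r: "rademacher M \<epsilon>"
  shows "ennreal (norm x) \<le> ennreal (3 * C) * random_norm M \<epsilon> (\<lambda>i. U i x)"
proof -
  have "((\<lambda>F. ennreal (norm (\<Sum>i\<in>F. U i x))) \<longlongrightarrow> ennreal (norm x)) (finite_subsets_at_top UNIV)"
    using blocks_sum_identity[of x] unfolding has_sum_def by (intro tendsto_ennrealI tendsto_norm)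
  then show ?thesis
    by (rule tendsto_upperbound)
       (auto intro!: eventually_finite_subsets_at_top_weakI random_norm_lower_finite[OF r])
qed

lemma multiplier_norm_upper: "multiplier_norm (\<lambda>i. U i x) \<le> ennreal (C * norm x)"
  unfolding multiplier_norm_def by (rule SUP_least) (auto intro!: ennreal_leI norm_infsum_blocks)

lemma multiplier_norm_lower: "ennreal (norm x) \<le> multiplier_norm (\<lambda>i. U i x)"
  unfolding multiplier_norm_def
  by (rule SUP_upper2[of "\<lambda>_. 1"]) (use infsumI[OF blocks_sum_identity[of x]] in auto)

lemma norm_equivalents:
  assumes r: "rademacher M \<epsilon>"
  shows "norm_equivalent (\<lambda>x. ennreal (norm x)) (\<lambda>x. random_norm M \<epsilon> (\<lambda>i. U i x))"
    and "norm_equivalent (\<lambda>x. random_norm M \<epsilon> (\<lambda>i. U i x)) (\<lambda>x. multiplier_norm (\<lambda>i. U i x))"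
proof -
  define c where "c = 3 * C + 1"
  have c: "c > 0" "3 * C \<le> c" "C \<le> c" "1 \<le> c" using C by (auto simp: c_def)
  have inv: "ennreal (inverse c) * p \<le> q" if "p \<le> ennreal c * q" for p q
  proof -
    have "ennreal (inverse c) * p \<le> ennreal (inverse c) * (ennreal c * q)" using that by (rule mult_left_mono) simp
    also have "\<dots> = q" using c(1) by (simp add: mult.assoc[symmetric] ennreal_mult[symmetric])
    finally show ?thesis .
  qed
  have up: "random_norm M \<epsilon> (\<lambda>i. U i x) \<le> ennreal c * ennreal (norm x)" for x
  proof -
    have "C * norm x \<le> c * norm x" using c(3) by (rule mult_right_mono) simp
    then have "ennreal (C * norm x) \<le> ennreal c * ennreal (norm x)"
      using c(1) by (simp add: ennreal_mult[symmetric] ennreal_leI)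
    then show ?thesis by (rule order_trans[OF random_norm_upper[OF r]])
  qed
  have low: "ennreal (norm x) \<le> ennreal c * random_norm M \<epsilon> (\<lambda>i. U i x)" for x
    by (rule order_trans[OF random_norm_lower[OF r] mult_right_mono]) (use c in \<open>auto intro: ennreal_leI\<close>)
  have mup: "multiplier_norm (\<lambda>i. U i x) \<le> ennreal c * ennreal (norm x)" for x
  proof -
    have "C * norm x \<le> c * norm x" using c(3) by (rule mult_right_mono) simp
    then have "ennreal (C * norm x) \<le> ennreal c * ennreal (norm x)"
      using c(1) by (simp add: ennreal_mult[symmetric] ennreal_leI)
    then show ?thesis by (rule order_trans[OF multiplier_norm_upper])
  qed
  show "norm_equivalent (\<lambda>x. ennreal (norm x)) (\<lambda>x. random_norm M \<epsilon> (\<lambda>i. U i x))"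
    unfolding norm_equivalent_def using c(1) inv[OF low] up by blast
  have cc: "ennreal c * (ennreal c * q) = ennreal (c * c) * q" for q
    using c(1) by (simp add: ennreal_mult mult.assoc)
  show "norm_equivalent (\<lambda>x. random_norm M \<epsilon> (\<lambda>i. U i x)) (\<lambda>x. multiplier_norm (\<lambda>i. U i x))"
    unfolding norm_equivalent_def
  proof (intro exI[of _ "c * c"] conjI allI)
    show "0 < c * c" using c(1) by simp
    fix x
    have "multiplier_norm (\<lambda>i. U i x) \<le> ennreal c * (ennreal c * random_norm M \<epsilon> (\<lambda>i. U i x))"
      by (rule order_trans[OF mup mult_left_mono[OF low]]) simp
    then show "multiplier_norm (\<lambda>i. U i x) \<le> ennreal (c * c) * random_norm M \<epsilon> (\<lambda>i. U i x)" by (simp add: cc)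
    have "random_norm M \<epsilon> (\<lambda>i. U i x) \<le> ennreal c * multiplier_norm (\<lambda>i. U i x)"
      by (rule order_trans[OF up mult_left_mono[OF multiplier_norm_lower]]) simp
    then have "ennreal (inverse c) * random_norm M \<epsilon> (\<lambda>i. U i x) \<le> multiplier_norm (\<lambda>i. U i x)" by (rule inv)
    moreover have "ennreal (inverse (c * c)) * random_norm M \<epsilon> (\<lambda>i. U i x) \<le> ennreal (inverse c) * random_norm M \<epsilon> (\<lambda>i. U i x)"
    proof (intro mult_right_mono ennreal_leI)
      have "c \<le> c * c" using c by simp
      then show "inverse (c * c) \<le> inverse c" using c(1) by (rule le_imp_inverse_le)
    qed simp
    ultimately show "ennreal (inverse (c * c)) * random_norm M \<epsilon> (\<lambda>i. U i x) \<le> multiplier_norm (\<lambda>i. U i x)"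
      by (rule order_trans[rotated])
  qed
qed

lemma summable_blocks: "(\<And>i. cmod (a i) \<le> 1) \<Longrightarrow> (\<lambda>i. a i *\<^sub>C U i x) summable_on UNIV"
  using has_sum_blocks has_sum_imp_summable by blast

end

lemma (in mihlin_partition) block_calculus_exists: "\<exists>C. block_calculus \<Phi> C"
proof -
  obtain C where C: "C \<ge> 0" "\<And>M a x. \<forall>n. cmod (a n) \<le> M \<Longrightarrow> norm (\<Phi> a x) \<le> C * M * norm x"
    using \<Phi>_bounded by blast
  have "block_calculus \<Phi> C"
  proof (rule block_calculus.intro)
    show "norm (\<Phi> a x) \<le> C * M * norm x" if "\<And>n. cmod (a n) \<le> M" for a M x using C(2) that by blast
  qed (fact C(1) \<Phi>_bounded_linear \<Phi>_add \<Phi>_cmult \<Phi>_one \<Phi>_separated \<Phi>_tail)+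
  then show ?thesis ..
qed

text \<open>The functions \<open>\<xi> i\<close> are the partial sums of the partition of unity over the blocks, so that \<open>\<xi> i\<close> gives the operator
\<open>U i\<close>.\<close>

lemma (in mihlin_partition) block_equivalence:
  fixes \<pi> :: "int \<Rightarrow> 'i" and \<iota> :: "'i \<Rightarrow> int" and \<xi> :: "'i \<Rightarrow> real \<Rightarrow> complex" and M :: "'w measure"
  assumes \<iota>: "inj \<iota>" "\<And>k l. \<bar>\<iota> (\<pi> k) - \<iota> (\<pi> l)\<bar> \<le> \<bar>k - l\<bar>"
    and \<xi>: "\<And>i t. t > 0 \<Longrightarrow> \<xi> i t = (\<Sum>\<^sub>\<infinity>k\<in>{k. \<pi> k = i}. \<psi> (2 powi (- k) * t))"
    and r: "rademacher M \<epsilon>"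
  shows "(\<forall>x a. (\<forall>i. cmod (a i) \<le> 1) \<longrightarrow> (\<lambda>i. a i *\<^sub>C mihlin_calc \<phi> \<alpha> A (\<xi> i) x) summable_on UNIV) \<and>
     norm_equivalent (\<lambda>x. ennreal (norm x)) (\<lambda>x. random_norm M \<epsilon> (\<lambda>i. mihlin_calc \<phi> \<alpha> A (\<xi> i) x)) \<and>
     norm_equivalent (\<lambda>x. random_norm M \<epsilon> (\<lambda>i. mihlin_calc \<phi> \<alpha> A (\<xi> i) x))
        (\<lambda>x. multiplier_norm (\<lambda>i. mihlin_calc \<phi> \<alpha> A (\<xi> i) x))"
proof -
  obtain C where "block_calculus \<Phi> C" using block_calculus_exists by blast
  then interpret block_calculus \<Phi> C .
  interpret blocks \<Phi> C \<pi> \<iota> by unfold_locales (use \<iota> in auto)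
  have "mihlin_calc \<phi> \<alpha> A (\<xi> i) x = U i x" for i x
    unfolding U_def \<Phi>_def
  proof (rule mihlin_calc_cong)
    fix t :: real assume "t > 0"
    show "\<xi> i t = S (\<lambda>k. if \<pi> k = i then 1 else 0) t"
      unfolding \<xi>[OF \<open>t > 0\<close>] S_def by (rule infsum_cong_neutral) auto
  qed
  then show ?thesis using summable_blocks norm_equivalents[OF r] by simp
qed

theorem theorem4p1:
  fixes A :: "('a::complex_banach \<times> 'a) set"
    and \<alpha> :: real
    and \<phi> :: "int \<Rightarrow> real \<Rightarrow> complex"
    and \<eta> :: "int \<Rightarrow> real \<Rightarrow> complex"
    and \<zeta> :: "nat \<Rightarrow> real \<Rightarrow> complex"
    and M :: "'w measure" and \<epsilon> :: "int \<Rightarrow> 'w \<Rightarrow> real"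
    and M' :: "'v measure" and \<epsilon>' :: "nat \<Rightarrow> 'v \<Rightarrow> real"
  assumes "besov_partition \<phi>"
    and "\<alpha> > 0"
    and "zero_sectorial A"
    and "has_mihlin_calculus \<phi> \<alpha> A"
    and "homogeneous_partition \<eta>"
    and "inhomogeneous_partition \<zeta>"
    and "rademacher M \<epsilon>"
    and "rademacher M' \<epsilon>'"
  shows
    "(\<forall>x. \<forall>a::int \<Rightarrow> complex. (\<forall>n. cmod (a n) \<le> 1) \<longrightarrow>
        (\<lambda>n. a n *\<^sub>C mihlin_calc \<phi> \<alpha> A (\<eta> n) x) summable_on UNIV) \<and>
     norm_equivalent (\<lambda>x. ennreal (norm x))
        (\<lambda>x. random_norm M \<epsilon> (\<lambda>n. mihlin_calc \<phi> \<alpha> A (\<eta> n) x)) \<and>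
     norm_equivalent (\<lambda>x. random_norm M \<epsilon> (\<lambda>n. mihlin_calc \<phi> \<alpha> A (\<eta> n) x))
        (\<lambda>x. multiplier_norm (\<lambda>n. mihlin_calc \<phi> \<alpha> A (\<eta> n) x)) \<and>
     (\<forall>x. \<forall>a::nat \<Rightarrow> complex. (\<forall>n. cmod (a n) \<le> 1) \<longrightarrow>
        (\<lambda>n. a n *\<^sub>C mihlin_calc \<phi> \<alpha> A (\<zeta> n) x) summable_on UNIV) \<and>
     norm_equivalent (\<lambda>x. ennreal (norm x))
        (\<lambda>x. random_norm M' \<epsilon>' (\<lambda>n. mihlin_calc \<phi> \<alpha> A (\<zeta> n) x)) \<and>
     norm_equivalent (\<lambda>x. random_norm M' \<epsilon>' (\<lambda>n. mihlin_calc \<phi> \<alpha> A (\<zeta> n) x))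
        (\<lambda>x. multiplier_norm (\<lambda>n. mihlin_calc \<phi> \<alpha> A (\<zeta> n) x)) \<and>
     (\<forall>x. (\<lambda>n. mihlin_calc \<phi> \<alpha> A (\<eta> n) x) summable_on UNIV)"
proof -
  interpret mihlin_operator A \<phi> \<alpha> by unfold_locales (rule assms)+
  obtain \<psi> where \<psi>: "smooth \<psi>" "supp \<psi> \<subseteq> {1/2..2}" "\<And>n t. t > 0 \<Longrightarrow> \<eta> n t = \<psi> (2 powi (- n) * t)"
    "\<And>t. t > 0 \<Longrightarrow> ((\<lambda>n::int. \<psi> (2 powi (- n) * t)) has_sum 1) UNIV"
    using assms(5) unfolding homogeneous_partition_def by blast
  \<comment> \<open>the two partitions of unity need not come from the same function\<close>
  interpret hom: mihlin_partition A \<phi> \<alpha> \<psi> by unfold_locales (use \<psi> in auto)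
  obtain \<eta>' where \<eta>': "homogeneous_partition \<eta>'" "\<And>n t. n \<ge> 1 \<Longrightarrow> t > 0 \<Longrightarrow> \<zeta> n t = \<eta>' (int n) t"
    "\<And>t. t > 0 \<Longrightarrow> \<zeta> 0 t = (\<Sum>\<^sub>\<infinity>k\<in>{..0}. \<eta>' k t)"
    using assms(6) unfolding inhomogeneous_partition_def by blast
  obtain \<psi>' where \<psi>': "smooth \<psi>'" "supp \<psi>' \<subseteq> {1/2..2}" "\<And>n t. t > 0 \<Longrightarrow> \<eta>' n t = \<psi>' (2 powi (- n) * t)"
    "\<And>t. t > 0 \<Longrightarrow> ((\<lambda>n::int. \<psi>' (2 powi (- n) * t)) has_sum 1) UNIV"
    using \<eta>'(1) unfolding homogeneous_partition_def by blast
  interpret inhom: mihlin_partition A \<phi> \<alpha> \<psi>' by unfold_locales (use \<psi>' in auto)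
  have hom: "(\<forall>x a. (\<forall>i. cmod (a i) \<le> 1) \<longrightarrow> (\<lambda>i. a i *\<^sub>C mihlin_calc \<phi> \<alpha> A (\<eta> i) x) summable_on UNIV) \<and>
     norm_equivalent (\<lambda>x. ennreal (norm x)) (\<lambda>x. random_norm M \<epsilon> (\<lambda>i. mihlin_calc \<phi> \<alpha> A (\<eta> i) x)) \<and>
     norm_equivalent (\<lambda>x. random_norm M \<epsilon> (\<lambda>i. mihlin_calc \<phi> \<alpha> A (\<eta> i) x))
        (\<lambda>x. multiplier_norm (\<lambda>i. mihlin_calc \<phi> \<alpha> A (\<eta> i) x))"
    \<comment> \<open>every integer is a block of its own\<close>
    by (rule hom.block_equivalence[of id id]) (use \<psi>(3) assms(7) in auto)
  moreover have "(\<forall>x a. (\<forall>i. cmod (a i) \<le> 1) \<longrightarrow> (\<lambda>i. a i *\<^sub>C mihlin_calc \<phi> \<alpha> A (\<zeta> i) x) summable_on UNIV) \<and>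
     norm_equivalent (\<lambda>x. ennreal (norm x)) (\<lambda>x. random_norm M' \<epsilon>' (\<lambda>i. mihlin_calc \<phi> \<alpha> A (\<zeta> i) x)) \<and>
     norm_equivalent (\<lambda>x. random_norm M' \<epsilon>' (\<lambda>i. mihlin_calc \<phi> \<alpha> A (\<zeta> i) x))
        (\<lambda>x. multiplier_norm (\<lambda>i. mihlin_calc \<phi> \<alpha> A (\<zeta> i) x))"
  \<comment> \<open>\<open>nat\<close> merges the nonpositive integers into one block\<close>
  proof (rule inhom.block_equivalence[of int nat])
    fix n :: nat and t :: real assume "t > 0"
    show "\<zeta> n t = (\<Sum>\<^sub>\<infinity>k\<in>{k. nat k = n}. \<psi>' (2 powi (- k) * t))"
    proof (cases "n = 0")
      case True
      moreover have "{k. nat k = 0} = {..0}" by auto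
      ultimately show ?thesis using \<eta>'(3)[OF \<open>t > 0\<close>] \<psi>'(3)[OF \<open>t > 0\<close>] by simp
    next
      case False
      then have "{k. nat k = n} = {int n}" by auto
      then show ?thesis using False \<eta>'(2)[of n, OF _ \<open>t > 0\<close>] \<psi>'(3)[OF \<open>t > 0\<close>] by simp
    qed
  qed (use assms(8) in auto)
  moreover have "(\<lambda>n. mihlin_calc \<phi> \<alpha> A (\<eta> n) x) summable_on UNIV" for x
    using hom[THEN conjunct1, rule_format, of "\<lambda>n. 1" x] by simp
  ultimately show ?thesis by blast
qed

end
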